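(* Let $p,s$ be in the admissible range (with $\alpha=0$), and let $(\varphi_t)_{t\ge0}$ be a non-trivial semigroup of holomorphic self-maps of $\mathbb D$ with infinitesimal generator $G$. The following are equivalent: (i) $[\varphi_t,M_0(D^p_s)]=m_0(D^p_s)$; (ii) $G$ satisfies the vanishing logarithmic Bloch condition $$\lim_{|z|\to1^-}\frac{1-|z|^2}{|G(z)|}\log\frac{1}{1-|z|^2}=0.$$
   Context: $\mathbb D$ is the open unit disk of $\mathbb C$, $\mathcal H(\mathbb D)$ the space of analytic functions on $\mathbb D$, $dA$ Lebesgue area measure. For $1<p<\infty$ and $-1<s<\infty$, $D^p_s$ is the Banach space of $f\in\mathcal H(\mathbb D)$ with $\|f\|_{D^p_s}=|f(0)|+\left(\int_{\mathbb D}|f'(z)|^p(1-|z|^2)^s\,dA(z)\right)^{1/p}<\infty$. For $a\in\mathbb D$ put $\sigma_a(z)=\frac{a-z}{1-\overline a z}$. For $1<p<\infty$, $p-2\le s<\infty$, $M_0(D^p_s)$ is the space of $f\in D^p_s$ with $\rho(f)=\sup_{a\in\mathbb D}\|f\circ\sigma_a-f(a)\|_{D^p_s}<\infty$, normed by $|f(0)|+\rho(f)$, and $m_0(D^p_s)$ is the subspace of those $f$ with $\lim_{|a|\to1^-}\|f\circ\sigma_a-f(a)\|_{D^p_s}=0$. The parameters $p,s$ are in the admissible range if either ($p\ge2$ and $s>p-2$) or ($1<p<2$ and $s\ge0$) (with $p<\infty$). A semigroup of holomorphic self-maps of $\mathbb D$ is a family $(\varphi_t)_{t\ge0}$ of analytic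 maps $\varphi_t:\mathbb D\to\mathbb D$ with $\varphi_0(z)=z$, $\varphi_t\circ\varphi_s=\varphi_{t+s}$ for $t,s\ge0$, and $\varphi_t(z)\to z$ uniformly on compact subsets of $\mathbb D$ as $t\to0^+$; it is non-trivial if not every $\varphi_t$ is the identity. Its infinitesimal generator is $G(z)=\lim_{t\to0^+}\frac{\varphi_t(z)-z}{t}$, $z\in\mathbb D$ (the limit exists uniformly on compact subsets, and $G$ is holomorphic). For a Banach space $X\subset\mathcal H(\mathbb D)$ (continuously embedded), $[\varphi_t,X]=\{f\in X:\lim_{t\to0^+}\|f\circ\varphi_t-f\|_X=0\}$. *)

theory Defs
  imports "HOL-Complex_Analysis.Complex_Analysis"
begin

abbreviation unit_disk :: "complex set"
  where "unit_disk \<equiv> ball 0 1"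

(* The filter for |z| -> 1-: neighbourhoods are the annuli r < |z| < 1. *)
abbreviation at_unit_circle :: "complex filter"
  where "at_unit_circle \<equiv> filtercomap cmod (at_left 1)"

(* Analytic functions on the disk are rendered as total functions on the complex plane; nothing
   below depends on their values outside the disk. *)

definition Dps_integrand :: "real \<Rightarrow> real \<Rightarrow> (complex \<Rightarrow> complex) \<Rightarrow> complex \<Rightarrow> real"
  where "Dps_integrand p s f z = cmod (deriv f z) powr p * (1 - (cmod z)\<^sup>2) powr s"

definition Dps :: "real \<Rightarrow> real \<Rightarrow> (complex \<Rightarrow> complex) set"
  where "Dps p s =
    {f. f holomorphic_on unit_disk \<and> set_integrable lborel unit_disk (Dps_integrand p s f)}"

(* Integrability is part of membership in Dps p s: the norm is only meaningful on that space,
   because the Bochner integral of a non-integrable function is 0. *)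
definition Dps_norm :: "real \<Rightarrow> real \<Rightarrow> (complex \<Rightarrow> complex) \<Rightarrow> real"
  where "Dps_norm p s f =
    cmod (f 0) + (LINT z:unit_disk|lborel. Dps_integrand p s f z) powr (1 / p)"

definition disk_aut :: "complex \<Rightarrow> complex \<Rightarrow> complex"
  where "disk_aut a z = (a - z) / (1 - cnj a * z)"

definition mob_translate :: "(complex \<Rightarrow> complex) \<Rightarrow> complex \<Rightarrow> complex \<Rightarrow> complex"
  where "mob_translate f a z = f (disk_aut a z) - f a"

definition mob_rho :: "real \<Rightarrow> real \<Rightarrow> (complex \<Rightarrow> complex) \<Rightarrow> real"
  where "mob_rho p s f = (SUP a\<in>unit_disk. Dps_norm p s (mob_translate f a))"

(* The last two conditions together say that the supremum defining mob_rho is finite. *)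
definition M0 :: "real \<Rightarrow> real \<Rightarrow> (complex \<Rightarrow> complex) set"
  where "M0 p s =
    {f \<in> Dps p s. (\<forall>a\<in>unit_disk. mob_translate f a \<in> Dps p s) \<and>
       bdd_above ((\<lambda>a. Dps_norm p s (mob_translate f a)) ` unit_disk)}"

definition M0_norm :: "real \<Rightarrow> real \<Rightarrow> (complex \<Rightarrow> complex) \<Rightarrow> real"
  where "M0_norm p s f = cmod (f 0) + mob_rho p s f"

definition m0 :: "real \<Rightarrow> real \<Rightarrow> (complex \<Rightarrow> complex) set"
  where "m0 p s =
    {f \<in> M0 p s. ((\<lambda>a. Dps_norm p s (mob_translate f a)) \<longlongrightarrow> 0) at_unit_circle}"

definition admissible :: "real \<Rightarrow> real \<Rightarrow> bool"
  where "admissible p s \<longleftrightarrow> (p \<ge> 2 \<and> s > p - 2) \<or> (1 < p \<and> p < 2 \<and> s \<ge> 0)"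

definition holo_semigroup :: "(real \<Rightarrow> complex \<Rightarrow> complex) \<Rightarrow> bool"
  where "holo_semigroup \<phi> \<longleftrightarrow>
    (\<forall>t\<ge>0. \<phi> t holomorphic_on unit_disk \<and> \<phi> t ` unit_disk \<subseteq> unit_disk) \<and>
    (\<forall>z\<in>unit_disk. \<phi> 0 z = z) \<and>
    (\<forall>t\<ge>0. \<forall>s\<ge>0. \<forall>z\<in>unit_disk. \<phi> t (\<phi> s z) = \<phi> (t + s) z) \<and>
    (\<forall>K. compact K \<and> K \<subseteq> unit_disk \<longrightarrow> uniform_limit K \<phi> (\<lambda>z. z) (at_right 0))"

definition nontrivial_semigroup :: "(real \<Rightarrow> complex \<Rightarrow> complex) \<Rightarrow> bool"
  where "nontrivial_semigroup \<phi> \<longleftrightarrow> (\<exists>t\<ge>0. \<exists>z\<in>unit_disk. \<phi> t z \<noteq> z)"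

(* Only pointwise convergence is required; locally uniform convergence and holomorphy of G are
   consequences for holomorphic semigroups. *)
definition is_inf_generator ::
    "(real \<Rightarrow> complex \<Rightarrow> complex) \<Rightarrow> (complex \<Rightarrow> complex) \<Rightarrow> bool"
  where "is_inf_generator \<phi> G \<longleftrightarrow>
    (\<forall>z\<in>unit_disk. ((\<lambda>t. (\<phi> t z - z) / complex_of_real t) \<longlongrightarrow> G z) (at_right 0))"

(* The space [phi_t, X] for X given by its carrier and norm. The norm is only meaningful on X, so
   the differences are required to lie in X for all small t > 0. *)
definition strong_cont_subspace ::
    "(real \<Rightarrow> complex \<Rightarrow> complex) \<Rightarrow> (complex \<Rightarrow> complex) set \<Rightarrow>
     ((complex \<Rightarrow> complex) \<Rightarrow> real) \<Rightarrow> (complex \<Rightarrow> complex) set"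
  where "strong_cont_subspace \<phi> X normX =
    {f \<in> X. (\<forall>\<^sub>F t in at_right 0. (\<lambda>z. f (\<phi> t z) - f z) \<in> X) \<and>
       ((\<lambda>t. normX (\<lambda>z. f (\<phi> t z) - f z)) \<longlongrightarrow> 0) (at_right 0)}"

(* A generator of a non-trivial semigroup has at most one zero in the disk, so the convention
   x / 0 = 0 plays no role as |z| -> 1-. *)
definition vanishing_log_Bloch :: "(complex \<Rightarrow> complex) \<Rightarrow> bool"
  where "vanishing_log_Bloch G \<longleftrightarrow>
    ((\<lambda>z. (1 - (cmod z)\<^sup>2) / cmod (G z) * ln (1 / (1 - (cmod z)\<^sup>2))) \<longlongrightarrow> 0) at_unit_circle"

end

theory Submission
  imports Defs
begin

text \<open>
  Let \<open>E(f, a)\<close> be the energy \<open>\<integral> |g'|\<^sup>p (1 - |z|\<^sup>2)\<^sup>s dA\<close> of \<open>g = f \<circ> \<sigma>\<^sub>a\<close>. For an injective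
  self-map \<open>\<phi>\<close>, such as \<open>\<phi>\<^sub>t\<close>, the area formula and Littlewood subordination give
  \<open>E(f \<circ> \<phi>, a) \<le> E(f, \<phi> a)\<close>. Hence functions in \<open>m\<^sub>0\<close> are strongly continuous under every semigroup:
  for \<open>a\<close> near the circle \<open>\<phi>\<^sub>t a\<close> stays near the circle, and for the other \<open>a\<close> the contraction property
  upgrades locally uniform convergence to convergence of energies. For \<open>f \<in> M\<^sub>0\<close> the averages
  \<open>A\<^sub>T = \<integral>\<^sub>0\<^sup>T f \<circ> \<phi>\<^sub>t dt\<close> are strongly continuous and satisfy \<open>A\<^sub>T' G = f \<circ> \<phi>\<^sub>T - f\<close>.

  Under the logarithmic condition \<open>G\<close> has a zero \<open>b\<close>, and then \<open>\<sigma>\<^sub>b / G\<close> is the derivative of an injective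
  function \<open>\<gamma>\<close>. A strongly continuous \<open>f\<close> is approximated by \<open>A\<^sub>T / T\<close>, where \<open>|A\<^sub>T'|\<close> is bounded by
  \<open>|\<gamma>'|\<close> times a function of logarithmic growth. Counting the area of the image of \<open>\<gamma>\<close> shows that
  \<open>E(A\<^sub>T, a)\<close> tends to \<open>0\<close>.

  If the condition fails along \<open>z\<^sub>n\<close>, put \<open>L\<^sub>n = log (1 / (1 - |z\<^sub>n|\<^sup>2))\<close>. A gliding hump of functions
  \<open>log(1 - cnj z\<^sub>n z)\<^sup>2 / L\<^sub>n\<close> yields \<open>h \<in> M\<^sub>0\<close> with \<open>|h(z\<^sub>n)| \<ge> L\<^sub>n / 2\<close>. If all averages \<open>A\<^sub>T\<close> of \<open>h\<close>
  were in \<open>m\<^sub>0\<close>, they would be little Bloch functions, so \<open>h(\<phi>\<^sub>T z\<^sub>n) - h(z\<^sub>n) = o(L\<^sub>n)\<close> for every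
  \<open>T\<close> by the equation for \<open>A\<^sub>T'\<close>. Averaging over \<open>T \<in> [0, 1]\<close> gives \<open>A\<^sub>1(z\<^sub>n) - h(z\<^sub>n) = o(L\<^sub>n)\<close>, which
  is absurd since also \<open>A\<^sub>1(z\<^sub>n) = o(L\<^sub>n)\<close>.
\<close>

subsection \<open>Change of variables for holomorphic maps\<close>

text \<open>Two points decide the form of the estimates. The contraction of energies has to hold
  with constant \<open>1\<close>: pointwise convergence of derivatives becomes norm convergence only
  if the energies of \<open>f \<circ> \<phi>\<^sub>t\<close> do not exceed that of \<open>f\<close>
  in the limit. For \<open>p \<ge> 2\<close> Schwarz--Pick removes \<open>p - 2\<close> powers of
  the derivative of the inner map and the area formula the other two. For \<open>p < 2\<close>
  Young's inequality interpolates between subordination, which allows for no power, and the area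
  formula, with weights that add up to \<open>1\<close>. The other point is the logarithm. Seen from
  the centre \<open>a\<close>, a logarithm at \<open>\<sigma>\<^sub>a z\<close> and the one at
  \<open>a\<close> differ by a factor that is at most a small power of \<open>1 - |z|\<close>. A
  derivative bounded only by \<open>1 / (1 - |z|)\<close> gives finite energy just for
  \<open>s > p - 1\<close>, so pointwise bounds leave no room for such a loss. Injectivity lowers
  the threshold to \<open>s > p - 2\<close>, and since this inequality is strict, a small exponent
  \<open>\<kappa>\<close> can be spent on the logarithms.\<close>

definition plane_of :: "complex \<Rightarrow> real^2" where "plane_of z = vector [Re z, Im z]"
definition of_plane :: "real^2 \<Rightarrow> complex" where "of_plane x = Complex (x$1) (x$2)"

lemma plane_of_nth [simp]: "plane_of z $ 1 = Re z" "plane_of z $ 2 = Im z"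
  by (auto simp: plane_of_def)

lemma of_plane_plane_of [simp]: "of_plane (plane_of z) = z"
  by (simp add: of_plane_def)

lemma plane_of_of_plane [simp]: "plane_of (of_plane x) = x"
  by (simp add: of_plane_def plane_of_def vec_eq_iff forall_2)

lemma linear_plane_of: "linear plane_of"
  by (rule linearI) (auto simp: vec_eq_iff forall_2)

lemma linear_of_plane: "linear of_plane"
  by (rule linearI) (auto simp: of_plane_def complex_eq_iff)

lemma has_derivative_plane_of: "(plane_of has_derivative plane_of) F"
  by (rule linear_imp_has_derivative[OF linear_plane_of])

lemma has_derivative_of_plane: "(of_plane has_derivative of_plane) F"
  by (rule linear_imp_has_derivative[OF linear_of_plane])

lemma plane_of_measurable [measurable]: "plane_of \<in> borel_measurable borel"
  by (intro borel_measurable_continuous_onI linear_continuous_on linear_conv_bounded_linear[THEN iffD1] linear_plane_of)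

lemma of_plane_measurable [measurable]: "of_plane \<in> borel_measurable borel"
  by (intro borel_measurable_continuous_onI linear_continuous_on linear_conv_bounded_linear[THEN iffD1] linear_of_plane)

lemma prod_Basis_plane: "(\<Prod>b\<in>Basis. f b) = f (axis 1 1) * f (axis 2 (1::real))"
  for f :: "real^2 \<Rightarrow> real"
proof -
  have "(Basis :: (real^2) set) = {axis 1 1, axis 2 1}"
    by (auto simp: Basis_vec_def UNIV_2)
  moreover have "axis 1 1 \<noteq> (axis 2 1 :: real^2)"
    by (simp add: axis_eq_axis)
  ultimately show ?thesis unfolding \<open>Basis = _\<close> by (subst prod.insert) auto
qed

text \<open>Preimages of boxes are boxes with the same side lengths, and boxes determine Lebesgue
  measure. Integrals over \<open>complex\<close> can thus be evaluated on \<open>real^2\<close>,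
  where Jacobians are determinants.\<close>

lemma lborel_distr_plane_of: "distr lborel borel plane_of = (lborel :: (real^2) measure)"
proof (rule lborel_eqI[symmetric])
  fix l u :: "real^2" assume le: "\<And>b. b \<in> Basis \<Longrightarrow> l \<bullet> b \<le> u \<bullet> b"
  have le': "l $ i \<le> u $ i" for i
    using le[of "axis i 1"] by (simp add: inner_axis axis_in_Basis_iff)
  have eq: "plane_of -` box l u = box (of_plane l) (of_plane u)"
    by (auto simp: box_def mem_box Basis_complex_def of_plane_def Basis_vec_def inner_axis forall_2)
  have "emeasure (distr lborel borel plane_of) (box l u) = emeasure lborel (box (of_plane l) (of_plane u))"
    by (subst emeasure_distr) (auto simp: eq)
  also have "\<dots> = (\<Prod>b\<in>Basis. (u - l) \<bullet> b)"
    using le' by (subst emeasure_lborel_box)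
      (auto simp: Basis_complex_def of_plane_def prod_Basis_plane inner_axis inner_diff_left)
  finally show "emeasure (distr lborel borel plane_of) (box l u) = (\<Prod>b\<in>Basis. (u - l) \<bullet> b)" .
qed simp

lemma nn_integral_of_plane:
  assumes "k \<in> borel_measurable borel"
  shows "(\<integral>\<^sup>+x. k (of_plane x) \<partial>lborel) = (\<integral>\<^sup>+z. k z \<partial>lborel)"
  using assms by (subst lborel_distr_plane_of[symmetric], subst nn_integral_distr) auto

text \<open>Multiplication by \<open>x + i y\<close> has the columns \<open>(x, y)\<close> and
  \<open>(- y, x)\<close>. The Jacobian of a holomorphic map is therefore the squared modulus of its
  derivative.\<close>

lemma det_complex_mult_plane:
  "det (matrix (\<lambda>x. plane_of (c * of_plane x))) = (cmod c)\<^sup>2"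
  by (simp add: det_2 matrix_def plane_of_def of_plane_def axis_def cmod_def power2_eq_square)

text \<open>The area formula for injective maps. An image of infinite measure is a trivial case; any
  other image is \<open>lmeasurable\<close>, as the change of variables on \<open>real^2\<close>
  demands.\<close>

lemma emeasure_holomorphic_image_ge:
  assumes \<Phi>: "\<Phi> holomorphic_on S" and S: "open S" and inj: "inj_on \<Phi> S"
    and A: "A \<in> sets borel" "A \<subseteq> S" and im: "\<Phi> ` A \<in> sets borel"
  shows "(\<integral>\<^sup>+z. ennreal ((cmod (deriv \<Phi> z))\<^sup>2) * indicator A z \<partial>lborel) \<le> emeasure lborel (\<Phi> ` A)"
proof (cases "emeasure lborel (\<Phi> ` A) = \<infinity>")
  case False
  define T where "T = plane_of ` A"
  define f where "f = plane_of \<circ> \<Phi> \<circ> of_plane"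
  define f' where "f' x = (\<lambda>v. plane_of (deriv \<Phi> (of_plane x) * of_plane v))" for x
  have T_eq: "T = of_plane -` A"
    by (auto simp: T_def image_iff) (metis plane_of_of_plane)
  have T: "T \<in> sets borel"
    unfolding T_eq using A(1) measurable_sets[OF of_plane_measurable A(1)] by simp
  have der: "(f has_derivative f' x) (at x within T)" if "x \<in> T" for x
  proof -
    have "of_plane x \<in> S" using that A by (auto simp: T_eq)
    then have "(\<Phi> has_field_derivative deriv \<Phi> (of_plane x)) (at (of_plane x))"
      using \<Phi> S by (simp add: holomorphic_derivI)
    then have d: "(\<Phi> has_derivative (\<lambda>v. deriv \<Phi> (of_plane x) * v)) (at (of_plane x))"
      by (simp add: has_field_derivative_def)
    have "((\<lambda>x. \<Phi> (of_plane x)) has_derivative (\<lambda>v. deriv \<Phi> (of_plane x) * of_plane v)) (at x)"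
      using has_derivative_compose[OF has_derivative_of_plane d] by simp
    from has_derivative_compose[OF this has_derivative_plane_of]
    have "(f has_derivative f' x) (at x)" by (simp add: f_def f'_def o_def)
    then show ?thesis by (rule has_derivative_at_withinI)
  qed
  have injT: "inj_on f T"
    unfolding f_def T_def using inj_on_subset[OF inj A(2)]
    by (auto simp: inj_on_def) (metis of_plane_plane_of)
  have fT: "f ` T = plane_of ` (\<Phi> ` A)"
    by (auto simp: f_def T_def image_iff)
  have fT': "f ` T = of_plane -` (\<Phi> ` A)"
    unfolding fT by (auto simp: image_iff) (metis plane_of_of_plane)
  have fTb: "f ` T \<in> sets borel"
    unfolding fT' using measurable_sets[OF of_plane_measurable im] by simp
  have em: "emeasure lborel (f ` T) = emeasure lborel (\<Phi> ` A)"
    using nn_integral_of_plane[of "indicator (\<Phi> ` A)"] im fTb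
    by (simp add: fT' indicator_vimage[symmetric])
  have "f ` T \<in> lmeasurable"
    using False em fTb by (intro fmeasurableI) (auto simp: top.not_eq_extremum)
  then have "((\<lambda>x. \<bar>det (matrix (f' x))\<bar>) has_integral measure lebesgue (f ` T)) T"
    using has_measure_differentiable_image[of T f f' "measure lebesgue (f ` T)"] T der injT by auto
  from nn_integral_has_integral_lebesgue'[OF _ this]
  have "(\<integral>\<^sup>+x. ennreal \<bar>det (matrix (f' x))\<bar> * indicator T x \<partial>lborel) = ennreal (measure lebesgue (f ` T))"
    by simp
  also have "\<dots> = emeasure lborel (\<Phi> ` A)"
    using False em fTb emeasure_eq_ennreal_measure[of lborel "f ` T"]
    by (metis infinity_ennreal_def measure_completion sets_lborel)
  also have "(\<integral>\<^sup>+x. ennreal \<bar>det (matrix (f' x))\<bar> * indicator T x \<partial>lborel)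
    = (\<integral>\<^sup>+x. (\<lambda>z. ennreal ((cmod (deriv \<Phi> z))\<^sup>2) * indicator A z) (of_plane x) \<partial>lborel)"
    by (intro nn_integral_cong) (auto simp: f'_def det_complex_mult_plane T_eq indicator_def)
  also have "\<dots> = (\<integral>\<^sup>+z. ennreal ((cmod (deriv \<Phi> z))\<^sup>2) * indicator A z \<partial>lborel)"
  proof (rule nn_integral_of_plane)
    have "continuous_on S (\<lambda>z. (cmod (deriv \<Phi> z))\<^sup>2)"
      using \<Phi> S by (intro continuous_intros holomorphic_on_imp_continuous_on holomorphic_deriv) auto
    then have "(\<lambda>z. indicator S z *\<^sub>R (cmod (deriv \<Phi> z))\<^sup>2) \<in> borel_measurable borel"
      using S by (intro borel_measurable_continuous_on_indicator) auto
    then have "(\<lambda>z. ennreal (indicator S z *\<^sub>R (cmod (deriv \<Phi> z))\<^sup>2) * indicator A z) \<in> borel_measurable borel"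
      using A by measurable
    also have "(\<lambda>z. ennreal (indicator S z *\<^sub>R (cmod (deriv \<Phi> z))\<^sup>2) * indicator A z)
      = (\<lambda>z. ennreal ((cmod (deriv \<Phi> z))\<^sup>2) * indicator A z)"
      using A by (auto simp: indicator_def fun_eq_iff)
    finally show "(\<lambda>z. ennreal ((cmod (deriv \<Phi> z))\<^sup>2) * indicator A z) \<in> borel_measurable borel" .
  qed
  finally show ?thesis by simp
qed auto

text \<open>The estimate for sets says that the push-forward of the measure with density
  \<open>(cmod (deriv \<Phi> z))\<^sup>2\<close> is dominated by Lebesgue measure on the image.
  Domination of measures passes to all nonnegative measurable integrands.\<close>

lemma nn_integral_holomorphic_subst_le:
  assumes \<Phi>: "\<Phi> holomorphic_on S" and S: "open S" and inj: "inj_on \<Phi> S"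
    and g: "g \<in> borel_measurable borel"
  shows "(\<integral>\<^sup>+z\<in>S. g (\<Phi> z) * ennreal ((cmod (deriv \<Phi> z))\<^sup>2) \<partial>lborel) \<le> (\<integral>\<^sup>+w\<in>\<Phi> ` S. g w \<partial>lborel)"
proof -
  \<comment> \<open>The extension by \<open>0\<close> is Borel measurable on the whole plane; the
    density \<open>d\<close> vanishes outside \<open>S\<close>, so the added values carry no
    mass.\<close>
  define \<Phi>0 where "\<Phi>0 z = (if z \<in> S then \<Phi> z else 0)" for z
  define d where "d z = ennreal ((cmod (deriv \<Phi> z))\<^sup>2) * indicator S z" for z
  have S' [measurable]: "S \<in> sets borel" using S by auto
  have "continuous_on S \<Phi>" using \<Phi> holomorphic_on_imp_continuous_on by blast
  then have "(\<lambda>z. indicator S z *\<^sub>R \<Phi> z) \<in> borel_measurable borel"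
    by (intro borel_measurable_continuous_on_indicator) auto
  then have \<Phi>0 [measurable]: "\<Phi>0 \<in> borel_measurable borel"
    by (rule measurable_cong[THEN iffD1, rotated]) (auto simp: \<Phi>0_def)
  have "continuous_on S (\<lambda>z. (cmod (deriv \<Phi> z))\<^sup>2)"
    using \<Phi> S by (intro continuous_intros holomorphic_on_imp_continuous_on holomorphic_deriv) auto
  then have "(\<lambda>z. indicator S z *\<^sub>R (cmod (deriv \<Phi> z))\<^sup>2) \<in> borel_measurable borel"
    by (intro borel_measurable_continuous_on_indicator) auto
  then have "(\<lambda>z. ennreal (indicator S z *\<^sub>R (cmod (deriv \<Phi> z))\<^sup>2)) \<in> borel_measurable borel"
    by measurable
  then have d [measurable]: "d \<in> borel_measurable borel"
    by (rule measurable_cong[THEN iffD1, rotated]) (auto simp: d_def indicator_def)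
  have opn: "open (\<Phi> ` S)"
    using open_mapping_thm3[OF \<Phi> S inj] .
  then have im [measurable]: "\<Phi> ` S \<in> sets borel" by auto
  define M where "M = distr (density lborel d) borel \<Phi>0"
  define N where "N = density lborel (indicator (\<Phi> ` S) :: complex \<Rightarrow> ennreal)"
  have le: "emeasure M B \<le> emeasure N B" if B [measurable]: "B \<in> sets borel" for B
  proof -
    have vim: "\<Phi>0 -` B \<in> sets borel"
      using measurable_sets[OF \<Phi>0 B] by simp
    have im2: "\<Phi> ` (S \<inter> \<Phi>0 -` B) = \<Phi> ` S \<inter> B"
      by (auto simp: \<Phi>0_def)
    have "emeasure M B = (\<integral>\<^sup>+z. d z * indicator (\<Phi>0 -` B) z \<partial>lborel)"
      unfolding M_def using vim by (subst emeasure_distr) (auto simp: emeasure_density)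
    also have "\<dots> = (\<integral>\<^sup>+z. ennreal ((cmod (deriv \<Phi> z))\<^sup>2) * indicator (S \<inter> \<Phi>0 -` B) z \<partial>lborel)"
      by (intro nn_integral_cong) (auto simp: d_def indicator_def)
    also have "\<dots> \<le> emeasure lborel (\<Phi> ` (S \<inter> \<Phi>0 -` B))"
      using vim im2 im B by (intro emeasure_holomorphic_image_ge[OF \<Phi> S inj]) auto
    also have "\<dots> = emeasure N B"
      unfolding N_def im2 by (subst emeasure_density) (auto simp: indicator_inter_arith[symmetric])
    finally show ?thesis .
  qed
  have "(\<integral>\<^sup>+w. g w \<partial>M) \<le> (\<integral>\<^sup>+w. g w \<partial>N)"
    using le by (intro nn_integral_mono_measure le_measure[THEN iffD2]) (auto simp: M_def N_def le_fun_def)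
  also have "(\<integral>\<^sup>+w. g w \<partial>N) = (\<integral>\<^sup>+w\<in>\<Phi> ` S. g w \<partial>lborel)"
    unfolding N_def using g by (subst nn_integral_density) (auto simp: mult.commute)
  also have "(\<integral>\<^sup>+w. g w \<partial>M) = (\<integral>\<^sup>+z\<in>S. g (\<Phi> z) * ennreal ((cmod (deriv \<Phi> z))\<^sup>2) \<partial>lborel)"
  proof -
    have "(\<integral>\<^sup>+w. g w \<partial>M) = (\<integral>\<^sup>+z. d z * g (\<Phi>0 z) \<partial>lborel)"
      unfolding M_def using g by (subst nn_integral_distr) (auto simp: nn_integral_density)
    also have "\<dots> = (\<integral>\<^sup>+z\<in>S. g (\<Phi> z) * ennreal ((cmod (deriv \<Phi> z))\<^sup>2) \<partial>lborel)"
      by (intro nn_integral_cong) (auto simp: d_def \<Phi>0_def indicator_def mult.commute)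
    finally show ?thesis .
  qed
  finally show ?thesis .
qed

subsection \<open>Subordination\<close>

text \<open>The substitution estimate, applied to the rotation and to its inverse, gives both
  inequalities.\<close>

lemma nn_integral_rotate:
  fixes g :: "complex \<Rightarrow> ennreal"
  assumes "cmod \<alpha> = 1" and g: "g \<in> borel_measurable borel"
  shows "(\<integral>\<^sup>+z. g (\<alpha> * z) \<partial>lborel) = (\<integral>\<^sup>+z. g z \<partial>lborel)"
proof -
  have le: "(\<integral>\<^sup>+z. k (\<beta> * z) \<partial>lborel) \<le> (\<integral>\<^sup>+z. k z \<partial>lborel)"
    if \<beta>: "cmod \<beta> = 1" and k: "k \<in> borel_measurable borel" for \<beta> and k :: "complex \<Rightarrow> ennreal"
  proof -
    have b0: "\<beta> \<noteq> 0" using \<beta> by auto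
    have "deriv (\<lambda>z. \<beta> * z) z = \<beta>" for z by (intro DERIV_imp_deriv) (auto intro!: derivative_eq_intros)
    moreover have "range (\<lambda>z. \<beta> * z) = UNIV"
      using b0 by (auto simp: image_iff) (metis nonzero_divide_eq_eq times_divide_eq_right mult.commute)
    ultimately show ?thesis
      using nn_integral_holomorphic_subst_le[of "\<lambda>z. \<beta> * z" UNIV k] \<beta> k b0
      by (auto intro!: holomorphic_intros simp: inj_on_def)
  qed
  have a0: "\<alpha> \<noteq> 0" using assms by auto
  have "(\<integral>\<^sup>+z. g z \<partial>lborel) = (\<integral>\<^sup>+z. g (\<alpha> * (inverse \<alpha> * z)) \<partial>lborel)"
    using a0 by (intro nn_integral_cong) (simp add: mult.assoc[symmetric])
  also have "\<dots> \<le> (\<integral>\<^sup>+z. g (\<alpha> * z) \<partial>lborel)"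
    using assms g by (intro le[of _ "\<lambda>z. g (\<alpha> * z)"]) (auto simp: norm_inverse)
  finally show ?thesis using le[OF assms] by simp
qed

text \<open>The parameter runs through \<open>{0..1}\<close>, as in \<open>circlepath\<close>, so
  that integrals over it are means.\<close>

abbreviation circ :: "complex \<Rightarrow> real \<Rightarrow> complex"
  where "circ z x \<equiv> exp (2 * of_real pi * \<i> * of_real x) * z"

lemma cmod_circ [simp]: "cmod (circ z x) = cmod z"
  by (simp add: norm_mult)

text \<open>Rotation invariance and Fubini. This takes the place of polar coordinates: inequalities
  between means on circles can be integrated over the plane.\<close>

lemma nn_integral_rotation_average:
  fixes k :: "complex \<Rightarrow> ennreal"
  assumes k [measurable]: "k \<in> borel_measurable borel"
  shows "(\<integral>\<^sup>+z. k z \<partial>lborel) = (\<integral>\<^sup>+z. (\<integral>\<^sup>+x\<in>{0..1}. k (circ z x) \<partial>lborel) \<partial>lborel)"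
proof -
  have "(\<lambda>p. circ (snd p) (fst p)) \<in> borel_measurable (borel :: (real \<times> complex) measure)"
    by (intro borel_measurable_continuous_onI continuous_intros)
  then have [measurable]: "(\<lambda>p. circ (snd p) (fst p)) \<in> borel_measurable (lborel \<Otimes>\<^sub>M lborel)"
    by (simp add: borel_prod[symmetric])
  have "(\<lambda>p. circ (fst p) (snd p)) \<in> borel_measurable (borel :: (complex \<times> real) measure)"
    by (intro borel_measurable_continuous_onI continuous_intros)
  then have [measurable]: "(\<lambda>p. circ (fst p) (snd p)) \<in> borel_measurable (lborel \<Otimes>\<^sub>M lborel)"
    by (simp add: borel_prod[symmetric])
  have "(\<integral>\<^sup>+z. (\<integral>\<^sup>+x. k (circ z x) * indicator {0..1} x \<partial>lborel) \<partial>lborel)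
      = (\<integral>\<^sup>+x. (\<integral>\<^sup>+z. k (circ z x) * indicator {0..1} x \<partial>lborel) \<partial>lborel)"
  proof (intro lborel_pair.Fubini')
    have "(\<lambda>p. k (circ (snd p) (fst p)) * indicator {0..1} (fst p)) \<in> borel_measurable (lborel \<Otimes>\<^sub>M lborel)"
      by measurable
    then show "(\<lambda>(x, z). k (circ z x) * indicator {0..1} x) \<in> borel_measurable (lborel \<Otimes>\<^sub>M lborel)"
      by (simp add: case_prod_beta)
  qed
  also have "\<dots> = (\<integral>\<^sup>+x. (\<integral>\<^sup>+z. k z \<partial>lborel) * indicator {0..1::real} x \<partial>lborel)"
  proof (intro nn_integral_cong)
    fix x :: real
    show "(\<integral>\<^sup>+z. k (circ z x) * indicator {0..1} x \<partial>lborel) = (\<integral>\<^sup>+z. k z \<partial>lborel) * indicator {0..1} x"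
      by (subst nn_integral_multc) (auto simp: nn_integral_rotate)
  qed
  also have "\<dots> = (\<integral>\<^sup>+z. k z \<partial>lborel)"
    by (subst nn_integral_cmult) auto
  finally show ?thesis by simp
qed

text \<open>Cauchy's formula written with \<open>dx\<close>: on the circle,
  \<open>d\<zeta> / (2 \<pi> i)\<close> equals \<open>\<zeta> dx\<close>.\<close>

lemma Cauchy_circle_mean:
  fixes F :: "complex \<Rightarrow> complex"
  assumes F: "F holomorphic_on cball 0 (cmod z)" and w: "cmod w < cmod z"
  shows "((\<lambda>x. F (circ z x) * (circ z x / (circ z x - w))) has_integral F w) {0..1}"
proof -
  define r where "r = cmod z"
  define \<alpha> where "\<alpha> = z / of_real r"
  have r: "0 < r" using w by (auto simp: r_def intro: le_less_trans[OF norm_ge_zero])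
  have cancel: "inverse c * (c * y) = y" if "c \<noteq> 0" for c y :: complex
    using that by simp
  have pi2: "2 * of_real pi * \<i> \<noteq> (0::complex)" by simp
  have \<alpha>: "cmod \<alpha> = 1" "\<alpha> \<noteq> 0" "\<alpha> * of_real r = z" using r by (auto simp: \<alpha>_def r_def norm_divide)
  have hol: "(\<lambda>u. F (\<alpha> * u)) holomorphic_on cball 0 r"
    using r \<alpha> by (intro holomorphic_on_compose_gen[OF _ F, unfolded o_def])
      (auto intro!: holomorphic_intros simp: norm_mult r_def)
  have "((\<lambda>u. F (\<alpha> * u) / (u - w / \<alpha>)) has_contour_integral (2 * of_real pi * \<i> * F (\<alpha> * (w / \<alpha>)))) (circlepath 0 r)"
    using w \<alpha> by (intro Cauchy_integral_circlepath_simple[OF hol]) (auto simp: r_def norm_divide)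
  then have "((\<lambda>x. (F (\<alpha> * circlepath 0 r x) / (circlepath 0 r x - w / \<alpha>)) *
       vector_derivative (circlepath 0 r) (at x within {0..1})) has_integral (2 * of_real pi * \<i> * F w)) {0..1}"
    using \<alpha> unfolding has_contour_integral_def by simp
  then have "((\<lambda>x. (2 * of_real pi * \<i>) * (F (circ z x) * (circ z x / (circ z x - w))))
     has_integral ((2 * of_real pi * \<i>) * F w)) {0..1}"
  proof (rule has_integral_eq[rotated])
    fix x :: real assume x: "x \<in> {0..1}"
    have c: "circ z x = \<alpha> * circlepath 0 r x"
      using \<alpha>(3) by (simp add: circlepath mult_ac)
    have "circ z x \<noteq> w" using w by (metis cmod_circ less_irrefl)
    then have ne: "circlepath 0 r x - w / \<alpha> \<noteq> 0"
      using \<alpha> unfolding c by (auto simp: field_simps)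
    have "circ z x - w = \<alpha> * (circlepath 0 r x - w / \<alpha>)"
      unfolding c using \<alpha> by (simp add: field_simps)
    moreover have "vector_derivative (circlepath 0 r) (at x within {0..1}) = 2 * of_real pi * \<i> * circlepath 0 r x"
      using x vector_derivative_circlepath01[of x 0 r] by (auto simp: circlepath)
    ultimately show "(F (\<alpha> * circlepath 0 r x) / (circlepath 0 r x - w / \<alpha>)) *
       vector_derivative (circlepath 0 r) (at x within {0..1})
       = (2 * of_real pi * \<i>) * (F (circ z x) * (circ z x / (circ z x - w)))"
      using \<alpha> ne unfolding c by (simp add: field_simps)
  qed
  from has_integral_mult_right[OF this, of "inverse (2 * of_real pi * \<i>)"]
  show ?thesis by (simp only: cancel[OF pi2])
qed

definition poisson :: "complex \<Rightarrow> complex \<Rightarrow> real"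
  where "poisson w \<zeta> = ((cmod \<zeta>)\<^sup>2 - (cmod w)\<^sup>2) / (cmod (\<zeta> - w))\<^sup>2"

lemma poisson_nonneg: "cmod w < cmod \<zeta> \<Longrightarrow> 0 \<le> poisson w \<zeta>"
  unfolding poisson_def by (intro divide_nonneg_nonneg) (auto simp: power_mono)

text \<open>In the first form the kernel is the Cauchy kernel plus a term that, on the circle,
  agrees with a function holomorphic in \<open>\<zeta>\<close> and vanishing at \<open>0\<close>;
  this term integrates to zero against holomorphic functions. In the second form the kernel is the
  real part of a function holomorphic in \<open>w\<close>, so it is harmonic in
  \<open>w\<close>.\<close>

lemma poisson_eq:
  assumes "cmod w < cmod \<zeta>"
  shows "of_real (poisson w \<zeta>) = \<zeta> / (\<zeta> - w) + cnj w * \<zeta> / ((cmod \<zeta>)\<^sup>2 - cnj w * \<zeta>)"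
    and "poisson w \<zeta> = Re ((\<zeta> + w) / (\<zeta> - w))"
proof -
  have ne: "\<zeta> - w \<noteq> 0" using assms by auto
  have z0: "\<zeta> \<noteq> 0" using assms by auto
  have ne': "cnj \<zeta> - cnj w \<noteq> 0" using ne by (metis complex_cnj_diff complex_cnj_zero_iff)
  have n1: "of_real ((cmod \<zeta>)\<^sup>2) = \<zeta> * cnj \<zeta>" "of_real ((cmod w)\<^sup>2) = w * cnj w"
    "of_real ((cmod (\<zeta> - w))\<^sup>2) = (\<zeta> - w) * (cnj \<zeta> - cnj w)"
    by (simp_all only: complex_norm_square complex_cnj_diff)
  have "of_real (poisson w \<zeta>) = (\<zeta> * cnj \<zeta> - w * cnj w) / ((\<zeta> - w) * (cnj \<zeta> - cnj w))"
    unfolding poisson_def of_real_divide of_real_diff n1 ..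
  also have "\<dots> = \<zeta> / (\<zeta> - w) + cnj w / (cnj \<zeta> - cnj w)"
    using ne ne' by (simp add: field_simps)
  also have "cnj w / (cnj \<zeta> - cnj w) = cnj w * \<zeta> / (of_real ((cmod \<zeta>)\<^sup>2) - cnj w * \<zeta>)"
    unfolding n1 using ne' z0 by (simp add: field_simps)
  finally show "of_real (poisson w \<zeta>) = \<zeta> / (\<zeta> - w) + cnj w * \<zeta> / ((cmod \<zeta>)\<^sup>2 - cnj w * \<zeta>)" 
    by simp
  have "(\<zeta> + w) / (\<zeta> - w) = (\<zeta> + w) * cnj (\<zeta> - w) / of_real ((cmod (\<zeta> - w))\<^sup>2)"
    unfolding n1 using ne ne' by simp
  then have "Re ((\<zeta> + w) / (\<zeta> - w)) = Re ((\<zeta> + w) * cnj (\<zeta> - w)) / (cmod (\<zeta> - w))\<^sup>2"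
    by (simp only: Re_divide_of_real)
  also have "Re ((\<zeta> + w) * cnj (\<zeta> - w)) = (cmod \<zeta>)\<^sup>2 - (cmod w)\<^sup>2"
    unfolding cmod_power2 by (simp add: algebra_simps power2_eq_square)
  finally show "poisson w \<zeta> = Re ((\<zeta> + w) / (\<zeta> - w))" by (simp add: poisson_def)
qed

lemma Poisson_formula:
  fixes F :: "complex \<Rightarrow> complex"
  assumes F: "F holomorphic_on cball 0 (cmod z)" and w: "cmod w < cmod z"
  shows "((\<lambda>x. of_real (poisson w (circ z x)) * F (circ z x)) has_integral F w) {0..1}"
proof -
  define r where "r = cmod z"
  have r: "0 < r" using w by (auto simp: r_def intro: le_less_trans[OF norm_ge_zero])
  \<comment> \<open>On the circle \<open>cmod u = r\<close> the fraction is the second summand of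
    the kernel. It is holomorphic on the closed disk because \<open>cmod w < r\<close>, and it
    vanishes at \<open>0\<close>, so its contribution to the mean is zero.\<close>
  define H where "H u = F u * (cnj w * u / (of_real (r\<^sup>2) - cnj w * u))" for u :: complex
  have H: "H holomorphic_on cball 0 (cmod z)"
    unfolding H_def
  proof (intro holomorphic_intros F)
    fix u :: complex assume u: "u \<in> cball 0 (cmod z)"
    have "cmod (cnj w * u) \<le> cmod w * r" using u by (simp add: norm_mult mult_left_mono r_def)
    also have "\<dots> < r * r" using w r unfolding r_def by (intro mult_strict_right_mono) auto
    finally have "cmod (cnj w * u) < cmod (of_real (r\<^sup>2))" by (simp add: power2_eq_square norm_mult)
    then show "of_real (r\<^sup>2) - cnj w * u \<noteq> 0" by (metis eq_iff_diff_eq_0 less_irrefl)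
  qed
  have "((\<lambda>x. H (circ z x) * (circ z x / (circ z x - 0))) has_integral H 0) {0..1}"
    using r by (intro Cauchy_circle_mean[OF H]) (simp add: r_def)
  moreover have "H 0 = 0" by (simp add: H_def)
  moreover have "z \<noteq> 0" using r r_def by auto
  ultimately have I2: "((\<lambda>x. F (circ z x) * (cnj w * circ z x / ((cmod (circ z x))\<^sup>2 - cnj w * circ z x))) has_integral 0) {0..1}"
    by (simp add: H_def r_def)
  have "((\<lambda>x. F (circ z x) * (circ z x / (circ z x - w)) +
      F (circ z x) * (cnj w * circ z x / ((cmod (circ z x))\<^sup>2 - cnj w * circ z x))) has_integral F w + 0) {0..1}"
    by (rule has_integral_add[OF Cauchy_circle_mean[OF assms] I2])
  moreover have "of_real (poisson w (circ z x)) = circ z x / (circ z x - w)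
      + cnj w * circ z x / ((cmod (circ z x))\<^sup>2 - cnj w * circ z x)" for x
    using w by (intro poisson_eq(1)) simp
  ultimately show ?thesis
    by (simp only: distrib_right add_0_right mult.commute[of "F _"])
qed

lemma powr_ge_tangent:
  fixes x y p :: real
  assumes "0 \<le> x" "0 \<le> y" "1 < p"
  shows "y powr p + p * y powr (p - 1) * (x - y) \<le> x powr p"
proof (cases "y = 0")
  case False
  then have y: "0 < y" using assms by simp
  show ?thesis
  proof (cases "x = 0")
    case True
    have "y powr p = y powr (p - 1) * y" using y powr_add[of y "p - 1" 1] by simp
    then have "y powr p + p * y powr (p - 1) * (x - y) = (1 - p) * y powr p"
      using True by (simp add: algebra_simps)
    then show ?thesis using True assms by (simp add: mult_nonpos_nonneg)
  next
    case False
    then have x: "0 < x" using assms by simp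
    have conv: "convex_on {0<..} (\<lambda>x::real. x powr p)"
      using assms by (intro powr_convex) auto
    have "p * y powr (p - 1) * (x - y) \<le> x powr p - y powr p"
    proof (rule convex_on_imp_above_tangent[OF conv])
      show "y \<in> interior {0<..}" "x \<in> {0<..}" using y x by (auto simp: interior_open)
      show "((\<lambda>x. x powr p) has_real_derivative p * y powr (p - 1)) (at y within {0<..})"
        using y by (auto intro!: derivative_eq_intros)
    qed auto
    then show ?thesis by simp
  qed
qed (use assms in auto)

text \<open>Jensen's inequality for the probability density \<open>k\<close>, by integrating the
  tangent of \<open>x powr p\<close> at \<open>cmod I\<close>. The linear term is nonnegative
  because \<open>cmod I\<close> is at most the integral of \<open>k x * cmod (v x)\<close>.\<close>

lemma powr_norm_integral_le:
  fixes v :: "real \<Rightarrow> complex" and k :: "real \<Rightarrow> real"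
  assumes p: "1 < p" and k: "\<And>x. x \<in> {a..b} \<Longrightarrow> 0 \<le> k x"
    and ck: "continuous_on {a..b} k" and cv: "continuous_on {a..b} v"
    and k1: "(k has_integral 1) {a..b}" and I: "((\<lambda>x. of_real (k x) * v x) has_integral I) {a..b}"
  shows "ennreal (cmod I powr p) \<le> (\<integral>\<^sup>+x\<in>{a..b}. ennreal (k x * cmod (v x) powr p) \<partial>lborel)"
proof -
  define y where "y = cmod I"
  have c1: "continuous_on {a..b} (\<lambda>x. k x * cmod (v x))"
    using ck cv by (intro continuous_intros)
  have c2: "continuous_on {a..b} (\<lambda>x. k x * cmod (v x) powr p)"
    using ck cv p by (intro continuous_intros continuous_on_powr') auto
  have i1: "((\<lambda>x. k x * cmod (v x)) has_integral integral {a..b} (\<lambda>x. k x * cmod (v x))) {a..b}"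
    using integrable_continuous_interval[OF c1] by blast
  have i2: "((\<lambda>x. k x * cmod (v x) powr p) has_integral integral {a..b} (\<lambda>x. k x * cmod (v x) powr p)) {a..b}"
    using integrable_continuous_interval[OF c2] by blast
  have yle: "y \<le> integral {a..b} (\<lambda>x. k x * cmod (v x))"
    unfolding y_def integral_unique[OF I, symmetric]
    using k I i1 by (intro integral_norm_bound_integral) (auto simp: norm_mult)
  have "y powr p * 1 + p * y powr (p - 1) * (integral {a..b} (\<lambda>x. k x * cmod (v x)) - y * 1)
      \<le> integral {a..b} (\<lambda>x. k x * cmod (v x) powr p)"
  proof (rule has_integral_le)
    show "((\<lambda>x. y powr p * k x + p * y powr (p - 1) * (k x * cmod (v x) - y * k x)) has_integral
       y powr p * 1 + p * y powr (p - 1) * (integral {a..b} (\<lambda>x. k x * cmod (v x)) - y * 1)) {a..b}"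
      using k1 i1 by (intro has_integral_add has_integral_mult_right has_integral_diff)
    fix x assume "x \<in> {a..b}"
    then have "k x * (y powr p + p * y powr (p - 1) * (cmod (v x) - y)) \<le> k x * cmod (v x) powr p"
      using p k by (intro mult_left_mono powr_ge_tangent) (auto simp: y_def)
    then show "y powr p * k x + p * y powr (p - 1) * (k x * cmod (v x) - y * k x) \<le> k x * cmod (v x) powr p"
      by (simp add: algebra_simps)
  qed (rule i2)
  moreover have "0 \<le> p * y powr (p - 1) * (integral {a..b} (\<lambda>x. k x * cmod (v x)) - y)"
    using yle p by auto
  ultimately have "y powr p \<le> integral {a..b} (\<lambda>x. k x * cmod (v x) powr p)" by simp
  then have "ennreal (y powr p) \<le> ennreal (integral {a..b} (\<lambda>x. k x * cmod (v x) powr p))"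
    by (rule ennreal_leI)
  also have "\<dots> = (\<integral>\<^sup>+x\<in>{a..b}. ennreal (k x * cmod (v x) powr p) \<partial>lborel)"
    using k by (intro nn_integral_has_integral_lebesgue'[symmetric] i2) auto
  finally show ?thesis by (simp add: y_def)
qed

text \<open>At each \<open>t\<close> the Poisson formula and Jensen's inequality bound
  \<open>cmod (F (\<Phi> (circ z t))) powr p\<close> by a Poisson mean over the circle. After
  exchanging the integrals, the kernel is averaged over \<open>t\<close> for a fixed boundary point;
  being harmonic in its first argument, it has the mean that belongs to \<open>\<Phi> 0 = 0\<close>,
  namely \<open>1\<close>. The strict inequality for \<open>\<Phi>\<close> keeps the kernel free of
  poles.\<close>

lemma circle_subordination:
  fixes F \<Phi> :: "complex \<Rightarrow> complex"
  assumes p: "1 < p" and F: "F holomorphic_on unit_disk" and \<Phi>: "\<Phi> holomorphic_on unit_disk" "\<Phi> 0 = 0"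
    and z: "cmod z < 1" "z \<noteq> 0" and lt: "\<And>u. cmod u \<le> cmod z \<Longrightarrow> cmod (\<Phi> u) < cmod z"
  shows "(\<integral>\<^sup>+x\<in>{0..1}. ennreal (cmod (F (\<Phi> (circ z x))) powr p) \<partial>lborel)
     \<le> (\<integral>\<^sup>+x\<in>{0..1}. ennreal (cmod (F (circ z x)) powr p) \<partial>lborel)"
proof -
  define r where "r = cmod z"
  have r: "0 < r" "r < 1" using z by (auto simp: r_def)
  have hF: "F holomorphic_on cball 0 (cmod z)" and h\<Phi>: "\<Phi> holomorphic_on cball 0 (cmod z)"
    using F \<Phi>(1) z by (auto elim!: holomorphic_on_subset)
  have cF: "continuous_on unit_disk F" and c\<Phi>: "continuous_on unit_disk \<Phi>"
    using F \<Phi> holomorphic_on_imp_continuous_on by auto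
  have c1: "continuous_on UNIV (\<lambda>x. F (circ z x))"
    using z by (intro continuous_on_compose2[OF cF] continuous_intros) (auto simp: norm_mult)
  have c2: "continuous_on UNIV (\<lambda>x. \<Phi> (circ z x))"
    using z by (intro continuous_on_compose2[OF c\<Phi>] continuous_intros) (auto simp: norm_mult)
  have ltc: "cmod (\<Phi> (circ z x)) < cmod (circ z y)" for x y
    using lt[of "circ z x"] by simp
  have ne: "circ z y \<noteq> \<Phi> (circ z x)" for x y using ltc[of x y] by (metis less_irrefl)
  define k where "k t \<theta> = ennreal (poisson (\<Phi> (circ z t)) (circ z \<theta>) * cmod (F (circ z \<theta>)) powr p)" for t \<theta>
  have cP: "continuous_on UNIV (\<lambda>\<theta>. poisson w (circ z \<theta>))" if "cmod w < cmod z" for w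
  proof -
    have "circ z \<theta> \<noteq> w" for \<theta> using that by (metis cmod_circ less_irrefl)
    then show ?thesis unfolding poisson_def by (intro continuous_intros) auto
  qed
  have pint: "((\<lambda>\<theta>. poisson w (circ z \<theta>)) has_integral 1) {0..1}" if "cmod w < cmod z" for w
  proof -
    have "((\<lambda>x. of_real (poisson w (circ z x)) * (1::complex)) has_integral 1) {0..1}"
      using Poisson_formula[of "\<lambda>_. 1" z w] that by auto
    from has_integral_Re[OF this] show ?thesis by simp
  qed
  have 1: "ennreal (cmod (F (\<Phi> (circ z t))) powr p) \<le> (\<integral>\<^sup>+\<theta>\<in>{0..1}. k t \<theta> \<partial>lborel)" for t
    unfolding k_def
    using lt[of "circ z t"] Poisson_formula[OF hF, where w = "\<Phi> (circ z t)"] p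
    by (intro powr_norm_integral_le[OF p _ _ _ pint] poisson_nonneg ltc continuous_on_subset[OF c1]
         continuous_on_subset[OF cP]) auto
  have 2: "(\<integral>\<^sup>+t\<in>{0..1}. ennreal (poisson (\<Phi> (circ z t)) \<zeta>) \<partial>lborel) = 1" if \<zeta>: "cmod \<zeta> = r" for \<zeta>
  proof -
    have "\<zeta> \<noteq> 0" using \<zeta> r by auto
    have "(\<lambda>u. (\<zeta> + \<Phi> u) / (\<zeta> - \<Phi> u)) holomorphic_on cball 0 (cmod z)"
    proof (intro holomorphic_intros h\<Phi>)
      fix u :: complex assume "u \<in> cball 0 (cmod z)"
      then show "\<zeta> - \<Phi> u \<noteq> 0" using lt[of u] \<zeta> by (auto simp: r_def)
    qed
    from Cauchy_circle_mean[OF this, of 0]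
    have "((\<lambda>x. (\<zeta> + \<Phi> (circ z x)) / (\<zeta> - \<Phi> (circ z x))) has_integral 1) {0..1}"
      using z r \<Phi> \<open>\<zeta> \<noteq> 0\<close> by simp
    from has_integral_Re[OF this]
    have "((\<lambda>x. poisson (\<Phi> (circ z x)) \<zeta>) has_integral 1) {0..1}"
      using lt \<zeta> by (subst poisson_eq(2)) (auto simp: r_def)
    from nn_integral_has_integral_lebesgue'[OF _ this]
    show ?thesis using lt \<zeta> by (auto simp: r_def poisson_nonneg)
  qed
  have cmeas: "(\<lambda>(t,\<theta>). k t \<theta>) \<in> borel_measurable (borel :: (real \<times> real) measure)"
  proof -
    have "continuous_on UNIV (\<lambda>q::real\<times>real. poisson (\<Phi> (circ z (fst q))) (circ z (snd q)) * cmod (F (circ z (snd q))) powr p)"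
      unfolding poisson_def using ne p
      by (intro continuous_intros continuous_on_powr' continuous_on_compose2[OF c1] continuous_on_compose2[OF c2]) auto
    from borel_measurable_continuous_onI[OF this] show ?thesis
      unfolding k_def by (simp add: case_prod_beta)
  qed
  have [measurable]: "(\<lambda>(t,\<theta>). k t \<theta>) \<in> borel_measurable (lborel \<Otimes>\<^sub>M lborel)"
    using cmeas by (simp add: borel_prod[symmetric])
  have km: "k t \<theta> = ennreal (cmod (F (circ z \<theta>)) powr p) * ennreal (poisson (\<Phi> (circ z t)) (circ z \<theta>))" for t \<theta>
    unfolding k_def by (simp only: mult.commute[of "poisson _ _"] ennreal_mult powr_ge_zero poisson_nonneg[OF ltc])
  have F1 [measurable]: "(\<lambda>x. ennreal (cmod (F (circ z x)) powr p)) \<in> borel_measurable borel"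
    using borel_measurable_continuous_onI[OF c1] by measurable
  have P1 [measurable]: "(\<lambda>t. ennreal (poisson (\<Phi> (circ z t)) (circ z \<theta>))) \<in> borel_measurable borel" for \<theta>
  proof -
    have "continuous_on UNIV (\<lambda>t. poisson (\<Phi> (circ z t)) (circ z \<theta>))"
      unfolding poisson_def using ne by (intro continuous_intros c2) auto
    from borel_measurable_continuous_onI[OF this] show ?thesis by measurable
  qed
  have "(\<integral>\<^sup>+t\<in>{0..1}. ennreal (cmod (F (\<Phi> (circ z t))) powr p) \<partial>lborel)
     \<le> (\<integral>\<^sup>+t\<in>{0..1}. (\<integral>\<^sup>+\<theta>\<in>{0..1}. k t \<theta> \<partial>lborel) \<partial>lborel)"
    by (intro nn_integral_mono mult_right_mono 1) auto
  also have "\<dots> = (\<integral>\<^sup>+t. (\<integral>\<^sup>+\<theta>. k t \<theta> * indicator {0..1} \<theta> * indicator {0..1} t \<partial>lborel) \<partial>lborel)"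
    by (intro nn_integral_cong nn_integral_multc[symmetric]) auto
  also have "\<dots> = (\<integral>\<^sup>+\<theta>. (\<integral>\<^sup>+t. k t \<theta> * indicator {0..1} \<theta> * indicator {0..1} t \<partial>lborel) \<partial>lborel)"
    by (intro lborel_pair.Fubini') (measurable)
  also have "\<dots> = (\<integral>\<^sup>+\<theta>. ennreal (cmod (F (circ z \<theta>)) powr p) * indicator {0..1} \<theta> \<partial>lborel)"
  proof (intro nn_integral_cong)
    fix \<theta>
    have "(\<integral>\<^sup>+t. k t \<theta> * indicator {0..1} \<theta> * indicator {0..1} t \<partial>lborel)
      = (\<integral>\<^sup>+t. (ennreal (cmod (F (circ z \<theta>)) powr p) * indicator {0..1} \<theta>) *
            (ennreal (poisson (\<Phi> (circ z t)) (circ z \<theta>)) * indicator {0..1} t) \<partial>lborel)"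
      by (intro nn_integral_cong) (simp only: km mult_ac)
    also have "\<dots> = (ennreal (cmod (F (circ z \<theta>)) powr p) * indicator {0..1} \<theta>) *
        (\<integral>\<^sup>+t\<in>{0..1}. ennreal (poisson (\<Phi> (circ z t)) (circ z \<theta>)) \<partial>lborel)"
      by (rule nn_integral_cmult) measurable
    also have "\<dots> = ennreal (cmod (F (circ z \<theta>)) powr p) * indicator {0..1} \<theta>"
      using 2[of "circ z \<theta>"] by (simp add: r_def)
    finally show "(\<integral>\<^sup>+t. k t \<theta> * indicator {0..1} \<theta> * indicator {0..1} t \<partial>lborel) = \<dots>" .
  qed
  finally show ?thesis .
qed

text \<open>By the Schwarz lemma \<open>\<Phi>\<close> is either a rotation, which preserves the
  integral, or strictly decreases the modulus off the origin. In the second case the means over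
  circles are compared and then integrated against the radial weight \<open>k\<close>.\<close>

lemma Littlewood_subordination:
  fixes F \<Phi> :: "complex \<Rightarrow> complex" and k :: "real \<Rightarrow> ennreal"
  assumes p: "1 < p" and F: "F holomorphic_on unit_disk" and \<Phi>: "\<Phi> holomorphic_on unit_disk" "\<Phi> 0 = 0"
    and \<Phi>im: "\<And>z. cmod z < 1 \<Longrightarrow> cmod (\<Phi> z) < 1"
    and k: "k \<in> borel_measurable borel"
  shows "(\<integral>\<^sup>+z\<in>unit_disk. ennreal (cmod (F (\<Phi> z)) powr p) * k (cmod z) \<partial>lborel)
     \<le> (\<integral>\<^sup>+z\<in>unit_disk. ennreal (cmod (F z) powr p) * k (cmod z) \<partial>lborel)"
proof -
  have meas: "(\<lambda>z. ennreal (cmod (H z) powr p) * k (cmod z) * indicator unit_disk z) \<in> borel_measurable borel"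
    if "H holomorphic_on unit_disk" for H
  proof -
    have "continuous_on unit_disk (\<lambda>z. cmod (H z) powr p)"
      using that p by (intro continuous_intros continuous_on_powr' holomorphic_on_imp_continuous_on) auto
    then have [measurable]: "(\<lambda>z. indicator unit_disk z *\<^sub>R (cmod (H z) powr p)) \<in> borel_measurable borel"
      by (intro borel_measurable_continuous_on_indicator) auto
    have "(\<lambda>z. ennreal (indicator unit_disk z *\<^sub>R (cmod (H z) powr p)) * k (cmod z)) \<in> borel_measurable borel"
      using k by measurable
    then show ?thesis by (rule measurable_cong[THEN iffD1, rotated]) (auto simp: indicator_def)
  qed
  have hol: "(\<lambda>z. F (\<Phi> z)) holomorphic_on unit_disk"
    using \<Phi>im by (intro holomorphic_on_compose_gen[OF \<Phi>(1) F, unfolded o_def]) auto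
  consider (rot) \<alpha> where "\<And>z. cmod z < 1 \<Longrightarrow> \<Phi> z = \<alpha> * z" "cmod \<alpha> = 1"
    | (strict) "\<And>z. cmod z < 1 \<Longrightarrow> z \<noteq> 0 \<Longrightarrow> cmod (\<Phi> z) < cmod z"
    using Schwarz_Lemma[OF \<Phi>(1) \<Phi>(2) \<Phi>im] by (metis less_eq_real_def)
  then show ?thesis
  proof cases
    case rot
    have "(\<integral>\<^sup>+z\<in>unit_disk. ennreal (cmod (F (\<Phi> z)) powr p) * k (cmod z) \<partial>lborel)
      = (\<integral>\<^sup>+z. (\<lambda>z. ennreal (cmod (F z) powr p) * k (cmod z) * indicator unit_disk z) (\<alpha> * z) \<partial>lborel)"
      using rot by (intro nn_integral_cong) (auto simp: indicator_def norm_mult)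
    also have "\<dots> = (\<integral>\<^sup>+z\<in>unit_disk. ennreal (cmod (F z) powr p) * k (cmod z) \<partial>lborel)"
      by (rule nn_integral_rotate[OF rot(2) meas[OF F]])
    finally show ?thesis by simp
  next
    case strict
    have avg: "(\<integral>\<^sup>+z\<in>unit_disk. ennreal (cmod (H z) powr p) * k (cmod z) \<partial>lborel)
       = (\<integral>\<^sup>+z. (\<integral>\<^sup>+x\<in>{0..1}. ennreal (cmod (H (circ z x)) powr p) \<partial>lborel) * (k (cmod z) * indicator unit_disk z) \<partial>lborel)"
      if H: "H holomorphic_on unit_disk" for H
    proof -
      have "(\<integral>\<^sup>+z\<in>unit_disk. ennreal (cmod (H z) powr p) * k (cmod z) \<partial>lborel)
        = (\<integral>\<^sup>+z. (\<integral>\<^sup>+x\<in>{0..1}. ennreal (cmod (H (circ z x)) powr p) * k (cmod (circ z x)) * indicator unit_disk (circ z x) \<partial>lborel) \<partial>lborel)"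
        by (rule nn_integral_rotation_average[OF meas[OF H]])
      also have "\<dots> = (\<integral>\<^sup>+z. (\<integral>\<^sup>+x\<in>{0..1}. ennreal (cmod (H (circ z x)) powr p) \<partial>lborel) * (k (cmod z) * indicator unit_disk z) \<partial>lborel)"
      proof (intro nn_integral_cong)
        fix z
        show "(\<integral>\<^sup>+x\<in>{0..1}. ennreal (cmod (H (circ z x)) powr p) * k (cmod (circ z x)) * indicator unit_disk (circ z x) \<partial>lborel)
          = (\<integral>\<^sup>+x\<in>{0..1}. ennreal (cmod (H (circ z x)) powr p) \<partial>lborel) * (k (cmod z) * indicator unit_disk z)"
        proof (cases "z \<in> unit_disk")
          case True
          have cH: "continuous_on UNIV (\<lambda>x. H (circ z x))"
            using True by (intro continuous_on_compose2[OF holomorphic_on_imp_continuous_on[OF H]] continuous_intros)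
               (auto simp: norm_mult)
          have [measurable]: "(\<lambda>x. H (circ z x)) \<in> borel_measurable borel"
            by (rule borel_measurable_continuous_onI[OF cH])
          show ?thesis
            by (subst nn_integral_multc[symmetric])
               (auto intro!: nn_integral_cong simp: indicator_def norm_mult)
        qed (simp add: norm_mult)
      qed
      finally show ?thesis .
    qed
    \<comment> \<open>The circle estimate excludes the origin, which is a null set.\<close>
    have AE: "AE z in lborel. z \<noteq> (0::complex)"
      by (rule AE_lborel_singleton)
    show ?thesis
      unfolding avg[OF hol] avg[OF F]
    proof (rule nn_integral_mono_AE, use AE in eventually_elim)
      fix z :: complex assume z: "z \<noteq> 0"
      show "(\<integral>\<^sup>+x\<in>{0..1}. ennreal (cmod (F (\<Phi> (circ z x))) powr p) \<partial>lborel) * (k (cmod z) * indicator unit_disk z)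
         \<le> (\<integral>\<^sup>+x\<in>{0..1}. ennreal (cmod (F (circ z x)) powr p) \<partial>lborel) * (k (cmod z) * indicator unit_disk z)"
      proof (cases "z \<in> unit_disk")
        case True
        then show ?thesis
          using strict z \<Phi>(2)
          by (intro mult_right_mono circle_subordination[OF p F \<Phi>])
            (auto, metis le_less_trans less_le_trans norm_zero not_le zero_less_norm_iff)
      qed auto
    qed
  qed
qed

subsection \<open>Moebius maps and energies\<close>

lemma one_minus_cnj_mult_nonzero:
  assumes "cmod a < 1" "cmod z < 1"
  shows "1 - cnj a * z \<noteq> 0"
proof
  assume "1 - cnj a * z = 0"
  then have "cmod (cnj a * z) = 1" by (metis eq_iff_diff_eq_0 norm_one)
  moreover have "cmod a * cmod z < 1"
    using assms mult_strict_mono'[of "cmod a" 1 "cmod z" 1] by simp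
  ultimately show False by (simp add: norm_mult)
qed

lemma one_minus_norm_pos: "cmod z < 1 \<Longrightarrow> 0 < 1 - (cmod z)\<^sup>2"
  by (simp add: power_less_one_iff abs_square_less_1)

lemma one_minus_norm_disk_aut:
  assumes "cmod a < 1" "cmod z < 1"
  shows "1 - (cmod (disk_aut a z))\<^sup>2 = (1 - (cmod a)\<^sup>2) * (1 - (cmod z)\<^sup>2) / (cmod (1 - cnj a * z))\<^sup>2"
proof -
  have ne: "(cmod (1 - cnj a * z))\<^sup>2 \<noteq> 0"
    using one_minus_cnj_mult_nonzero[OF assms] by simp
  have "(cmod (1 - cnj a * z))\<^sup>2 - (cmod (a - z))\<^sup>2 = (1 - (cmod a)\<^sup>2) * (1 - (cmod z)\<^sup>2)"
    unfolding cmod_power2 by (simp add: algebra_simps power2_eq_square)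
  then show ?thesis
    using ne by (simp add: disk_aut_def norm_divide power_divide field_simps)
qed

lemma cmod_disk_aut_less [simp]:
  assumes "cmod a < 1" "cmod z < 1"
  shows "cmod (disk_aut a z) < 1"
proof -
  have "0 < 1 - (cmod (disk_aut a z))\<^sup>2"
    unfolding one_minus_norm_disk_aut[OF assms]
    using assms one_minus_cnj_mult_nonzero[OF assms] one_minus_norm_pos by (intro divide_pos_pos mult_pos_pos) auto
  then show ?thesis using power2_less_imp_less[of "cmod (disk_aut a z)" 1] by simp
qed

lemma disk_aut_0 [simp]: "disk_aut a 0 = a"
  and disk_aut_self [simp]: "disk_aut a a = 0"
  by (auto simp: disk_aut_def)

lemma disk_aut_involution [simp]:
  assumes "cmod a < 1" "cmod z < 1"
  shows "disk_aut a (disk_aut a z) = z"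
proof -
  have n: "1 - cnj a * z \<noteq> 0" "1 - cnj a * a \<noteq> 0"
    using assms one_minus_cnj_mult_nonzero by auto
  have e1: "a - disk_aut a z = z * (1 - cnj a * a) / (1 - cnj a * z)"
    using n by (simp add: disk_aut_def field_simps)
  have e2: "1 - cnj a * disk_aut a z = (1 - cnj a * a) / (1 - cnj a * z)"
    using n by (simp add: disk_aut_def field_simps)
  have "disk_aut a (disk_aut a z) = (a - disk_aut a z) / (1 - cnj a * disk_aut a z)"
    by (simp add: disk_aut_def[of a "disk_aut a z"])
  also have "\<dots> = z"
    unfolding e1 e2 using n by simp
  finally show ?thesis .
qed

lemma inj_on_disk_aut: "cmod a < 1 \<Longrightarrow> inj_on (disk_aut a) unit_disk"
  by (rule inj_on_inverseI[of _ "disk_aut a"]) simp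

lemma disk_aut_has_derivative:
  assumes "cmod a < 1" "cmod z < 1"
  shows "(disk_aut a has_field_derivative (- of_real (1 - (cmod a)\<^sup>2) / (1 - cnj a * z)\<^sup>2)) (at z)"
proof -
  have n: "1 - cnj a * z \<noteq> 0" using assms one_minus_cnj_mult_nonzero by auto
  have "((\<lambda>z. (a - z) / (1 - cnj a * z)) has_field_derivative (- of_real (1 - (cmod a)\<^sup>2) / (1 - cnj a * z)\<^sup>2)) (at z)"
  proof -
    have e: "- of_real (1 - (cmod a)\<^sup>2) = (0 - 1) * (1 - cnj a * z) - (a - z) * (0 - cnj a * 1)"
      unfolding of_real_diff complex_norm_square by (simp add: algebra_simps)
    show ?thesis
      unfolding e power2_eq_square[of "1 - cnj a * z"] using n by (intro DERIV_divide) (auto intro!: derivative_eq_intros)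
  qed
  then show ?thesis by (simp add: disk_aut_def[abs_def])
qed

lemma disk_aut_holomorphic [holomorphic_intros]: "cmod a < 1 \<Longrightarrow> disk_aut a holomorphic_on unit_disk"
  unfolding holomorphic_on_open[OF open_ball] using disk_aut_has_derivative by (metis mem_ball_0)

lemma disk_aut_image [simp]: "cmod a < 1 \<Longrightarrow> disk_aut a ` unit_disk = unit_disk"
  by (auto simp: image_iff) (metis cmod_disk_aut_less disk_aut_involution dist_0_norm mem_ball)

text \<open>Invariance of the hyperbolic metric under \<open>disk_aut a\<close>. It trades
  derivatives of Moebius maps for distances to the boundary.\<close>

lemma norm_deriv_disk_aut:
  assumes "cmod a < 1" "cmod z < 1"
  shows "cmod (deriv (disk_aut a) z) * (1 - (cmod z)\<^sup>2) = 1 - (cmod (disk_aut a z))\<^sup>2"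
proof -
  have "deriv (disk_aut a) z = - of_real (1 - (cmod a)\<^sup>2) / (1 - cnj a * z)\<^sup>2"
    using disk_aut_has_derivative[OF assms] by (rule DERIV_imp_deriv)
  then have "cmod (deriv (disk_aut a) z) = (1 - (cmod a)\<^sup>2) / (cmod (1 - cnj a * z))\<^sup>2"
    using one_minus_norm_pos[OF assms(1)] by (simp only: norm_divide norm_minus_cancel norm_of_real norm_power)
  then show ?thesis by (simp add: one_minus_norm_disk_aut[OF assms])
qed

lemma deriv_disk_aut_nonzero:
  assumes "cmod a < 1" "cmod z < 1"
  shows "deriv (disk_aut a) z \<noteq> 0"
  using norm_deriv_disk_aut[OF assms] one_minus_norm_pos[OF cmod_disk_aut_less[OF assms]] by auto

lemma norm_deriv_disk_aut_bounds:
  assumes "cmod a < 1" "cmod z < 1"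
  shows "(1 - cmod a) / (1 + cmod a) \<le> cmod (deriv (disk_aut a) z)"
    and "cmod (deriv (disk_aut a) z) * (1 - cmod z)\<^sup>2 \<le> 2 * (1 - cmod a)"
proof -
  have d: "deriv (disk_aut a) z = - of_real (1 - (cmod a)\<^sup>2) / (1 - cnj a * z)\<^sup>2"
    using disk_aut_has_derivative[OF assms] by (rule DERIV_imp_deriv)
  have e: "cmod (deriv (disk_aut a) z) = (1 - (cmod a)\<^sup>2) / (cmod (1 - cnj a * z))\<^sup>2"
    using one_minus_norm_pos[OF assms(1)] unfolding d
    by (simp only: norm_divide norm_minus_cancel norm_of_real norm_power)
  have f: "1 - (cmod a)\<^sup>2 = (1 - cmod a) * (1 + cmod a)" by (simp add: power2_eq_square algebra_simps)
  have az: "cmod a * cmod z \<le> cmod a" "cmod a * cmod z \<le> cmod z"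
    using assms by (auto simp: mult_left_le mult_left_le_one_le)
  have up: "cmod (1 - cnj a * z) \<le> 1 + cmod a"
    using norm_triangle_ineq4[of 1 "cnj a * z"] az by (simp add: norm_mult)
  have lo: "1 - cmod z \<le> cmod (1 - cnj a * z)"
    using norm_triangle_ineq2[of 1 "cnj a * z"] az by (simp add: norm_mult)
  have p: "0 < cmod (1 - cnj a * z)" using one_minus_cnj_mult_nonzero[OF assms] by simp
  have "(cmod (1 - cnj a * z))\<^sup>2 \<le> (1 + cmod a)\<^sup>2"
    using up by (intro power_mono) auto
  then have "(1 - (cmod a)\<^sup>2) / (1 + cmod a)\<^sup>2 \<le> cmod (deriv (disk_aut a) z)"
    unfolding e using p one_minus_norm_pos[OF assms(1)]
    by (intro divide_left_mono mult_pos_pos zero_less_power) (auto simp: add_pos_nonneg)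
  also have "(1 - (cmod a)\<^sup>2) / (1 + cmod a)\<^sup>2 = (1 - cmod a) / (1 + cmod a)"
    unfolding f by (simp add: power2_eq_square)
  finally show "(1 - cmod a) / (1 + cmod a) \<le> cmod (deriv (disk_aut a) z)" .
  have "(1 - cmod z)\<^sup>2 \<le> (cmod (1 - cnj a * z))\<^sup>2"
    using lo assms by (intro power_mono) auto
  then have "(1 - (cmod a)\<^sup>2) / (cmod (1 - cnj a * z))\<^sup>2 * (1 - cmod z)\<^sup>2 \<le> (1 - (cmod a)\<^sup>2)"
    using p one_minus_norm_pos[OF assms(1)] mult_left_le[of "(1 - cmod z)\<^sup>2 / (cmod (1 - cnj a * z))\<^sup>2" "1 - (cmod a)\<^sup>2"]
    by simp
  also have "\<dots> \<le> 2 * (1 - cmod a)" unfolding f using assms mult_left_mono[of "1 + cmod a" 2 "1 - cmod a"] by simp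
  finally show "cmod (deriv (disk_aut a) z) * (1 - cmod z)\<^sup>2 \<le> 2 * (1 - cmod a)" unfolding e .
qed

lemma deriv_compose_holomorphic:
  assumes "f holomorphic_on unit_disk" "\<Phi> holomorphic_on unit_disk"
    and "\<And>z. cmod z < 1 \<Longrightarrow> cmod (\<Phi> z) < 1" and "cmod z < 1"
  shows "deriv (\<lambda>z. f (\<Phi> z)) z = deriv f (\<Phi> z) * deriv \<Phi> z"
proof -
  have "(f has_field_derivative deriv f (\<Phi> z)) (at (\<Phi> z))" "(\<Phi> has_field_derivative deriv \<Phi> z) (at z)"
    using assms by (auto intro!: holomorphic_derivI[of _ unit_disk])
  from DERIV_chain2[OF this] show ?thesis by (rule DERIV_imp_deriv)
qed

text \<open>Composing with \<open>disk_aut z\<close> on the right and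
  \<open>disk_aut (\<Phi> z)\<close> on the left yields a self-map that fixes the origin, to which
  the Schwarz lemma applies.\<close>

lemma Schwarz_Pick:
  assumes \<Phi>: "\<Phi> holomorphic_on unit_disk" and im: "\<And>z. cmod z < 1 \<Longrightarrow> cmod (\<Phi> z) < 1"
    and z: "cmod z < 1"
  shows "\<And>w. cmod w < 1 \<Longrightarrow> cmod (disk_aut (\<Phi> z) (\<Phi> w)) \<le> cmod (disk_aut z w)"
    and "cmod (deriv \<Phi> z) * (1 - (cmod z)\<^sup>2) \<le> 1 - (cmod (\<Phi> z))\<^sup>2"
proof -
  define F where "F w = disk_aut (\<Phi> z) (\<Phi> (disk_aut z w))" for w
  have hol1: "(\<lambda>w. \<Phi> (disk_aut z w)) holomorphic_on unit_disk"
    using z by (intro holomorphic_on_compose_gen[OF disk_aut_holomorphic \<Phi>, unfolded o_def]) auto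
  have hol: "F holomorphic_on unit_disk"
    unfolding F_def
    using z im by (intro holomorphic_on_compose_gen[OF hol1 disk_aut_holomorphic, unfolded o_def]) auto
  have F0: "F 0 = 0" by (simp add: F_def)
  have Fim: "cmod w < 1 \<Longrightarrow> cmod (F w) < 1" for w
    using z im by (simp add: F_def)
  note S = Schwarz_Lemma[OF hol F0 Fim]
  show "cmod (disk_aut (\<Phi> z) (\<Phi> w)) \<le> cmod (disk_aut z w)" if "cmod w < 1" for w
    using S(1)[of "disk_aut z w"] that z by (simp add: F_def)
  have "(disk_aut z has_field_derivative deriv (disk_aut z) 0) (at 0)"
    using z by (auto intro!: holomorphic_derivI[of _ unit_disk] holomorphic_intros)
  moreover have "(\<Phi> has_field_derivative deriv \<Phi> z) (at (disk_aut z 0))"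
    using z \<Phi> by (auto intro!: holomorphic_derivI[of _ unit_disk])
  ultimately have "((\<lambda>w. \<Phi> (disk_aut z w)) has_field_derivative deriv \<Phi> z * deriv (disk_aut z) 0) (at 0)"
    by (rule DERIV_chain2[rotated])
  moreover have "(disk_aut (\<Phi> z) has_field_derivative deriv (disk_aut (\<Phi> z)) (\<Phi> z)) (at (\<Phi> (disk_aut z 0)))"
    using z im by (auto intro!: holomorphic_derivI[of _ unit_disk] holomorphic_intros)
  ultimately have "(F has_field_derivative deriv (disk_aut (\<Phi> z)) (\<Phi> z) * (deriv \<Phi> z * deriv (disk_aut z) 0)) (at 0)"
    unfolding F_def by (rule DERIV_chain2[rotated])
  then have "deriv F 0 = deriv (disk_aut (\<Phi> z)) (\<Phi> z) * (deriv \<Phi> z * deriv (disk_aut z) 0)"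
    by (rule DERIV_imp_deriv)
  with S(2)[of 0] have le: "cmod (deriv (disk_aut (\<Phi> z)) (\<Phi> z)) * (cmod (deriv \<Phi> z) * cmod (deriv (disk_aut z) 0)) \<le> 1"
    by (simp add: norm_mult)
  have a: "cmod (deriv (disk_aut z) 0) = 1 - (cmod z)\<^sup>2"
    using norm_deriv_disk_aut[OF z, of 0] by simp
  have b: "cmod (deriv (disk_aut (\<Phi> z)) (\<Phi> z)) * (1 - (cmod (\<Phi> z))\<^sup>2) = 1"
    using norm_deriv_disk_aut[OF im[OF z] im[OF z]] by simp
  have pos: "0 < 1 - (cmod (\<Phi> z))\<^sup>2" using one_minus_norm_pos im z by blast
  have "(1 - (cmod (\<Phi> z))\<^sup>2) * (cmod (deriv (disk_aut (\<Phi> z)) (\<Phi> z)) * (cmod (deriv \<Phi> z) * (1 - (cmod z)\<^sup>2))) \<le> (1 - (cmod (\<Phi> z))\<^sup>2) * 1"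
    using le pos unfolding a by (intro mult_left_mono) auto
  then show "cmod (deriv \<Phi> z) * (1 - (cmod z)\<^sup>2) \<le> 1 - (cmod (\<Phi> z))\<^sup>2"
    using b by (simp add: mult.assoc[symmetric] mult.commute[of "1 - (cmod (\<Phi> z))\<^sup>2"])
qed

section \<open>Energies and their contraction under injective self-maps\<close>

definition energy :: "real \<Rightarrow> real \<Rightarrow> (complex \<Rightarrow> complex) \<Rightarrow> ennreal"
  where "energy p s f = (\<integral>\<^sup>+z\<in>unit_disk. ennreal (Dps_integrand p s f z) \<partial>lborel)"

lemma Dps_integrand_nonneg: "0 \<le> Dps_integrand p s f z"
  by (simp add: Dps_integrand_def)

lemma deriv_cong_disk:
  assumes "\<And>z. z \<in> unit_disk \<Longrightarrow> f z = g z" "z \<in> unit_disk"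
  shows "deriv f z = deriv g z"
  using assms by (intro deriv_cong_ev) (auto simp: eventually_nhds intro!: exI[of _ unit_disk])

lemma energy_cong:
  assumes "\<And>z. z \<in> unit_disk \<Longrightarrow> f z = g z"
  shows "energy p s f = energy p s g"
  unfolding energy_def using deriv_cong_disk[of f g, OF assms]
  by (intro nn_integral_cong) (auto simp: Dps_integrand_def indicator_def)

lemma continuous_on_Dps_integrand:
  assumes "f holomorphic_on unit_disk" "0 < p"
  shows "continuous_on unit_disk (Dps_integrand p s f)"
proof -
  have "continuous_on unit_disk (deriv f)"
    using assms by (intro holomorphic_on_imp_continuous_on holomorphic_deriv) auto
  moreover have "1 - (cmod z)\<^sup>2 \<noteq> 0" if "z \<in> unit_disk" for z
    using one_minus_norm_pos[of z] that by auto
  ultimately show ?thesis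
    unfolding Dps_integrand_def[abs_def] using assms
    by (intro continuous_intros continuous_on_powr') auto
qed

lemma measurable_on_disk:
  fixes f :: "complex \<Rightarrow> real"
  assumes "continuous_on unit_disk f"
  shows "(\<lambda>z. ennreal (f z) * indicator unit_disk z) \<in> borel_measurable borel"
proof -
  have [measurable]: "(\<lambda>z. indicator unit_disk z *\<^sub>R f z) \<in> borel_measurable borel"
    using assms by (intro borel_measurable_continuous_on_indicator) auto
  have "(\<lambda>z. ennreal (indicator unit_disk z *\<^sub>R f z)) \<in> borel_measurable borel" by measurable
  then show ?thesis by (rule measurable_cong[THEN iffD1, rotated]) (auto simp: indicator_def)
qed

lemma measurable_Dps_integrand:
  assumes "f holomorphic_on unit_disk" "0 < p"
  shows "(\<lambda>z. ennreal (Dps_integrand p s f z) * indicator unit_disk z) \<in> borel_measurable borel"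
  using assms by (intro measurable_on_disk continuous_on_Dps_integrand)

text \<open>Extended nonnegative integrals replace the Bochner integral from here on: integrability
  becomes finiteness and need not be carried along.\<close>

lemma Dps_iff_energy:
  assumes "0 < p"
  shows "f \<in> Dps p s \<longleftrightarrow> f holomorphic_on unit_disk \<and> energy p s f < \<infinity>"
proof (cases "f holomorphic_on unit_disk")
  case True
  have "(\<lambda>z. indicator unit_disk z *\<^sub>R Dps_integrand p s f z) \<in> borel_measurable borel"
    using continuous_on_Dps_integrand[OF True assms]
    by (intro borel_measurable_continuous_on_indicator) auto
  moreover have "(\<integral>\<^sup>+z. ennreal (norm (indicator unit_disk z *\<^sub>R Dps_integrand p s f z)) \<partial>lborel) = energy p s f"
    unfolding energy_def by (intro nn_integral_cong) (auto simp: indicator_def Dps_integrand_nonneg)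
  ultimately show ?thesis
    using True by (simp add: Dps_def set_integrable_def integrable_iff_bounded)
qed (simp add: Dps_def)

lemma Dps_norm_energy:
  assumes "f holomorphic_on unit_disk" "0 < p"
  shows "Dps_norm p s f = cmod (f 0) + enn2real (energy p s f) powr (1 / p)"
proof -
  have "(\<lambda>z. indicator unit_disk z *\<^sub>R Dps_integrand p s f z) \<in> borel_measurable borel"
    using continuous_on_Dps_integrand[OF assms]
    by (intro borel_measurable_continuous_on_indicator) auto
  then have "(LINT z:unit_disk|lborel. Dps_integrand p s f z)
     = enn2real (\<integral>\<^sup>+z. ennreal (indicator unit_disk z *\<^sub>R Dps_integrand p s f z) \<partial>lborel)"
    unfolding set_lebesgue_integral_def
    by (intro integral_eq_nn_integral) (auto simp: Dps_integrand_nonneg)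
  also have "(\<integral>\<^sup>+z. ennreal (indicator unit_disk z *\<^sub>R Dps_integrand p s f z) \<partial>lborel) = energy p s f"
    unfolding energy_def by (intro nn_integral_cong) (auto simp: indicator_def)
  finally show ?thesis by (simp add: Dps_norm_def)
qed

lemma admissible_range:
  assumes "admissible p s"
  shows "1 < p" "0 < p" "0 \<le> s" "p - 2 < s"
  using assms by (auto simp: admissible_def)

text \<open>The tangent at \<open>1\<close> of \<open>x powr (2 / p)\<close>, which is convex since
  \<open>p < 2\<close>, evaluated at \<open>x powr p\<close>. The two coefficients add up to
  \<open>1\<close>, and this is what keeps the constant \<open>1\<close> in
  \<open>energy_compose_le\<close>.\<close>

lemma powr_le_Young:
  fixes x p :: real
  assumes "0 \<le> x" "0 < p" "p < 2"
  shows "x powr p \<le> (1 - p / 2) + p / 2 * x\<^sup>2"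
proof -
  have "1 powr (2 / p) + (2 / p) * 1 powr (2 / p - 1) * (x powr p - 1) \<le> (x powr p) powr (2 / p)"
    using assms by (intro powr_ge_tangent) auto
  moreover have "(x powr p) powr (2 / p) = x\<^sup>2"
    using assms by (cases "x = 0") (auto simp: powr_powr)
  ultimately show ?thesis using assms by (simp add: field_simps)
qed

lemma energy_compose_le:
  assumes adm: "admissible p s" and g: "g holomorphic_on unit_disk"
    and \<Phi>: "\<Phi> holomorphic_on unit_disk" "\<Phi> 0 = 0" "inj_on \<Phi> unit_disk"
    and im: "\<And>z. cmod z < 1 \<Longrightarrow> cmod (\<Phi> z) < 1"
  shows "energy p s (\<lambda>z. g (\<Phi> z)) \<le> energy p s g"
proof -
  note ps = admissible_range[OF adm]
  define h where "h w = ennreal (Dps_integrand p s g w) * indicator unit_disk w" for w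
  have h [measurable]: "h \<in> borel_measurable borel"
    unfolding h_def using g ps by (intro measurable_Dps_integrand)
  have cv: "(\<integral>\<^sup>+z\<in>unit_disk. h (\<Phi> z) * ennreal ((cmod (deriv \<Phi> z))\<^sup>2) \<partial>lborel) \<le> energy p s g"
  proof -
    have "(\<integral>\<^sup>+z\<in>unit_disk. h (\<Phi> z) * ennreal ((cmod (deriv \<Phi> z))\<^sup>2) \<partial>lborel) \<le> (\<integral>\<^sup>+w\<in>\<Phi> ` unit_disk. h w \<partial>lborel)"
      by (rule nn_integral_holomorphic_subst_le[OF \<Phi>(1) _ \<Phi>(3) h]) auto
    also have "\<dots> \<le> (\<integral>\<^sup>+w. h w \<partial>lborel)"
      by (intro nn_integral_mono) (auto simp: indicator_def)
    finally show ?thesis by (simp add: h_def energy_def)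
  qed
  have d: "deriv (\<lambda>z. g (\<Phi> z)) z = deriv g (\<Phi> z) * deriv \<Phi> z" if "cmod z < 1" for z
    by (rule deriv_compose_holomorphic[OF g \<Phi>(1) im that])
  have le: "1 - (cmod z)\<^sup>2 \<le> 1 - (cmod (\<Phi> z))\<^sup>2" if "cmod z < 1" for z
    using Schwarz_Lemma(1)[OF \<Phi>(1,2) im that] by (simp add: power_mono)
  show ?thesis
  proof (cases "2 \<le> p")
    case True
    have "Dps_integrand p s (\<lambda>z. g (\<Phi> z)) z \<le> Dps_integrand p s g (\<Phi> z) * (cmod (deriv \<Phi> z))\<^sup>2"
      if z: "cmod z < 1" for z
    proof (cases "deriv \<Phi> z = 0")
      case True then show ?thesis using ps by (simp add: Dps_integrand_def d[OF z])
    next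
      case False
      define D where "D = cmod (deriv \<Phi> z)"
      define x where "x = 1 - (cmod z)\<^sup>2"
      define y where "y = 1 - (cmod (\<Phi> z))\<^sup>2"
      have D: "0 < D" using False by (simp add: D_def)
      have x: "0 < x" "x \<le> y" using le[OF z] one_minus_norm_pos[OF z] by (auto simp: x_def y_def)
      have sp: "D * x \<le> y" using Schwarz_Pick(2)[OF \<Phi>(1) im z] by (simp add: D_def x_def y_def)
      have e: "D powr p = D powr (p - 2) * D\<^sup>2"
        using D powr_add[of D "p - 2" 2] by simp
      \<comment> \<open>The weight is split: \<open>p - 2\<close> of its powers pair with
        \<open>D\<close> in Schwarz--Pick, while the remaining \<open>s - (p - 2)\<close> powers, a
        positive number, use \<open>x \<le> y\<close>.\<close>
      have "D powr (p - 2) * x powr s = (D * x) powr (p - 2) * x powr (s - (p - 2))"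
        using D x powr_add[of x "p - 2" "s - (p - 2)"] by (simp add: powr_mult)
      also have "\<dots> \<le> y powr (p - 2) * y powr (s - (p - 2))"
        using sp x D True ps by (intro mult_mono powr_mono2) auto
      also have "\<dots> = y powr s"
        using x powr_add[of y "p - 2" "s - (p - 2)"] by simp
      finally have *: "D powr (p - 2) * x powr s \<le> y powr s" .
      have "Dps_integrand p s (\<lambda>z. g (\<Phi> z)) z = cmod (deriv g (\<Phi> z)) powr p * D\<^sup>2 * (D powr (p - 2) * x powr s)"
        unfolding Dps_integrand_def d[OF z] norm_mult D_def[symmetric] x_def[symmetric]
        using D by (simp add: powr_mult e mult_ac)
      also have "\<dots> \<le> cmod (deriv g (\<Phi> z)) powr p * D\<^sup>2 * y powr s"
        by (intro mult_left_mono *) auto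
      finally show ?thesis by (simp add: Dps_integrand_def D_def y_def mult_ac)
    qed
    then have "energy p s (\<lambda>z. g (\<Phi> z)) \<le> (\<integral>\<^sup>+z\<in>unit_disk. h (\<Phi> z) * ennreal ((cmod (deriv \<Phi> z))\<^sup>2) \<partial>lborel)"
      unfolding energy_def h_def using im
      by (intro nn_integral_mono) (auto simp: indicator_def ennreal_mult[symmetric] Dps_integrand_nonneg)
    then show ?thesis using cv by simp
  next
    case False
    \<comment> \<open>The integrand without the derivative of \<open>\<Phi>\<close>. Subordination
      bounds its integral (\<open>A1\<close>), the area formula bounds the integral of
      \<open>A\<close> times the squared derivative (\<open>A2\<close>), and Young's inequality
      places the power \<open>p\<close> between the two.\<close>
    define A where "A z = ennreal (cmod (deriv g (\<Phi> z)) powr p) * ennreal ((1 - (cmod z)\<^sup>2) powr s) * indicator unit_disk z" for z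
    have cg: "continuous_on unit_disk (\<lambda>z. deriv g (\<Phi> z))"
      using im by (intro continuous_on_compose2[OF holomorphic_on_imp_continuous_on[OF holomorphic_deriv[OF g]]]
          holomorphic_on_imp_continuous_on[OF \<Phi>(1)]) auto
    have cx: "continuous_on unit_disk (\<lambda>z::complex. (1 - (cmod z)\<^sup>2) powr s)"
    proof -
      have "1 - (cmod z)\<^sup>2 \<noteq> 0" if "z \<in> unit_disk" for z
        using one_minus_norm_pos[of z] that by auto
      then show ?thesis by (intro continuous_intros) auto
    qed
    have A [measurable]: "A \<in> borel_measurable borel"
    proof -
      have "continuous_on unit_disk (\<lambda>z. cmod (deriv g (\<Phi> z)) powr p * (1 - (cmod z)\<^sup>2) powr s)"
        using ps by (intro continuous_on_mult cx continuous_on_powr' continuous_on_norm cg continuous_on_const) auto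
      from measurable_on_disk[OF this] show ?thesis unfolding A_def by (simp add: ennreal_mult)
    qed
    have B: "(\<lambda>z. ennreal ((cmod (deriv \<Phi> z))\<^sup>2) * indicator unit_disk z) \<in> borel_measurable borel"
      using \<Phi>(1) by (intro measurable_on_disk continuous_intros holomorphic_on_imp_continuous_on holomorphic_deriv) auto
    have A1: "(\<integral>\<^sup>+z. A z \<partial>lborel) \<le> energy p s g"
    proof -
      have "(\<integral>\<^sup>+z. A z \<partial>lborel) \<le> (\<integral>\<^sup>+z\<in>unit_disk. ennreal (cmod (deriv g z) powr p) * ennreal ((1 - (cmod z)\<^sup>2) powr s) \<partial>lborel)"
        unfolding A_def
        using g by (intro Littlewood_subordination[OF ps(1) _ \<Phi>(1,2) im, of "deriv g" "\<lambda>r. ennreal ((1 - r\<^sup>2) powr s)"] holomorphic_deriv) auto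
      then show ?thesis by (simp add: energy_def Dps_integrand_def ennreal_mult)
    qed
    have pw: "(1 - (cmod z)\<^sup>2) powr s \<le> (1 - (cmod (\<Phi> z))\<^sup>2) powr s" if "cmod z < 1" for z
      using le[OF that] one_minus_norm_pos[OF that] ps by (intro powr_mono2) auto
    have A2: "(\<integral>\<^sup>+z. A z * (ennreal ((cmod (deriv \<Phi> z))\<^sup>2) * indicator unit_disk z) \<partial>lborel) \<le> energy p s g"
    proof -
      have "(\<integral>\<^sup>+z. A z * (ennreal ((cmod (deriv \<Phi> z))\<^sup>2) * indicator unit_disk z) \<partial>lborel)
        \<le> (\<integral>\<^sup>+z\<in>unit_disk. h (\<Phi> z) * ennreal ((cmod (deriv \<Phi> z))\<^sup>2) \<partial>lborel)"
        unfolding A_def h_def Dps_integrand_def using im pw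
        by (intro nn_integral_mono) (auto simp: indicator_def ennreal_mult[symmetric] intro!: ennreal_leI mult_mono)
      then show ?thesis using cv by simp
    qed
    have "energy p s (\<lambda>z. g (\<Phi> z)) \<le>
      (\<integral>\<^sup>+z. ennreal (1 - p / 2) * A z + ennreal (p / 2) * (A z * (ennreal ((cmod (deriv \<Phi> z))\<^sup>2) * indicator unit_disk z)) \<partial>lborel)"
      unfolding energy_def
    proof (intro nn_integral_mono)
      fix z :: complex
      show "ennreal (Dps_integrand p s (\<lambda>z. g (\<Phi> z)) z) * indicator unit_disk z
        \<le> ennreal (1 - p / 2) * A z + ennreal (p / 2) * (A z * (ennreal ((cmod (deriv \<Phi> z))\<^sup>2) * indicator unit_disk z))"
      proof (cases "z \<in> unit_disk")
        case z: True
        define X where "X = cmod (deriv g (\<Phi> z)) powr p * (1 - (cmod z)\<^sup>2) powr s"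
        have X: "0 \<le> X" by (simp add: X_def)
        have AX: "A z = ennreal X" using z by (simp add: A_def X_def ennreal_mult)
        have "Dps_integrand p s (\<lambda>z. g (\<Phi> z)) z = X * cmod (deriv \<Phi> z) powr p"
          using z by (simp add: Dps_integrand_def d norm_mult powr_mult X_def mult_ac)
        also have "\<dots> \<le> X * ((1 - p / 2) + p / 2 * (cmod (deriv \<Phi> z))\<^sup>2)"
          using False ps X by (intro mult_left_mono powr_le_Young) auto
        finally have "ennreal (Dps_integrand p s (\<lambda>z. g (\<Phi> z)) z) \<le> ennreal ((1 - p / 2) * X + p / 2 * (X * (cmod (deriv \<Phi> z))\<^sup>2))"
          by (intro ennreal_leI) (simp add: algebra_simps)
        also have "\<dots> = ennreal (1 - p / 2) * ennreal X + ennreal (p / 2) * (ennreal X * ennreal ((cmod (deriv \<Phi> z))\<^sup>2))"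
          using False ps X by (simp add: ennreal_plus[symmetric] ennreal_mult[symmetric] del: ennreal_plus)
        finally show ?thesis using z by (simp add: AX)
      qed simp
    qed
    also have "\<dots> = ennreal (1 - p / 2) * (\<integral>\<^sup>+z. A z \<partial>lborel) +
        ennreal (p / 2) * (\<integral>\<^sup>+z. A z * (ennreal ((cmod (deriv \<Phi> z))\<^sup>2) * indicator unit_disk z) \<partial>lborel)"
      using A B by (subst nn_integral_add) (auto simp: nn_integral_cmult)
    also have "\<dots> \<le> ennreal (1 - p / 2) * energy p s g + ennreal (p / 2) * energy p s g"
      by (intro add_mono mult_left_mono A1 A2) auto
    also have "\<dots> = energy p s g"
      using False ps by (simp add: distrib_right[symmetric] ennreal_plus[symmetric] del: ennreal_plus)
    finally show ?thesis .
  qed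
qed

text \<open>This is \<open>E(f, a)\<close> of the overview.\<close>

definition mob_energy :: "real \<Rightarrow> real \<Rightarrow> (complex \<Rightarrow> complex) \<Rightarrow> complex \<Rightarrow> ennreal"
  where "mob_energy p s f a = energy p s (\<lambda>z. f (disk_aut a z))"

lemma holomorphic_compose_disk:
  assumes "f holomorphic_on unit_disk" "\<Phi> holomorphic_on unit_disk"
    and "\<And>z. cmod z < 1 \<Longrightarrow> cmod (\<Phi> z) < 1"
  shows "(\<lambda>z. f (\<Phi> z)) holomorphic_on unit_disk"
  using assms by (intro holomorphic_on_compose_gen[OF assms(2,1), unfolded o_def]) auto

lemma holomorphic_compose_disk_aut:
  assumes "f holomorphic_on unit_disk" "cmod a < 1"
  shows "(\<lambda>z. f (disk_aut a z)) holomorphic_on unit_disk"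
  by (rule holomorphic_compose_disk[OF assms(1) disk_aut_holomorphic[OF assms(2)]]) (simp add: assms(2))

lemma deriv_compose_disk_aut:
  assumes "f holomorphic_on unit_disk" "cmod a < 1" "cmod z < 1"
  shows "deriv (\<lambda>z. f (disk_aut a z)) z = deriv f (disk_aut a z) * deriv (disk_aut a) z"
  by (rule deriv_compose_holomorphic[OF assms(1) disk_aut_holomorphic[OF assms(2)] _ assms(3)]) (simp add: assms(2))

text \<open>Since \<open>disk_aut\<close> is an involution, \<open>\<phi> \<circ> disk_aut a\<close>
  equals \<open>disk_aut (\<phi> a) \<circ> \<Phi>\<close> with an injective self-map
  \<open>\<Phi>\<close> that fixes the origin. This reduces the claim to
  \<open>energy_compose_le\<close>.\<close>

lemma mob_energy_compose_le:
  assumes adm: "admissible p s" and f: "f holomorphic_on unit_disk"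
    and \<phi>: "\<phi> holomorphic_on unit_disk" "inj_on \<phi> unit_disk" and im: "\<And>z. cmod z < 1 \<Longrightarrow> cmod (\<phi> z) < 1"
    and a: "cmod a < 1"
  shows "mob_energy p s (\<lambda>z. f (\<phi> z)) a \<le> mob_energy p s f (\<phi> a)"
proof -
  define \<Phi> where "\<Phi> z = disk_aut (\<phi> a) (\<phi> (disk_aut a z))" for z
  have "mob_energy p s (\<lambda>z. f (\<phi> z)) a = energy p s (\<lambda>z. f (disk_aut (\<phi> a) (\<Phi> z)))"
    unfolding mob_energy_def using a im by (intro energy_cong) (simp add: \<Phi>_def)
  also have "\<dots> \<le> energy p s (\<lambda>z. f (disk_aut (\<phi> a) z))"
  proof (rule energy_compose_le[OF adm, where g = "\<lambda>z. f (disk_aut (\<phi> a) z)"])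
    show "(\<lambda>z. f (disk_aut (\<phi> a) z)) holomorphic_on unit_disk"
      using im a by (intro holomorphic_compose_disk_aut f) auto
    show "\<Phi> holomorphic_on unit_disk"
      unfolding \<Phi>_def using a im
      by (intro holomorphic_compose_disk[OF disk_aut_holomorphic holomorphic_compose_disk_aut[OF \<phi>(1) a]]) auto
    show "inj_on \<Phi> unit_disk"
    proof (rule inj_onI)
      fix x y assume xy: "x \<in> unit_disk" "y \<in> unit_disk" "\<Phi> x = \<Phi> y"
      have "\<phi> (disk_aut a x) = \<phi> (disk_aut a y)"
        using xy im a inj_onD[OF inj_on_disk_aut[of "\<phi> a"], of "\<phi> (disk_aut a x)" "\<phi> (disk_aut a y)"]
        by (auto simp: \<Phi>_def)
      then have "disk_aut a x = disk_aut a y"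
        using xy a \<phi>(2) by (auto dest!: inj_onD)
      then have "disk_aut a (disk_aut a x) = disk_aut a (disk_aut a y)" by (rule arg_cong)
      then show "x = y" using xy a by simp
    qed
    show "\<Phi> 0 = 0" by (simp add: \<Phi>_def)
    show "cmod (\<Phi> z) < 1" if "cmod z < 1" for z
      unfolding \<Phi>_def using im a that by (intro cmod_disk_aut_less) auto
  qed
  finally show ?thesis by (simp add: mob_energy_def)
qed

text \<open>Let \<open>D\<close> be the modulus of the derivative of \<open>disk_aut a\<close>. The
  substitution \<open>w = disk_aut a z\<close> consumes two powers of \<open>D\<close> and leaves
  \<open>D powr (p - 2 - s)\<close>. The exponent is negative, so the smallest value of
  \<open>D\<close> yields the constant, which tends to \<open>1\<close> as \<open>a\<close> tends to
  \<open>0\<close>.\<close>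

lemma mob_energy_le_energy:
  assumes adm: "admissible p s" and g: "g holomorphic_on unit_disk" and a: "cmod a < 1"
  shows "mob_energy p s g a \<le> ennreal (((1 + cmod a) / (1 - cmod a)) powr (s - p + 2)) * energy p s g"
proof -
  note ps = admissible_range[OF adm]
  define c where "c = ((1 + cmod a) / (1 - cmod a)) powr (s - p + 2)"
  define h where "h w = ennreal (Dps_integrand p s g w) * indicator unit_disk w" for w
  have h [measurable]: "h \<in> borel_measurable borel"
    unfolding h_def using g ps by (intro measurable_Dps_integrand)
  have pw: "Dps_integrand p s (\<lambda>z. g (disk_aut a z)) z \<le> c * (Dps_integrand p s g (disk_aut a z) * (cmod (deriv (disk_aut a) z))\<^sup>2)"
    if z: "cmod z < 1" for z
  proof -
    define D where "D = cmod (deriv (disk_aut a) z)"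
    define x where "x = 1 - (cmod z)\<^sup>2"
    have D: "0 < D" using deriv_disk_aut_nonzero[OF a z] by (simp add: D_def)
    have x: "0 < x" using one_minus_norm_pos[OF z] by (simp add: x_def)
    have m: "(1 - cmod a) / (1 + cmod a) \<le> D" using norm_deriv_disk_aut_bounds(1)[OF a z] by (simp add: D_def)
    have m0: "0 < (1 - cmod a) / (1 + cmod a)" using a by (intro divide_pos_pos) (auto simp: add_pos_nonneg)
    have y: "1 - (cmod (disk_aut a z))\<^sup>2 = D * x" using norm_deriv_disk_aut[OF a z] by (simp add: D_def x_def)
    have "D powr p * x powr s = D powr (- (s - p + 2)) * (D\<^sup>2 * (D * x) powr s)"
    proof -
      have "D powr p = D powr (- (s - p + 2) + 2 + s)" by simp
      also have "\<dots> = D powr (- (s - p + 2)) * D\<^sup>2 * D powr s"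
        using D by (simp only: powr_add) simp
      finally show ?thesis using D x by (simp add: powr_mult mult_ac)
    qed
    also have "\<dots> \<le> ((1 - cmod a) / (1 + cmod a)) powr (- (s - p + 2)) * (D\<^sup>2 * (D * x) powr s)"
      using m m0 ps D by (intro mult_right_mono powr_mono2') auto
    also have "((1 - cmod a) / (1 + cmod a)) powr (- (s - p + 2)) = c"
    proof -
      have "(1 + cmod a) / (1 - cmod a) = 1 / ((1 - cmod a) / (1 + cmod a))" by simp
      then have "c = 1 / ((1 - cmod a) / (1 + cmod a)) powr (s - p + 2)"
        using m0 unfolding c_def by (simp only: powr_divide powr_one_eq_one less_imp_le zero_le_one)
      then show ?thesis using powr_minus_divide by metis
    qed
    finally have "D powr p * x powr s \<le> c * (D\<^sup>2 * (D * x) powr s)" .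
    then have "cmod (deriv g (disk_aut a z)) powr p * (D powr p * x powr s)
      \<le> cmod (deriv g (disk_aut a z)) powr p * (c * (D\<^sup>2 * (D * x) powr s))"
      by (intro mult_left_mono) auto
    then show ?thesis
      unfolding Dps_integrand_def deriv_compose_disk_aut[OF g a z] norm_mult D_def[symmetric] x_def[symmetric] y
      using D by (simp add: powr_mult mult_ac)
  qed
  have "mob_energy p s g a \<le> (\<integral>\<^sup>+z\<in>unit_disk. ennreal c * (h (disk_aut a z) * ennreal ((cmod (deriv (disk_aut a) z))\<^sup>2)) \<partial>lborel)"
    unfolding mob_energy_def energy_def h_def using pw a
    by (intro nn_integral_mono)
      (auto simp: indicator_def ennreal_mult[symmetric] Dps_integrand_nonneg c_def)
  also have "\<dots> = (\<integral>\<^sup>+z\<in>unit_disk. (\<lambda>w. ennreal c * h w) (disk_aut a z) * ennreal ((cmod (deriv (disk_aut a) z))\<^sup>2) \<partial>lborel)"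
    by (simp add: mult_ac)
  also have "\<dots> \<le> (\<integral>\<^sup>+w\<in>disk_aut a ` unit_disk. ennreal c * h w \<partial>lborel)"
    using a by (intro nn_integral_holomorphic_subst_le disk_aut_holomorphic inj_on_disk_aut) auto
  also have "\<dots> = (\<integral>\<^sup>+w. ennreal c * h w \<partial>lborel)"
    using a by (intro nn_integral_cong) (auto simp: h_def indicator_def)
  also have "\<dots> = ennreal c * energy p s g"
    using nn_integral_cmult[of h lborel "ennreal c"] by (simp add: energy_def h_def[abs_def] h[unfolded h_def[abs_def]])
  finally show ?thesis by (simp add: c_def)
qed

text \<open>The energy of the identity is the constant by which energies control the derivative at
  the origin. It is finite because \<open>0 \<le> s\<close> makes the weight bounded.\<close>

lemma energy_id_bounds:
  assumes "0 \<le> s"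
  shows "0 < energy p s (\<lambda>z. z)" "energy p s (\<lambda>z. z) < \<infinity>"
proof -
  have eq: "Dps_integrand p s (\<lambda>z. z) z = (1 - (cmod z)\<^sup>2) powr s" for z
    by (simp add: Dps_integrand_def)
  have "energy p s (\<lambda>z. z) \<le> (\<integral>\<^sup>+z. indicator unit_disk z \<partial>lborel)"
    unfolding energy_def eq using assms one_minus_norm_pos
    by (intro nn_integral_mono) (auto simp: indicator_def powr_le1 less_imp_le)
  also have "\<dots> < \<infinity>" using emeasure_lborel_ball_finite[of "0::complex" 1] by simp
  finally show "energy p s (\<lambda>z. z) < \<infinity>" .
  have "0 < ennreal ((3 / 4) powr s) * emeasure lborel (ball (0::complex) (1 / 2))"
    by (simp add: emeasure_ball ennreal_zero_less_mult_iff zero_less_mult_iff unit_ball_vol_pos)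
  also have "\<dots> = (\<integral>\<^sup>+z. ennreal ((3 / 4) powr s) * indicator (ball (0::complex) (1 / 2)) z \<partial>lborel)"
    by (subst nn_integral_cmult_indicator) auto
  also have "\<dots> \<le> energy p s (\<lambda>z. z)"
    unfolding energy_def eq
  proof (intro nn_integral_mono)
    fix z :: complex
    have "(3 / 4) powr s \<le> (1 - (cmod z)\<^sup>2) powr s" if "cmod z < 1 / 2"
    proof -
      have "(cmod z)\<^sup>2 \<le> (1 / 2)\<^sup>2" using that by (intro power_mono) auto
      then show ?thesis using assms by (intro powr_mono2) (auto simp: power2_eq_square)
    qed
    then show "ennreal ((3 / 4) powr s) * indicator (ball 0 (1 / 2)) z \<le> ennreal ((1 - (cmod z)\<^sup>2) powr s) * indicator unit_disk z"
      by (auto simp: indicator_def intro!: ennreal_leI)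
  qed
  finally show "0 < energy p s (\<lambda>z. z)" .
qed

text \<open>The sub-mean value property of \<open>cmod (deriv g z) powr p\<close>, obtained as
  subordination under the constant map \<open>0\<close>.\<close>

lemma norm_deriv_0_le_energy:
  assumes p: "1 < p" and g: "g holomorphic_on unit_disk"
  shows "ennreal (cmod (deriv g 0) powr p) * energy p s (\<lambda>z. z) \<le> energy p s g"
proof -
  have "(\<integral>\<^sup>+z\<in>unit_disk. ennreal (cmod (deriv g ((\<lambda>_. 0) z)) powr p) * ennreal ((1 - (cmod z)\<^sup>2) powr s) \<partial>lborel)
     \<le> (\<integral>\<^sup>+z\<in>unit_disk. ennreal (cmod (deriv g z) powr p) * ennreal ((1 - (cmod z)\<^sup>2) powr s) \<partial>lborel)"
    using g by (intro Littlewood_subordination[OF p, of "deriv g" "\<lambda>_. 0" "\<lambda>r. ennreal ((1 - r\<^sup>2) powr s)"] holomorphic_deriv) auto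
  also have "(\<integral>\<^sup>+z\<in>unit_disk. ennreal (cmod (deriv g ((\<lambda>_. 0) z)) powr p) * ennreal ((1 - (cmod z)\<^sup>2) powr s) \<partial>lborel)
    = ennreal (cmod (deriv g 0) powr p) * energy p s (\<lambda>z. z)"
    unfolding energy_def
    by (subst nn_integral_cmult[symmetric])
       (auto simp: Dps_integrand_def mult.assoc intro!: measurable_Dps_integrand[of "\<lambda>z. z" 1 s, unfolded Dps_integrand_def, simplified])
  finally show ?thesis by (simp add: energy_def Dps_integrand_def ennreal_mult)
qed

text \<open>The bound on the derivative at the origin, applied to
  \<open>f \<circ> disk_aut a\<close>, whose derivative there has modulus
  \<open>(1 - (cmod a)\<^sup>2) * cmod (deriv f a)\<close>. It places \<open>M0\<close> inside the
  Bloch space and \<open>m0\<close> inside the little Bloch space.\<close>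

lemma Bloch_le_mob_energy:
  assumes "admissible p s"
  obtains c where "0 < c"
    "\<And>f a B. f holomorphic_on unit_disk \<Longrightarrow> cmod a < 1 \<Longrightarrow> 0 \<le> B \<Longrightarrow> mob_energy p s f a \<le> ennreal (B powr p)
       \<Longrightarrow> (1 - (cmod a)\<^sup>2) * cmod (deriv f a) \<le> c * B"
proof -
  note ps = admissible_range[OF assms]
  define e where "e = enn2real (energy p s (\<lambda>z. z))"
  have e: "0 < e" "energy p s (\<lambda>z. z) = ennreal e"
    using energy_id_bounds[OF ps(3), of p] by (auto simp: e_def enn2real_positive_iff less_top[symmetric])
  define c where "c = e powr (- (1 / p))"
  show thesis
  proof (rule that[of c])
    show "0 < c" using e by (simp add: c_def)
    fix f a B assume f: "f holomorphic_on unit_disk" and a: "cmod a < 1" and B: "0 \<le> B" "mob_energy p s f a \<le> ennreal (B powr p)"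
    define x where "x = (1 - (cmod a)\<^sup>2) * cmod (deriv f a)"
    have x: "0 \<le> x" using one_minus_norm_pos[OF a] by (simp add: x_def)
    have "cmod (deriv (disk_aut a) 0) = 1 - (cmod a)\<^sup>2"
      using norm_deriv_disk_aut[OF a, of 0] by simp
    then have d: "cmod (deriv (\<lambda>z. f (disk_aut a z)) 0) = x"
      using deriv_compose_disk_aut[OF f a, of 0] by (simp add: x_def norm_mult)
    have "ennreal (x powr p) * ennreal e \<le> ennreal (B powr p)"
      using norm_deriv_0_le_energy[OF ps(1) holomorphic_compose_disk_aut[OF f a], of s] B(2)
      unfolding d e(2) mob_energy_def by simp
    then have le: "x powr p * e \<le> B powr p"
      using e by (simp add: ennreal_mult[symmetric])
    have "(x powr p * e) powr (1 / p) \<le> (B powr p) powr (1 / p)"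
      using le e ps by (intro powr_mono2) auto
    then have "x * e powr (1 / p) \<le> B"
      using x B ps e by (simp add: powr_mult powr_powr)
    then show "(1 - (cmod a)\<^sup>2) * cmod (deriv f a) \<le> c * B"
      unfolding x_def[symmetric] c_def using e by (simp add: powr_minus field_simps)
  qed
qed

section \<open>Minkowski's inequality for energies\<close>

lemma powr_add_convex:
  fixes x y A B p :: real
  assumes "0 \<le> x" "0 \<le> y" "0 < A" "0 < B" "1 < p"
  shows "((x + y) / (A + B)) powr p \<le> A / (A + B) * (x / A) powr p + B / (A + B) * (y / B) powr p"
proof -
  define m where "m = (x + y) / (A + B)"
  define t where "t = p * m powr (p - 1)"
  have AB: "0 < A + B" using assms by simp
  have m: "0 \<le> m" using assms AB by (simp add: m_def)
  have t1: "m powr p + t * (x / A - m) \<le> (x / A) powr p"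
    unfolding t_def using assms m by (intro powr_ge_tangent) auto
  have t2: "m powr p + t * (y / B - m) \<le> (y / B) powr p"
    unfolding t_def using assms m by (intro powr_ge_tangent) auto
  have "A * (m powr p + t * (x / A - m)) + B * (m powr p + t * (y / B - m)) \<le> A * (x / A) powr p + B * (y / B) powr p"
    using t1 t2 assms by (intro add_mono mult_left_mono) auto
  moreover have "A * (m powr p + t * (x / A - m)) + B * (m powr p + t * (y / B - m)) = (A + B) * m powr p"
  proof -
    have "A * (x / A - m) = x - A * m" "B * (y / B - m) = y - B * m" "(A + B) * m = x + y"
      using assms AB by (simp_all add: right_diff_distrib m_def)
    then have "A * (x / A - m) + B * (y / B - m) = 0" by (simp add: algebra_simps)
    then have "t * (A * (x / A - m) + B * (y / B - m)) = 0" by simp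
    moreover have "A * (c + t * u) + B * (c + t * v) = (A + B) * c + t * (A * u + B * v)" for c u v
      by (simp add: algebra_simps)
    ultimately show ?thesis by simp
  qed
  ultimately have "(A + B) * m powr p \<le> A * (x / A) powr p + B * (y / B) powr p" by simp
  then have "(A + B) * m powr p / (A + B) \<le> (A * (x / A) powr p + B * (y / B) powr p) / (A + B)"
    using AB by (intro divide_right_mono) auto
  then show ?thesis using AB by (simp add: m_def add_divide_distrib)
qed

text \<open>The quotient \<open>(x + y) / (A + B)\<close> is a convex combination of
  \<open>x / A\<close> and \<open>y / B\<close>, so convexity of \<open>x powr p\<close> can be
  integrated. \<open>A\<close> and \<open>B\<close> are bounds for the seminorms rather than the
  seminorms themselves: they can be taken positive, and divided by, even if an energy is
  zero.\<close>

lemma energy_add_le: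
  assumes p: "1 < p" and f: "f holomorphic_on unit_disk" and g: "g holomorphic_on unit_disk"
    and A: "0 < A" "energy p s f \<le> ennreal (A powr p)" and B: "0 < B" "energy p s g \<le> ennreal (B powr p)"
  shows "energy p s (\<lambda>z. f z + g z) \<le> ennreal ((A + B) powr p)"
proof -
  have mf [measurable]: "(\<lambda>z. ennreal (Dps_integrand p s f z) * indicator unit_disk z) \<in> borel_measurable borel"
    and mg [measurable]: "(\<lambda>z. ennreal (Dps_integrand p s g z) * indicator unit_disk z) \<in> borel_measurable borel"
    using f g p by (auto intro!: measurable_Dps_integrand)
  define cf where "cf = (A + B) powr p * (A / (A + B)) * A powr (- p)"
  define cg where "cg = (A + B) powr p * (B / (A + B)) * B powr (- p)"
  have c0: "0 \<le> cf" "0 \<le> cg" using A B by (auto simp: cf_def cg_def)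
  have pw: "Dps_integrand p s (\<lambda>z. f z + g z) z \<le> cf * Dps_integrand p s f z + cg * Dps_integrand p s g z"
    if z: "z \<in> unit_disk" for z
  proof -
    have d: "deriv (\<lambda>z. f z + g z) z = deriv f z + deriv g z"
      using f g z by (intro deriv_add) (auto simp: holomorphic_on_imp_differentiable_at)
    define x where "x = cmod (deriv f z)"
    define y where "y = cmod (deriv g z)"
    define w where "w = (1 - (cmod z)\<^sup>2) powr s"
    have "cmod (deriv f z + deriv g z) powr p \<le> (x + y) powr p"
      using p by (intro powr_mono2) (auto simp: x_def y_def norm_triangle_ineq)
    also have "\<dots> = (A + B) powr p * ((x + y) / (A + B)) powr p"
      using A B by (simp add: x_def y_def powr_divide)
    also have "\<dots> \<le> (A + B) powr p * (A / (A + B) * (x / A) powr p + B / (A + B) * (y / B) powr p)"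
      using A B p by (intro mult_left_mono powr_add_convex) (auto simp: x_def y_def)
    also have "\<dots> = cf * x powr p + cg * y powr p"
      using A B by (simp add: cf_def cg_def x_def y_def powr_divide powr_minus field_simps)
    finally have "cmod (deriv f z + deriv g z) powr p * w \<le> (cf * x powr p + cg * y powr p) * w"
      by (intro mult_right_mono) (auto simp: w_def)
    then show ?thesis
      by (simp add: Dps_integrand_def d x_def y_def w_def algebra_simps)
  qed
  have "energy p s (\<lambda>z. f z + g z) \<le>
    (\<integral>\<^sup>+z. ennreal cf * (ennreal (Dps_integrand p s f z) * indicator unit_disk z) +
          ennreal cg * (ennreal (Dps_integrand p s g z) * indicator unit_disk z) \<partial>lborel)"
    unfolding energy_def
  proof (intro nn_integral_mono)
    fix z :: complex
    show "ennreal (Dps_integrand p s (\<lambda>z. f z + g z) z) * indicator unit_disk z \<le>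
      ennreal cf * (ennreal (Dps_integrand p s f z) * indicator unit_disk z) +
          ennreal cg * (ennreal (Dps_integrand p s g z) * indicator unit_disk z)"
    proof (cases "z \<in> unit_disk")
      case True
      then show ?thesis
        using ennreal_leI[OF pw[OF True]] c0
        by (simp add: ennreal_mult Dps_integrand_nonneg)
    qed simp
  qed
  also have "\<dots> = ennreal cf * energy p s f + ennreal cg * energy p s g"
    using mf mg by (subst nn_integral_add) (auto simp: nn_integral_cmult energy_def)
  also have "\<dots> \<le> ennreal cf * ennreal (A powr p) + ennreal cg * ennreal (B powr p)"
    using A B by (intro add_mono mult_left_mono) auto
  also have "\<dots> = ennreal (cf * A powr p + cg * B powr p)"
    using c0 by (simp add: ennreal_mult)
  also have "cf * A powr p + cg * B powr p = (A + B) powr p"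
  proof -
    have "A powr (- p) * A powr p = 1" "B powr (- p) * B powr p = 1"
      using A B by (simp_all add: powr_add[symmetric])
    then have "cf * A powr p + cg * B powr p = (A + B) powr p * (A / (A + B)) + (A + B) powr p * (B / (A + B))"
      by (simp only: cf_def cg_def mult.assoc mult_1_right)
    also have "\<dots> = (A + B) powr p"
      using A B by (simp add: distrib_left[symmetric] add_divide_distrib[symmetric])
    finally show ?thesis .
  qed
  finally show ?thesis .
qed

lemma mob_energy_add_le:
  assumes "1 < p" "f holomorphic_on unit_disk" "g holomorphic_on unit_disk" "cmod a < 1"
    and "0 < A" "mob_energy p s f a \<le> ennreal (A powr p)" "0 < B" "mob_energy p s g a \<le> ennreal (B powr p)"
  shows "mob_energy p s (\<lambda>z. f z + g z) a \<le> ennreal ((A + B) powr p)"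
  using assms holomorphic_compose_disk_aut unfolding mob_energy_def by (intro energy_add_le) auto

lemma energy_cmult:
  assumes f: "f holomorphic_on unit_disk" and p: "0 < p"
  shows "energy p s (\<lambda>z. c * f z) = ennreal (cmod c powr p) * energy p s f"
proof -
  have "Dps_integrand p s (\<lambda>z. c * f z) z = cmod c powr p * Dps_integrand p s f z" if "z \<in> unit_disk" for z
  proof -
    have "deriv (\<lambda>z. c * f z) z = c * deriv f z"
      using f that by (intro deriv_cmult) (auto simp: holomorphic_on_imp_differentiable_at)
    then show ?thesis by (simp add: Dps_integrand_def norm_mult powr_mult)
  qed
  then have "energy p s (\<lambda>z. c * f z) = (\<integral>\<^sup>+z. ennreal (cmod c powr p) * (ennreal (Dps_integrand p s f z) * indicator unit_disk z) \<partial>lborel)"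
    unfolding energy_def
    by (intro nn_integral_cong) (auto simp: indicator_def ennreal_mult Dps_integrand_nonneg)
  then show ?thesis using f p by (simp add: nn_integral_cmult measurable_Dps_integrand energy_def)
qed

lemma mob_energy_cmult:
  assumes "f holomorphic_on unit_disk" "0 < p" "cmod a < 1"
  shows "mob_energy p s (\<lambda>z. c * f z) a = ennreal (cmod c powr p) * mob_energy p s f a"
  using assms holomorphic_compose_disk_aut unfolding mob_energy_def by (intro energy_cmult) auto

lemma mob_energy_uminus:
  assumes "f holomorphic_on unit_disk" "0 < p" "cmod a < 1"
  shows "mob_energy p s (\<lambda>z. - f z) a = mob_energy p s f a"
proof -
  have "mob_energy p s (\<lambda>z. (- 1) * f z) a = ennreal (cmod (- 1) powr p) * mob_energy p s f a"
    using assms by (rule mob_energy_cmult)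
  then show ?thesis by simp
qed

lemma mob_energy_diff_le:
  assumes "1 < p" "f holomorphic_on unit_disk" "g holomorphic_on unit_disk" "cmod a < 1"
    and "0 < A" "mob_energy p s f a \<le> ennreal (A powr p)" "0 < B" "mob_energy p s g a \<le> ennreal (B powr p)"
  shows "mob_energy p s (\<lambda>z. f z - g z) a \<le> ennreal ((A + B) powr p)"
proof -
  have "mob_energy p s (\<lambda>z. - g z) a \<le> ennreal (B powr p)"
    using assms by (subst mob_energy_uminus) auto
  then have "mob_energy p s (\<lambda>z. f z + - g z) a \<le> ennreal ((A + B) powr p)"
    using assms by (intro mob_energy_add_le holomorphic_on_minus)
  then show ?thesis by simp
qed

section \<open>Limits of energies\<close>

lemma energy_Fatou:
  assumes f: "\<And>n. f n holomorphic_on unit_disk" and p: "0 < p"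
    and lim: "\<And>z. z \<in> unit_disk \<Longrightarrow> (\<lambda>n. deriv (f n) z) \<longlonglongrightarrow> deriv g z"
    and le: "\<And>n. energy p s (f n) \<le> B"
  shows "energy p s g \<le> B"
proof -
  have "energy p s g \<le> (\<integral>\<^sup>+z. liminf (\<lambda>n. ennreal (Dps_integrand p s (f n) z) * indicator unit_disk z) \<partial>lborel)"
    unfolding energy_def
  proof (intro nn_integral_mono)
    fix z :: complex
    show "ennreal (Dps_integrand p s g z) * indicator unit_disk z
      \<le> liminf (\<lambda>n. ennreal (Dps_integrand p s (f n) z) * indicator unit_disk z)"
    proof (cases "z \<in> unit_disk")
      case True
      have "(\<lambda>n. cmod (deriv (f n) z) powr p) \<longlonglongrightarrow> cmod (deriv g z) powr p"
        using p by (intro tendsto_powr' tendsto_norm lim True tendsto_const) auto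
      then have "(\<lambda>n. ennreal (Dps_integrand p s (f n) z)) \<longlonglongrightarrow> ennreal (Dps_integrand p s g z)"
        unfolding Dps_integrand_def by (intro tendsto_ennrealI tendsto_mult tendsto_const)
      from lim_imp_Liminf[OF _ this] True show ?thesis by simp
    qed simp
  qed
  also have "\<dots> \<le> liminf (\<lambda>n. \<integral>\<^sup>+z. ennreal (Dps_integrand p s (f n) z) * indicator unit_disk z \<partial>lborel)"
    using measurable_Dps_integrand[OF f p] by (intro nn_integral_liminf) auto
  also have "\<dots> \<le> B"
  proof -
    have "liminf (\<lambda>n. \<integral>\<^sup>+z. ennreal (Dps_integrand p s (f n) z) * indicator unit_disk z \<partial>lborel) \<le> liminf (\<lambda>n. B)"
      using le by (intro Liminf_mono) (auto simp: energy_def)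
    then show ?thesis by (simp add: Liminf_const)
  qed
  finally show ?thesis .
qed

lemma mob_energy_Fatou:
  assumes f: "\<And>n. f n holomorphic_on unit_disk" and p: "0 < p" and g: "g holomorphic_on unit_disk" and a: "cmod a < 1"
    and lim: "\<And>z. z \<in> unit_disk \<Longrightarrow> (\<lambda>n. deriv (f n) z) \<longlonglongrightarrow> deriv g z"
    and le: "\<And>n. mob_energy p s (f n) a \<le> B"
  shows "mob_energy p s g a \<le> B"
  unfolding mob_energy_def
proof (rule energy_Fatou[where f = "\<lambda>n z. f n (disk_aut a z)", OF _ p])
  show "(\<lambda>z. f n (disk_aut a z)) holomorphic_on unit_disk" for n
    by (rule holomorphic_compose_disk_aut[OF f a])
  show "energy p s (\<lambda>z. f n (disk_aut a z)) \<le> B" for n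
    using le[of n] by (simp add: mob_energy_def)
  fix z assume z: "z \<in> unit_disk"
  have "(\<lambda>n. deriv (f n) (disk_aut a z) * deriv (disk_aut a) z) \<longlonglongrightarrow> deriv g (disk_aut a z) * deriv (disk_aut a) z"
    using z a by (intro tendsto_mult lim tendsto_const) auto
  then show "(\<lambda>n. deriv (\<lambda>z. f n (disk_aut a z)) z) \<longlonglongrightarrow> deriv (\<lambda>z. g (disk_aut a z)) z"
    using z a by (simp add: deriv_compose_disk_aut f g)
qed

lemma powr_norm_diff_le:
  fixes x y :: complex
  assumes "0 < p"
  shows "cmod (x - y) powr p \<le> 2 powr p * (cmod x powr p + cmod y powr p)"
proof -
  define M where "M = max (cmod x) (cmod y)"
  have M: "cmod x \<le> M" "cmod y \<le> M" "M = cmod x \<or> M = cmod y" unfolding M_def by linarith+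
  have "cmod (x - y) \<le> 2 * M" using norm_triangle_ineq4[of x y] M by linarith
  then have "cmod (x - y) powr p \<le> (2 * M) powr p"
    using assms by (intro powr_mono2) auto
  also have "\<dots> = 2 powr p * M powr p"
    using M by (intro powr_mult)
  also have "\<dots> \<le> 2 powr p * (cmod x powr p + cmod y powr p)"
    using M(3) by (intro mult_left_mono) auto
  finally show ?thesis .
qed

text \<open>The Brezis--Lieb argument: Fatou's lemma is applied to the nonnegative functions
  \<open>2\<^sup>p(|f\<^sub>n'|\<^sup>p + |f'|\<^sup>p) - |f\<^sub>n' - f'|\<^sup>p\<close>.\<close>

lemma energy_diff_tendsto_0:
  assumes f: "\<And>n. f n holomorphic_on unit_disk" and g: "g holomorphic_on unit_disk" and p: "0 < p"
    and lim: "\<And>z. z \<in> unit_disk \<Longrightarrow> (\<lambda>n. deriv (f n) z) \<longlonglongrightarrow> deriv g z"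
    and fin: "energy p s g < \<infinity>" and c: "c \<longlonglongrightarrow> (1::real)"
    and le: "\<And>n. energy p s (f n) \<le> ennreal (c n) * energy p s g"
  shows "(\<lambda>n. energy p s (\<lambda>z. f n z - g z)) \<longlonglongrightarrow> 0"
proof -
  define e where "e = enn2real (energy p s g)"
  have e: "0 \<le> e" "energy p s g = ennreal e" using fin by (auto simp: e_def less_top[symmetric])
  define K where "K = (2::real) powr p"
  have K: "0 \<le> K" by (simp add: K_def)
  define H where "H n z = K * (Dps_integrand p s (f n) z + Dps_integrand p s g z) - Dps_integrand p s (\<lambda>z. f n z - g z) z" for n z
  have dd: "deriv (\<lambda>z. f n z - g z) z = deriv (f n) z - deriv g z" if "z \<in> unit_disk" for n z
    using f[of n] g that by (intro deriv_diff) (auto simp: holomorphic_on_imp_differentiable_at)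
  have H0: "0 \<le> H n z" if "z \<in> unit_disk" for n z
  proof -
    have "cmod (deriv (f n) z - deriv g z) powr p * (1 - (cmod z)\<^sup>2) powr s
      \<le> K * (cmod (deriv (f n) z) powr p + cmod (deriv g z) powr p) * (1 - (cmod z)\<^sup>2) powr s"
      unfolding K_def using p by (intro mult_right_mono powr_norm_diff_le) auto
    then show ?thesis by (simp add: H_def Dps_integrand_def dd[OF that] algebra_simps)
  qed
  have hol: "(\<lambda>z. f n z - g z) holomorphic_on unit_disk" for n
    using f g by (intro holomorphic_intros)
  have Hm [measurable]: "(\<lambda>z. ennreal (H n z) * indicator unit_disk z) \<in> borel_measurable borel" for n
    unfolding H_def using f g hol p
    by (intro measurable_on_disk continuous_intros continuous_on_Dps_integrand)
  \<comment> \<open>Stated as a sum, since differences of possibly infinite energies are of no use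
    in \<open>ennreal\<close>.\<close>
  have sum: "(\<integral>\<^sup>+z\<in>unit_disk. ennreal (H n z) \<partial>lborel) + energy p s (\<lambda>z. f n z - g z)
      = ennreal K * (energy p s (f n) + energy p s g)" for n
  proof -
    have "(\<integral>\<^sup>+z\<in>unit_disk. ennreal (H n z) \<partial>lborel) + energy p s (\<lambda>z. f n z - g z)
      = (\<integral>\<^sup>+z. ennreal (H n z) * indicator unit_disk z + ennreal (Dps_integrand p s (\<lambda>z. f n z - g z) z) * indicator unit_disk z \<partial>lborel)"
      unfolding energy_def using measurable_Dps_integrand[OF hol p] by (subst nn_integral_add) auto
    also have "\<dots> = (\<integral>\<^sup>+z. ennreal K * (ennreal (Dps_integrand p s (f n) z) * indicator unit_disk z + ennreal (Dps_integrand p s g z) * indicator unit_disk z) \<partial>lborel)"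
    proof (intro nn_integral_cong)
      fix z :: complex
      have "ennreal (H n z) + ennreal (Dps_integrand p s (\<lambda>z. f n z - g z) z)
        = ennreal K * (ennreal (Dps_integrand p s (f n) z) + ennreal (Dps_integrand p s g z))" if "z \<in> unit_disk"
        using K H0[OF that, of n]
        by (simp add: ennreal_plus[symmetric] ennreal_mult[symmetric] Dps_integrand_nonneg H_def del: ennreal_plus)
      then show "ennreal (H n z) * indicator unit_disk z + ennreal (Dps_integrand p s (\<lambda>z. f n z - g z) z) * indicator unit_disk z
        = ennreal K * (ennreal (Dps_integrand p s (f n) z) * indicator unit_disk z + ennreal (Dps_integrand p s g z) * indicator unit_disk z)"
        by (cases "z \<in> unit_disk") auto
    qed
    also have "\<dots> = ennreal K * (energy p s (f n) + energy p s g)"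
    proof -
      have [measurable]: "(\<lambda>z. ennreal (Dps_integrand p s (f n) z) * indicator unit_disk z) \<in> borel_measurable borel"
        "(\<lambda>z. ennreal (Dps_integrand p s g z) * indicator unit_disk z) \<in> borel_measurable borel"
        using f g p by (auto intro!: measurable_Dps_integrand)
      show ?thesis
        unfolding energy_def by (subst nn_integral_cmult, measurable) (subst nn_integral_add, auto)
    qed
    finally show ?thesis .
  qed
  \<comment> \<open>The pointwise limit of \<open>H n\<close> is \<open>2 * K\<close> times the
    integrand of \<open>g\<close>, because the subtracted term tends to zero.\<close>
  have "ennreal (2 * K * e) \<le> (\<integral>\<^sup>+z. liminf (\<lambda>n. ennreal (H n z) * indicator unit_disk z) \<partial>lborel)"
  proof -
    have "ennreal (2 * K * e) = ennreal (2 * K) * energy p s g"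
      using K e by (simp add: ennreal_mult)
    also have "\<dots> = (\<integral>\<^sup>+z. ennreal (2 * K) * (ennreal (Dps_integrand p s g z) * indicator unit_disk z) \<partial>lborel)"
      using g p by (simp add: nn_integral_cmult measurable_Dps_integrand energy_def)
    also have "\<dots> \<le> (\<integral>\<^sup>+z. liminf (\<lambda>n. ennreal (H n z) * indicator unit_disk z) \<partial>lborel)"
    proof (intro nn_integral_mono)
      fix z :: complex
      show "ennreal (2 * K) * (ennreal (Dps_integrand p s g z) * indicator unit_disk z)
        \<le> liminf (\<lambda>n. ennreal (H n z) * indicator unit_disk z)"
      proof (cases "z \<in> unit_disk")
        case True
        have l1: "(\<lambda>n. Dps_integrand p s (f n) z) \<longlonglongrightarrow> Dps_integrand p s g z"
          unfolding Dps_integrand_def using p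
          by (intro tendsto_mult tendsto_powr' tendsto_norm lim True tendsto_const) auto
        have "(\<lambda>n. cmod (deriv (f n) z - deriv g z)) \<longlonglongrightarrow> cmod (deriv g z - deriv g z)"
          by (intro tendsto_norm tendsto_diff lim True tendsto_const)
        then have "(\<lambda>n. cmod (deriv (f n) z - deriv g z) powr p * (1 - (cmod z)\<^sup>2) powr s) \<longlonglongrightarrow> 0 powr p * (1 - (cmod z)\<^sup>2) powr s"
          using p by (intro tendsto_mult tendsto_powr' tendsto_const) auto
        then have l2: "(\<lambda>n. Dps_integrand p s (\<lambda>z. f n z - g z) z) \<longlonglongrightarrow> 0"
          by (simp add: Dps_integrand_def dd[OF True])
        have "(\<lambda>n. H n z) \<longlonglongrightarrow> K * (Dps_integrand p s g z + Dps_integrand p s g z) - 0"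
          unfolding H_def by (intro tendsto_intros l1 l2)
        then have "(\<lambda>n. ennreal (H n z)) \<longlonglongrightarrow> ennreal (2 * K * Dps_integrand p s g z)"
          by (intro tendsto_ennrealI) (simp add: algebra_simps)
        from lim_imp_Liminf[OF _ this] True show ?thesis
          using K by (simp add: ennreal_mult Dps_integrand_nonneg)
      qed simp
    qed
    finally show ?thesis .
  qed
  also have "\<dots> \<le> liminf (\<lambda>n. \<integral>\<^sup>+z\<in>unit_disk. ennreal (H n z) \<partial>lborel)"
    by (intro nn_integral_liminf) auto
  finally have Fat: "ennreal (2 * K * e) \<le> liminf (\<lambda>n. \<integral>\<^sup>+z\<in>unit_disk. ennreal (H n z) \<partial>lborel)" .
  show ?thesis
  proof (rule order_tendstoI)
    fix y :: ennreal assume y: "0 < y"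
    obtain \<epsilon> :: real where \<epsilon>: "0 < \<epsilon>" "ennreal \<epsilon> < y"
    proof -
      obtain w where w: "0 < w" "w < y" using y dense by blast
      then have "w < top" by (meson less_le_trans top_greatest)
      then show ?thesis using that[of "enn2real w"] w by (auto simp: enn2real_positive_iff)
    qed
    have ev1: "\<forall>\<^sub>F n in sequentially. ennreal (2 * K * e - \<epsilon> / 2) \<le> (\<integral>\<^sup>+z\<in>unit_disk. ennreal (H n z) \<partial>lborel)"
    proof (cases "2 * K * e - \<epsilon> / 2 \<le> 0")
      case False
      then have "ennreal (2 * K * e - \<epsilon> / 2) < ennreal (2 * K * e)" using \<epsilon> by (intro ennreal_lessI) auto
      then have "\<forall>\<^sub>F n in sequentially. ennreal (2 * K * e - \<epsilon> / 2) < (\<integral>\<^sup>+z\<in>unit_disk. ennreal (H n z) \<partial>lborel)"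
        using Fat[unfolded le_Liminf_iff] by blast
      then show ?thesis by (rule eventually_mono) (rule less_imp_le)
    qed (simp add: ennreal_neg)
    have "(\<lambda>n. K * (c n * e) - K * e) \<longlonglongrightarrow> K * (1 * e) - K * e"
      by (intro tendsto_intros c)
    then have "(\<lambda>n. K * (c n * e) - K * e) \<longlonglongrightarrow> 0" by simp
    then have ev2: "\<forall>\<^sub>F n in sequentially. K * (c n * e) - K * e < \<epsilon> / 2"
      using \<epsilon> by (intro order_tendstoD) auto
    have ev3: "\<forall>\<^sub>F n in sequentially. 0 < c n" using c by (intro order_tendstoD) auto
    show "\<forall>\<^sub>F n in sequentially. energy p s (\<lambda>z. f n z - g z) < y"
      using ev1 ev2 ev3
    proof eventually_elim
      case (elim n)
      have le1: "energy p s (f n) \<le> ennreal (c n * e)"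
        using le[of n] e elim by (simp add: ennreal_mult)
      \<comment> \<open>The integral of \<open>H n\<close> is at least
        \<open>2 * K * e - \<epsilon> / 2\<close> and the total at most
        \<open>K * (c n * e) + K * e\<close>. As \<open>c n\<close> is close to \<open>1\<close>,
        less than \<open>\<epsilon>\<close> remains for the difference.\<close>
      have "ennreal (2 * K * e - \<epsilon> / 2) + energy p s (\<lambda>z. f n z - g z) \<le> ennreal K * (energy p s (f n) + energy p s g)"
        unfolding sum[symmetric] using elim(1) by (rule add_right_mono)
      also have "\<dots> \<le> ennreal K * (ennreal (c n * e) + ennreal e)"
        using le1 e by (intro mult_left_mono add_mono) auto
      also have "\<dots> = ennreal (K * (c n * e) + K * e)"
        using K e elim by (simp add: ennreal_mult ennreal_plus distrib_left)
      finally have l: "ennreal (2 * K * e - \<epsilon> / 2) + energy p s (\<lambda>z. f n z - g z) \<le> ennreal (K * (c n * e) + K * e)" .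
      have "energy p s (\<lambda>z. f n z - g z) \<le> ennreal (K * (c n * e) + K * e)"
        by (rule order_trans[OF _ l]) simp
      then obtain d where d: "0 \<le> d" "energy p s (\<lambda>z. f n z - g z) = ennreal d"
        by (cases "energy p s (\<lambda>z. f n z - g z)") (auto simp: top_unique)
      have nn: "0 \<le> K * (c n * e)" "0 \<le> K * e" using K e elim by auto
      have "d < \<epsilon>"
      \<comment> \<open>\<open>ennreal\<close> truncates a negative lower bound to \<open>0\<close>;
        the argument is the same, but the terms differ.\<close>
      proof (cases "0 \<le> 2 * K * e - \<epsilon> / 2")
        case True
        then have "ennreal (2 * K * e - \<epsilon> / 2 + d) \<le> ennreal (K * (c n * e) + K * e)"
          using l d by (simp add: ennreal_plus[symmetric] del: ennreal_plus)
        then have "2 * K * e - \<epsilon> / 2 + d \<le> K * (c n * e) + K * e"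
          using nn by (simp add: ennreal_le_iff del: ennreal_plus)
        then show ?thesis using elim(2) by linarith
      next
        case False
        then have "ennreal d \<le> ennreal (K * (c n * e) + K * e)"
          using l d by (simp add: ennreal_neg del: ennreal_plus)
        then have "d \<le> K * (c n * e) + K * e"
          using nn by (simp add: ennreal_le_iff del: ennreal_plus)
        then show ?thesis using elim(2) False by linarith
      qed
      then have "ennreal d < ennreal \<epsilon>" using d by (intro ennreal_lessI) auto
      then show ?case using \<epsilon> d by simp
    qed
  qed auto
qed

section \<open>The spaces \<open>M0\<close> and \<open>m0\<close> in terms of energies\<close>

lemma eventually_at_unit_circle:
  "eventually P at_unit_circle \<longleftrightarrow> (\<exists>r<1. \<forall>z. r < cmod z \<and> cmod z < 1 \<longrightarrow> P z)"
proof
  assume "eventually P at_unit_circle"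
  then obtain Q where Q: "eventually Q (at_left (1::real))" "\<And>z. Q (cmod z) \<Longrightarrow> P z"
    by (auto simp: eventually_filtercomap)
  then show "\<exists>r<1. \<forall>z. r < cmod z \<and> cmod z < 1 \<longrightarrow> P z"
    unfolding eventually_at_left_field by blast
next
  assume "\<exists>r<1. \<forall>z. r < cmod z \<and> cmod z < 1 \<longrightarrow> P z"
  then obtain r where r: "r < 1" "\<And>z. r < cmod z \<Longrightarrow> cmod z < 1 \<Longrightarrow> P z" by blast
  show "eventually P at_unit_circle"
    unfolding eventually_filtercomap
    by (rule exI[of _ "\<lambda>x. r < x \<and> x < 1"]) (use r in \<open>auto simp: eventually_at_left_field\<close>)
qed

lemma energy_mob_translate:
  assumes "f holomorphic_on unit_disk" "cmod a < 1"
  shows "energy p s (mob_translate f a) = mob_energy p s f a"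
    and "mob_translate f a holomorphic_on unit_disk" "mob_translate f a 0 = 0"
proof -
  have "deriv (\<lambda>z. f (disk_aut a z) - f a) z = deriv (\<lambda>z. f (disk_aut a z)) z" if "z \<in> unit_disk" for z
    using holomorphic_compose_disk_aut[OF assms] that
    by (subst deriv_diff) (auto simp: holomorphic_on_imp_differentiable_at)
  then show "energy p s (mob_translate f a) = mob_energy p s f a"
    unfolding mob_energy_def energy_def mob_translate_def[abs_def] Dps_integrand_def
    by (intro nn_integral_cong) (auto simp: indicator_def)
  show "mob_translate f a holomorphic_on unit_disk"
    unfolding mob_translate_def[abs_def] using assms
    by (intro holomorphic_intros holomorphic_compose_disk_aut)
  show "mob_translate f a 0 = 0" by (simp add: mob_translate_def)
qed

lemma Dps_norm_mob_translate:
  assumes "f holomorphic_on unit_disk" "cmod a < 1" "0 < p"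
  shows "Dps_norm p s (mob_translate f a) = enn2real (mob_energy p s f a) powr (1 / p)"
  using assms by (subst Dps_norm_energy) (auto simp: energy_mob_translate)

text \<open>Finiteness of \<open>x\<close> is a hypothesis because \<open>enn2real\<close> sends
  infinity to \<open>0\<close>.\<close>

lemma enn2real_powr_le_iff:
  assumes "x < \<infinity>" "0 \<le> B" "0 < p"
  shows "enn2real x powr (1 / p) \<le> B \<longleftrightarrow> x \<le> ennreal (B powr p)"
proof -
  obtain r where r: "0 \<le> r" "x = ennreal r" using assms by (cases x) auto
  have "r powr (1 / p) \<le> B \<longleftrightarrow> r \<le> B powr p"
  proof
    assume "r powr (1 / p) \<le> B"
    then have "(r powr (1 / p)) powr p \<le> B powr p" using assms by (intro powr_mono2) auto
    then show "r \<le> B powr p" using r assms by (simp add: powr_powr)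
  next
    assume "r \<le> B powr p"
    then have "r powr (1 / p) \<le> (B powr p) powr (1 / p)" using assms r by (intro powr_mono2) auto
    then show "r powr (1 / p) \<le> B" using assms by (simp add: powr_powr)
  qed
  then show ?thesis using r by simp
qed

text \<open>The bound on the norms becomes a bound \<open>B powr p\<close> on the energies, with a
  positive \<open>B\<close> as in \<open>mob_energy_add_le\<close>.\<close>

lemma M0_iff:
  assumes adm: "admissible p s"
  shows "f \<in> M0 p s \<longleftrightarrow> f holomorphic_on unit_disk \<and> (\<exists>B>0. \<forall>a. cmod a < 1 \<longrightarrow> mob_energy p s f a \<le> ennreal (B powr p))"
proof (cases "f holomorphic_on unit_disk")
  case f: True
  note ps = admissible_range[OF adm]
  have D: "mob_translate f a \<in> Dps p s \<longleftrightarrow> mob_energy p s f a < \<infinity>" if "cmod a < 1" for a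
    using that f ps by (simp add: Dps_iff_energy energy_mob_translate)
  show ?thesis
  proof
    assume M: "f \<in> M0 p s"
    then have "\<exists>B. \<forall>a\<in>unit_disk. Dps_norm p s (mob_translate f a) \<le> B"
      by (auto simp: M0_def bdd_above_def)
    then obtain B where B: "\<And>a. cmod a < 1 \<Longrightarrow> Dps_norm p s (mob_translate f a) \<le> B"
      by (meson mem_ball_0)
    have "mob_energy p s f a \<le> ennreal ((max B 1) powr p)" if a: "cmod a < 1" for a
    proof -
      have "mob_energy p s f a < \<infinity>" using M D a by (auto simp: M0_def)
      moreover have "enn2real (mob_energy p s f a) powr (1 / p) \<le> max B 1"
        using B[OF a] Dps_norm_mob_translate[OF f a ps(2)] by simp
      ultimately show ?thesis using ps by (simp add: enn2real_powr_le_iff)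
    qed
    then show "f holomorphic_on unit_disk \<and> (\<exists>B>0. \<forall>a. cmod a < 1 \<longrightarrow> mob_energy p s f a \<le> ennreal (B powr p))"
      using f by (intro conjI exI[of _ "max B 1"]) auto
  next
    assume "f holomorphic_on unit_disk \<and> (\<exists>B>0. \<forall>a. cmod a < 1 \<longrightarrow> mob_energy p s f a \<le> ennreal (B powr p))"
    then obtain B where B: "0 < B" "\<And>a. cmod a < 1 \<Longrightarrow> mob_energy p s f a \<le> ennreal (B powr p)" by auto
    have fin: "mob_energy p s f a < \<infinity>" if "cmod a < 1" for a
      using B(2)[OF that] by (simp add: le_less_trans)
    have "energy p s f < \<infinity>"
    proof -
      \<comment> \<open>\<open>disk_aut 0\<close> is the map \<open>- z\<close>. Applying it twice
        recovers \<open>f\<close> from its translate at \<open>0\<close>, whose energy is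
        finite.\<close>
      have "energy p s f = energy p s (\<lambda>z. f (disk_aut 0 (disk_aut 0 z)))"
        by (intro energy_cong) simp
      also have "\<dots> \<le> ennreal (((1 + cmod 0) / (1 - cmod 0)) powr (s - p + 2)) * energy p s (\<lambda>z. f (disk_aut 0 z))"
        using mob_energy_le_energy[OF adm holomorphic_compose_disk_aut[OF f], of 0 0] by (simp add: mob_energy_def)
      also have "\<dots> < \<infinity>" using fin[of 0] by (simp add: mob_energy_def)
      finally show ?thesis .
    qed
    then have "f \<in> Dps p s" using f ps by (simp add: Dps_iff_energy)
    moreover have "Dps_norm p s (mob_translate f a) \<le> B" if "cmod a < 1" for a
      using B fin that ps f by (simp add: Dps_norm_mob_translate enn2real_powr_le_iff)
    ultimately show "f \<in> M0 p s"
      using D fin unfolding M0_def by (auto intro!: bdd_aboveI2[of _ _ B])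
  qed
qed (auto simp: M0_def Dps_def)

lemma M0_energy_finite:
  assumes adm: "admissible p s" and f: "f \<in> M0 p s"
  shows "energy p s f < \<infinity>"
  using f admissible_range[OF adm] by (auto simp: M0_def Dps_iff_energy)

lemma M0_norm_le:
  assumes adm: "admissible p s" and f: "f holomorphic_on unit_disk"
    and B: "0 < B" "\<And>a. cmod a < 1 \<Longrightarrow> mob_energy p s f a \<le> ennreal (B powr p)"
  shows "M0_norm p s f \<le> cmod (f 0) + B" "0 \<le> M0_norm p s f"
proof -
  note ps = admissible_range[OF adm]
  have *: "Dps_norm p s (mob_translate f a) \<le> B" if "cmod a < 1" for a
  proof -
    have "mob_energy p s f a < \<infinity>" using B(2)[OF that] by (simp add: le_less_trans)
    then show ?thesis using B that ps f by (simp add: Dps_norm_mob_translate enn2real_powr_le_iff)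
  qed
  then have "mob_rho p s f \<le> B" unfolding mob_rho_def by (intro cSUP_least) auto
  then show "M0_norm p s f \<le> cmod (f 0) + B" by (simp add: M0_norm_def)
  have "0 \<le> Dps_norm p s (mob_translate f 0)" using f ps by (simp add: Dps_norm_mob_translate)
  also have "\<dots> \<le> mob_rho p s f"
    unfolding mob_rho_def using * by (intro cSUP_upper bdd_aboveI2[of _ _ B]) auto
  finally show "0 \<le> M0_norm p s f" by (simp add: M0_norm_def)
qed

lemma mob_energy_le_M0_norm:
  assumes adm: "admissible p s" and f: "f \<in> M0 p s" and a: "cmod a < 1"
  shows "mob_energy p s f a \<le> ennreal (M0_norm p s f powr p)"
proof -
  note ps = admissible_range[OF adm]
  have hol: "f holomorphic_on unit_disk" using f by (auto simp: M0_iff[OF adm])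
  have fin: "mob_energy p s f a < \<infinity>"
    using f a by (auto simp: M0_iff[OF adm]) (metis ennreal_less_top order_le_less_trans)
  have "enn2real (mob_energy p s f a) powr (1 / p) \<le> mob_rho p s f"
    unfolding mob_rho_def Dps_norm_mob_translate[OF hol a ps(2), symmetric]
    using f a by (intro cSUP_upper) (auto simp: M0_def)
  then have "enn2real (mob_energy p s f a) powr (1 / p) \<le> M0_norm p s f" by (simp add: M0_norm_def add_increasing)
  moreover from this have "0 \<le> M0_norm p s f" by (meson order_trans powr_ge_zero)
  ultimately show ?thesis using fin ps by (simp add: enn2real_powr_le_iff)
qed

lemma m0_iff:
  assumes adm: "admissible p s"
  shows "f \<in> m0 p s \<longleftrightarrow> f \<in> M0 p s \<and>
    (\<forall>\<epsilon>>0. \<exists>r<1. \<forall>a. r < cmod a \<and> cmod a < 1 \<longrightarrow> mob_energy p s f a \<le> ennreal (\<epsilon> powr p))"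
proof (cases "f \<in> M0 p s")
  case f: True
  note ps = admissible_range[OF adm]
  have hol: "f holomorphic_on unit_disk" using f by (auto simp: M0_iff[OF adm])
  have fin: "mob_energy p s f a < \<infinity>" if "cmod a < 1" for a
    using f that by (auto simp: M0_iff[OF adm]) (metis ennreal_less_top order_le_less_trans)
  have iff: "Dps_norm p s (mob_translate f a) \<le> \<epsilon> \<longleftrightarrow> mob_energy p s f a \<le> ennreal (\<epsilon> powr p)"
    if "cmod a < 1" "0 < \<epsilon>" for a \<epsilon>
    using that fin ps hol by (simp add: Dps_norm_mob_translate enn2real_powr_le_iff)
  have "((\<lambda>a. Dps_norm p s (mob_translate f a)) \<longlongrightarrow> 0) at_unit_circle \<longleftrightarrow>
    (\<forall>\<epsilon>>0. \<exists>r<1. \<forall>a. r < cmod a \<and> cmod a < 1 \<longrightarrow> Dps_norm p s (mob_translate f a) \<le> \<epsilon>)"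
  proof
    assume L: "((\<lambda>a. Dps_norm p s (mob_translate f a)) \<longlongrightarrow> 0) at_unit_circle"
    show "\<forall>\<epsilon>>0. \<exists>r<1. \<forall>a. r < cmod a \<and> cmod a < 1 \<longrightarrow> Dps_norm p s (mob_translate f a) \<le> \<epsilon>"
    proof (intro allI impI)
      fix \<epsilon> :: real assume "0 < \<epsilon>"
      from order_tendstoD(2)[OF L this] show "\<exists>r<1. \<forall>a. r < cmod a \<and> cmod a < 1 \<longrightarrow> Dps_norm p s (mob_translate f a) \<le> \<epsilon>"
        unfolding eventually_at_unit_circle by (meson less_imp_le)
    qed
  next
    assume R: "\<forall>\<epsilon>>0. \<exists>r<1. \<forall>a. r < cmod a \<and> cmod a < 1 \<longrightarrow> Dps_norm p s (mob_translate f a) \<le> \<epsilon>"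
    show "((\<lambda>a. Dps_norm p s (mob_translate f a)) \<longlongrightarrow> 0) at_unit_circle"
    proof (rule tendstoI)
      fix \<epsilon> :: real assume "0 < \<epsilon>"
      then obtain r where r: "r < 1" "\<And>a. r < cmod a \<Longrightarrow> cmod a < 1 \<Longrightarrow> Dps_norm p s (mob_translate f a) \<le> \<epsilon> / 2"
        using R[rule_format, of "\<epsilon> / 2"] by auto
      have "dist (Dps_norm p s (mob_translate f a)) 0 < \<epsilon>" if "r < cmod a" "cmod a < 1" for a
        using r(2)[OF that] \<open>0 < \<epsilon>\<close> Dps_norm_mob_translate[OF hol that(2) ps(2), of s] by simp
      then show "\<forall>\<^sub>F a in at_unit_circle. dist (Dps_norm p s (mob_translate f a)) 0 < \<epsilon>"
        unfolding eventually_at_unit_circle using r(1) by blast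
    qed
  qed
  also have "\<dots> \<longleftrightarrow> (\<forall>\<epsilon>>0. \<exists>r<1. \<forall>a. r < cmod a \<and> cmod a < 1 \<longrightarrow> mob_energy p s f a \<le> ennreal (\<epsilon> powr p))"
    by (simp add: iff cong: conj_cong imp_cong)
  finally show ?thesis using f by (simp add: m0_def)
qed (auto simp: m0_def)

subsection \<open>Semigroups and their averages\<close>

text \<open>Schwarz--Pick for the pair \<open>0\<close>, \<open>z\<close>, solved for
  \<open>1 - (cmod (\<Phi> z))\<^sup>2\<close>. How much closer to the circle a self-map can bring a
  point depends only on its value at \<open>0\<close>.\<close>

lemma self_map_one_minus_norm:
  assumes \<Phi>: "\<Phi> holomorphic_on unit_disk" and im: "\<And>z. cmod z < 1 \<Longrightarrow> cmod (\<Phi> z) < 1" and z: "cmod z < 1"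
  shows "(1 - (cmod z)\<^sup>2) * ((1 - cmod (\<Phi> 0)) / (1 + cmod (\<Phi> 0))) \<le> 1 - (cmod (\<Phi> z))\<^sup>2"
proof -
  define b where "b = \<Phi> 0"
  define w where "w = \<Phi> z"
  have b: "cmod b < 1" and w: "cmod w < 1" using im z by (auto simp: b_def w_def)
  have "cmod (disk_aut b w) \<le> cmod (disk_aut 0 z)"
    unfolding b_def w_def using z by (intro Schwarz_Pick(1)[OF \<Phi> im]) auto
  also have "\<dots> = cmod z" by (simp add: disk_aut_def)
  finally have "1 - (cmod z)\<^sup>2 \<le> 1 - (cmod (disk_aut b w))\<^sup>2" by (simp add: power_mono)
  also have "\<dots> = (1 - (cmod b)\<^sup>2) * (1 - (cmod w)\<^sup>2) / (cmod (1 - cnj b * w))\<^sup>2"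
    by (rule one_minus_norm_disk_aut[OF b w])
  also have "\<dots> \<le> (1 - (cmod b)\<^sup>2) * (1 - (cmod w)\<^sup>2) / (1 - cmod b)\<^sup>2"
  proof -
    have "cmod b * cmod w \<le> cmod b" using w by (simp add: mult_left_le)
    then have "1 - cmod b \<le> cmod (1 - cnj b * w)"
      using norm_triangle_ineq2[of 1 "cnj b * w"] by (simp add: norm_mult)
    then have "(1 - cmod b)\<^sup>2 \<le> (cmod (1 - cnj b * w))\<^sup>2" using b by (intro power_mono) auto
    moreover have "0 < (1 - cmod b)\<^sup>2" using b by simp
    ultimately have "0 < (cmod (1 - cnj b * w))\<^sup>2 * (1 - cmod b)\<^sup>2"
      by (intro mult_pos_pos) auto
    then show ?thesis
      using one_minus_norm_pos[OF b] one_minus_norm_pos[OF w] \<open>(1 - cmod b)\<^sup>2 \<le> _\<close>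
      by (intro divide_left_mono mult_nonneg_nonneg) auto
  qed
  also have "\<dots> = (1 - (cmod w)\<^sup>2) * ((1 + cmod b) / (1 - cmod b))"
  proof -
    have "1 - (cmod b)\<^sup>2 = (1 - cmod b) * (1 + cmod b)" by (simp add: power2_eq_square algebra_simps)
    then show ?thesis using b by (simp add: power2_eq_square)
  qed
  finally have *: "1 - (cmod z)\<^sup>2 \<le> (1 - (cmod w)\<^sup>2) * ((1 + cmod b) / (1 - cmod b))" .
  have "(1 - (cmod z)\<^sup>2) * ((1 - cmod b) / (1 + cmod b))
    \<le> (1 - (cmod w)\<^sup>2) * ((1 + cmod b) / (1 - cmod b)) * ((1 - cmod b) / (1 + cmod b))"
    using * b by (intro mult_right_mono) (auto simp: add_nonneg_nonneg)
  also have "\<dots> = 1 - (cmod w)\<^sup>2"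
  proof -
    have "1 + cmod b \<noteq> 0" using norm_ge_zero[of b] by linarith
    then show ?thesis using b by simp
  qed
  finally show ?thesis by (simp add: b_def w_def)
qed

text \<open>The constant comes from the derivative form of Schwarz--Pick and depends on
  \<open>R\<close> only, so it serves all maps of the semigroup at once.\<close>

lemma self_map_Lipschitz:
  assumes \<Phi>: "\<Phi> holomorphic_on unit_disk" and im: "\<And>z. cmod z < 1 \<Longrightarrow> cmod (\<Phi> z) < 1"
    and R: "R < 1" and xy: "cmod x \<le> R" "cmod y \<le> R"
  shows "cmod (\<Phi> x - \<Phi> y) \<le> 1 / (1 - R\<^sup>2) * cmod (x - y)"
proof (rule field_differentiable_bound[where S = "cball 0 R" and f' = "deriv \<Phi>"])
  fix z assume "z \<in> cball (0::complex) R"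
  then have z: "cmod z \<le> R" "cmod z < 1" using R by auto
  then show "(\<Phi> has_field_derivative deriv \<Phi> z) (at z within cball 0 R)"
    using holomorphic_derivI[OF \<Phi> open_ball, of z] by (auto intro: has_field_derivative_at_within)
  have "(cmod z)\<^sup>2 \<le> R\<^sup>2" using z by (intro power_mono) auto
  moreover have "R\<^sup>2 < 1"
  proof -
    have "\<bar>R\<bar> < 1" using R z norm_ge_zero[of z] by linarith
    then show ?thesis by (simp add: abs_square_less_1)
  qed
  moreover have "cmod (deriv \<Phi> z) * (1 - (cmod z)\<^sup>2) \<le> 1"
    using Schwarz_Pick(2)[OF \<Phi> im z(2)] by (smt (verit) zero_le_power2)
  ultimately have "cmod (deriv \<Phi> z) * (1 - R\<^sup>2) \<le> 1"
    by (smt (verit) mult_left_mono norm_ge_zero)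
  then show "cmod (deriv \<Phi> z) \<le> 1 / (1 - R\<^sup>2)"
    using \<open>R\<^sup>2 < 1\<close> by (simp add: field_simps)
qed (use xy in auto)

lemma norm_deriv_le_sup:
  assumes "f holomorphic_on unit_disk" "0 < r" "cball z r \<subseteq> unit_disk" "\<And>w. w \<in> cball z r \<Longrightarrow> cmod (f w) \<le> B"
  shows "cmod (deriv f z) \<le> B / r"
proof -
  have "cmod ((deriv ^^ 1) f z) \<le> fact 1 * B / r ^ 1"
  proof (rule Cauchy_inequality)
    show "f holomorphic_on ball z r" using assms by (meson ball_subset_cball holomorphic_on_subset subset_trans)
    show "continuous_on (cball z r) f" using assms holomorphic_on_imp_continuous_on holomorphic_on_subset by metis
    show "cmod (f w) \<le> B" if "cmod (z - w) = r" for w using assms that by (auto simp: dist_norm)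
  qed fact
  then show ?thesis by simp
qed

text \<open>Joint continuity is uniform on compact sets, and Cauchy's estimate on disks of a fixed
  radius \<open>r\<close> turns closeness of \<open>u s\<close> and \<open>u t\<close> into
  closeness of their derivatives.\<close>

lemma continuous_on_deriv_param:
  fixes u :: "real \<Rightarrow> complex \<Rightarrow> complex"
  assumes cont: "continuous_on ({a..b} \<times> unit_disk) (\<lambda>x. u (fst x) (snd x))"
    and hol: "\<And>t. t \<in> {a..b} \<Longrightarrow> u t holomorphic_on unit_disk"
  shows "continuous_on ({a..b} \<times> unit_disk) (\<lambda>x. deriv (u (fst x)) (snd x))"
proof (rule continuous_onI, safe)
  fix t z and \<epsilon> :: real
  assume t: "t \<in> {a..b}" and z: "z \<in> unit_disk" and \<epsilon>: "0 < \<epsilon>"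
  define R where "R = (1 + cmod z) / 2"
  define r where "r = (1 - R) / 2"
  have R: "cmod z < R" "R < 1" using z by (auto simp: R_def)
  have r: "0 < r" "R + r < 1" using R by (auto simp: r_def field_simps)
  have "uniformly_continuous_on ({a..b} \<times> cball 0 (R + r)) (\<lambda>x. u (fst x) (snd x))"
    using r by (intro compact_uniformly_continuous compact_Times continuous_on_subset[OF cont]) auto
  then obtain \<delta>1 where \<delta>1: "0 < \<delta>1" "\<And>x y. x \<in> {a..b} \<times> cball 0 (R + r) \<Longrightarrow> y \<in> {a..b} \<times> cball 0 (R + r) \<Longrightarrow> dist y x < \<delta>1
      \<Longrightarrow> dist (u (fst y) (snd y)) (u (fst x) (snd x)) < \<epsilon> * r / 2"
    unfolding uniformly_continuous_on_def using \<epsilon> r by (metis half_gt_zero mult_pos_pos)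
  have "continuous_on unit_disk (deriv (u t))"
    using hol t by (intro holomorphic_on_imp_continuous_on holomorphic_deriv) auto
  then have "isCont (deriv (u t)) z" using z by (simp add: continuous_on_eq_continuous_at)
  then obtain \<delta>2 where \<delta>2: "0 < \<delta>2" "\<And>w. dist w z < \<delta>2 \<Longrightarrow> dist (deriv (u t) w) (deriv (u t) z) < \<epsilon> / 2"
    unfolding continuous_at_eps_delta using \<epsilon> half_gt_zero by blast
  define \<delta> where "\<delta> = min (min \<delta>1 \<delta>2) (R - cmod z)"
  have \<delta>: "0 < \<delta>" using \<delta>1 \<delta>2 R by (simp add: \<delta>_def)
  show "\<exists>d>0. \<forall>x'\<in>{a..b} \<times> unit_disk. dist x' (t, z) < d \<longrightarrow>
      dist (deriv (u (fst x')) (snd x')) (deriv (u (fst (t, z))) (snd (t, z))) \<le> \<epsilon>"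
  proof (intro exI[of _ \<delta>] conjI ballI impI \<delta>, clarify)
    fix s w assume s: "s \<in> {a..b}" and w: "w \<in> unit_disk" and d: "dist (s, w) (t, z) < \<delta>"
    have ds: "dist s t < \<delta>" using d dist_fst_le[of "(s, w)" "(t, z)"] by simp
    have dw: "dist w z < \<delta>" using d dist_snd_le[of "(s, w)" "(t, z)"] by simp
    have wR: "cmod w \<le> R"
      using dw norm_triangle_sub[of w z] by (simp add: \<delta>_def dist_norm)
    have "cmod (deriv (\<lambda>v. u s v - u t v) w) \<le> (\<epsilon> * r / 2) / r"
    proof (rule norm_deriv_le_sup)
      show "(\<lambda>v. u s v - u t v) holomorphic_on unit_disk" using hol s t by (intro holomorphic_intros)
      have sub: "cball w r \<subseteq> cball 0 (R + r)"
      proof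
        fix v assume "v \<in> cball w r"
        then show "v \<in> cball 0 (R + r)"
          using wR norm_triangle_sub[of v w] by (simp add: dist_norm norm_minus_commute)
      qed
      then show "cball w r \<subseteq> unit_disk" using r by auto
      fix v assume v: "v \<in> cball w r"
      have "dist (u (fst (s, v)) (snd (s, v))) (u (fst (t, v)) (snd (t, v))) < \<epsilon> * r / 2"
        using v sub s t ds by (intro \<delta>1(2)) (auto simp: \<delta>_def dist_Pair_Pair)
      then show "cmod (u s v - u t v) \<le> \<epsilon> * r / 2" by (simp add: dist_norm)
    qed (rule r)
    moreover have "deriv (\<lambda>v. u s v - u t v) w = deriv (u s) w - deriv (u t) w"
      using holomorphic_on_imp_differentiable_at[OF hol open_ball] s t w by (intro deriv_diff) auto
    ultimately have "dist (deriv (u s) w) (deriv (u t) w) \<le> \<epsilon> / 2" using r by (simp add: dist_norm)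
    moreover have "dist (deriv (u t) w) (deriv (u t) z) < \<epsilon> / 2" using dw by (intro \<delta>2(2)) (simp add: \<delta>_def)
    ultimately show "dist (deriv (u (fst (s, w))) (snd (s, w))) (deriv (u (fst (t, z))) (snd (t, z))) \<le> \<epsilon>"
      using dist_triangle[of "deriv (u s) w" "deriv (u t) z" "deriv (u t) w"] by simp
  qed
qed

section \<open>Continuity and injectivity of the flow\<close>

locale disk_semigroup =
  fixes \<phi> :: "real \<Rightarrow> complex \<Rightarrow> complex"
  assumes semigroup: "holo_semigroup \<phi>"
begin

lemma holomorphic: "0 \<le> t \<Longrightarrow> \<phi> t holomorphic_on unit_disk"
  and in_disk: "0 \<le> t \<Longrightarrow> cmod z < 1 \<Longrightarrow> cmod (\<phi> t z) < 1"
  and zero [simp]: "cmod z < 1 \<Longrightarrow> \<phi> 0 z = z"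
  and add: "0 \<le> t \<Longrightarrow> 0 \<le> s \<Longrightarrow> cmod z < 1 \<Longrightarrow> \<phi> t (\<phi> s z) = \<phi> (t + s) z"
  using semigroup unfolding holo_semigroup_def by (auto simp: image_subset_iff)

lemma uniformly_near_id:
  assumes "R < 1" "0 < \<epsilon>"
  obtains \<delta> where "0 < \<delta>" "\<And>t z. 0 \<le> t \<Longrightarrow> t < \<delta> \<Longrightarrow> cmod z \<le> R \<Longrightarrow> cmod (\<phi> t z - z) < \<epsilon>"
proof -
  have "uniform_limit (cball 0 R) \<phi> (\<lambda>z. z) (at_right 0)"
  proof -
    have "cball 0 R \<subseteq> unit_disk" using assms by auto
    moreover have "\<forall>K. compact K \<and> K \<subseteq> unit_disk \<longrightarrow> uniform_limit K \<phi> (\<lambda>z. z) (at_right 0)"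
      using semigroup unfolding holo_semigroup_def by (elim conjE)
    ultimately show ?thesis using compact_cball[of "0::complex" R] by metis
  qed
  then have "\<forall>\<^sub>F t in at_right 0. \<forall>z\<in>cball 0 R. dist (\<phi> t z) z < \<epsilon>"
    using assms by (auto dest: uniform_limitD)
  then obtain \<delta> where \<delta>: "0 < \<delta>" "\<And>t. 0 < t \<Longrightarrow> t < \<delta> \<Longrightarrow> \<forall>z\<in>cball 0 R. dist (\<phi> t z) z < \<epsilon>"
    unfolding eventually_at_right_field by auto
  show ?thesis
  proof (rule that[OF \<delta>(1)])
    fix t z assume "0 \<le> (t::real)" "t < \<delta>" "cmod z \<le> R"
    then show "cmod (\<phi> t z - z) < \<epsilon>"
      using \<delta>(2)[of t] assms by (cases "t = 0") (auto simp: dist_norm)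
  qed
qed

text \<open>For short times \<open>cmod (\<phi> t 0) < 1 / 2\<close>, and
  \<open>self_map_one_minus_norm\<close> yields the factor
  \<open>(1 - 1/2) / (1 + 1/2) = 1/3\<close>. Longer times are reached in steps of length
  \<open>\<delta> / 2\<close>, each costing one such factor.\<close>

lemma one_minus_norm_ge:
  obtains c where "0 < c" "\<And>t z. 0 \<le> t \<Longrightarrow> t \<le> T \<Longrightarrow> cmod z < 1 \<Longrightarrow> c * (1 - (cmod z)\<^sup>2) \<le> 1 - (cmod (\<phi> t z))\<^sup>2"
proof -
  obtain \<delta> where \<delta>: "0 < \<delta>" "\<And>t z. 0 \<le> t \<Longrightarrow> t < \<delta> \<Longrightarrow> cmod z \<le> 0 \<Longrightarrow> cmod (\<phi> t z - z) < 1 / 2"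
    using uniformly_near_id[of 0 "1 / 2"] by auto
  have step: "(1 - (cmod z)\<^sup>2) / 3 \<le> 1 - (cmod (\<phi> t z))\<^sup>2" if t: "0 \<le> t" "t < \<delta>" and z: "cmod z < 1" for t z
  proof -
    have h: "cmod (\<phi> t 0) < 1 / 2" using \<delta>(2)[of t 0] t by simp
    have "(1 - (cmod z)\<^sup>2) / 3 = (1 - (cmod z)\<^sup>2) * (1 / 3)" by simp
    also have "\<dots> \<le> (1 - (cmod z)\<^sup>2) * ((1 - cmod (\<phi> t 0)) / (1 + cmod (\<phi> t 0)))"
    proof (rule mult_left_mono)
      have "0 < 1 + cmod (\<phi> t 0)" using norm_ge_zero[of "\<phi> t 0"] by linarith
      then show "1 / 3 \<le> (1 - cmod (\<phi> t 0)) / (1 + cmod (\<phi> t 0))" using h by (simp add: field_simps)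
    qed (use one_minus_norm_pos[OF z] in simp)
    also have "\<dots> \<le> 1 - (cmod (\<phi> t z))\<^sup>2"
      using holomorphic in_disk t z by (intro self_map_one_minus_norm) auto
    finally show ?thesis .
  qed
  have iter: "(1 - (cmod z)\<^sup>2) / 3 ^ n \<le> 1 - (cmod (\<phi> t z))\<^sup>2"
    if "0 \<le> t" "t \<le> real n * (\<delta> / 2)" "cmod z < 1" for n t z
    using that
  proof (induction n arbitrary: t)
    case (Suc n)
    \<comment> \<open>All but the last step; the minimum also covers times \<open>t\<close> that
      fewer steps would reach.\<close>
    define t1 where "t1 = min t (real n * (\<delta> / 2))"
    have t1: "0 \<le> t1" "t1 \<le> real n * (\<delta> / 2)" "0 \<le> t - t1" "t - t1 < \<delta>"
      using Suc.prems \<delta>(1) by (auto simp: t1_def min_def algebra_simps)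
    have "(1 - (cmod z)\<^sup>2) / 3 ^ Suc n \<le> (1 - (cmod (\<phi> t1 z))\<^sup>2) / 3"
      using Suc.IH[of t1] t1 Suc.prems by (simp add: field_simps)
    also have "\<dots> \<le> 1 - (cmod (\<phi> (t - t1) (\<phi> t1 z)))\<^sup>2"
      using t1 Suc.prems in_disk by (intro step) auto
    also have "\<phi> (t - t1) (\<phi> t1 z) = \<phi> t z"
      using t1 Suc.prems by (subst add) auto
    finally show ?case .
  qed simp
  obtain n where n: "T \<le> real n * (\<delta> / 2)"
    using \<delta>(1) reals_Archimedean3[of "\<delta> / 2"] by (metis half_gt_zero less_imp_le)
  show ?thesis
    using that[of "1 / 3 ^ n"] iter[of _ n] n by auto
qed

lemma orbit_bounded:
  assumes "R < 1"
  obtains R' where "R' < 1" "R \<le> R'" "0 < R'" "\<And>t z. 0 \<le> t \<Longrightarrow> t \<le> T \<Longrightarrow> cmod z \<le> R \<Longrightarrow> cmod (\<phi> t z) \<le> R'"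
proof -
  obtain c where c: "0 < c" "\<And>t z. 0 \<le> t \<Longrightarrow> t \<le> T \<Longrightarrow> cmod z < 1 \<Longrightarrow> c * (1 - (cmod z)\<^sup>2) \<le> 1 - (cmod (\<phi> t z))\<^sup>2"
    using one_minus_norm_ge[of T] by metis
  define R0 where "R0 = max 0 R"
  have R0: "0 \<le> R0" "R0 < 1" using assms by (auto simp: R0_def)
  define m where "m = min 1 (c * (1 - R0\<^sup>2))"
  have R02: "R0\<^sup>2 < 1" using R0 by (simp add: power_less_one_iff)
  have m: "0 < m" "m \<le> 1" using c R02 by (auto simp: m_def)
  define R1 where "R1 = max (max (sqrt (1 - m)) R) (1 / 2)"
  show ?thesis
  proof (rule that[of R1])
    show "R1 < 1" "R \<le> R1" "0 < R1" using m assms by (auto simp: R1_def real_sqrt_lt_1_iff)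
    fix t z assume t: "0 \<le> t" "t \<le> T" and z: "cmod z \<le> R"
    have "cmod z \<le> R0" using z by (simp add: R0_def)
    then have "(cmod z)\<^sup>2 \<le> R0\<^sup>2" by (intro power_mono) auto
    then have "c * (1 - R0\<^sup>2) \<le> c * (1 - (cmod z)\<^sup>2)" using c by simp
    also have "\<dots> \<le> 1 - (cmod (\<phi> t z))\<^sup>2" using c t z assms by auto
    finally have "(cmod (\<phi> t z))\<^sup>2 \<le> 1 - m" by (simp add: m_def)
    then have "cmod (\<phi> t z) \<le> sqrt (1 - m)" by (simp add: real_le_rsqrt)
    then show "cmod (\<phi> t z) \<le> R1" by (simp add: R1_def)
  qed
qed

text \<open>Since \<open>\<phi> t = \<phi> s \<circ> \<phi> (t - s)\<close>, the Lipschitz bound for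
  \<open>\<phi> s\<close> reduces the claim to \<open>\<phi> (t - s)\<close> being close to the
  identity. Because that bound is the same for all self-maps, \<open>\<delta>\<close> does not
  depend on how large \<open>s\<close> and \<open>t\<close> are.\<close>

lemma uniformly_continuous_in_time:
  assumes "R < 1" "0 < \<epsilon>"
  obtains \<delta> where "0 < \<delta>"
    "\<And>s t z. 0 \<le> s \<Longrightarrow> 0 \<le> t \<Longrightarrow> \<bar>s - t\<bar> < \<delta> \<Longrightarrow> cmod z \<le> R \<Longrightarrow> cmod (\<phi> s z - \<phi> t z) < \<epsilon>"
proof -
  obtain R' where R': "R' < 1" "R \<le> R'" "0 < R'" "\<And>t z. 0 \<le> t \<Longrightarrow> t \<le> 1 \<Longrightarrow> cmod z \<le> R \<Longrightarrow> cmod (\<phi> t z) \<le> R'"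
    using orbit_bounded[OF assms(1), of 1] by metis
  define L where "L = 1 / (1 - R'\<^sup>2)"
  have "R'\<^sup>2 < 1" using R' by (simp add: power_less_one_iff)
  then have L: "0 < L" by (simp add: L_def)
  obtain \<delta> where \<delta>: "0 < \<delta>" "\<And>t z. 0 \<le> t \<Longrightarrow> t < \<delta> \<Longrightarrow> cmod z \<le> R \<Longrightarrow> cmod (\<phi> t z - z) < \<epsilon> / L"
    using uniformly_near_id[OF assms(1), of "\<epsilon> / L"] assms L by (metis divide_pos_pos)
  have main: "cmod (\<phi> s z - \<phi> t z) < \<epsilon>"
    if "0 \<le> s" "s \<le> t" "t - s < min \<delta> 1" "cmod z \<le> R" for s t z
  proof -
    have z: "cmod z < 1" using that assms by simp
    have "\<phi> t z = \<phi> s (\<phi> (t - s) z)" using that z by (subst add) auto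
    moreover have "cmod (\<phi> s z - \<phi> s (\<phi> (t - s) z)) \<le> L * cmod (z - \<phi> (t - s) z)"
      unfolding L_def using that R' holomorphic in_disk by (intro self_map_Lipschitz) auto
    moreover have "L * cmod (z - \<phi> (t - s) z) < \<epsilon>"
      using \<delta>(2)[of "t - s" z] that L by (simp add: norm_minus_commute field_simps)
    ultimately show ?thesis by simp
  qed
  show ?thesis
  proof (rule that[of "min \<delta> 1"])
    fix s t z assume h: "0 \<le> s" "0 \<le> t" "\<bar>s - t\<bar> < min \<delta> 1" "cmod z \<le> R"
    show "cmod (\<phi> s z - \<phi> t z) < \<epsilon>"
    proof (cases "s \<le> t")
      case True
      then show ?thesis using h by (intro main) auto
    next
      case False
      then have "cmod (\<phi> t z - \<phi> s z) < \<epsilon>" using h by (intro main) auto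
      then show ?thesis by (simp add: norm_minus_commute)
    qed
  qed (use \<delta> in auto)
qed

lemma continuous_on_flow:
  "continuous_on ({0..} \<times> unit_disk) (\<lambda>x. \<phi> (fst x) (snd x))"
proof (rule continuous_onI)
  fix x :: "real \<times> complex" and \<epsilon> :: real
  assume "x \<in> {0..} \<times> unit_disk" and \<epsilon>: "0 < \<epsilon>"
  then obtain t z where x: "x = (t, z)" and t: "t \<in> {0..}" and z: "z \<in> unit_disk" by auto
  define R where "R = (1 + cmod z) / 2"
  have R: "cmod z < R" "R < 1" using z by (auto simp: R_def)
  obtain \<delta>1 where \<delta>1: "0 < \<delta>1"
    "\<And>s t z. 0 \<le> s \<Longrightarrow> 0 \<le> t \<Longrightarrow> \<bar>s - t\<bar> < \<delta>1 \<Longrightarrow> cmod z \<le> R \<Longrightarrow> cmod (\<phi> s z - \<phi> t z) < \<epsilon> / 2"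
    using uniformly_continuous_in_time[OF R(2), of "\<epsilon> / 2"] \<epsilon> by (metis half_gt_zero)
  have "isCont (\<phi> t) z"
    using holomorphic[of t] t z by (auto simp: continuous_on_eq_continuous_at dest!: holomorphic_on_imp_continuous_on)
  then obtain \<delta>2 where \<delta>2: "0 < \<delta>2" "\<And>w. dist w z < \<delta>2 \<Longrightarrow> dist (\<phi> t w) (\<phi> t z) < \<epsilon> / 2"
    unfolding continuous_at_eps_delta using \<epsilon> half_gt_zero by blast
  define \<delta> where "\<delta> = min (min \<delta>1 \<delta>2) (R - cmod z)"
  have \<delta>: "0 < \<delta>" using \<delta>1 \<delta>2 R by (simp add: \<delta>_def)
  show "\<exists>d>0. \<forall>x'\<in>{0..} \<times> unit_disk. dist x' x < d \<longrightarrow>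
      dist (\<phi> (fst x') (snd x')) (\<phi> (fst x) (snd x)) \<le> \<epsilon>"
    unfolding x
  proof (intro exI[of _ \<delta>] conjI ballI impI \<delta>)
    fix y :: "real \<times> complex" assume "y \<in> {0..} \<times> unit_disk" and "dist y (t, z) < \<delta>"
    then obtain s w where y: "y = (s, w)" and s: "s \<in> {(0::real)..}" and w: "w \<in> unit_disk" and d: "dist (s, w) (t, z) < \<delta>"
      by auto
    have ds: "\<bar>s - t\<bar> < \<delta>1" using d dist_fst_le[of "(s, w)" "(t, z)"] by (simp add: dist_real_def \<delta>_def)
    have dw: "dist w z < \<delta>" using d dist_snd_le[of "(s, w)" "(t, z)"] by simp
    have wR: "cmod w \<le> R"
      using dw norm_triangle_sub[of w z] by (simp add: \<delta>_def dist_norm)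
    have "dist (\<phi> s w) (\<phi> t w) < \<epsilon> / 2"
      using \<delta>1(2)[of s t w] s t ds wR by (simp add: dist_norm)
    moreover have "dist (\<phi> t w) (\<phi> t z) < \<epsilon> / 2" using dw by (intro \<delta>2(2)) (simp add: \<delta>_def)
    ultimately show "dist (\<phi> (fst y) (snd y)) (\<phi> (fst (t, z)) (snd (t, z))) \<le> \<epsilon>"
      unfolding y using dist_triangle[of "\<phi> s w" "\<phi> t z" "\<phi> t w"] by simp
  qed
qed

lemma deriv_near_1:
  assumes "R < 1" "0 < \<epsilon>"
  obtains \<delta> where "0 < \<delta>" "\<And>t z. 0 \<le> t \<Longrightarrow> t < \<delta> \<Longrightarrow> cmod z \<le> R \<Longrightarrow> cmod (deriv (\<phi> t) z - 1) < \<epsilon>"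
proof -
  define r where "r = (1 - R) / 2"
  have r: "0 < r" "R + r < 1" using assms by (auto simp: r_def field_simps)
  obtain \<delta> where \<delta>: "0 < \<delta>" "\<And>t z. 0 \<le> t \<Longrightarrow> t < \<delta> \<Longrightarrow> cmod z \<le> R + r \<Longrightarrow> cmod (\<phi> t z - z) < \<epsilon> * r / 2"
    using uniformly_near_id[OF r(2), of "\<epsilon> * r / 2"] assms r by (metis half_gt_zero mult_pos_pos)
  show ?thesis
  proof (rule that[OF \<delta>(1)])
    fix t z assume t: "0 \<le> (t::real)" "t < \<delta>" and z: "cmod z \<le> R"
    have sub: "cmod w \<le> R + r" if "w \<in> cball z r" for w
      using that z norm_triangle_sub[of w z] by (simp add: dist_norm norm_minus_commute)
    have "cmod (deriv (\<lambda>w. \<phi> t w - w) z) \<le> (\<epsilon> * r / 2) / r"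
    proof (rule norm_deriv_le_sup)
      show "(\<lambda>w. \<phi> t w - w) holomorphic_on unit_disk" using holomorphic t by (intro holomorphic_intros)
      show "cball z r \<subseteq> unit_disk" using sub r by force
      show "cmod (\<phi> t w - w) \<le> \<epsilon> * r / 2" if "w \<in> cball z r" for w
        using \<delta>(2)[OF t sub[OF that]] by simp
    qed (rule r)
    moreover have "deriv (\<lambda>w. \<phi> t w - w) z = deriv (\<phi> t) z - 1"
    proof -
      have "\<phi> t field_differentiable at z"
        using holomorphic[of t] t z assms by (intro holomorphic_on_imp_differentiable_at[of _ unit_disk]) auto
      then show ?thesis by (subst deriv_diff) auto
    qed
    ultimately show "cmod (deriv (\<phi> t) z - 1) < \<epsilon>" using r assms by simp
  qed
qed

text \<open>On a compact disk the maps of short time are close to the identity together with their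
  derivatives, hence injective. The orbits of \<open>x\<close> and \<open>y\<close> up to time
  \<open>t\<close> stay in such a disk, so \<open>\<phi> t\<close> can be undone in short
  steps.\<close>

lemma inj_on_flow:
  assumes t: "0 \<le> t"
  shows "inj_on (\<phi> t) unit_disk"
proof (rule inj_onI)
  fix x y assume x: "x \<in> unit_disk" and y: "y \<in> unit_disk" and eq: "\<phi> t x = \<phi> t y"
  define R where "R = max (cmod x) (cmod y)"
  have R: "R < 1" "cmod x \<le> R" "cmod y \<le> R" using x y by (auto simp: R_def)
  obtain R' where R': "R' < 1" "\<And>s z. 0 \<le> s \<Longrightarrow> s \<le> t \<Longrightarrow> cmod z \<le> R \<Longrightarrow> cmod (\<phi> s z) \<le> R'"
    using orbit_bounded[OF R(1), of t] by metis
  obtain \<delta> where \<delta>: "0 < \<delta>" "\<And>s z. 0 \<le> s \<Longrightarrow> s < \<delta> \<Longrightarrow> cmod z \<le> R' \<Longrightarrow> cmod (deriv (\<phi> s) z - 1) < 1 / 2"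
    using deriv_near_1[OF R'(1), of "1 / 2"] by auto
  have inj: "u = v" if s: "0 \<le> s" "s < \<delta>" and uv: "cmod u \<le> R'" "cmod v \<le> R'" "\<phi> s u = \<phi> s v" for s u v
  proof -
    \<comment> \<open>The map \<open>\<phi> s z - z\<close> contracts by \<open>1 / 2\<close>, but
      if \<open>\<phi> s u = \<phi> s v\<close>, it takes \<open>u\<close> and \<open>v\<close> to
      points at distance \<open>cmod (u - v)\<close>.\<close>
    have "cmod ((\<phi> s u - u) - (\<phi> s v - v)) \<le> 1 / 2 * cmod (u - v)"
    proof (rule field_differentiable_bound[where S = "cball 0 R'" and f = "\<lambda>z. \<phi> s z - z" and f' = "\<lambda>z. deriv (\<phi> s) z - 1"])
      fix z :: complex assume z: "z \<in> cball 0 R'"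
      have "(\<phi> s has_field_derivative deriv (\<phi> s) z) (at z)"
        using holomorphic[OF s(1)] z R' by (intro holomorphic_derivI[of _ unit_disk]) auto
      then show "((\<lambda>z. \<phi> s z - z) has_field_derivative deriv (\<phi> s) z - 1) (at z within cball 0 R')"
        by (auto intro!: derivative_eq_intros intro: has_field_derivative_at_within)
      show "cmod (deriv (\<phi> s) z - 1) \<le> 1 / 2" using \<delta>(2)[OF s, of z] z by simp
    qed (use uv in auto)
    moreover have "(\<phi> s u - u) - (\<phi> s v - v) = v - u" using uv by simp
    ultimately show "u = v" by (simp add: norm_minus_commute)
  qed
  obtain n :: nat where n: "n \<noteq> 0" "t / real n < \<delta>"
  proof -
    obtain n :: nat where "t / \<delta> < real n" using reals_Archimedean2 by blast
    moreover from this have "n \<noteq> 0" using t \<delta>(1) by (intro notI) (auto simp: field_simps)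
    ultimately show ?thesis using that[of n] \<delta>(1) by (simp add: field_simps)
  qed
  define h where "h = t / real n"
  have h: "0 \<le> h" "h < \<delta>" "real n * h = t" using n t by (auto simp: h_def)
  \<comment> \<open>Downward induction from \<open>k = n\<close>: each step cancels one application
    of \<open>\<phi> h\<close>.\<close>
  have "\<phi> (real k * h) x = \<phi> (real k * h) y" if "k \<le> n" for k
    using that
  proof (induction rule: inc_induct)
    case base
    then show ?case using h eq by simp
  next
    case (step k)
    have le: "real k * h \<le> t" using step h by (metis less_imp_le mult_right_mono of_nat_le_iff)
    have e: "\<phi> h (\<phi> (real k * h) z) = \<phi> (real (Suc k) * h) z" if "cmod z < 1" for z
      using that h by (subst add) (auto simp: algebra_simps)
    have "\<phi> h (\<phi> (real k * h) x) = \<phi> h (\<phi> (real k * h) y)"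
      using step.IH x y by (simp add: e)
    then show ?case
      using h R le by (intro inj[of h "\<phi> (real k * h) x" "\<phi> (real k * h) y"] R'(2)) auto
  qed
  from this[of 0] show "x = y" using x y by simp
qed

end

section \<open>Integrals of families of holomorphic functions\<close>

lemma tendsto_average_at_right_0:
  fixes g :: "real \<Rightarrow> complex"
  assumes g: "continuous_on {0..b} g" and b: "0 < b"
  shows "((\<lambda>\<tau>. integral {0..\<tau>} g / of_real \<tau>) \<longlongrightarrow> g 0) (at_right 0)"
proof (rule tendstoI)
  fix \<epsilon> :: real assume \<epsilon>: "0 < \<epsilon>"
  have "continuous (at 0 within {0..b}) g"
    using g b by (simp add: continuous_on_eq_continuous_within)
  then obtain \<delta> where \<delta>: "0 < \<delta>" "\<And>x. x \<in> {0..b} \<Longrightarrow> dist x 0 < \<delta> \<Longrightarrow> dist (g x) (g 0) < \<epsilon> / 2"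
    unfolding continuous_within_eps_delta using \<epsilon> by (metis half_gt_zero)
  have "dist (integral {0..\<tau>} g / of_real \<tau>) (g 0) < \<epsilon>" if \<tau>: "0 < \<tau>" "\<tau> < min \<delta> b" for \<tau>
  proof -
    have gi: "g integrable_on {0..\<tau>}"
      using \<tau> by (intro integrable_continuous_interval continuous_on_subset[OF g]) auto
    have "norm (integral {0..\<tau>} (\<lambda>x. g x - g 0)) \<le> \<epsilon> / 2 * (\<tau> - 0)"
    proof (rule integral_bound)
      show "continuous_on {0..\<tau>} (\<lambda>x. g x - g 0)"
        using \<tau> by (intro continuous_intros continuous_on_subset[OF g]) auto
      show "norm (g t - g 0) \<le> \<epsilon> / 2" if "t \<in> {0..\<tau>}" for t
        using \<delta>(2)[of t] that \<tau> by (auto simp: dist_norm)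
    qed (use \<tau> in auto)
    also have "integral {0..\<tau>} (\<lambda>x. g x - g 0) = integral {0..\<tau>} g - of_real \<tau> * g 0"
      using gi \<tau> by (subst integral_diff) (auto simp: scaleR_conv_of_real)
    also have "\<dots> = of_real \<tau> * (integral {0..\<tau>} g / of_real \<tau> - g 0)"
      using \<tau> by (simp add: right_diff_distrib)
    finally have "\<tau> * norm (integral {0..\<tau>} g / of_real \<tau> - g 0) \<le> \<tau> * (\<epsilon> / 2)"
      using \<tau> by (simp add: norm_mult mult.commute)
    then have "norm (integral {0..\<tau>} g / of_real \<tau> - g 0) \<le> \<epsilon> / 2"
      using \<tau> by simp
    then show ?thesis using \<epsilon> by (simp add: dist_norm)
  qed
  then show "\<forall>\<^sub>F \<tau> in at_right 0. dist (integral {0..\<tau>} g / of_real \<tau>) (g 0) < \<epsilon>"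
    unfolding eventually_at_right_field using \<delta>(1) b by (intro exI[of _ "min \<delta> b"]) auto
qed

lemma has_field_derivative_integral_param:
  fixes u :: "real \<Rightarrow> complex \<Rightarrow> complex"
  assumes cont: "continuous_on ({0..T} \<times> unit_disk) (\<lambda>x. u (fst x) (snd x))"
    and hol: "\<And>t. t \<in> {0..T} \<Longrightarrow> u t holomorphic_on unit_disk" and z: "z \<in> unit_disk"
  shows "((\<lambda>z. integral {0..T} (\<lambda>t. u t z)) has_field_derivative integral {0..T} (\<lambda>t. deriv (u t) z)) (at z)"
proof -
  have "((\<lambda>z. integral (cbox 0 T) (\<lambda>t. u t z)) has_field_derivative integral (cbox 0 T) (\<lambda>t. deriv (u t) z)) (at z within unit_disk)"
  proof (rule leibniz_rule_field_derivative)
    fix x t assume x: "x \<in> unit_disk" and t: "t \<in> cbox 0 T"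
    show "((\<lambda>x. u t x) has_field_derivative deriv (u t) x) (at x within unit_disk)"
      using holomorphic_derivI[OF hol open_ball x, of t] t by (auto intro: has_field_derivative_at_within)
  next
    fix x assume x: "x \<in> unit_disk"
    show "(\<lambda>t. u t x) integrable_on cbox 0 T"
      using x by (intro integrable_continuous continuous_on_compose2[OF cont, of _ "\<lambda>t. (t, x)", simplified] continuous_intros) auto
  next
    have "continuous_on (unit_disk \<times> {0..T}) (\<lambda>x. deriv (u (fst (snd x, fst x))) (snd (snd x, fst x)))"
      by (rule continuous_on_compose2[OF continuous_on_deriv_param[OF cont hol]])
        (auto intro!: continuous_intros)
    then show "continuous_on (unit_disk \<times> cbox 0 T) (\<lambda>(x, t). deriv (u t) x)"
      by (simp add: case_prod_beta)
  qed (use z in auto)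
  then show ?thesis using z by (simp add: at_within_open[of z unit_disk])
qed

text \<open>Minkowski's inequality for integrals: Jensen's inequality for the density
  \<open>1 / T\<close> at each point \<open>z\<close>, then Fubini. The bound is assumed for
  \<open>0 < t\<close> only, matching limits at \<open>0\<close> from the right; the time
  \<open>0\<close> is a null set.\<close>

lemma energy_integral_le:
  fixes u :: "real \<Rightarrow> complex \<Rightarrow> complex"
  assumes p: "1 < p" and T: "0 < T"
    and cont: "continuous_on ({0..T} \<times> unit_disk) (\<lambda>x. u (fst x) (snd x))"
    and hol: "\<And>t. t \<in> {0..T} \<Longrightarrow> u t holomorphic_on unit_disk"
    and B: "\<And>t. 0 < t \<Longrightarrow> t \<le> T \<Longrightarrow> energy p s (u t) \<le> B"
  shows "energy p s (\<lambda>z. integral {0..T} (\<lambda>t. u t z)) \<le> ennreal (T powr p) * B"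
proof -
  define W where "W z = (1 - (cmod z)\<^sup>2) powr s" for z :: complex
  define k where "k t z = ennreal (Dps_integrand p s (u t) z) * indicator unit_disk z * indicator {0..T} t" for t z
  have cd: "continuous_on ({0..T} \<times> unit_disk) (\<lambda>x. deriv (u (fst x)) (snd x))"
    by (rule continuous_on_deriv_param[OF cont hol])
  have kmeas: "(\<lambda>(t, z). k t z) \<in> borel_measurable (lborel \<Otimes>\<^sub>M lborel)"
  proof -
    have "continuous_on ({0..T} \<times> unit_disk) (\<lambda>x. Dps_integrand p s (u (fst x)) (snd x))"
    proof -
      have "1 - (cmod (snd x))\<^sup>2 \<noteq> 0" if "x \<in> {0..T} \<times> unit_disk" for x :: "real \<times> complex"
        using one_minus_norm_pos[of "snd x"] that by auto
      then show ?thesis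
        unfolding Dps_integrand_def using p
        by (intro continuous_on_mult continuous_on_powr' continuous_on_norm cd continuous_intros) auto
    qed
    then have "(\<lambda>x. indicator ({0..T} \<times> unit_disk) x *\<^sub>R Dps_integrand p s (u (fst x)) (snd x)) \<in> borel_measurable borel"
      by (intro borel_measurable_continuous_on_indicator) (auto intro!: borel_Times)
    then have "(\<lambda>x. ennreal (indicator ({0..T} \<times> unit_disk) x *\<^sub>R Dps_integrand p s (u (fst x)) (snd x))) \<in> borel_measurable borel"
      by measurable
    also have "(\<lambda>x. ennreal (indicator ({0..T} \<times> unit_disk) x *\<^sub>R Dps_integrand p s (u (fst x)) (snd x))) = (\<lambda>(t, z). k t z)"
      by (auto simp: k_def fun_eq_iff indicator_def)
    finally show ?thesis by (simp add: borel_prod[symmetric] sets_pair_measure_cong[OF sets_lborel sets_lborel] cong: measurable_cong_sets)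
  qed
  have pw: "ennreal (Dps_integrand p s (\<lambda>z. integral {0..T} (\<lambda>t. u t z)) z) * indicator unit_disk z
      \<le> ennreal (T powr p / T) * (\<integral>\<^sup>+t. k t z \<partial>lborel)" for z
  proof (cases "z \<in> unit_disk")
    case z: True
    define v where "v t = deriv (u t) z" for t
    define I where "I = integral {0..T} (\<lambda>t. of_real (1 / T) * v t)"
    have cv: "continuous_on {0..T} v"
      unfolding v_def using z by (intro continuous_on_compose2[OF cd, of _ "\<lambda>t. (t, z)", simplified] continuous_intros) auto
    have d: "deriv (\<lambda>z. integral {0..T} (\<lambda>t. u t z)) z = integral {0..T} v"
      unfolding v_def using has_field_derivative_integral_param[OF cont hol z] by (rule DERIV_imp_deriv)
    have IT: "integral {0..T} v = of_real T * I"
      unfolding I_def using T by simp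
    have le: "ennreal (cmod I powr p) \<le> (\<integral>\<^sup>+t\<in>{0..T}. ennreal (1 / T * cmod (v t) powr p) \<partial>lborel)"
    proof (rule powr_norm_integral_le[OF p])
      show "((\<lambda>x. 1 / T) has_integral 1) {0..T}"
        using T has_integral_const_real[of "1 / T" 0 T] by simp
      show "((\<lambda>x. of_real (1 / T) * v x) has_integral I) {0..T}"
        unfolding I_def using cv by (intro integrable_integral integrable_continuous_interval continuous_intros)
    qed (use T cv in auto)
    have m: "(\<lambda>t. ennreal (1 / T * cmod (v t) powr p) * indicator {0..T} t) \<in> borel_measurable borel"
    proof -
      have "(\<lambda>t. indicator {0..T} t *\<^sub>R v t) \<in> borel_measurable borel"
        using cv by (intro borel_measurable_continuous_on_indicator) auto
      then have "(\<lambda>t. ennreal (1 / T * cmod (indicator {0..T} t *\<^sub>R v t) powr p) * indicator {0..T} t) \<in> borel_measurable borel"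
        by measurable
      also have "(\<lambda>t. ennreal (1 / T * cmod (indicator {0..T} t *\<^sub>R v t) powr p) * indicator {0..T} t)
        = (\<lambda>t. ennreal (1 / T * cmod (v t) powr p) * indicator {0..T} t)"
        by (auto simp: indicator_def fun_eq_iff)
      finally show ?thesis .
    qed
    have "ennreal (Dps_integrand p s (\<lambda>z. integral {0..T} (\<lambda>t. u t z)) z) = ennreal (T powr p * W z) * ennreal (cmod I powr p)"
      using T by (simp add: Dps_integrand_def d IT norm_mult powr_mult W_def ennreal_mult[symmetric] mult_ac)
    also have "\<dots> \<le> ennreal (T powr p * W z) * (\<integral>\<^sup>+t\<in>{0..T}. ennreal (1 / T * cmod (v t) powr p) \<partial>lborel)"
      by (intro mult_left_mono le) auto
    also have "\<dots> = (\<integral>\<^sup>+t. ennreal (T powr p * W z) * (ennreal (1 / T * cmod (v t) powr p) * indicator {0..T} t) \<partial>lborel)"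
      using m by (intro nn_integral_cmult[symmetric]) auto
    also have "\<dots> = (\<integral>\<^sup>+t. ennreal (T powr p / T) * k t z \<partial>lborel)"
      using z T unfolding k_def
      by (intro nn_integral_cong)
        (auto simp: indicator_def Dps_integrand_def v_def W_def ennreal_mult[symmetric] mult_ac)
    also have "\<dots> = ennreal (T powr p / T) * (\<integral>\<^sup>+t. k t z \<partial>lborel)"
      using measurable_compose[OF measurable_Pair2'[of z lborel lborel] kmeas] by (intro nn_integral_cmult) simp
    finally show ?thesis using z by simp
  qed simp
  have "energy p s (\<lambda>z. integral {0..T} (\<lambda>t. u t z)) \<le> (\<integral>\<^sup>+z. ennreal (T powr p / T) * (\<integral>\<^sup>+t. k t z \<partial>lborel) \<partial>lborel)"
    unfolding energy_def by (intro nn_integral_mono pw)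
  also have "\<dots> = ennreal (T powr p / T) * (\<integral>\<^sup>+z. (\<integral>\<^sup>+t. k t z \<partial>lborel) \<partial>lborel)"
  proof (rule nn_integral_cmult)
    have "(\<lambda>(z, t). k t z) \<in> borel_measurable (lborel \<Otimes>\<^sub>M lborel)"
      using measurable_compose[OF measurable_pair_swap' kmeas] by (simp add: case_prod_beta)
    then show "(\<lambda>z. \<integral>\<^sup>+t. k t z \<partial>lborel) \<in> borel_measurable lborel"
      using lborel.borel_measurable_nn_integral[of "\<lambda>z t. k t z" lborel] by simp
  qed
  also have "(\<integral>\<^sup>+z. (\<integral>\<^sup>+t. k t z \<partial>lborel) \<partial>lborel) = (\<integral>\<^sup>+t. (\<integral>\<^sup>+z. k t z \<partial>lborel) \<partial>lborel)"
    by (rule lborel_pair.Fubini'[OF kmeas])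
  also have "\<dots> \<le> (\<integral>\<^sup>+t. B * indicator {0..T} t \<partial>lborel)"
  proof (rule nn_integral_mono_AE)
    have "AE t in lborel. t \<noteq> (0::real)" by (rule AE_lborel_singleton)
    then show "AE t in lborel. (\<integral>\<^sup>+z. k t z \<partial>lborel) \<le> B * indicator {0..T} t"
    proof eventually_elim
      fix t :: real assume t: "t \<noteq> 0"
      show "(\<integral>\<^sup>+z. k t z \<partial>lborel) \<le> B * indicator {0..T} t"
      proof (cases "t \<in> {0..T}")
        case True
        then have "(\<integral>\<^sup>+z. k t z \<partial>lborel) = energy p s (u t)" by (simp add: k_def energy_def)
        then show ?thesis using B[of t] True t by simp
      qed (simp add: k_def)
    qed
  qed
  also have "\<dots> = B * ennreal T"
    using T by (subst nn_integral_cmult_indicator) auto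
  also have "ennreal (T powr p / T) * (B * ennreal T) = ennreal (T powr p) * B"
  proof -
    have "ennreal (T powr p / T) * ennreal T = ennreal (T powr p)" using T by (simp add: ennreal_mult[symmetric])
    then show ?thesis by (simp add: mult_ac)
  qed
  finally show ?thesis by (simp add: mult_left_mono)
qed

lemma mob_energy_integral_le:
  fixes u :: "real \<Rightarrow> complex \<Rightarrow> complex"
  assumes p: "1 < p" and T: "0 < T" and a: "cmod a < 1"
    and cont: "continuous_on ({0..T} \<times> unit_disk) (\<lambda>x. u (fst x) (snd x))"
    and hol: "\<And>t. t \<in> {0..T} \<Longrightarrow> u t holomorphic_on unit_disk"
    and B: "\<And>t. 0 < t \<Longrightarrow> t \<le> T \<Longrightarrow> mob_energy p s (u t) a \<le> B"
  shows "mob_energy p s (\<lambda>z. integral {0..T} (\<lambda>t. u t z)) a \<le> ennreal (T powr p) * B"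
  unfolding mob_energy_def
proof (rule energy_integral_le[OF p T, where u = "\<lambda>t z. u t (disk_aut a z)"])
  have ca: "continuous_on unit_disk (disk_aut a)"
    using a by (intro holomorphic_on_imp_continuous_on disk_aut_holomorphic)
  have "continuous_on ({0..T} \<times> unit_disk) (\<lambda>x. u (fst (fst x, disk_aut a (snd x))) (snd (fst x, disk_aut a (snd x))))"
    by (rule continuous_on_compose2[OF cont])
      (use a in \<open>auto intro!: continuous_intros continuous_on_compose2[OF ca]\<close>)
  then show "continuous_on ({0..T} \<times> unit_disk) (\<lambda>x. u (fst x) (disk_aut a (snd x)))" by simp
  show "(\<lambda>z. u t (disk_aut a z)) holomorphic_on unit_disk" if "t \<in> {0..T}" for t
    by (rule holomorphic_compose_disk_aut[OF hol[OF that] a])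
  show "energy p s (\<lambda>z. u t (disk_aut a z)) \<le> B" if "0 < t" "t \<le> T" for t
    using B[OF that] by (simp add: mob_energy_def)
qed

section \<open>Averages along the flow and the generator\<close>

context disk_semigroup
begin

text \<open>An integral rather than a mean: without the factor \<open>1 / T\<close>,
  \<open>avg_shift\<close> is symmetric in the two times and the equation with the generator has no
  constant.\<close>

definition avg :: "(complex \<Rightarrow> complex) \<Rightarrow> real \<Rightarrow> complex \<Rightarrow> complex"
  where "avg f T z = integral {0..T} (\<lambda>t. f (\<phi> t z))"

lemma holomorphic_compose: "f holomorphic_on unit_disk \<Longrightarrow> 0 \<le> t \<Longrightarrow> (\<lambda>z. f (\<phi> t z)) holomorphic_on unit_disk"
  by (rule holomorphic_compose_disk[OF _ holomorphic]) (simp_all add: in_disk)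

lemma continuous_on_compose_flow:
  assumes f: "f holomorphic_on unit_disk"
  shows "continuous_on ({0..T} \<times> unit_disk) (\<lambda>x. f (\<phi> (fst x) (snd x)))"
proof -
  have "continuous_on ({0..T} \<times> unit_disk) (\<lambda>x. \<phi> (fst x) (snd x))"
    by (rule continuous_on_subset[OF continuous_on_flow]) auto
  then show ?thesis
    by (rule continuous_on_compose2[OF holomorphic_on_imp_continuous_on[OF f]]) (auto simp: in_disk)
qed

lemma continuous_on_time:
  assumes f: "f holomorphic_on unit_disk" and z: "cmod z < 1"
  shows "continuous_on {0..T} (\<lambda>t. f (\<phi> t z))"
proof -
  have "continuous_on {0..T} (\<lambda>t. f (\<phi> (fst (t, z)) (snd (t, z))))"
    by (rule continuous_on_compose2[OF continuous_on_compose_flow[OF f, of T]]) (use z in \<open>auto intro!: continuous_intros\<close>)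
  then show ?thesis by simp
qed

lemma avg_holomorphic:
  assumes f: "f holomorphic_on unit_disk"
  shows "avg f T holomorphic_on unit_disk"
  unfolding avg_def[abs_def] holomorphic_on_open[OF open_ball]
  using has_field_derivative_integral_param[OF continuous_on_compose_flow[OF f], of T] holomorphic_compose[OF f]
  by (auto intro!: exI)

lemma mob_energy_avg_le:
  assumes "1 < p" "0 < T" "cmod a < 1" "f holomorphic_on unit_disk"
    "\<And>t. 0 < t \<Longrightarrow> t \<le> T \<Longrightarrow> mob_energy p s (\<lambda>z. f (\<phi> t z)) a \<le> B"
  shows "mob_energy p s (avg f T) a \<le> ennreal (T powr p) * B"
  unfolding avg_def[abs_def]
  using assms continuous_on_compose_flow[OF assms(4)] holomorphic_compose[OF assms(4)]
  by (intro mob_energy_integral_le[where u = "\<lambda>t z. f (\<phi> t z)"]) auto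

lemma mob_energy_avg_diff_le:
  assumes p: "1 < p" and T: "0 < T" and a: "cmod a < 1" and f: "f holomorphic_on unit_disk"
    and B: "\<And>t. 0 < t \<Longrightarrow> t \<le> T \<Longrightarrow> mob_energy p s (\<lambda>z. f (\<phi> t z) - f z) a \<le> B"
  shows "mob_energy p s (\<lambda>z. avg f T z - of_real T * f z) a \<le> ennreal (T powr p) * B"
proof -
  have "mob_energy p s (\<lambda>z. integral {0..T} (\<lambda>t. f (\<phi> t z) - f z)) a \<le> ennreal (T powr p) * B"
  proof (rule mob_energy_integral_le[OF p T a, where u = "\<lambda>t z. f (\<phi> t z) - f z"])
    have "continuous_on ({0..T} \<times> unit_disk) (\<lambda>x. f (snd x))"
      by (rule continuous_on_compose2[OF holomorphic_on_imp_continuous_on[OF f]]) (auto intro!: continuous_intros)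
    then show "continuous_on ({0..T} \<times> unit_disk) (\<lambda>x. f (\<phi> (fst x) (snd x)) - f (snd x))"
      by (intro continuous_on_diff continuous_on_compose_flow[OF f])
    show "(\<lambda>z. f (\<phi> t z) - f z) holomorphic_on unit_disk" if "t \<in> {0..T}" for t
      using that by (intro holomorphic_on_diff holomorphic_compose f) auto
  qed (rule B)
  also have "mob_energy p s (\<lambda>z. integral {0..T} (\<lambda>t. f (\<phi> t z) - f z)) a = mob_energy p s (\<lambda>z. avg f T z - of_real T * f z) a"
    unfolding mob_energy_def
  proof (rule energy_cong)
    fix z :: complex assume z: "z \<in> unit_disk"
    have "(\<lambda>t. f (\<phi> t (disk_aut a z))) integrable_on {0..T}"
      using z a by (intro integrable_continuous_interval continuous_on_time f) auto
    then show "integral {0..T} (\<lambda>t. f (\<phi> t (disk_aut a z)) - f (disk_aut a z)) = avg f T (disk_aut a z) - of_real T * f (disk_aut a z)"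
      unfolding avg_def using T by (subst integral_diff) (auto simp: scaleR_conv_of_real)
  qed
  finally show ?thesis .
qed

text \<open>Moving the negative terms to the other side, both sums are the integral over
  \<open>{0..T + \<tau>}\<close>, cut once at \<open>T\<close> and once at \<open>\<tau>\<close>.
  Divided by \<open>\<tau>\<close>, this is the source of the equation with the generator;
  undivided, it makes averages strongly continuous.\<close>

lemma avg_shift:
  assumes f: "f holomorphic_on unit_disk" and T: "0 \<le> T" and \<tau>: "0 \<le> \<tau>" and z: "cmod z < 1"
  shows "avg f T (\<phi> \<tau> z) - avg f T z = avg f \<tau> (\<phi> T z) - avg f \<tau> z"
proof -
  have shift: "avg f S (\<phi> h z) = integral {h..S + h} (\<lambda>t. f (\<phi> t z))" if h: "0 \<le> h" "0 \<le> S" for S h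
  proof -
    have "avg f S (\<phi> h z) = integral {0..S} ((\<lambda>t. f (\<phi> t z)) \<circ> (+) h)"
      unfolding avg_def using h z by (intro integral_cong) (auto simp: add add.commute)
    then show ?thesis unfolding integral_shift_Icc_real by simp
  qed
  have int: "(\<lambda>t. f (\<phi> t z)) integrable_on {0..T + \<tau>}"
    using z by (intro integrable_continuous_interval continuous_on_time f)
  have "avg f T z + avg f \<tau> (\<phi> T z) = integral {0..T + \<tau>} (\<lambda>t. f (\<phi> t z))"
    using Henstock_Kurzweil_Integration.integral_combine[of 0 T "T + \<tau>" "\<lambda>t. f (\<phi> t z)"] T \<tau> int
    unfolding shift[OF T \<tau>] by (simp add: avg_def add.commute)
  moreover have "avg f \<tau> z + avg f T (\<phi> \<tau> z) = integral {0..T + \<tau>} (\<lambda>t. f (\<phi> t z))"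
    using Henstock_Kurzweil_Integration.integral_combine[of 0 \<tau> "T + \<tau>" "\<lambda>t. f (\<phi> t z)"] T \<tau> int
    unfolding shift[OF \<tau> T] by (simp add: avg_def add.commute)
  ultimately show ?thesis by (simp add: algebra_simps)
qed

text \<open>Divide \<open>avg_shift\<close> by \<open>\<tau>\<close> and let \<open>\<tau>\<close>
  tend to \<open>0\<close>. On the left this is the derivative of the average along the flow; on the
  right are means over short times of continuous functions.\<close>

lemma avg_deriv_generator:
  assumes G: "is_inf_generator \<phi> G" and f: "f holomorphic_on unit_disk" and T: "0 \<le> T" and z: "cmod z < 1"
  shows "deriv (avg f T) z * G z = f (\<phi> T z) - f z"
proof -
  have F: "(avg f T has_field_derivative deriv (avg f T) z) (at z)"
    using holomorphic_derivI[OF avg_holomorphic[OF f] open_ball, of z] z by simp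
  \<comment> \<open>Caratheodory's slope function \<open>g\<close> avoids a difference quotient,
    whose denominator \<open>\<phi> \<tau> z - z\<close> may vanish.\<close>
  then obtain g where g: "\<And>w. avg f T w - avg f T z = g w * (w - z)" "isCont g z" "g z = deriv (avg f T) z"
    unfolding CARAT_DERIV by blast
  have Gz: "((\<lambda>t. (\<phi> t z - z) / of_real t) \<longlongrightarrow> G z) (at_right 0)"
    using G z unfolding is_inf_generator_def by simp
  have id: "((\<lambda>\<tau>. \<phi> \<tau> z) \<longlongrightarrow> z) (at_right 0)"
  proof (rule tendstoI)
    fix \<epsilon> :: real assume "0 < \<epsilon>"
    then obtain \<delta> where \<delta>: "0 < \<delta>" "\<And>t w. 0 \<le> t \<Longrightarrow> t < \<delta> \<Longrightarrow> cmod w \<le> cmod z \<Longrightarrow> cmod (\<phi> t w - w) < \<epsilon>"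
      using uniformly_near_id[OF z] by metis
    then show "\<forall>\<^sub>F \<tau> in at_right 0. dist (\<phi> \<tau> z) z < \<epsilon>"
      unfolding eventually_at_right_field by (intro exI[of _ \<delta>]) (auto simp: dist_norm)
  qed
  have "((\<lambda>\<tau>. g (\<phi> \<tau> z) * ((\<phi> \<tau> z - z) / of_real \<tau>)) \<longlongrightarrow> g z * G z) (at_right 0)"
    by (intro tendsto_mult isCont_tendsto_compose[OF g(2) id] Gz)
  moreover have "((\<lambda>\<tau>. avg f \<tau> (\<phi> T z) / of_real \<tau> - avg f \<tau> z / of_real \<tau>) \<longlongrightarrow> f (\<phi> 0 (\<phi> T z)) - f (\<phi> 0 z)) (at_right 0)"
    unfolding avg_def using z in_disk[OF T z]
    by (intro tendsto_diff tendsto_average_at_right_0[of 1] continuous_on_time f) auto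
  moreover have "\<forall>\<^sub>F \<tau> in at_right 0. g (\<phi> \<tau> z) * ((\<phi> \<tau> z - z) / of_real \<tau>) = avg f \<tau> (\<phi> T z) / of_real \<tau> - avg f \<tau> z / of_real \<tau>"
    unfolding eventually_at_right_field
  proof (intro exI[of _ 1] conjI allI impI)
    fix \<tau> :: real assume \<tau>: "0 < \<tau>"
    have "g (\<phi> \<tau> z) * (\<phi> \<tau> z - z) = avg f \<tau> (\<phi> T z) - avg f \<tau> z"
      using avg_shift[OF f T _ z, of \<tau>] g(1)[of "\<phi> \<tau> z"] \<tau> by simp
    then show "g (\<phi> \<tau> z) * ((\<phi> \<tau> z - z) / of_real \<tau>) = avg f \<tau> (\<phi> T z) / of_real \<tau> - avg f \<tau> z / of_real \<tau>"
      by (simp add: diff_divide_distrib[symmetric])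
  qed simp
  ultimately have "((\<lambda>\<tau>. avg f \<tau> (\<phi> T z) / of_real \<tau> - avg f \<tau> z / of_real \<tau>) \<longlongrightarrow> g z * G z) (at_right 0)"
      and "((\<lambda>\<tau>. avg f \<tau> (\<phi> T z) / of_real \<tau> - avg f \<tau> z / of_real \<tau>) \<longlongrightarrow> f (\<phi> 0 (\<phi> T z)) - f (\<phi> 0 z)) (at_right 0)"
    by (auto intro: Lim_transform_eventually)
  from tendsto_unique[OF trivial_limit_at_right_real this]
  have "g z * G z = f (\<phi> 0 (\<phi> T z)) - f (\<phi> 0 z)" .
  then show ?thesis using g(3) z in_disk[OF T z] by simp
qed

text \<open>The equation for the average of the identity can be solved for \<open>G\<close>: for
  small \<open>T\<close> the derivative of this average is within \<open>T / 2\<close> of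
  \<open>T\<close> on a given disk, so it has no zeros there. This gives holomorphy although
  \<open>G\<close> is only a pointwise limit.\<close>

lemma generator_holomorphic:
  assumes G: "is_inf_generator \<phi> G"
  shows "G holomorphic_on unit_disk"
proof -
  have "G analytic_on unit_disk"
    unfolding analytic_on_def
  proof
    fix z0 :: complex assume z0: "z0 \<in> unit_disk"
    define R where "R = (1 + cmod z0) / 2"
    have R: "cmod z0 < R" "R < 1" using z0 by (auto simp: R_def)
    obtain \<delta> where \<delta>: "0 < \<delta>" "\<And>t z. 0 \<le> t \<Longrightarrow> t < \<delta> \<Longrightarrow> cmod z \<le> R \<Longrightarrow> cmod (deriv (\<phi> t) z - 1) < 1 / 2"
      using deriv_near_1[OF R(2), of "1 / 2"] by auto
    define T where "T = \<delta> / 2"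
    have T: "0 < T" "T < \<delta>" using \<delta> by (auto simp: T_def)
    have id: "(\<lambda>z. z) holomorphic_on unit_disk" by (intro holomorphic_intros)
    have cont: "continuous_on ({0..T} \<times> unit_disk) (\<lambda>x. \<phi> (fst x) (snd x))"
      by (rule continuous_on_subset[OF continuous_on_flow]) auto
    have ne: "deriv (avg (\<lambda>z. z) T) z \<noteq> 0" if z: "cmod z < R" for z
    proof -
      have zd: "z \<in> unit_disk" using z R by simp
      have d: "deriv (avg (\<lambda>z. z) T) z = integral {0..T} (\<lambda>t. deriv (\<phi> t) z)"
        unfolding avg_def[abs_def]
        using has_field_derivative_integral_param[OF cont _ zd] holomorphic by (intro DERIV_imp_deriv) auto
      have cd: "continuous_on {0..T} (\<lambda>t. deriv (\<phi> t) z)"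
      proof -
        have "continuous_on {0..T} (\<lambda>t. deriv (\<phi> (fst (t, z))) (snd (t, z)))"
          by (rule continuous_on_compose2[OF continuous_on_deriv_param[OF cont]])
            (use zd holomorphic in \<open>auto intro!: continuous_intros\<close>)
        then show ?thesis by simp
      qed
      have "norm (integral {0..T} (\<lambda>t. deriv (\<phi> t) z - 1)) \<le> 1 / 2 * (T - 0)"
      proof (rule integral_bound)
        show "norm (deriv (\<phi> t) z - 1) \<le> 1 / 2" if "t \<in> {0..T}" for t
          using \<delta>(2)[of t z] that T z by simp
      qed (use T cd in \<open>auto intro!: continuous_intros\<close>)
      moreover have "integral {0..T} (\<lambda>t. deriv (\<phi> t) z - 1) = integral {0..T} (\<lambda>t. deriv (\<phi> t) z) - of_real T"
        using T cd by (subst integral_diff) (auto intro!: integrable_continuous_interval simp: scaleR_conv_of_real)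
      ultimately show ?thesis using T unfolding d by auto
    qed
    have "(\<lambda>z. (\<phi> T z - z) / deriv (avg (\<lambda>z. z) T) z) holomorphic_on ball 0 R"
    proof (intro holomorphic_on_divide holomorphic_on_diff holomorphic_on_ident)
      show "\<phi> T holomorphic_on ball 0 R"
        by (rule holomorphic_on_subset[OF holomorphic]) (use T R in auto)
      show "deriv (avg (\<lambda>z. z) T) holomorphic_on ball 0 R"
        by (rule holomorphic_on_subset[OF holomorphic_deriv[OF avg_holomorphic[OF id]]]) (use R in auto)
    qed (use ne in auto)
    moreover have "(\<phi> T z - z) / deriv (avg (\<lambda>z. z) T) z = G z" if "z \<in> ball 0 R" for z
      using avg_deriv_generator[OF G id, of T z] ne[of z] that T R by (simp add: field_simps)
    ultimately have "G holomorphic_on ball 0 R" by (rule holomorphic_transform)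
    moreover have "ball z0 (R - cmod z0) \<subseteq> ball 0 R"
    proof
      fix w assume "w \<in> ball z0 (R - cmod z0)"
      then show "w \<in> ball 0 R" using norm_triangle_sub[of w z0] by (simp add: dist_norm norm_minus_commute)
    qed
    ultimately have "G holomorphic_on ball z0 (R - cmod z0)"
      by (rule holomorphic_on_subset)
    then show "\<exists>e>0. G holomorphic_on ball z0 e" using R by (intro exI[of _ "R - cmod z0"]) auto
  qed
  then show ?thesis by (rule analytic_imp_holomorphic)
qed

lemma trivial_if_generator_0:
  assumes G: "is_inf_generator \<phi> G" and 0: "\<And>z. cmod z < 1 \<Longrightarrow> G z = 0"
  shows "\<not> nontrivial_semigroup \<phi>"
proof -
  have "(\<lambda>z. z) holomorphic_on unit_disk" by (intro holomorphic_intros)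
  from avg_deriv_generator[OF G this] 0 show ?thesis
    unfolding nontrivial_semigroup_def by auto
qed

end

subsection \<open>Energies of functions dominated by an injective map\<close>

lemma norm_diff_0_le_radial:
  assumes f: "f holomorphic_on unit_disk" and z: "cmod z < 1"
    and g: "\<And>x. 0 \<le> x \<Longrightarrow> x < 1 \<Longrightarrow> (g has_real_derivative g' x) (at x)"
    and le: "\<And>w. cmod w < 1 \<Longrightarrow> cmod (deriv f w) \<le> g' (cmod w)"
  shows "cmod (f z - f 0) \<le> g (cmod z) - g 0"
proof -
  have tz: "cmod (of_real t * z) = t * cmod z" "t * cmod z < 1" "0 \<le> t * cmod z" if "0 \<le> t" "t \<le> 1" for t
    using that z mult_left_le_one_le[of "cmod z" t] by (auto simp: norm_mult)
  have d1: "((\<lambda>t. f (of_real t * z)) has_vector_derivative (z * deriv f (of_real t * z))) (at t)" if "0 \<le> t" "t \<le> 1" for t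
  proof -
    have "(f has_field_derivative deriv f (of_real t * z)) (at (of_real t * z))"
      using tz[OF that] by (intro holomorphic_derivI[OF f open_ball]) auto
    moreover have "((\<lambda>t. of_real t * z) has_vector_derivative z) (at t)"
      by (auto intro!: derivative_eq_intros simp: has_vector_derivative_def scaleR_conv_of_real)
    ultimately show ?thesis
      using field_vector_diff_chain_at[of "\<lambda>t. of_real t * z" z t f] by (simp add: o_def)
  qed
  have d2: "((\<lambda>t. g (t * cmod z)) has_vector_derivative (cmod z * g' (t * cmod z))) (at t)" if "0 \<le> t" "t \<le> 1" for t
  proof -
    have "(g has_real_derivative g' (t * cmod z)) (at (t * cmod z))" using tz[OF that] by (intro g) auto
    moreover have "((\<lambda>t. t * cmod z) has_real_derivative cmod z) (at t)"
      by (auto intro!: derivative_eq_intros)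
    ultimately have "((\<lambda>t. g (t * cmod z)) has_real_derivative (g' (t * cmod z) * cmod z)) (at t)"
      by (rule DERIV_chain2)
    then show ?thesis by (simp add: has_real_derivative_iff_has_vector_derivative mult.commute)
  qed
  have "cmod (f (of_real 1 * z) - f (of_real 0 * z)) \<le> g (1 * cmod z) - g (0 * cmod z)"
  proof (rule differentiable_bound_general[where f = "\<lambda>t. f (of_real t * z)" and \<phi> = "\<lambda>t. g (t * cmod z)"])
    show "continuous_on {0..1} (\<lambda>t. f (of_real t * z))"
      using d1 by (auto intro!: continuous_at_imp_continuous_on has_vector_derivative_continuous)
    show "continuous_on {0..1} (\<lambda>t. g (t * cmod z))"
      using d2 by (auto intro!: continuous_at_imp_continuous_on has_vector_derivative_continuous)
    show "cmod (z * deriv f (of_real t * z)) \<le> cmod z * g' (t * cmod z)" if "0 < t" "t < 1" for t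
      using le[of "of_real t * z"] tz[of t] that by (simp add: norm_mult mult_left_mono)
  qed (use d1 d2 in auto)
  then show ?thesis by simp
qed

lemma norm_diff_0_le_powr:
  assumes f: "f holomorphic_on unit_disk" and z: "cmod z < 1" and \<kappa>: "0 < \<kappa>" and K: "0 \<le> K"
    and le: "\<And>w. cmod w < 1 \<Longrightarrow> cmod (deriv f w) \<le> K * (1 - cmod w) powr (- 1 - \<kappa>)"
  shows "cmod (f z - f 0) \<le> K / \<kappa> * (1 - cmod z) powr (- \<kappa>)"
proof -
  have "cmod (f z - f 0) \<le> K / \<kappa> * (1 - cmod z) powr (- \<kappa>) - K / \<kappa> * (1 - 0) powr (- \<kappa>)"
  proof (rule norm_diff_0_le_radial[OF f z _ le, where g = "\<lambda>x. K / \<kappa> * (1 - x) powr (- \<kappa>)"])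
    fix x :: real assume "0 \<le> x" "x < 1"
    then have "((\<lambda>x. K / \<kappa> * (1 - x) powr (- \<kappa>)) has_real_derivative K * (1 - x) powr (- \<kappa> - 1)) (at x)"
      using \<kappa> by (auto intro!: derivative_eq_intros)
    moreover have "- \<kappa> - 1 = - 1 - \<kappa>" by simp
    ultimately show "((\<lambda>x. K / \<kappa> * (1 - x) powr (- \<kappa>)) has_real_derivative K * (1 - x) powr (- 1 - \<kappa>)) (at x)"
      by (simp only:)
  qed
  also have "\<dots> \<le> K / \<kappa> * (1 - cmod z) powr (- \<kappa>)" using K \<kappa> by simp
  finally show ?thesis .
qed

lemma one_minus_norm_le: "cmod w \<le> 1 \<Longrightarrow> 1 - cmod w \<le> 1 - (cmod w)\<^sup>2" "1 - (cmod w)\<^sup>2 \<le> 2 * (1 - cmod w)"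
proof -
  assume "cmod w \<le> 1"
  then have "(cmod w)\<^sup>2 \<le> cmod w" by (simp add: power2_eq_square mult_left_le)
  then show "1 - cmod w \<le> 1 - (cmod w)\<^sup>2" by simp
next
  have "0 \<le> (1 - cmod w)\<^sup>2" by simp
  then show "1 - (cmod w)\<^sup>2 \<le> 2 * (1 - cmod w)" by (simp add: power2_eq_square algebra_simps)
qed

lemma Bloch_norm_diff_0_le:
  assumes f: "f holomorphic_on unit_disk" and z: "cmod z < 1"
    and le: "\<And>w. cmod w < 1 \<Longrightarrow> (1 - (cmod w)\<^sup>2) * cmod (deriv f w) \<le> \<beta>"
  shows "cmod (f z - f 0) \<le> \<beta> * ln (1 / (1 - cmod z))"
proof -
  have "cmod (f z - f 0) \<le> - \<beta> * ln (1 - cmod z) - (- \<beta> * ln (1 - 0))"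
  proof (rule norm_diff_0_le_radial[OF f z, where g = "\<lambda>x. - \<beta> * ln (1 - x)" and g' = "\<lambda>x. \<beta> / (1 - x)"])
    fix x :: real assume "0 \<le> x" "x < 1"
    then show "((\<lambda>x. - \<beta> * ln (1 - x)) has_real_derivative \<beta> / (1 - x)) (at x)"
      by (auto intro!: derivative_eq_intros)
  next
    fix w :: complex assume w: "cmod w < 1"
    have "(1 - cmod w) * cmod (deriv f w) \<le> (1 - (cmod w)\<^sup>2) * cmod (deriv f w)"
      using w one_minus_norm_le(1)[of w] by (intro mult_right_mono) auto
    also have "\<dots> \<le> \<beta>" using le[OF w] .
    finally show "cmod (deriv f w) \<le> \<beta> / (1 - cmod w)" using w by (simp add: field_simps)
  qed
  then show ?thesis using z by (simp add: ln_div)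
qed

section \<open>Dyadic annuli and area estimates\<close>

definition annulus :: "nat \<Rightarrow> complex set"
  where "annulus j = {z. 1 - (1 / 2) ^ j \<le> cmod z \<and> cmod z < 1 - (1 / 2) ^ Suc j}"

lemma annulus_measurable [measurable]: "annulus j \<in> sets borel"
  unfolding annulus_def by measurable

lemma annulus_subset: "annulus j \<subseteq> unit_disk" "annulus j \<subseteq> ball 0 (1 - (1 / 2) ^ Suc j)"
proof -
  show "annulus j \<subseteq> ball 0 (1 - (1 / 2) ^ Suc j)" by (auto simp: annulus_def)
  have "0 < (1 / 2 :: real) ^ Suc j" by simp
  then have "cmod z < 1" if "cmod z < 1 - (1 / 2) ^ Suc j" for z :: complex
    using that by linarith
  then show "annulus j \<subseteq> unit_disk" unfolding annulus_def by (auto simp del: power_Suc)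
qed

lemma unit_disk_subset_annuli:
  assumes "z \<in> unit_disk"
  shows "\<exists>j. z \<in> annulus j"
proof -
  have "\<exists>n. cmod z < 1 - (1 / 2) ^ n"
    using assms real_arch_pow_inv[of "1 - cmod z" "1 / 2"] by (auto simp: algebra_simps)
  then obtain n where n: "cmod z < 1 - (1 / 2) ^ n" "\<And>m. m < n \<Longrightarrow> \<not> cmod z < 1 - (1 / 2) ^ m"
    using exists_least_iff[of "\<lambda>n. cmod z < 1 - (1 / 2) ^ n"] by blast
  then have "n \<noteq> 0" by (intro notI) (use norm_ge_zero[of z] in auto)
  then obtain j where "n = Suc j" using not0_implies_Suc by blast
  then show ?thesis using n(1) n(2)[of j] by (auto simp: annulus_def not_less intro!: exI[of _ j])
qed

lemma nn_integral_annuli_le: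
  fixes h :: "complex \<Rightarrow> ennreal"
  assumes h: "\<And>j. (\<lambda>z. h z * indicator (annulus j) z) \<in> borel_measurable borel"
    and le: "\<And>j. (\<integral>\<^sup>+z\<in>annulus j. h z \<partial>lborel) \<le> ennreal (C * r ^ j)"
    and r: "0 \<le> r" "r < 1" and C: "0 \<le> C"
  shows "(\<integral>\<^sup>+z\<in>unit_disk. h z \<partial>lborel) \<le> ennreal (C / (1 - r))"
proof -
  have "(\<integral>\<^sup>+z\<in>unit_disk. h z \<partial>lborel) \<le> (\<integral>\<^sup>+z. (\<Sum>j. h z * indicator (annulus j) z) \<partial>lborel)"
  proof (intro nn_integral_mono)
    fix z :: complex
    show "h z * indicator unit_disk z \<le> (\<Sum>j. h z * indicator (annulus j) z)"
    proof (cases "z \<in> unit_disk")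
      case True
      then obtain j where "z \<in> annulus j" using unit_disk_subset_annuli by blast
      then have "h z * indicator unit_disk z \<le> (\<Sum>i\<in>{j}. h z * indicator (annulus i) z)" using True by simp
      also have "\<dots> \<le> (\<Sum>j. h z * indicator (annulus j) z)" by (rule sum_le_suminf) auto
      finally show ?thesis .
    qed simp
  qed
  also have "\<dots> = (\<Sum>j. \<integral>\<^sup>+z\<in>annulus j. h z \<partial>lborel)"
    using h by (intro nn_integral_suminf) auto
  also have "\<dots> \<le> (\<Sum>j. ennreal (C * r ^ j))"
    by (intro suminf_le le) auto
  also have "\<dots> = ennreal (C / (1 - r))"
  proof -
    have "(\<lambda>j. C * r ^ j) sums (C * (1 / (1 - r)))"
      using r by (intro sums_mult geometric_sums) auto
    then show ?thesis using r C by (subst suminf_ennreal_eq[of _ "C / (1 - r)"]) auto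
  qed
  finally show ?thesis .
qed

lemma emeasure_ball_complex:
  assumes "0 \<le> r"
  shows "emeasure lborel (ball (c::complex) r) = ennreal (pi * r\<^sup>2)"
  using assms by (subst emeasure_ball) (auto simp: unit_ball_vol_2)

lemma emeasure_annulus_le: "emeasure lborel (annulus j) \<le> ennreal (2 * pi * (1 / 2) ^ j)"
proof -
  define x where "x = (1 / 2 :: real) ^ j"
  have x: "0 \<le> x" "x \<le> 1" by (auto simp: x_def power_le_one)
  have "annulus j \<subseteq> unit_disk - ball 0 (1 - x)"
    using annulus_subset(1)[of j] by (auto simp: annulus_def x_def)
  then have "emeasure lborel (annulus j) \<le> emeasure lborel (unit_disk - ball 0 (1 - x))"
    by (intro emeasure_mono) auto
  also have "\<dots> = emeasure lborel unit_disk - emeasure lborel (ball (0::complex) (1 - x))"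
    using x emeasure_lborel_ball_finite[of "0::complex" "1 - x"] by (intro emeasure_Diff) auto
  also have "\<dots> = ennreal (pi * 1\<^sup>2 - pi * (1 - x)\<^sup>2)"
    using x by (subst (1 2) emeasure_ball_complex) (auto simp: ennreal_minus)
  also have "\<dots> \<le> ennreal (2 * pi * x)"
  proof (rule ennreal_leI)
    have "0 \<le> pi * x\<^sup>2" by simp
    then show "pi * 1\<^sup>2 - pi * (1 - x)\<^sup>2 \<le> 2 * pi * x" by (simp add: power2_eq_square algebra_simps)
  qed
  finally show ?thesis by (simp add: x_def)
qed

lemma one_minus_norm_annulus:
  assumes "z \<in> annulus j"
  shows "(1 / 2) ^ Suc j \<le> 1 - cmod z" "1 - cmod z \<le> (1 / 2) ^ j"
  using assms by (auto simp: annulus_def)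

lemma half_power_powr: "((1 / 2) ^ j) powr t = (2 powr (- t)) ^ j" for t :: real
proof -
  have "((1 / 2 :: real) ^ j) powr t = (2 powr (- real j)) powr t"
    by (simp add: powr_minus powr_realpow power_one_over field_simps)
  also have "\<dots> = (2 powr (- t)) powr real j" by (simp add: powr_powr mult.commute)
  finally show ?thesis by (simp add: powr_realpow)
qed

lemma measurable_annulus:
  fixes f :: "complex \<Rightarrow> real"
  assumes "continuous_on unit_disk f"
  shows "(\<lambda>z. ennreal (f z) * indicator (annulus j) z) \<in> borel_measurable borel"
proof -
  have [measurable]: "(\<lambda>z. ennreal (f z) * indicator unit_disk z) \<in> borel_measurable borel"
    by (rule measurable_on_disk[OF assms])
  have "(\<lambda>z. (ennreal (f z) * indicator unit_disk z) * indicator (annulus j) z) \<in> borel_measurable borel"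
    by measurable
  also have "(\<lambda>z. (ennreal (f z) * indicator unit_disk z) * indicator (annulus j) z) = (\<lambda>z. ennreal (f z) * indicator (annulus j) z)"
    using annulus_subset(1)[of j] by (auto simp: fun_eq_iff indicator_def)
  finally show ?thesis .
qed

lemma continuous_on_one_minus_powr: "continuous_on unit_disk (\<lambda>z::complex. (1 - cmod z) powr t)"
  by (intro continuous_intros) auto

text \<open>\<open>annulus j\<close> has area at most of order \<open>(1/2) ^ j\<close>, and the
  integrand there is at most of order \<open>(2 powr (- t)) ^ j\<close>. The ratio
  \<open>2 powr (- t - 1)\<close> of the resulting series is below \<open>1\<close> because
  \<open>- 1 < t\<close>.\<close>

lemma nn_integral_disk_powr:
  assumes "- 1 < t" "t \<le> 0"
  shows "(\<integral>\<^sup>+z\<in>unit_disk. ennreal ((1 - cmod z) powr t) \<partial>lborel)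
    \<le> ennreal (2 powr (- t) * 2 * pi / (1 - 2 powr (- t - 1)))"
proof (rule nn_integral_annuli_le[OF measurable_annulus[OF continuous_on_one_minus_powr]])
  fix j
  have "(\<integral>\<^sup>+z\<in>annulus j. ennreal ((1 - cmod z) powr t) \<partial>lborel) \<le> (\<integral>\<^sup>+z. ennreal (((1 / 2) ^ Suc j) powr t) * indicator (annulus j) z \<partial>lborel)"
  proof (intro nn_integral_mono)
    fix z :: complex
    have "(1 - cmod z) powr t \<le> ((1 / 2) ^ Suc j) powr t" if "z \<in> annulus j"
      using one_minus_norm_annulus[OF that] assms by (intro powr_mono2') auto
    then show "ennreal ((1 - cmod z) powr t) * indicator (annulus j) z \<le> ennreal (((1 / 2) ^ Suc j) powr t) * indicator (annulus j) z"
      by (auto simp: indicator_def intro!: ennreal_leI simp del: power_Suc)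
  qed
  also have "\<dots> = ennreal (((1 / 2) ^ Suc j) powr t) * emeasure lborel (annulus j)"
    by (subst nn_integral_cmult_indicator) auto
  also have "\<dots> \<le> ennreal (((1 / 2) ^ Suc j) powr t) * ennreal (2 * pi * (1 / 2) ^ j)"
    by (intro mult_left_mono emeasure_annulus_le) auto
  also have "\<dots> = ennreal (2 powr (- t) * 2 * pi * (2 powr (- t - 1)) ^ j)"
  proof -
    have "((1 / 2) ^ Suc j) powr t * (2 * pi * (1 / 2) ^ j) = 2 powr (- t) * 2 * pi * ((2 powr (- t)) ^ j * (1 / 2) ^ j)"
      unfolding half_power_powr by simp
    also have "(2 powr (- t)) ^ j * (1 / 2) ^ j = (2 powr (- t - 1)) ^ j"
      by (simp add: power_mult_distrib[symmetric] powr_diff)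
    finally show ?thesis by (simp add: ennreal_mult[symmetric] del: power_Suc)
  qed
  finally show "(\<integral>\<^sup>+z\<in>annulus j. ennreal ((1 - cmod z) powr t) \<partial>lborel) \<le> ennreal (2 powr (- t) * 2 * pi * (2 powr (- t - 1)) ^ j)" .
next
  show "2 powr (- t - 1) < (1::real)" using assms powr_less_mono[of "- t - 1" 0 2] by simp
qed auto

text \<open>The area of the image of a disk under an injective map is at most that of any disk
  containing it; this gains a whole power of \<open>1 - cmod z\<close> over the pointwise bound on
  \<open>deriv u\<close>.\<close>

lemma nn_integral_deriv_square_le:
  assumes u: "u holomorphic_on unit_disk" "inj_on u unit_disk" and \<kappa>: "0 < \<kappa>" and \<epsilon>: "2 * \<kappa> < \<epsilon>" and K: "0 \<le> K"
    and le: "\<And>w. cmod w < 1 \<Longrightarrow> cmod (deriv u w) \<le> K * (1 - cmod w) powr (- 1 - \<kappa>)"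
  shows "(\<integral>\<^sup>+z\<in>unit_disk. ennreal ((cmod (deriv u z))\<^sup>2 * (1 - cmod z) powr \<epsilon>) \<partial>lborel)
    \<le> ennreal (pi * (2 powr \<kappa> / \<kappa>)\<^sup>2 / (1 - 2 powr (2 * \<kappa> - \<epsilon>)) * K\<^sup>2)"
proof -
  have cont: "continuous_on unit_disk (\<lambda>z. (cmod (deriv u z))\<^sup>2)"
    using u(1) by (intro continuous_intros holomorphic_on_imp_continuous_on holomorphic_deriv) auto
  have "(\<integral>\<^sup>+z\<in>unit_disk. ennreal ((cmod (deriv u z))\<^sup>2 * (1 - cmod z) powr \<epsilon>) \<partial>lborel)
    \<le> ennreal (pi * (2 powr \<kappa> / \<kappa>)\<^sup>2 * K\<^sup>2 / (1 - 2 powr (2 * \<kappa> - \<epsilon>)))"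
  proof (rule nn_integral_annuli_le)
    show "(\<lambda>z. ennreal ((cmod (deriv u z))\<^sup>2 * (1 - cmod z) powr \<epsilon>) * indicator (annulus j) z) \<in> borel_measurable borel" for j
      by (intro measurable_annulus continuous_on_mult cont continuous_on_one_minus_powr)
    show "2 powr (2 * \<kappa> - \<epsilon>) < 1" using \<epsilon> powr_less_mono[of "2 * \<kappa> - \<epsilon>" 0 2] by simp
    fix j
    define r where "r = 1 - (1 / 2 :: real) ^ Suc j"
    define M where "M = K / \<kappa> * ((1 / 2) ^ Suc j) powr (- \<kappa>)"
    have r: "0 < r" "r < 1" using power_Suc_less_one[of "1/2 :: real" j] by (auto simp: r_def simp del: power_Suc)
    have M: "0 \<le> M" using K \<kappa> by (simp add: M_def)
    have sub: "ball 0 r \<subseteq> unit_disk" using r by auto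
    have im: "u ` ball 0 r \<subseteq> cball (u 0) M"
    proof
      fix w assume "w \<in> u ` ball 0 r"
      then obtain z where z: "w = u z" "cmod z < r" by auto
      have "cmod (u z - u 0) \<le> K / \<kappa> * (1 - cmod z) powr (- \<kappa>)"
        using z r by (intro norm_diff_0_le_powr u \<kappa> K le) auto
      also have "\<dots> \<le> M"
        unfolding M_def using z K \<kappa> by (intro mult_left_mono powr_mono2') (auto simp: r_def simp del: power_Suc)
      finally show "w \<in> cball (u 0) M" by (simp add: z dist_norm norm_minus_commute)
    qed
    \<comment> \<open>On the annulus the weight is at most
      \<open>((1/2) ^ j) powr \<epsilon>\<close>. The squared derivative is integrated over the
      whole disk of radius \<open>r\<close>, which gives at most the area of a disk of radius
      \<open>M\<close>. The resulting series is geometric, and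
      \<open>2 * \<kappa> < \<epsilon>\<close> makes it converge.\<close>
    have "(\<integral>\<^sup>+z\<in>annulus j. ennreal ((cmod (deriv u z))\<^sup>2 * (1 - cmod z) powr \<epsilon>) \<partial>lborel)
      \<le> (\<integral>\<^sup>+z. ennreal (((1 / 2) ^ j) powr \<epsilon>) * (ennreal ((cmod (deriv u z))\<^sup>2) * indicator (ball 0 r) z) \<partial>lborel)"
    proof (intro nn_integral_mono)
      fix z :: complex
      show "ennreal ((cmod (deriv u z))\<^sup>2 * (1 - cmod z) powr \<epsilon>) * indicator (annulus j) z
        \<le> ennreal (((1 / 2) ^ j) powr \<epsilon>) * (ennreal ((cmod (deriv u z))\<^sup>2) * indicator (ball 0 r) z)"
      proof (cases "z \<in> annulus j")
        case True
        then have z: "z \<in> ball 0 r" using annulus_subset(2)[of j] by (auto simp: r_def simp del: power_Suc)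
        have "0 \<le> 1 - cmod z" using z r by simp
        then have "(1 - cmod z) powr \<epsilon> \<le> ((1 / 2) ^ j) powr \<epsilon>"
          using one_minus_norm_annulus[OF True] \<kappa> \<epsilon> by (intro powr_mono2) auto
        then have "(cmod (deriv u z))\<^sup>2 * (1 - cmod z) powr \<epsilon> \<le> ((1 / 2) ^ j) powr \<epsilon> * (cmod (deriv u z))\<^sup>2"
          unfolding mult.commute[of "_ powr \<epsilon>" "(cmod (deriv u z))\<^sup>2"] by (intro mult_left_mono) auto
        then show ?thesis using True z by (simp add: ennreal_mult[symmetric] ennreal_leI)
      qed simp
    qed
    also have "\<dots> = ennreal (((1 / 2) ^ j) powr \<epsilon>) * (\<integral>\<^sup>+z. ennreal ((cmod (deriv u z))\<^sup>2) * indicator (ball 0 r) z \<partial>lborel)"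
    proof (rule nn_integral_cmult)
      have "(\<lambda>z. (ennreal ((cmod (deriv u z))\<^sup>2) * indicator unit_disk z) * indicator (ball 0 r) z) \<in> borel_measurable borel"
        by (intro borel_measurable_times_ennreal measurable_on_disk[OF cont] borel_measurable_indicator) auto
      also have "(\<lambda>z. (ennreal ((cmod (deriv u z))\<^sup>2) * indicator unit_disk z) * indicator (ball 0 r) z)
        = (\<lambda>z. ennreal ((cmod (deriv u z))\<^sup>2) * indicator (ball 0 r) z)"
        using sub by (auto simp: fun_eq_iff indicator_def)
      finally show "(\<lambda>z. ennreal ((cmod (deriv u z))\<^sup>2) * indicator (ball 0 r) z) \<in> borel_measurable lborel" by simp
    qed
    also have "\<dots> \<le> ennreal (((1 / 2) ^ j) powr \<epsilon>) * emeasure lborel (u ` ball 0 r)"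
    proof (intro mult_left_mono emeasure_holomorphic_image_ge)
      show "u holomorphic_on ball 0 r" "inj_on u (ball 0 r)"
        using u sub by (auto intro: holomorphic_on_subset inj_on_subset)
      then show "u ` ball 0 r \<in> sets borel" by (intro borel_open open_mapping_thm3) auto
    qed auto
    also have "\<dots> \<le> ennreal (((1 / 2) ^ j) powr \<epsilon>) * emeasure lborel (cball (u 0) M)"
      using im by (intro mult_left_mono emeasure_mono) auto
    also have "emeasure lborel (cball (u 0) M) = ennreal (pi * M\<^sup>2)"
      using M by (subst emeasure_cball) (auto simp: unit_ball_vol_2)
    also have "ennreal (((1 / 2) ^ j) powr \<epsilon>) * ennreal (pi * M\<^sup>2) = ennreal (pi * (2 powr \<kappa> / \<kappa>)\<^sup>2 * K\<^sup>2 * (2 powr (2 * \<kappa> - \<epsilon>)) ^ j)"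
    proof -
      have "((1 / 2) ^ j) powr \<epsilon> * M\<^sup>2 = (2 powr \<kappa> / \<kappa>)\<^sup>2 * K\<^sup>2 * ((2 powr (- \<epsilon>)) ^ j * ((2 powr \<kappa>) ^ j)\<^sup>2)"
        unfolding M_def half_power_powr by (simp add: power_mult_distrib power_divide mult_ac)
      also have "(2 powr (- \<epsilon>)) ^ j * ((2 powr \<kappa>) ^ j)\<^sup>2 = (2 powr (- \<epsilon>) * (2 powr \<kappa> * 2 powr \<kappa>)) ^ j"
        by (simp add: power_mult_distrib power2_eq_square)
      also have "2 powr (- \<epsilon>) * (2 powr \<kappa> * 2 powr \<kappa>) = (2::real) powr (2 * \<kappa> - \<epsilon>)"
        by (simp add: powr_add[symmetric])
      finally show ?thesis by (simp add: ennreal_mult[symmetric] mult_ac)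
    qed
    finally show "(\<integral>\<^sup>+z\<in>annulus j. ennreal ((cmod (deriv u z))\<^sup>2 * (1 - cmod z) powr \<epsilon>) \<partial>lborel)
      \<le> ennreal (pi * (2 powr \<kappa> / \<kappa>)\<^sup>2 * K\<^sup>2 * (2 powr (2 * \<kappa> - \<epsilon>)) ^ j)" .
  qed auto
  then show ?thesis by simp
qed

text \<open>For \<open>2 \<le> p\<close>, the pointwise bound is used for \<open>p - 2\<close>
  powers of the derivative and the area estimate for the other two. For \<open>p < 2\<close>,
  Young's inequality compares the power \<open>p\<close> with the square and with an integrable
  power of \<open>1 - cmod z\<close>. The exponent \<open>\<kappa>\<close> is what the strict
  inequality \<open>p - 2 < s\<close> leaves over; \<open>\<kappa>\<close> and \<open>C\<close> must
  not depend on \<open>u\<close> and \<open>K\<close>.\<close>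

lemma injective_weighted_energy_bound:
  assumes adm: "admissible p s"
  obtains \<kappa> C where "0 < \<kappa>" "\<kappa> \<le> 1" "0 < C"
    "\<forall>u K. u holomorphic_on unit_disk \<longrightarrow> inj_on u unit_disk \<longrightarrow> 0 < K \<longrightarrow>
       (\<forall>w. cmod w < 1 \<longrightarrow> cmod (deriv u w) \<le> K * (1 - cmod w) powr (- 1 - \<kappa>)) \<longrightarrow>
       (\<integral>\<^sup>+z\<in>unit_disk. ennreal (cmod (deriv u z) powr p * (1 - cmod z) powr (s - \<kappa> * p)) \<partial>lborel) \<le> ennreal (C * K powr p)"
proof (cases "2 \<le> p")
  case True
  note ps = admissible_range[OF adm]
  define q where "q = s - p + 2"
  have q: "0 < q" using ps by (simp add: q_def)
  \<comment> \<open>After the pointwise bound the weight has the exponent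
    \<open>\<epsilon> = q - \<kappa> * (2 * p - 2)\<close>. The area estimate demands
    \<open>2 * \<kappa> < \<epsilon>\<close>, that is \<open>2 * \<kappa> * p < q\<close>.\<close>
  define \<kappa> where "\<kappa> = min 1 (q / (4 * p))"
  have \<kappa>: "0 < \<kappa>" "\<kappa> \<le> 1" using q ps by (auto simp: \<kappa>_def)
  have "\<kappa> * (4 * p) \<le> q" using ps by (simp add: \<kappa>_def min_def field_simps)
  then have qk: "2 * \<kappa> * p < q" using q by simp
  define \<epsilon> where "\<epsilon> = q - \<kappa> * (2 * p - 2)"
  have \<epsilon>: "2 * \<kappa> < \<epsilon>" using qk by (simp add: \<epsilon>_def algebra_simps)
  define C where "C = pi * (2 powr \<kappa> / \<kappa>)\<^sup>2 / (1 - 2 powr (2 * \<kappa> - \<epsilon>))"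
  have "2 powr (2 * \<kappa> - \<epsilon>) < (1::real)" using \<epsilon> powr_less_mono[of "2 * \<kappa> - \<epsilon>" 0 2] by simp
  then have C: "0 < C" using \<kappa> by (simp add: C_def)
  show thesis
  proof (rule that[OF \<kappa> C], intro allI impI)
    fix u K assume u: "u holomorphic_on unit_disk" "inj_on u unit_disk" and K: "0 < (K::real)"
      and "\<forall>w. cmod w < 1 \<longrightarrow> cmod (deriv u w) \<le> K * (1 - cmod w) powr (- 1 - \<kappa>)"
    then have le: "\<And>w. cmod w < 1 \<Longrightarrow> cmod (deriv u w) \<le> K * (1 - cmod w) powr (- 1 - \<kappa>)" by blast
    have cont: "continuous_on unit_disk (\<lambda>z. (cmod (deriv u z))\<^sup>2 * (1 - cmod z) powr \<epsilon>)"
      using u(1) by (intro continuous_on_mult continuous_on_one_minus_powr continuous_intros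
          holomorphic_on_imp_continuous_on holomorphic_deriv) auto
    have "(\<integral>\<^sup>+z\<in>unit_disk. ennreal (cmod (deriv u z) powr p * (1 - cmod z) powr (s - \<kappa> * p)) \<partial>lborel)
      \<le> (\<integral>\<^sup>+z. ennreal (K powr (p - 2)) * (ennreal ((cmod (deriv u z))\<^sup>2 * (1 - cmod z) powr \<epsilon>) * indicator unit_disk z) \<partial>lborel)"
    proof (intro nn_integral_mono)
      fix z :: complex
      have "cmod (deriv u z) powr p * (1 - cmod z) powr (s - \<kappa> * p) \<le> K powr (p - 2) * ((cmod (deriv u z))\<^sup>2 * (1 - cmod z) powr \<epsilon>)"
        if z: "z \<in> unit_disk"
      proof (cases "deriv u z = 0")
        case False
        define d where "d = cmod (deriv u z)"
        define x where "x = 1 - cmod z"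
        have d: "0 < d" and x: "0 < x" using False z by (auto simp: d_def x_def)
        have "d powr p = d powr (p - 2) * d\<^sup>2" using d powr_add[of d "p - 2" 2] by simp
        also have "d powr (p - 2) \<le> (K * x powr (- 1 - \<kappa>)) powr (p - 2)"
          using le[of z] z True d by (intro powr_mono2) (auto simp: d_def x_def)
        also have "\<dots> = K powr (p - 2) * x powr ((- 1 - \<kappa>) * (p - 2))"
          using K x by (simp add: powr_mult powr_powr)
        finally have "d powr p * x powr (s - \<kappa> * p) \<le> K powr (p - 2) * x powr ((- 1 - \<kappa>) * (p - 2)) * d\<^sup>2 * x powr (s - \<kappa> * p)"
          by (simp add: mult_right_mono)
        also have "\<dots> = K powr (p - 2) * (d\<^sup>2 * (x powr ((- 1 - \<kappa>) * (p - 2)) * x powr (s - \<kappa> * p)))"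
          by (simp add: mult_ac)
        also have "x powr ((- 1 - \<kappa>) * (p - 2)) * x powr (s - \<kappa> * p) = x powr \<epsilon>"
          by (simp add: powr_add[symmetric] \<epsilon>_def q_def algebra_simps)
        finally show ?thesis by (simp add: d_def x_def)
      qed (use ps in simp)
      then show "ennreal (cmod (deriv u z) powr p * (1 - cmod z) powr (s - \<kappa> * p)) * indicator unit_disk z
        \<le> ennreal (K powr (p - 2)) * (ennreal ((cmod (deriv u z))\<^sup>2 * (1 - cmod z) powr \<epsilon>) * indicator unit_disk z)"
        by (cases "z \<in> unit_disk") (auto simp: ennreal_mult[symmetric] ennreal_leI)
    qed
    also have "\<dots> = ennreal (K powr (p - 2)) * (\<integral>\<^sup>+z\<in>unit_disk. ennreal ((cmod (deriv u z))\<^sup>2 * (1 - cmod z) powr \<epsilon>) \<partial>lborel)"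
      using measurable_on_disk[OF cont] by (intro nn_integral_cmult) auto
    also have "\<dots> \<le> ennreal (K powr (p - 2)) * ennreal (C * K\<^sup>2)"
      unfolding C_def using K by (intro mult_left_mono nn_integral_deriv_square_le u \<kappa> \<epsilon> le) auto
    also have "\<dots> = ennreal (C * K powr p)"
      using K C powr_add[of K "p - 2" 2] by (simp add: ennreal_mult[symmetric] mult_ac)
    finally show "(\<integral>\<^sup>+z\<in>unit_disk. ennreal (cmod (deriv u z) powr p * (1 - cmod z) powr (s - \<kappa> * p)) \<partial>lborel) \<le> ennreal (C * K powr p)" .
  qed
next
  case False
  note ps = admissible_range[OF adm]
  define \<kappa> where "\<kappa> = (2 - p) / (16 * p)"
  have \<kappa>: "0 < \<kappa>" "\<kappa> \<le> 1" using False ps by (auto simp: \<kappa>_def field_simps)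
  \<comment> \<open>The solution of
    \<open>(\<epsilon> + 1 / 2) / 2 * p - 1 / 2 = s - \<kappa> * p\<close>, which makes the
    exponents below fit. With \<open>\<kappa> * p = (2 - p) / 16\<close>, the requirement
    \<open>2 * \<kappa> < \<epsilon>\<close> follows from \<open>0 \<le> s\<close>.\<close>
  define \<epsilon> where "\<epsilon> = 2 / p * (s - \<kappa> * p + (2 - p) / 4)"
  have kp: "\<kappa> * p = (2 - p) / 16" using ps by (simp add: \<kappa>_def)
  have "\<kappa> * p < s - \<kappa> * p + (2 - p) / 4" 
  proof -
    have "t < s - t + (2 - p) / 4" if "t = (2 - p) / 16" for t
      using that False ps(3) by (simp add: field_simps)
    then show ?thesis using kp by blast
  qed
  then have "2 / p * (\<kappa> * p) < \<epsilon>" unfolding \<epsilon>_def using ps by (intro mult_strict_left_mono) auto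
  then have \<epsilon>: "2 * \<kappa> < \<epsilon>" using ps by simp
  define C1 where "C1 = pi * (2 powr \<kappa> / \<kappa>)\<^sup>2 / (1 - 2 powr (2 * \<kappa> - \<epsilon>))"
  have "2 powr (2 * \<kappa> - \<epsilon>) < (1::real)" using \<epsilon> powr_less_mono[of "2 * \<kappa> - \<epsilon>" 0 2] by simp
  then have C1: "0 < C1" using \<kappa> by (simp add: C1_def)
  define C2 where "C2 = 2 powr (- (- 1 / 2)) * 2 * pi / (1 - 2 powr (- (- 1 / 2) - 1))"
  have "2 powr (- (- 1 / 2) - 1) < (1::real)" using powr_less_mono[of "- (- 1 / 2) - 1" 0 "2::real"] by simp
  then have C2: "0 < C2" by (simp add: C2_def)
  show thesis
  proof (rule that[OF \<kappa>, of "C1 + C2"], use C1 C2 in simp, intro allI impI)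
    fix u K assume u: "u holomorphic_on unit_disk" "inj_on u unit_disk" and K: "0 < (K::real)"
      and "\<forall>w. cmod w < 1 \<longrightarrow> cmod (deriv u w) \<le> K * (1 - cmod w) powr (- 1 - \<kappa>)"
    then have le: "\<And>w. cmod w < 1 \<Longrightarrow> cmod (deriv u w) \<le> K * (1 - cmod w) powr (- 1 - \<kappa>)" by blast
    have cont: "continuous_on unit_disk (\<lambda>z. (cmod (deriv u z))\<^sup>2 * (1 - cmod z) powr \<epsilon>)"
      using u(1) by (intro continuous_on_mult continuous_on_one_minus_powr continuous_intros
          holomorphic_on_imp_continuous_on holomorphic_deriv) auto
    define c1 where "c1 = K powr (p - 2)"
    define c2 where "c2 = K powr p"
    have "(\<integral>\<^sup>+z\<in>unit_disk. ennreal (cmod (deriv u z) powr p * (1 - cmod z) powr (s - \<kappa> * p)) \<partial>lborel)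
      \<le> (\<integral>\<^sup>+z. ennreal c1 * (ennreal ((cmod (deriv u z))\<^sup>2 * (1 - cmod z) powr \<epsilon>) * indicator unit_disk z) +
             ennreal c2 * (ennreal ((1 - cmod z) powr (- 1 / 2)) * indicator unit_disk z) \<partial>lborel)"
    proof (intro nn_integral_mono)
      fix z :: complex
      have "cmod (deriv u z) powr p * (1 - cmod z) powr (s - \<kappa> * p)
        \<le> c1 * ((cmod (deriv u z))\<^sup>2 * (1 - cmod z) powr \<epsilon>) + c2 * (1 - cmod z) powr (- 1 / 2)"
        if z: "z \<in> unit_disk"
      proof -
        define d where "d = cmod (deriv u z)"
        define x where "x = 1 - cmod z"
        define X where "X = d / K"
        have d: "0 \<le> d" and x: "0 < x" using z by (auto simp: d_def x_def)
        have X: "0 \<le> X" using d K by (simp add: X_def)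
        have dX: "d = K * X" using K by (simp add: X_def)
        \<comment> \<open>Scaled such that, after multiplication by \<open>x powr (- 1 / 2)\<close>,
          the power \<open>p\<close> of \<open>Y\<close> carries the weight of the claim and its
          square the weight \<open>x powr \<epsilon>\<close> of the area estimate.\<close>
        define Y where "Y = X * x powr ((\<epsilon> + 1 / 2) / 2)"
        have Y: "0 \<le> Y" using X by (simp add: Y_def)
        have "Y powr p \<le> (1 - p / 2) + p / 2 * Y\<^sup>2"
          using Y ps False by (intro powr_le_Young) auto
        also have "\<dots> \<le> 1 + Y\<^sup>2"
        proof -
          have "p / 2 * Y\<^sup>2 \<le> 1 * Y\<^sup>2" using False by (intro mult_right_mono) auto
          then show ?thesis using ps by simp
        qed
        finally have "Y powr p * x powr (- 1 / 2) \<le> (1 + Y\<^sup>2) * x powr (- 1 / 2)"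
          by (intro mult_right_mono) auto
        moreover have "Y powr p * x powr (- 1 / 2) = X powr p * x powr (s - \<kappa> * p)"
        proof -
          have "(\<epsilon> + 1 / 2) / 2 * p + (- 1 / 2) = s - \<kappa> * p"
            using ps by (simp add: \<epsilon>_def field_simps)
          then show ?thesis
            using X x by (simp add: Y_def powr_mult powr_powr mult.assoc powr_add[symmetric])
        qed
        moreover have "Y\<^sup>2 * x powr (- 1 / 2) = X\<^sup>2 * x powr \<epsilon>"
        proof -
          have "(x powr ((\<epsilon> + 1 / 2) / 2))\<^sup>2 = x powr (\<epsilon> + 1 / 2)"
            using x by (simp add: power2_eq_square powr_add[symmetric])
          then show ?thesis by (simp add: Y_def power_mult_distrib mult.assoc powr_add[symmetric])
        qed
        ultimately have "X powr p * x powr (s - \<kappa> * p) \<le> x powr (- 1 / 2) + X\<^sup>2 * x powr \<epsilon>"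
          by (simp add: distrib_right)
        then have le': "K powr p * (X powr p * x powr (s - \<kappa> * p)) \<le> K powr p * (x powr (- 1 / 2) + X\<^sup>2 * x powr \<epsilon>)"
          by (intro mult_left_mono) auto
        have e1: "d powr p * x powr (s - \<kappa> * p) = K powr p * (X powr p * x powr (s - \<kappa> * p))"
          using K X by (simp add: dX powr_mult)
        have e2: "c1 * (d\<^sup>2 * x powr \<epsilon>) = K powr p * (X\<^sup>2 * x powr \<epsilon>)"
          using K powr_add[of K "p - 2" 2] by (simp add: c1_def dX power_mult_distrib mult_ac)
        show ?thesis
          using le' unfolding d_def[symmetric] x_def[symmetric] c2_def e1 e2
          by (simp only: distrib_left add.commute)
      qed
      then show "ennreal (cmod (deriv u z) powr p * (1 - cmod z) powr (s - \<kappa> * p)) * indicator unit_disk z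
        \<le> ennreal c1 * (ennreal ((cmod (deriv u z))\<^sup>2 * (1 - cmod z) powr \<epsilon>) * indicator unit_disk z) +
             ennreal c2 * (ennreal ((1 - cmod z) powr (- 1 / 2)) * indicator unit_disk z)"
        by (cases "z \<in> unit_disk")
          (auto simp: ennreal_mult[symmetric] ennreal_plus[symmetric] c1_def c2_def simp del: ennreal_plus intro!: ennreal_leI)
    qed
    also have "\<dots> = ennreal c1 * (\<integral>\<^sup>+z\<in>unit_disk. ennreal ((cmod (deriv u z))\<^sup>2 * (1 - cmod z) powr \<epsilon>) \<partial>lborel) +
        ennreal c2 * (\<integral>\<^sup>+z\<in>unit_disk. ennreal ((1 - cmod z) powr (- 1 / 2)) \<partial>lborel)"
      using measurable_on_disk[OF cont] measurable_on_disk[OF continuous_on_one_minus_powr[of "- 1 / 2"]]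
      by (subst nn_integral_add) (auto simp: nn_integral_cmult)
    also have "\<dots> \<le> ennreal c1 * ennreal (C1 * K\<^sup>2) + ennreal c2 * ennreal C2"
    proof (intro add_mono mult_left_mono)
      show "(\<integral>\<^sup>+z\<in>unit_disk. ennreal ((cmod (deriv u z))\<^sup>2 * (1 - cmod z) powr \<epsilon>) \<partial>lborel) \<le> ennreal (C1 * K\<^sup>2)"
        unfolding C1_def using K by (intro nn_integral_deriv_square_le u \<kappa> \<epsilon> le) auto
      show "(\<integral>\<^sup>+z\<in>unit_disk. ennreal ((1 - cmod z) powr (- 1 / 2)) \<partial>lborel) \<le> ennreal C2"
        unfolding C2_def by (rule nn_integral_disk_powr) auto
    qed auto
    also have "\<dots> = ennreal ((C1 + C2) * K powr p)"
    proof -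
      have "c1 * (C1 * K\<^sup>2) + c2 * C2 = (C1 + C2) * K powr p"
        using K powr_add[of K "p - 2" 2] by (simp add: c1_def c2_def algebra_simps)
      moreover have "0 \<le> c1" "0 \<le> c2" by (auto simp: c1_def c2_def)
      ultimately show ?thesis using C1 C2
        by (simp add: ennreal_mult[symmetric] ennreal_plus[symmetric] del: ennreal_plus)
    qed
    finally show "(\<integral>\<^sup>+z\<in>unit_disk. ennreal (cmod (deriv u z) powr p * (1 - cmod z) powr (s - \<kappa> * p)) \<partial>lborel) \<le> ennreal ((C1 + C2) * K powr p)" .
  qed
qed

lemma holomorphic_isCont:
  assumes "f holomorphic_on unit_disk" "cmod z < 1"
  shows "isCont f z"
  using continuous_on_interior[OF holomorphic_on_imp_continuous_on[OF assms(1)], of z] assms(2) by simp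

text \<open>As \<open>a\<close> tends to the circle, so does \<open>disk_aut a z\<close>, and the
  dependence on \<open>z\<close> costs only one power of \<open>1 - cmod z\<close>.\<close>

lemma one_minus_norm_disk_aut_le:
  assumes "cmod a < 1" "cmod z < 1"
  shows "(1 - (cmod (disk_aut a z))\<^sup>2) * (1 - cmod z) \<le> 2 * (1 - (cmod a)\<^sup>2)"
proof -
  define D where "D = cmod (1 - cnj a * z)"
  have az: "cmod a * cmod z \<le> cmod z" using assms by (auto simp: mult_left_le_one_le)
  have lo: "1 - cmod z \<le> D"
    using norm_triangle_ineq2[of 1 "cnj a * z"] az by (simp add: norm_mult D_def)
  have D: "0 < D" using one_minus_cnj_mult_nonzero[OF assms] by (simp add: D_def)
  have a: "0 < 1 - (cmod a)\<^sup>2" using one_minus_norm_pos assms by blast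
  have "(1 - (cmod z)\<^sup>2) * (1 - cmod z) \<le> (2 * (1 - cmod z)) * (1 - cmod z)"
    using assms one_minus_norm_le(2)[of z] by (intro mult_right_mono) auto
  also have "\<dots> = 2 * (1 - cmod z)\<^sup>2" by (simp add: power2_eq_square)
  also have "\<dots> \<le> 2 * D\<^sup>2" using lo assms by (intro mult_left_mono power_mono) auto
  finally have "(1 - (cmod z)\<^sup>2) * (1 - cmod z) / D\<^sup>2 \<le> 2" using D by (simp add: field_simps)
  then have "(1 - (cmod a)\<^sup>2) * ((1 - (cmod z)\<^sup>2) * (1 - cmod z) / D\<^sup>2) \<le> (1 - (cmod a)\<^sup>2) * 2"
    using a by (intro mult_left_mono) auto
  then show ?thesis
    unfolding one_minus_norm_disk_aut[OF assms] D_def by (simp add: mult_ac)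
qed

text \<open>The form in which the area estimate is used below: \<open>\<gamma>\<close> is a fixed
  injective function that dominates \<open>f\<close> in the derivative, and both bounds may lose a
  power \<open>\<kappa>\<close> when seen from \<open>a\<close>. The weighted bound is applied to
  \<open>\<gamma> \<circ> disk_aut a\<close>; the hypothesis on \<open>\<gamma>\<close> becomes a
  bound on its derivative by invariance of the hyperbolic metric, and the loss in the hypothesis on
  \<open>f\<close> changes the weight to \<open>s - \<kappa> * p\<close>.\<close>

lemma injective_mob_energy_bound:
  assumes adm: "admissible p s"
  obtains \<kappa> C where "0 < \<kappa>" "\<kappa> \<le> 1" "0 < C"
    "\<forall>f \<gamma> a K M. f holomorphic_on unit_disk \<longrightarrow> \<gamma> holomorphic_on unit_disk \<longrightarrow> inj_on \<gamma> unit_disk \<longrightarrow>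
       cmod a < 1 \<longrightarrow> 0 < K \<longrightarrow> 0 < M \<longrightarrow>
       (\<forall>z. cmod z < 1 \<longrightarrow> cmod (deriv \<gamma> (disk_aut a z)) * (1 - (cmod (disk_aut a z))\<^sup>2) \<le> K * (1 - cmod z) powr (- \<kappa>)) \<longrightarrow>
       (\<forall>z. cmod z < 1 \<longrightarrow> cmod (deriv f (disk_aut a z)) \<le> M * (1 - cmod z) powr (- \<kappa>) * cmod (deriv \<gamma> (disk_aut a z))) \<longrightarrow>
       mob_energy p s f a \<le> ennreal ((C * M * K) powr p)"
proof -
  note ps = admissible_range[OF adm]
  obtain \<kappa> C where \<kappa>: "0 < \<kappa>" "\<kappa> \<le> 1" and C: "0 < C"
    and bound: "\<forall>u K. u holomorphic_on unit_disk \<longrightarrow> inj_on u unit_disk \<longrightarrow> 0 < K \<longrightarrow>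
       (\<forall>w. cmod w < 1 \<longrightarrow> cmod (deriv u w) \<le> K * (1 - cmod w) powr (- 1 - \<kappa>)) \<longrightarrow>
       (\<integral>\<^sup>+z\<in>unit_disk. ennreal (cmod (deriv u z) powr p * (1 - cmod z) powr (s - \<kappa> * p)) \<partial>lborel) \<le> ennreal (C * K powr p)"
    by (rule injective_weighted_energy_bound[OF adm]) (erule (3) that)
  \<comment> \<open>The factor \<open>2 powr s\<close> comes from replacing
    \<open>1 - (cmod z)\<^sup>2\<close> by \<open>2 * (1 - cmod z)\<close>.\<close>
  define C' where "C' = (2 powr s * C) powr (1 / p)"
  have C': "0 < C'" "C' powr p = 2 powr s * C" using C ps by (auto simp: C'_def powr_powr)
  show thesis
  proof (rule that[OF \<kappa> C'(1)], intro allI impI)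
    fix f \<gamma> a K M
    assume f: "f holomorphic_on unit_disk" and \<gamma>: "\<gamma> holomorphic_on unit_disk" "inj_on \<gamma> unit_disk"
      and a: "cmod a < 1" and K: "0 < (K::real)" and M: "0 < (M::real)"
      and h1: "\<forall>z. cmod z < 1 \<longrightarrow> cmod (deriv \<gamma> (disk_aut a z)) * (1 - (cmod (disk_aut a z))\<^sup>2) \<le> K * (1 - cmod z) powr (- \<kappa>)"
      and h2: "\<forall>z. cmod z < 1 \<longrightarrow> cmod (deriv f (disk_aut a z)) \<le> M * (1 - cmod z) powr (- \<kappa>) * cmod (deriv \<gamma> (disk_aut a z))"
    note le1 = h1[rule_format] and le2 = h2[rule_format]
    define u where "u z = \<gamma> (disk_aut a z)" for z
    have u: "u holomorphic_on unit_disk"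
      unfolding u_def by (rule holomorphic_compose_disk_aut[OF \<gamma>(1) a])
    have inj: "inj_on u unit_disk"
    proof -
      have "inj_on (\<gamma> \<circ> disk_aut a) unit_disk"
        using a \<gamma>(2) by (intro comp_inj_on inj_on_disk_aut) auto
      then show ?thesis by (simp add: u_def[abs_def] o_def)
    qed
    have du: "cmod (deriv u z) = cmod (deriv \<gamma> (disk_aut a z)) * cmod (deriv (disk_aut a) z)" if "cmod z < 1" for z
      unfolding u_def using deriv_compose_disk_aut[OF \<gamma>(1) a that] by (simp add: norm_mult)
    have ub: "cmod (deriv u z) \<le> K * (1 - cmod z) powr (- 1 - \<kappa>)" if z: "cmod z < 1" for z
    proof -
      have "cmod (deriv u z) * (1 - cmod z) \<le> cmod (deriv u z) * (1 - (cmod z)\<^sup>2)"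
        using z one_minus_norm_le(1)[of z] by (intro mult_left_mono) auto
      also have "\<dots> = cmod (deriv \<gamma> (disk_aut a z)) * (1 - (cmod (disk_aut a z))\<^sup>2)"
        unfolding du[OF z] mult.assoc norm_deriv_disk_aut[OF a z] ..
      also have "\<dots> \<le> K * (1 - cmod z) powr (- \<kappa>)" by (rule le1[OF z])
      also have "(1 - cmod z) powr (- \<kappa>) = (1 - cmod z) powr (- 1 - \<kappa>) * (1 - cmod z)"
        using z powr_add[of "1 - cmod z" "- 1 - \<kappa>" 1] by simp
      finally show ?thesis using z by (simp add: mult.assoc[symmetric])
    qed
    have "mob_energy p s f a \<le> (\<integral>\<^sup>+z. ennreal (M powr p * 2 powr s) *
        (ennreal (cmod (deriv u z) powr p * (1 - cmod z) powr (s - \<kappa> * p)) * indicator unit_disk z) \<partial>lborel)"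
      unfolding mob_energy_def energy_def
    proof (intro nn_integral_mono)
      fix z :: complex
      have "Dps_integrand p s (\<lambda>z. f (disk_aut a z)) z \<le>
        M powr p * 2 powr s * (cmod (deriv u z) powr p * (1 - cmod z) powr (s - \<kappa> * p))" if z: "cmod z < 1"
      proof -
        define x where "x = 1 - cmod z"
        have x: "0 < x" using z by (simp add: x_def)
        have "cmod (deriv (\<lambda>z. f (disk_aut a z)) z) = cmod (deriv f (disk_aut a z)) * cmod (deriv (disk_aut a) z)"
          using deriv_compose_disk_aut[OF f a z] by (simp add: norm_mult)
        also have "\<dots> \<le> (M * x powr (- \<kappa>) * cmod (deriv \<gamma> (disk_aut a z))) * cmod (deriv (disk_aut a) z)"
          unfolding x_def by (intro mult_right_mono le2 z) auto
        also have "\<dots> = M * x powr (- \<kappa>) * cmod (deriv u z)" by (simp add: du[OF z])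
        finally have "cmod (deriv (\<lambda>z. f (disk_aut a z)) z) powr p \<le> (M * x powr (- \<kappa>) * cmod (deriv u z)) powr p"
          using ps by (intro powr_mono2) auto
        also have "\<dots> = M powr p * x powr (- \<kappa> * p) * cmod (deriv u z) powr p"
          using M x by (simp add: powr_mult powr_powr)
        finally have 1: "cmod (deriv (\<lambda>z. f (disk_aut a z)) z) powr p \<le> M powr p * x powr (- \<kappa> * p) * cmod (deriv u z) powr p" .
        have "(1 - (cmod z)\<^sup>2) powr s \<le> (2 * x) powr s"
          using one_minus_norm_le(2)[of z] one_minus_norm_pos[OF z] ps unfolding x_def by (intro powr_mono2) auto
        also have "\<dots> = 2 powr s * x powr s" using x by (simp add: powr_mult)
        finally have 2: "(1 - (cmod z)\<^sup>2) powr s \<le> 2 powr s * x powr s" .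
        have "Dps_integrand p s (\<lambda>z. f (disk_aut a z)) z \<le> (M powr p * x powr (- \<kappa> * p) * cmod (deriv u z) powr p) * (2 powr s * x powr s)"
          unfolding Dps_integrand_def by (intro mult_mono 1 2) auto
        also have "\<dots> = M powr p * 2 powr s * (cmod (deriv u z) powr p * (x powr (- \<kappa> * p) * x powr s))"
          by (simp add: mult_ac)
        also have "x powr (- \<kappa> * p) * x powr s = x powr (s - \<kappa> * p)"
          by (simp add: powr_add[symmetric])
        finally show ?thesis by (simp add: x_def)
      qed
      then show "ennreal (Dps_integrand p s (\<lambda>z. f (disk_aut a z)) z) * indicator unit_disk z \<le>
        ennreal (M powr p * 2 powr s) * (ennreal (cmod (deriv u z) powr p * (1 - cmod z) powr (s - \<kappa> * p)) * indicator unit_disk z)"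
        by (cases "z \<in> unit_disk") (auto simp: ennreal_mult[symmetric] ennreal_leI)
    qed
    also have "\<dots> = ennreal (M powr p * 2 powr s) * (\<integral>\<^sup>+z\<in>unit_disk. ennreal (cmod (deriv u z) powr p * (1 - cmod z) powr (s - \<kappa> * p)) \<partial>lborel)"
    proof (rule nn_integral_cmult)
      have "continuous_on unit_disk (deriv u)"
        using u by (intro holomorphic_on_imp_continuous_on holomorphic_deriv) auto
      then have "continuous_on unit_disk (\<lambda>z. cmod (deriv u z) powr p * (1 - cmod z) powr (s - \<kappa> * p))"
        using ps by (intro continuous_on_mult continuous_on_one_minus_powr continuous_on_powr' continuous_on_norm continuous_on_const) auto
      from measurable_on_disk[OF this]
      show "(\<lambda>z. ennreal (cmod (deriv u z) powr p * (1 - cmod z) powr (s - \<kappa> * p)) * indicator unit_disk z) \<in> borel_measurable lborel" by simp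
    qed
    also have "\<dots> \<le> ennreal (M powr p * 2 powr s) * ennreal (C * K powr p)"
      using bound u inj K ub by (intro mult_left_mono) auto
    also have "\<dots> = ennreal ((C' * M * K) powr p)"
      using M K C C' by (simp add: powr_mult ennreal_mult[symmetric] mult_ac)
    finally show "mob_energy p s f a \<le> ennreal ((C' * M * K) powr p)" .
  qed
qed

lemma tendsto_one_minus_norm_at_unit_circle: "((\<lambda>a. 1 - (cmod a)\<^sup>2) \<longlongrightarrow> 0) at_unit_circle"
proof (rule tendstoI)
  fix \<epsilon> :: real assume \<epsilon>: "0 < \<epsilon>"
  have "dist (1 - (cmod a)\<^sup>2) 0 < \<epsilon>" if "1 - \<epsilon> / 2 < cmod a" "cmod a < 1" for a
    using one_minus_norm_le(2)[of a] one_minus_norm_pos[of a] that by (simp add: dist_norm)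
  then show "\<forall>\<^sub>F a in at_unit_circle. dist (1 - (cmod a)\<^sup>2) 0 < \<epsilon>"
    unfolding eventually_at_unit_circle using \<epsilon> by (intro exI[of _ "1 - \<epsilon> / 2"]) auto
qed

text \<open>Here \<open>\<gamma>\<close> is the identity. Its constant \<open>K\<close> tends to
  zero with \<open>1 - (cmod a)\<^sup>2\<close>: as \<open>\<kappa> \<le> 1\<close>, the number
  \<open>y = 1 - (cmod (disk_aut a z))\<^sup>2\<close> is at most \<open>y powr \<kappa>\<close>, to
  which \<open>one_minus_norm_disk_aut_le\<close> applies.\<close>

lemma bounded_deriv_in_m0:
  assumes adm: "admissible p s" and f: "f holomorphic_on unit_disk"
    and le: "\<And>z. cmod z < 1 \<Longrightarrow> cmod (deriv f z) \<le> M"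
  shows "f \<in> m0 p s"
proof -
  obtain \<kappa> C where \<kappa>: "0 < \<kappa>" "\<kappa> \<le> 1" and C: "0 < C"
    and bound: "\<forall>f \<gamma> a K M. f holomorphic_on unit_disk \<longrightarrow> \<gamma> holomorphic_on unit_disk \<longrightarrow> inj_on \<gamma> unit_disk \<longrightarrow>
       cmod a < 1 \<longrightarrow> 0 < K \<longrightarrow> 0 < M \<longrightarrow>
       (\<forall>z. cmod z < 1 \<longrightarrow> cmod (deriv \<gamma> (disk_aut a z)) * (1 - (cmod (disk_aut a z))\<^sup>2) \<le> K * (1 - cmod z) powr (- \<kappa>)) \<longrightarrow>
       (\<forall>z. cmod z < 1 \<longrightarrow> cmod (deriv f (disk_aut a z)) \<le> M * (1 - cmod z) powr (- \<kappa>) * cmod (deriv \<gamma> (disk_aut a z))) \<longrightarrow>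
       mob_energy p s f a \<le> ennreal ((C * M * K) powr p)"
    by (rule injective_mob_energy_bound[OF adm]) (erule (3) that)
  define N where "N = max M 1"
  have N: "0 < N" "M \<le> N" by (auto simp: N_def)
  have main: "mob_energy p s f a \<le> ennreal ((C * N * (2 * (1 - (cmod a)\<^sup>2)) powr \<kappa>) powr p)" if a: "cmod a < 1" for a
  proof (rule bound[rule_format, OF f, where \<gamma> = "\<lambda>z. z"])
    have a': "0 < 1 - (cmod a)\<^sup>2" using one_minus_norm_pos[OF a] .
    then show "0 < (2 * (1 - (cmod a)\<^sup>2)) powr \<kappa>" by simp
    fix z assume z: "cmod z < 1"
    define y where "y = 1 - (cmod (disk_aut a z))\<^sup>2"
    define x where "x = 2 * (1 - (cmod a)\<^sup>2) / (1 - cmod z)"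
    have y: "0 < y" "y \<le> 1" using one_minus_norm_pos[OF cmod_disk_aut_less[OF a z]] by (auto simp: y_def)
    have yx: "y \<le> x" using one_minus_norm_disk_aut_le[OF a z] z by (simp add: x_def y_def field_simps)
    have "y = y powr 1" using y by simp
    also have "\<dots> \<le> y powr \<kappa>" using y \<kappa> by (intro powr_mono') auto
    also have "\<dots> \<le> x powr \<kappa>" using y yx \<kappa> by (intro powr_mono2) auto
    also have "\<dots> = (2 * (1 - (cmod a)\<^sup>2)) powr \<kappa> * (1 - cmod z) powr (- \<kappa>)"
      using a' z by (simp add: x_def powr_divide powr_minus divide_simps)
    finally show "cmod (deriv (\<lambda>z. z) (disk_aut a z)) * (1 - (cmod (disk_aut a z))\<^sup>2) \<le> (2 * (1 - (cmod a)\<^sup>2)) powr \<kappa> * (1 - cmod z) powr (- \<kappa>)"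
      by (simp add: y_def)
    have "cmod (deriv f (disk_aut a z)) \<le> N" using le[of "disk_aut a z"] a z N by simp
    also have "\<dots> \<le> N * (1 - cmod z) powr (- \<kappa>)"
      using N z \<kappa> by (simp add: powr_minus field_simps powr_le1)
    finally show "cmod (deriv f (disk_aut a z)) \<le> N * (1 - cmod z) powr (- \<kappa>) * cmod (deriv (\<lambda>z. z) (disk_aut a z))"
      by simp
  qed (use a N in \<open>auto intro!: holomorphic_intros\<close>)
  have ps: "0 < p" using admissible_range[OF adm] by simp
  have "f \<in> M0 p s"
    unfolding M0_iff[OF adm]
  proof (intro conjI f exI[of _ "C * N * 2 powr \<kappa>"] allI impI)
    fix a assume a: "cmod (a::complex) < 1"
    have "(2 * (1 - (cmod a)\<^sup>2)) powr \<kappa> \<le> 2 powr \<kappa>"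
      using \<kappa> one_minus_norm_pos[OF a] by (intro powr_mono2) auto
    then have "C * N * (2 * (1 - (cmod a)\<^sup>2)) powr \<kappa> \<le> C * N * 2 powr \<kappa>"
      using C N by (intro mult_left_mono) auto
    then have "(C * N * (2 * (1 - (cmod a)\<^sup>2)) powr \<kappa>) powr p \<le> (C * N * 2 powr \<kappa>) powr p"
      using C N ps by (intro powr_mono2[of p]) auto
    then show "mob_energy p s f a \<le> ennreal ((C * N * 2 powr \<kappa>) powr p)"
      using main[OF a] ennreal_leI order_trans by blast
  qed (use C N in auto)
  moreover have "\<exists>r<1. \<forall>a. r < cmod a \<and> cmod a < 1 \<longrightarrow> mob_energy p s f a \<le> ennreal (\<epsilon> powr p)" if \<epsilon>: "0 < \<epsilon>" for \<epsilon>
  proof -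
    have "((\<lambda>a. C * N * (2 * (1 - (cmod a)\<^sup>2)) powr \<kappa>) \<longlongrightarrow> C * N * (2 * 0) powr \<kappa>) at_unit_circle"
    proof (intro tendsto_mult tendsto_const tendsto_powr' tendsto_one_minus_norm_at_unit_circle disjI2 conjI)
      show "\<forall>\<^sub>F a in at_unit_circle. 0 \<le> 2 * (1 - (cmod a)\<^sup>2)"
        unfolding eventually_at_unit_circle
        using one_minus_norm_pos by (intro exI[of _ 0]) (auto intro: less_imp_le)
    qed (use \<kappa> in auto)
    then have "\<forall>\<^sub>F a in at_unit_circle. C * N * (2 * (1 - (cmod a)\<^sup>2)) powr \<kappa> < \<epsilon>"
      using \<epsilon> by (auto dest: order_tendstoD)
    then obtain r where r: "r < 1" "\<And>a. r < cmod a \<Longrightarrow> cmod a < 1 \<Longrightarrow> C * N * (2 * (1 - (cmod a)\<^sup>2)) powr \<kappa> < \<epsilon>"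
      unfolding eventually_at_unit_circle by blast
    have "mob_energy p s f a \<le> ennreal (\<epsilon> powr p)" if "r < cmod a" "cmod a < 1" for a
    proof -
      have "(C * N * (2 * (1 - (cmod a)\<^sup>2)) powr \<kappa>) powr p \<le> \<epsilon> powr p"
        using r(2)[OF that] C N ps by (intro powr_mono2[of p]) auto
      then show ?thesis using main[OF that(2)] ennreal_leI order_trans by blast
    qed
    then show ?thesis using r(1) by blast
  qed
  ultimately show ?thesis unfolding m0_iff[OF adm] by blast
qed

text \<open>At \<open>a = 0\<close> the constant of \<open>mob_energy_le_energy\<close> is
  \<open>1\<close>, and \<open>disk_aut 0\<close> is an involution.\<close>

lemma mob_energy_0:
  assumes adm: "admissible p s" and f: "f holomorphic_on unit_disk"
  shows "mob_energy p s f 0 = energy p s f"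
proof (rule antisym)
  show "mob_energy p s f 0 \<le> energy p s f"
    using mob_energy_le_energy[OF adm f, of 0] by simp
  have "energy p s f = mob_energy p s (\<lambda>z. f (disk_aut 0 z)) 0"
    unfolding mob_energy_def by (intro energy_cong) simp
  also have "\<dots> \<le> energy p s (\<lambda>z. f (disk_aut 0 z))"
    using mob_energy_le_energy[OF adm holomorphic_compose_disk_aut[OF f], of 0 0] by simp
  finally show "energy p s f \<le> mob_energy p s f 0" by (simp add: mob_energy_def)
qed

subsection \<open>Strong continuity on the little space and of averages\<close>

context disk_semigroup
begin

text \<open>The flow is close to the identity only on compact sets, which says nothing directly
  about points near the circle. However, by Brouwer's theorem \<open>\<phi> t\<close> takes every
  value in \<open>cball 0 R\<close> already on \<open>cball 0 R2\<close>, being close to the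
  identity there. By injectivity no point outside \<open>cball 0 R2\<close> can be mapped into
  \<open>cball 0 R\<close>.\<close>

lemma boundary_stays_near_boundary:
  assumes R1: "R1 < 1"
  obtains R2 \<delta> where "R2 < 1" "0 < \<delta>"
    "\<And>t a. 0 \<le> t \<Longrightarrow> t < \<delta> \<Longrightarrow> R2 < cmod a \<Longrightarrow> cmod a < 1 \<Longrightarrow> R1 < cmod (\<phi> t a)"
proof -
  define R where "R = max R1 0"
  have R: "0 \<le> R" "R < 1" "R1 \<le> R" using R1 by (auto simp: R_def)
  define R2 where "R2 = (1 + R) / 2"
  have R2: "R < R2" "R2 < 1" "0 < R2" using R by (auto simp: R2_def)
  obtain \<delta> where \<delta>: "0 < \<delta>" "\<And>t z. 0 \<le> t \<Longrightarrow> t < \<delta> \<Longrightarrow> cmod z \<le> R2 \<Longrightarrow> cmod (\<phi> t z - z) < R2 - R"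
    using uniformly_near_id[OF R2(2), of "R2 - R"] R2 by auto
  show ?thesis
  proof (rule that[OF R2(2) \<delta>(1)])
    fix t a assume t: "0 \<le> t" "t < \<delta>" and a: "R2 < cmod a" "cmod a < 1"
    show "R1 < cmod (\<phi> t a)"
    proof (rule ccontr)
      assume "\<not> R1 < cmod (\<phi> t a)"
      then have w: "cmod (\<phi> t a) \<le> R" using R by simp
      have "continuous_on (cball 0 R2) (\<phi> t)"
        using R2 by (intro holomorphic_on_imp_continuous_on holomorphic_on_subset[OF holomorphic[OF t(1)]]) auto
      then have "\<exists>z\<in>cball 0 R2. \<phi> t z = \<phi> t a"
      proof (rule brouwer_surjective_cball[where S = "{\<phi> t a}"])
        show "x + (y - \<phi> t y) \<in> cball 0 R2" if "x \<in> {\<phi> t a}" "y \<in> cball 0 R2" for x y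
          using \<delta>(2)[OF t, of y] that w norm_triangle_ineq[of x "y - \<phi> t y"] by (simp add: norm_minus_commute)
      qed (use R2 in auto)
      then obtain z where z: "z \<in> cball 0 R2" "\<phi> t z = \<phi> t a" by blast
      then have "z = a" using inj_onD[OF inj_on_flow[OF t(1)], of z a] a R2 by auto
      then show False using z a by simp
    qed
  qed
qed

lemma mob_energy_flow_le:
  assumes "admissible p s" "f holomorphic_on unit_disk" "0 \<le> t" "cmod a < 1"
  shows "mob_energy p s (\<lambda>z. f (\<phi> t z)) a \<le> mob_energy p s f (\<phi> t a)"
  by (rule mob_energy_compose_le[OF assms(1,2) holomorphic inj_on_flow in_disk]) (use assms in auto)

lemma tendsto_flow_0: "cmod z < 1 \<Longrightarrow> ((\<lambda>t. \<phi> t z) \<longlongrightarrow> z) (at_right 0)"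
proof (rule tendstoI)
  fix \<epsilon> :: real assume z: "cmod z < 1" and "0 < \<epsilon>"
  then obtain \<delta> where \<delta>: "0 < \<delta>" "\<And>t w. 0 \<le> t \<Longrightarrow> t < \<delta> \<Longrightarrow> cmod w \<le> cmod z \<Longrightarrow> cmod (\<phi> t w - w) < \<epsilon>"
    using uniformly_near_id[OF z] by metis
  then show "\<forall>\<^sub>F \<tau> in at_right 0. dist (\<phi> \<tau> z) z < \<epsilon>"
    unfolding eventually_at_right_field by (intro exI[of _ \<delta>]) (auto simp: dist_norm)
qed

lemma tendsto_deriv_flow_0:
  assumes z: "cmod z < 1"
  shows "((\<lambda>t. deriv (\<phi> t) z) \<longlongrightarrow> 1) (at_right 0)"
proof (rule tendstoI)
  fix \<epsilon> :: real assume "0 < \<epsilon>"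
  then obtain \<delta> where \<delta>: "0 < \<delta>" "\<And>t w. 0 \<le> t \<Longrightarrow> t < \<delta> \<Longrightarrow> cmod w \<le> cmod z \<Longrightarrow> cmod (deriv (\<phi> t) w - 1) < \<epsilon>"
    using deriv_near_1[OF z] by metis
  then show "\<forall>\<^sub>F \<tau> in at_right 0. dist (deriv (\<phi> \<tau>) z) 1 < \<epsilon>"
    unfolding eventually_at_right_field by (intro exI[of _ \<delta>]) (auto simp: dist_norm)
qed

text \<open>The contraction bounds the energy of \<open>f \<circ> \<phi> t\<close> by that of
  \<open>f\<close> seen from \<open>\<phi> t 0\<close>. This point tends to \<open>0\<close>, so the
  factor \<open>c\<close> from \<open>mob_energy_le_energy\<close> tends to \<open>1\<close>, as
  \<open>energy_diff_tendsto_0\<close> requires.\<close>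

lemma energy_flow_diff_tendsto_0:
  assumes adm: "admissible p s" and f: "f holomorphic_on unit_disk" and fin: "energy p s f < \<infinity>"
  shows "((\<lambda>t. energy p s (\<lambda>z. f (\<phi> t z) - f z)) \<longlongrightarrow> 0) (at_right 0)"
proof (rule tendsto_at_right_sequentially[of 0 1])
  fix S :: "nat \<Rightarrow> real" assume S: "\<And>n. 0 < S n" "S \<longlonglongrightarrow> 0"
  have Sf: "filterlim S (at_right 0) sequentially"
  proof -
    have "S n \<noteq> 0" for n using S(1)[of n] by simp
    then show ?thesis using S by (auto simp: filterlim_at)
  qed
  define c where "c n = ((1 + cmod (\<phi> (S n) 0)) / (1 - cmod (\<phi> (S n) 0))) powr (s - p + 2)" for n
  show "(\<lambda>n. energy p s (\<lambda>z. f (\<phi> (S n) z) - f z)) \<longlonglongrightarrow> 0"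
  proof (rule energy_diff_tendsto_0[OF _ f _ _ fin, where c = c])
    show "(\<lambda>z. f (\<phi> (S n) z)) holomorphic_on unit_disk" for n
      using S by (intro holomorphic_compose f) (simp add: less_imp_le)
    show "0 < p" using admissible_range[OF adm] by simp
    have "(\<lambda>n. \<phi> (S n) 0) \<longlonglongrightarrow> 0"
      by (rule filterlim_compose[OF tendsto_flow_0 Sf]) simp
    then have "c \<longlonglongrightarrow> ((1 + cmod 0) / (1 - cmod 0)) powr (s - p + 2)"
      unfolding c_def[abs_def] by (intro tendsto_powr tendsto_divide tendsto_add tendsto_diff tendsto_norm tendsto_const) auto
    then show "c \<longlonglongrightarrow> 1" by simp
    show "energy p s (\<lambda>z. f (\<phi> (S n) z)) \<le> ennreal (c n) * energy p s f" for n
    proof -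
      have t: "0 \<le> S n" using S(1)[of n] by simp
      have "energy p s (\<lambda>z. f (\<phi> (S n) z)) = mob_energy p s (\<lambda>z. f (\<phi> (S n) z)) 0"
        by (rule mob_energy_0[OF adm holomorphic_compose[OF f t], symmetric])
      also have "\<dots> \<le> mob_energy p s f (\<phi> (S n) 0)"
        by (rule mob_energy_flow_le[OF adm f t]) simp
      also have "\<dots> \<le> ennreal (c n) * energy p s f"
        unfolding c_def using t by (intro mob_energy_le_energy adm f in_disk) auto
      finally show ?thesis .
    qed
    fix z :: complex assume z: "z \<in> unit_disk"
    have cd: "isCont (deriv f) z"
      using z f by (intro holomorphic_isCont holomorphic_deriv) auto
    have "(\<lambda>n. deriv f (\<phi> (S n) z) * deriv (\<phi> (S n)) z) \<longlonglongrightarrow> deriv f z * 1"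
      using z by (intro tendsto_mult isCont_tendsto_compose[OF cd] filterlim_compose[OF tendsto_flow_0 Sf]
          filterlim_compose[OF tendsto_deriv_flow_0 Sf]) auto
    moreover have "deriv (\<lambda>z. f (\<phi> (S n) z)) z = deriv f (\<phi> (S n) z) * deriv (\<phi> (S n)) z" for n
      by (rule deriv_compose_holomorphic[OF f holomorphic in_disk]) (use S(1)[of n] z in auto)
    ultimately show "(\<lambda>n. deriv (\<lambda>z. f (\<phi> (S n) z)) z) \<longlonglongrightarrow> deriv f z" by simp
  qed
qed simp

text \<open>The norm consists of the seminorm and the value at \<open>0\<close>. The latter
  converges by continuity, so smallness of the energies uniformly in \<open>a\<close> is all there
  is to check.\<close>

lemma strong_cont_subspaceI:
  assumes adm: "admissible p s" and f: "f \<in> M0 p s"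
    and small: "\<And>\<epsilon>. 0 < \<epsilon> \<Longrightarrow> \<exists>\<delta>>0. \<forall>t a. 0 < t \<and> t < \<delta> \<and> cmod a < 1 \<longrightarrow>
        mob_energy p s (\<lambda>z. f (\<phi> t z) - f z) a \<le> ennreal (\<epsilon> powr p)"
  shows "f \<in> strong_cont_subspace \<phi> (M0 p s) (M0_norm p s)"
proof -
  have hol: "f holomorphic_on unit_disk" using f by (simp add: M0_iff[OF adm])
  have dh: "(\<lambda>z. f (\<phi> t z) - f z) holomorphic_on unit_disk" if "0 \<le> t" for t
    using that by (intro holomorphic_on_diff holomorphic_compose hol)
  have ev: "\<forall>\<^sub>F t in at_right 0. (\<lambda>z. f (\<phi> t z) - f z) \<in> M0 p s"
  proof -
    obtain \<delta> where \<delta>: "\<delta> > 0" "\<And>t a. 0 < t \<Longrightarrow> t < \<delta> \<Longrightarrow> cmod a < 1 \<Longrightarrow>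
        mob_energy p s (\<lambda>z. f (\<phi> t z) - f z) a \<le> ennreal (1 powr p)"
      using small[of 1] by auto
    have "(\<lambda>z. f (\<phi> t z) - f z) \<in> M0 p s" if "0 < t" "t < \<delta>" for t
      unfolding M0_iff[OF adm] using dh \<delta>(2)[OF that] that by (intro conjI exI[of _ 1]) auto
    then show ?thesis unfolding eventually_at_right_field using \<delta>(1) by blast
  qed
  have "((\<lambda>t. M0_norm p s (\<lambda>z. f (\<phi> t z) - f z)) \<longlongrightarrow> 0) (at_right 0)"
  proof (rule tendstoI)
    fix \<epsilon> :: real assume \<epsilon>: "0 < \<epsilon>"
    obtain \<delta> where \<delta>: "\<delta> > 0" "\<And>t a. 0 < t \<Longrightarrow> t < \<delta> \<Longrightarrow> cmod a < 1 \<Longrightarrow>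
        mob_energy p s (\<lambda>z. f (\<phi> t z) - f z) a \<le> ennreal ((\<epsilon> / 2) powr p)"
      using small[of "\<epsilon> / 2"] \<epsilon> by auto
    have "isCont f 0"
      using hol by (intro holomorphic_isCont) auto
    then have "((\<lambda>t. f (\<phi> t 0) - f 0) \<longlongrightarrow> f 0 - f 0) (at_right 0)"
      by (intro tendsto_diff tendsto_const isCont_tendsto_compose[of 0 f] tendsto_flow_0) auto
    then have "((\<lambda>t. f (\<phi> t 0) - f 0) \<longlongrightarrow> 0) (at_right 0)" by simp
    then have "\<forall>\<^sub>F t in at_right 0. dist (f (\<phi> t 0) - f 0) 0 < \<epsilon> / 2"
      using \<epsilon> half_gt_zero tendstoD by blast
    moreover have "\<forall>\<^sub>F t in at_right 0. 0 < t \<and> t < \<delta>"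
      unfolding eventually_at_right_field using \<delta>(1) by blast
    ultimately show "\<forall>\<^sub>F t in at_right 0. dist (M0_norm p s (\<lambda>z. f (\<phi> t z) - f z)) 0 < \<epsilon>"
    proof eventually_elim
      case (elim t)
      have h: "(\<lambda>z. f (\<phi> t z) - f z) holomorphic_on unit_disk" using elim by (intro dh) auto
      have "M0_norm p s (\<lambda>z. f (\<phi> t z) - f z) \<le> cmod (f (\<phi> t 0) - f 0) + \<epsilon> / 2"
        "0 \<le> M0_norm p s (\<lambda>z. f (\<phi> t z) - f z)"
        using M0_norm_le[OF adm h, of "\<epsilon> / 2"] \<epsilon> \<delta>(2) elim by auto
      then show ?case using elim by simp
    qed
  qed
  then show ?thesis using f ev by (simp add: strong_cont_subspace_def)
qed

lemma m0_subset_strong_cont: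
  assumes adm: "admissible p s"
  shows "m0 p s \<subseteq> strong_cont_subspace \<phi> (M0 p s) (M0_norm p s)"
proof
  fix f assume f: "f \<in> m0 p s"
  then have fM: "f \<in> M0 p s" by (simp add: m0_iff[OF adm])
  have hol: "f holomorphic_on unit_disk" using fM by (simp add: M0_iff[OF adm])
  note ps = admissible_range[OF adm]
  show "f \<in> strong_cont_subspace \<phi> (M0 p s) (M0_norm p s)"
  proof (rule strong_cont_subspaceI[OF adm fM])
    fix \<epsilon> :: real assume \<epsilon>: "0 < \<epsilon>"
    obtain R1 where R1: "R1 < 1" "\<And>a. R1 < cmod a \<Longrightarrow> cmod a < 1 \<Longrightarrow> mob_energy p s f a \<le> ennreal ((\<epsilon> / 2) powr p)"
      using f \<epsilon> unfolding m0_iff[OF adm] by (meson half_gt_zero)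
    obtain R2 \<delta>1 where R2: "R2 < 1" and \<delta>1: "0 < \<delta>1"
      "\<And>t a. 0 \<le> t \<Longrightarrow> t < \<delta>1 \<Longrightarrow> R2 < cmod a \<Longrightarrow> cmod a < 1 \<Longrightarrow> R1 < cmod (\<phi> t a)"
      using boundary_stays_near_boundary[OF R1(1)] by metis
    \<comment> \<open>Beyond \<open>R3\<close> both \<open>f\<close> and
      \<open>f \<circ> \<phi> t\<close> have small energy at \<open>a\<close>, so their difference
      has. Up to \<open>R3\<close> the energy at \<open>a\<close> is at most \<open>c\<close> times
      the energy at the origin, which tends to zero.\<close>
    define R3 where "R3 = max (max R1 R2) 0"
    have R3: "R3 < 1" "R1 \<le> R3" "R2 \<le> R3" "0 \<le> R3" using R1 R2 by (auto simp: R3_def)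
    define c where "c = ((1 + R3) / (1 - R3)) powr (s - p + 2)"
    have c: "0 < c" using R3 by (simp add: c_def)
    have "0 < ennreal (\<epsilon> powr p / c)" using \<epsilon> c by simp
    then have "\<forall>\<^sub>F t in at_right 0. energy p s (\<lambda>z. f (\<phi> t z) - f z) < ennreal (\<epsilon> powr p / c)"
      by (intro order_tendstoD(2)[OF energy_flow_diff_tendsto_0[OF adm hol M0_energy_finite[OF adm fM]]])
    then obtain \<delta>2 where \<delta>2: "0 < \<delta>2" "\<And>t. 0 < t \<Longrightarrow> t < \<delta>2 \<Longrightarrow> energy p s (\<lambda>z. f (\<phi> t z) - f z) < ennreal (\<epsilon> powr p / c)"
      unfolding eventually_at_right_field by blast
    have "mob_energy p s (\<lambda>z. f (\<phi> t z) - f z) a \<le> ennreal (\<epsilon> powr p)"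
      if t: "0 < t" "t < min \<delta>1 \<delta>2" and a: "cmod a < 1" for t a
    proof (cases "R3 < cmod a")
      case True
      have "mob_energy p s (\<lambda>z. f (\<phi> t z)) a \<le> mob_energy p s f (\<phi> t a)"
        using t a by (intro mob_energy_flow_le adm hol) auto
      also have "\<dots> \<le> ennreal ((\<epsilon> / 2) powr p)"
        using t a True R3 by (intro R1(2) \<delta>1(2) in_disk) auto
      finally have "mob_energy p s (\<lambda>z. f (\<phi> t z) - f z) a \<le> ennreal ((\<epsilon> / 2 + \<epsilon> / 2) powr p)"
        using t a True R3 \<epsilon> by (intro mob_energy_diff_le ps hol holomorphic_compose R1(2)) auto
      then show ?thesis by simp
    next
      case False
      have "mob_energy p s (\<lambda>z. f (\<phi> t z) - f z) a
        \<le> ennreal (((1 + cmod a) / (1 - cmod a)) powr (s - p + 2)) * energy p s (\<lambda>z. f (\<phi> t z) - f z)"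
        using t a by (intro mob_energy_le_energy adm holomorphic_on_diff holomorphic_compose hol) auto
      also have "\<dots> \<le> ennreal c * ennreal (\<epsilon> powr p / c)"
      proof (intro mult_mono)
        have "(1 + cmod a) / (1 - cmod a) \<le> (1 + R3) / (1 - R3)"
          using False R3 by (intro frac_le) auto
        then show "ennreal (((1 + cmod a) / (1 - cmod a)) powr (s - p + 2)) \<le> ennreal c"
          unfolding c_def using a ps by (intro ennreal_leI powr_mono2) auto
        show "energy p s (\<lambda>z. f (\<phi> t z) - f z) \<le> ennreal (\<epsilon> powr p / c)" using \<delta>2(2)[of t] t by simp
      qed auto
      also have "\<dots> = ennreal (\<epsilon> powr p)" using c by (simp add: ennreal_mult[symmetric])
      finally show ?thesis .
    qed
    then show "\<exists>\<delta>>0. \<forall>t a. 0 < t \<and> t < \<delta> \<and> cmod a < 1 \<longrightarrow>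
        mob_energy p s (\<lambda>z. f (\<phi> t z) - f z) a \<le> ennreal (\<epsilon> powr p)"
      using \<delta>1(1) \<delta>2(1) by (intro exI[of _ "min \<delta>1 \<delta>2"]) auto
  qed
qed

lemma M0_flow_bound:
  assumes adm: "admissible p s" and f: "f holomorphic_on unit_disk"
    and B: "\<And>a. cmod a < 1 \<Longrightarrow> mob_energy p s f a \<le> ennreal (B powr p)" and "0 \<le> t" "cmod a < 1"
  shows "mob_energy p s (\<lambda>z. f (\<phi> t z)) a \<le> ennreal (B powr p)"
  using mob_energy_flow_le[OF adm f, of t a] B[of "\<phi> t a"] in_disk[of t a] assms(4,5) by simp

lemma avg_bound:
  assumes adm: "admissible p s" and f: "f holomorphic_on unit_disk" and B0: "0 < B"
    and B: "\<And>a. cmod a < 1 \<Longrightarrow> mob_energy p s f a \<le> ennreal (B powr p)" and T: "0 < T" and a: "cmod a < 1"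
  shows "mob_energy p s (avg f T) a \<le> ennreal ((T * B) powr p)"
proof -
  have "mob_energy p s (avg f T) a \<le> ennreal (T powr p) * ennreal (B powr p)"
    using admissible_range[OF adm] T a f M0_flow_bound[OF adm f B _ a] by (intro mob_energy_avg_le) auto
  then show ?thesis using T B0 by (simp add: powr_mult ennreal_mult)
qed

lemma avg_in_M0:
  assumes adm: "admissible p s" and f: "f \<in> M0 p s" and T: "0 < T"
  shows "avg f T \<in> M0 p s"
proof -
  have hol: "f holomorphic_on unit_disk" using f by (simp add: M0_iff[OF adm])
  obtain B where B: "0 < B" "\<And>a. cmod a < 1 \<Longrightarrow> mob_energy p s f a \<le> ennreal (B powr p)"
    using f unfolding M0_iff[OF adm] by auto
  show ?thesis
    unfolding M0_iff[OF adm]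
    using avg_holomorphic[OF hol] avg_bound[OF adm hol B T] B T by (intro conjI exI[of _ "T * B"]) auto
qed

text \<open>By \<open>avg_shift\<close> the increment over time \<open>\<tau>\<close> is a
  difference of two averages over an interval of length \<open>\<tau>\<close>. Its seminorm is at
  most \<open>2 * \<tau> * B\<close>.\<close>

lemma avg_in_strong_cont:
  assumes adm: "admissible p s" and f: "f \<in> M0 p s" and T: "0 < T"
  shows "avg f T \<in> strong_cont_subspace \<phi> (M0 p s) (M0_norm p s)"
proof (rule strong_cont_subspaceI[OF adm avg_in_M0[OF adm f T]])
  have hol: "f holomorphic_on unit_disk" using f by (simp add: M0_iff[OF adm])
  obtain B where B: "0 < B" "\<And>a. cmod a < 1 \<Longrightarrow> mob_energy p s f a \<le> ennreal (B powr p)"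
    using f unfolding M0_iff[OF adm] by auto
  note ps = admissible_range[OF adm]
  fix \<epsilon> :: real assume \<epsilon>: "0 < \<epsilon>"
  define \<delta> where "\<delta> = \<epsilon> / (2 * B)"
  have \<delta>: "0 < \<delta>" using \<epsilon> B by (simp add: \<delta>_def)
  have "mob_energy p s (\<lambda>z. avg f T (\<phi> \<tau> z) - avg f T z) a \<le> ennreal (\<epsilon> powr p)"
    if \<tau>: "0 < \<tau>" "\<tau> < \<delta>" and a: "cmod a < 1" for \<tau> a
  proof -
    have bd: "mob_energy p s (avg f \<tau>) a \<le> ennreal ((\<tau> * B) powr p)" if "cmod a < 1" for a
      by (rule avg_bound[OF adm hol B \<tau>(1) that])
    have "mob_energy p s (\<lambda>z. avg f T (\<phi> \<tau> z) - avg f T z) a = mob_energy p s (\<lambda>z. avg f \<tau> (\<phi> T z) - avg f \<tau> z) a"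
      unfolding mob_energy_def using T \<tau> a by (intro energy_cong avg_shift hol) auto
    also have "\<dots> \<le> ennreal ((\<tau> * B + \<tau> * B) powr p)"
      using T \<tau> a B bd M0_flow_bound[OF adm avg_holomorphic[OF hol] bd]
      by (intro mob_energy_diff_le ps holomorphic_compose avg_holomorphic hol) auto
    also have "\<dots> \<le> ennreal (\<epsilon> powr p)"
    proof (intro ennreal_leI powr_mono2)
      show "\<tau> * B + \<tau> * B \<le> \<epsilon>" using \<tau> B by (simp add: \<delta>_def field_simps)
    qed (use ps \<tau> B in auto)
    finally show ?thesis .
  qed
  then show "\<exists>\<delta>>0. \<forall>t a. 0 < t \<and> t < \<delta> \<and> cmod a < 1 \<longrightarrow>
        mob_energy p s (\<lambda>z. avg f T (\<phi> t z) - avg f T z) a \<le> ennreal (\<epsilon> powr p)"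
    using \<delta> by blast
qed

end

subsection \<open>Zeros of the generator\<close>

text \<open>The image of a nonconstant \<open>q\<close> would be open, hence reach to the left of
  the imaginary axis near \<open>q z0\<close>.\<close>

lemma holomorphic_const_if_Re_nonneg_zero:
  assumes q: "q holomorphic_on unit_disk" and nn: "\<And>z. cmod z < 1 \<Longrightarrow> 0 \<le> Re (q z)"
    and z0: "cmod z0 < 1" "Re (q z0) = 0" and z: "cmod z < 1"
  shows "q z = q z0"
proof (rule ccontr)
  assume ne: "q z \<noteq> q z0"
  then have "\<not> q constant_on unit_disk"
    using z z0 unfolding constant_on_def by (metis mem_ball_0)
  then have "open (q ` unit_disk)"
    by (intro open_mapping_thm[OF q]) auto
  then obtain e where e: "0 < e" "ball (q z0) e \<subseteq> q ` unit_disk"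
    using z0 by (metis image_eqI mem_ball_0 openE)
  have "q z0 - of_real (e / 2) \<in> ball (q z0) e" using e by (simp add: dist_norm)
  then have "q z0 - of_real (e / 2) \<in> q ` unit_disk" by (rule subsetD[OF e(2)])
  then obtain w where w: "w \<in> unit_disk" "q z0 - of_real (e / 2) = q w" by (rule imageE) simp
  then have "Re (q w) = - (e / 2)" using z0 by (simp add: w(2)[symmetric])
  then show False using nn[of w] w(1) e by simp
qed

lemma Re_of_real_mult: "Re (of_real r * z) = r * Re z"
  by simp

text \<open>The Noshiro--Warschawski criterion: along the segment from \<open>y\<close> to
  \<open>x\<close>, the real part of \<open>\<alpha> * cnj (x - y) * f\<close> strictly
  increases.\<close>

lemma inj_on_if_Re_deriv_pos:
  assumes f: "f holomorphic_on unit_disk" and pos: "\<And>z. cmod z < 1 \<Longrightarrow> 0 < Re (\<alpha> * deriv f z)"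
  shows "inj_on f unit_disk"
proof (rule inj_onI, rule ccontr)
  fix x y assume x: "x \<in> unit_disk" and y: "y \<in> unit_disk" and eq: "f x = f y" and ne: "x \<noteq> y"
  define l where "l t = y + of_real t * (x - y)" for t :: real
  define h where "h t = Re (\<alpha> * (cnj (x - y) * f (l t)))" for t
  have l: "cmod (l t) < 1" if "0 \<le> t" "t \<le> 1" for t
  proof -
    have "l t = (1 - t) *\<^sub>R y + t *\<^sub>R x" by (simp add: l_def scaleR_conv_of_real algebra_simps)
    then have "l t \<in> unit_disk"
      using convexD_alt[OF convex_ball[of "0::complex" 1] y x that] by simp
    then show ?thesis by simp
  qed
  have "h 0 < h 1"
  proof (rule DERIV_pos_imp_increasing[of 0 1 h])
    fix t :: real assume t: "0 \<le> t" "t \<le> 1"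
    have "(f has_field_derivative deriv f (l t)) (at (l t))"
      using l[OF t] by (intro holomorphic_derivI[OF f open_ball]) auto
    moreover have "(l has_vector_derivative (x - y)) (at t)"
      unfolding l_def by (auto intro!: derivative_eq_intros simp: has_vector_derivative_def scaleR_conv_of_real)
    ultimately have "((\<lambda>t. f (l t)) has_vector_derivative ((x - y) * deriv f (l t))) (at t)"
      using field_vector_diff_chain_at[of l "x - y" t f] by (simp add: o_def)
    then have "((\<lambda>t. \<alpha> * (cnj (x - y) * f (l t))) has_vector_derivative (\<alpha> * (cnj (x - y) * ((x - y) * deriv f (l t))))) (at t)"
      by (intro has_vector_derivative_mult_right)
    then have "(h has_vector_derivative Re (\<alpha> * (cnj (x - y) * ((x - y) * deriv f (l t))))) (at t)"
      unfolding h_def by (rule bounded_linear.has_vector_derivative[OF bounded_linear_Re])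
    then have "(h has_real_derivative Re (\<alpha> * (cnj (x - y) * ((x - y) * deriv f (l t))))) (at t)"
      by (simp add: has_real_derivative_iff_has_vector_derivative)
    moreover have "\<alpha> * (cnj (x - y) * ((x - y) * deriv f (l t))) = of_real ((cmod (x - y))\<^sup>2) * (\<alpha> * deriv f (l t))"
      unfolding complex_norm_square by (simp add: mult_ac)
    moreover have "0 < (cmod (x - y))\<^sup>2 * Re (\<alpha> * deriv f (l t))"
      using ne pos[OF l[OF t]] by (intro mult_pos_pos) auto
    ultimately show "\<exists>d. (h has_real_derivative d) (at t) \<and> 0 < d"
      by (auto simp only: Re_of_real_mult)
  qed simp
  moreover have "h 0 = h 1" by (simp add: h_def l_def eq)
  ultimately show False by simp
qed

lemma log_term_nonneg: "cmod z < 1 \<Longrightarrow> 0 \<le> ln (1 / (1 - (cmod z)\<^sup>2))"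
  using one_minus_norm_pos[of z] by (simp add: ln_div)

lemma vanishing_log_Bloch_iff:
  "vanishing_log_Bloch G \<longleftrightarrow> (\<forall>\<epsilon>>0. \<exists>r<1. \<forall>z. r < cmod z \<and> cmod z < 1 \<longrightarrow>
     (1 - (cmod z)\<^sup>2) / cmod (G z) * ln (1 / (1 - (cmod z)\<^sup>2)) < \<epsilon>)"
proof
  assume L: "vanishing_log_Bloch G"
  show "\<forall>\<epsilon>>0. \<exists>r<1. \<forall>z. r < cmod z \<and> cmod z < 1 \<longrightarrow>
     (1 - (cmod z)\<^sup>2) / cmod (G z) * ln (1 / (1 - (cmod z)\<^sup>2)) < \<epsilon>"
  proof (intro allI impI)
    fix \<epsilon> :: real assume "0 < \<epsilon>"
    from order_tendstoD(2)[OF L[unfolded vanishing_log_Bloch_def] this]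
    show "\<exists>r<1. \<forall>z. r < cmod z \<and> cmod z < 1 \<longrightarrow>
     (1 - (cmod z)\<^sup>2) / cmod (G z) * ln (1 / (1 - (cmod z)\<^sup>2)) < \<epsilon>"
      unfolding eventually_at_unit_circle .
  qed
next
  assume R: "\<forall>\<epsilon>>0. \<exists>r<1. \<forall>z. r < cmod z \<and> cmod z < 1 \<longrightarrow>
     (1 - (cmod z)\<^sup>2) / cmod (G z) * ln (1 / (1 - (cmod z)\<^sup>2)) < \<epsilon>"
  show "vanishing_log_Bloch G"
    unfolding vanishing_log_Bloch_def
  proof (rule tendstoI)
    fix \<epsilon> :: real assume "0 < \<epsilon>"
    then obtain r where r: "r < 1" "\<And>z. r < cmod z \<Longrightarrow> cmod z < 1 \<Longrightarrow>
       (1 - (cmod z)\<^sup>2) / cmod (G z) * ln (1 / (1 - (cmod z)\<^sup>2)) < \<epsilon>"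
      using R by blast
    have "dist ((1 - (cmod z)\<^sup>2) / cmod (G z) * ln (1 / (1 - (cmod z)\<^sup>2))) 0 < \<epsilon>" if z: "r < cmod z" "cmod z < 1" for z
    proof -
      have "0 \<le> (1 - (cmod z)\<^sup>2) / cmod (G z) * ln (1 / (1 - (cmod z)\<^sup>2))"
        using one_minus_norm_pos[OF z(2)] log_term_nonneg[OF z(2)] by (intro mult_nonneg_nonneg divide_nonneg_nonneg) auto
      then show ?thesis using r(2)[OF z] by (simp only: dist_real_def)
    qed
    then show "\<forall>\<^sub>F z in at_unit_circle. dist ((1 - (cmod z)\<^sup>2) / cmod (G z) * ln (1 / (1 - (cmod z)\<^sup>2))) 0 < \<epsilon>"
      unfolding eventually_at_unit_circle using r(1) by blast
  qed
qed

lemma log_term_ge: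
  obtains r where "r < 1" "\<And>z. r < cmod z \<Longrightarrow> cmod z < 1 \<Longrightarrow> N \<le> ln (1 / (1 - (cmod z)\<^sup>2))"
proof -
  have "\<forall>\<^sub>F z in at_unit_circle. 1 - (cmod z)\<^sup>2 < exp (- N)"
    by (rule order_tendstoD(2)[OF tendsto_one_minus_norm_at_unit_circle]) simp
  then obtain r where r: "r < 1" "\<And>z. r < cmod z \<Longrightarrow> cmod z < 1 \<Longrightarrow> 1 - (cmod z)\<^sup>2 < exp (- N)"
    unfolding eventually_at_unit_circle by blast
  show ?thesis
  proof (rule that[OF r(1)])
    fix z assume z: "r < cmod z" "cmod z < 1"
    have "ln (1 - (cmod z)\<^sup>2) < ln (exp (- N))"
      using r(2)[OF z] one_minus_norm_pos[OF z(2)] by (subst ln_less_cancel_iff) auto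
    then show "N \<le> ln (1 / (1 - (cmod z)\<^sup>2))" using one_minus_norm_pos[OF z(2)] by (simp add: ln_div)
  qed
qed

lemma cmod_disk_aut_commute: "cmod (disk_aut a z) = cmod (disk_aut z a)"
proof -
  have "cmod (1 - cnj a * z) = cmod (cnj (1 - cnj a * z))" by (simp only: complex_mod_cnj)
  also have "\<dots> = cmod (1 - cnj z * a)" by (simp add: mult.commute)
  finally show ?thesis by (simp add: disk_aut_def norm_divide norm_minus_commute)
qed

text \<open>The infinitesimal form of the Schwarz--Pick inequality for the pair \<open>0\<close>, \<open>z\<close>.\<close>

lemma generator_inequality:
  assumes hol: "\<And>t. 0 < t \<Longrightarrow> \<psi> t holomorphic_on unit_disk"
    and im: "\<And>t z. 0 < t \<Longrightarrow> cmod z < 1 \<Longrightarrow> cmod (\<psi> t z) < 1"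
    and lim: "\<And>z. cmod z < 1 \<Longrightarrow> ((\<lambda>t. (\<psi> t z - z) / of_real t) \<longlongrightarrow> H z) (at_right 0)"
    and z: "cmod z < 1"
  shows "Re (cnj z * (H z - H 0 + cnj (H 0) * z\<^sup>2)) \<le> 0"
proof -
  define x where "x t = \<psi> t z" for t
  define y where "y t = \<psi> t 0" for t
  define u where "u t = (x t - z) / of_real t" for t
  define v where "v t = y t / of_real t" for t
  \<comment> \<open>With \<open>x t\<close> and \<open>y t\<close> the images of \<open>z\<close>
    and \<open>0\<close>, Schwarz--Pick reads \<open>(cmod (x t - y t))\<^sup>2 \<le> (cmod
    z)\<^sup>2 * (cmod (1 - cnj (y t) * x t))\<^sup>2\<close>. At time \<open>0\<close> both sides
    agree, and \<open>t * \<Delta> t\<close> is their difference at time \<open>t\<close>.\<close>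
  define \<Delta> where "\<Delta> t = 2 * Re (cnj z * (u t - v t)) + t * (cmod (u t - v t))\<^sup>2
     + (cmod z)\<^sup>2 * (2 * Re (cnj (v t) * x t) - t * (cmod (cnj (v t) * x t))\<^sup>2)" for t
  have u: "(u \<longlongrightarrow> H z) (at_right 0)" and v: "(v \<longlongrightarrow> H 0) (at_right 0)"
    using lim[OF z] lim[of 0] by (auto simp: u_def[abs_def] v_def[abs_def] x_def y_def)
  have idt: "((\<lambda>t::real. t) \<longlongrightarrow> 0) (at_right 0)" by (rule tendsto_ident_at)
  have x: "(x \<longlongrightarrow> z) (at_right 0)"
  proof -
    have "((\<lambda>t. z + of_real t * u t) \<longlongrightarrow> z + of_real 0 * H z) (at_right 0)"
      by (intro tendsto_add tendsto_mult tendsto_const tendsto_of_real u idt)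
    moreover have "\<forall>\<^sub>F t in at_right 0. z + of_real t * u t = x t"
      unfolding eventually_at_right_field by (intro exI[of _ 1]) (auto simp: u_def)
    ultimately show ?thesis by (simp add: tendsto_cong)
  qed
  have neg: "\<Delta> t \<le> 0" if t: "0 < t" for t
  proof -
    have sp: "cmod (disk_aut (y t) (x t)) \<le> cmod z"
    proof -
      have "cmod (disk_aut (\<psi> t 0) (\<psi> t z)) \<le> cmod (disk_aut 0 z)"
        using t z by (intro Schwarz_Pick(1) hol im) auto
      then show ?thesis by (simp add: x_def y_def disk_aut_def)
    qed
    have ne: "1 - cnj (y t) * x t \<noteq> 0"
      unfolding x_def y_def using t z by (intro one_minus_cnj_mult_nonzero im) auto
    have "cmod (y t - x t) \<le> cmod z * cmod (1 - cnj (y t) * x t)"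
      using sp ne by (simp add: disk_aut_def norm_divide field_simps)
    then have "(cmod (y t - x t))\<^sup>2 \<le> (cmod z * cmod (1 - cnj (y t) * x t))\<^sup>2"
      by (intro power_mono) auto
    then have le: "(cmod (x t - y t))\<^sup>2 - (cmod z)\<^sup>2 * (cmod (1 - cnj (y t) * x t))\<^sup>2 \<le> 0"
      by (simp add: power_mult_distrib norm_minus_commute)
    have exp1: "(cmod (p + of_real t * q))\<^sup>2 = (cmod p)\<^sup>2 + t * (2 * Re (cnj p * q) + t * (cmod q)\<^sup>2)" for p q :: complex
      unfolding cmod_power2 by (simp add: power2_eq_square algebra_simps)
    have xy: "x t - y t = z + of_real t * (u t - v t)" using t by (simp add: u_def v_def diff_divide_distrib[symmetric])
    have yx: "1 - cnj (y t) * x t = 1 + of_real t * (- (cnj (v t) * x t))" using t by (simp add: v_def)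
    have "(cmod (x t - y t))\<^sup>2 - (cmod z)\<^sup>2 * (cmod (1 - cnj (y t) * x t))\<^sup>2 = t * \<Delta> t"
      unfolding xy yx exp1 \<Delta>_def by (simp add: algebra_simps)
    with le have "t * \<Delta> t \<le> 0" by simp
    then show ?thesis using t by (simp add: mult_le_0_iff)
  qed
  have "(\<Delta> \<longlongrightarrow> 2 * Re (cnj z * (H z - H 0)) + 0 * (cmod (H z - H 0))\<^sup>2
     + (cmod z)\<^sup>2 * (2 * Re (cnj (H 0) * z) - 0 * (cmod (cnj (H 0) * z))\<^sup>2)) (at_right 0)"
    unfolding \<Delta>_def[abs_def]
    by (intro tendsto_add tendsto_diff tendsto_mult tendsto_const tendsto_Re tendsto_cnj tendsto_norm tendsto_power u v x idt)
  moreover have "\<forall>\<^sub>F t in at_right 0. \<Delta> t \<le> 0"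
    unfolding eventually_at_right_field using neg by (intro exI[of _ 1]) auto
  ultimately have "2 * Re (cnj z * (H z - H 0)) + (cmod z)\<^sup>2 * (2 * Re (cnj (H 0) * z)) \<le> 0"
    by (auto dest: tendsto_upperbound)
  moreover have "cnj z * (H z - H 0 + cnj (H 0) * z\<^sup>2) = cnj z * (H z - H 0) + of_real ((cmod z)\<^sup>2) * (cnj (H 0) * z)"
    unfolding complex_norm_square by (simp add: algebra_simps power2_eq_square)
  ultimately show ?thesis
    by (simp only: Re_of_real_mult plus_complex.simps)
qed

section \<open>Conjugation of the generator and its zero\<close>

context disk_semigroup
begin

text \<open>The generator of the semigroup conjugated by \<open>disk_aut b\<close>; the origin takes
  over the role of \<open>b\<close>.\<close>

definition conj_generator :: "(complex \<Rightarrow> complex) \<Rightarrow> complex \<Rightarrow> complex \<Rightarrow> complex"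
  where "conj_generator G b \<zeta> = deriv (disk_aut b) (disk_aut b \<zeta>) * G (disk_aut b \<zeta>)"

lemma conj_generator_holomorphic:
  assumes "is_inf_generator \<phi> G" "cmod b < 1"
  shows "conj_generator G b holomorphic_on unit_disk"
proof -
  have "deriv (disk_aut b) holomorphic_on unit_disk"
    using assms by (intro holomorphic_deriv disk_aut_holomorphic) auto
  then show ?thesis
    unfolding conj_generator_def[abs_def]
    by (intro holomorphic_on_mult holomorphic_compose_disk_aut[OF _ assms(2)] generator_holomorphic[OF assms(1)])
qed

lemma conj_generator_inequality:
  assumes G: "is_inf_generator \<phi> G" and b: "cmod b < 1" and z: "cmod z < 1"
  defines "H \<equiv> conj_generator G b"
  shows "Re (cnj z * (H z - H 0 + cnj (H 0) * z\<^sup>2)) \<le> 0"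
proof (rule generator_inequality[where \<psi> = "\<lambda>t z. disk_aut b (\<phi> t (disk_aut b z))"])
  fix t :: real assume t: "0 < t"
  have "(\<lambda>z. \<phi> t (disk_aut b z)) holomorphic_on unit_disk"
    using t by (intro holomorphic_compose_disk_aut[OF holomorphic b]) auto
  then show "(\<lambda>z. disk_aut b (\<phi> t (disk_aut b z))) holomorphic_on unit_disk"
    by (rule holomorphic_compose_disk[OF disk_aut_holomorphic[OF b]]) (use t b in \<open>auto intro!: in_disk\<close>)
  show "cmod (disk_aut b (\<phi> t (disk_aut b z))) < 1" if "cmod z < 1" for z
    using b that t by (intro cmod_disk_aut_less in_disk) auto
next
  fix z assume z: "cmod z < 1"
  define w where "w = disk_aut b z"
  have w: "cmod w < 1" using b z by (simp add: w_def)
  have "(disk_aut b has_field_derivative deriv (disk_aut b) w) (at w)"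
    using w b by (intro holomorphic_derivI[OF disk_aut_holomorphic open_ball]) auto
  then obtain g where g: "\<And>x. disk_aut b x - disk_aut b w = g x * (x - w)" "isCont g w" "g w = deriv (disk_aut b) w"
    unfolding CARAT_DERIV by blast
  have "((\<lambda>t. (\<phi> t w - w) / of_real t) \<longlongrightarrow> G w) (at_right 0)"
    using G w unfolding is_inf_generator_def by simp
  then have "((\<lambda>t. g (\<phi> t w) * ((\<phi> t w - w) / of_real t)) \<longlongrightarrow> g w * G w) (at_right 0)"
    by (intro tendsto_mult isCont_tendsto_compose[OF g(2) tendsto_flow_0[OF w]])
  moreover have "g (\<phi> t w) * ((\<phi> t w - w) / of_real t) = (disk_aut b (\<phi> t w) - disk_aut b w) / of_real t" for t
    using g(1)[of "\<phi> t w"] by simp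
  moreover have "disk_aut b w = z" using b z by (simp add: w_def)
  ultimately have "((\<lambda>t. (disk_aut b (\<phi> t w) - z) / of_real t) \<longlongrightarrow> g w * G w) (at_right 0)"
    by (simp only:)
  then show "((\<lambda>t. (disk_aut b (\<phi> t (disk_aut b z)) - z) / of_real t) \<longlongrightarrow> H z) (at_right 0)"
    by (simp only: H_def conj_generator_def w_def[symmetric] g(3))
qed (rule z)

text \<open>\<open>cmod (G w) / (1 - (cmod w)\<^sup>2)\<close> is the hyperbolic length of the
  vector field \<open>G\<close>, hence invariant under conjugation.\<close>

lemma conj_generator_norm:
  assumes b: "cmod b < 1" and w: "cmod w < 1"
  shows "cmod (conj_generator G b (disk_aut b w)) / (1 - (cmod (disk_aut b w))\<^sup>2) = cmod (G w) / (1 - (cmod w)\<^sup>2)"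
proof -
  have "cmod (deriv (disk_aut b) w) = (1 - (cmod (disk_aut b w))\<^sup>2) / (1 - (cmod w)\<^sup>2)"
    using norm_deriv_disk_aut[OF b w] one_minus_norm_pos[OF w] by (simp add: field_simps)
  then show ?thesis
    using b w one_minus_norm_pos[OF cmod_disk_aut_less[OF b w]] by (simp add: conj_generator_def norm_mult)
qed

text \<open>A decomposition in the spirit of Berkson and Porta: with \<open>c\<close> the value at
  \<open>0\<close>, the part \<open>c - cnj c * z\<^sup>2\<close> generates automorphisms, and the
  rest is \<open>z\<close> times a function with real part of one sign. Off the origin the sign is
  \<open>conj_generator_inequality\<close> divided by \<open>(cmod z)\<^sup>2\<close>; at the origin
  it follows by continuity.\<close>

lemma conj_generator_factor:
  assumes G: "is_inf_generator \<phi> G" and b: "cmod b < 1"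
  obtains h where "h holomorphic_on unit_disk"
    "\<And>z. cmod z < 1 \<Longrightarrow> conj_generator G b z - conj_generator G b 0 + cnj (conj_generator G b 0) * z\<^sup>2 = z * h z"
    "h 0 = deriv (conj_generator G b) 0" "\<And>z. cmod z < 1 \<Longrightarrow> Re (h z) \<le> 0"
proof -
  define H where "H = conj_generator G b"
  have hol: "H holomorphic_on unit_disk"
    unfolding H_def by (rule conj_generator_holomorphic[OF G b])
  define F where "F z = H z - H 0 + cnj (H 0) * z\<^sup>2" for z
  have F: "F holomorphic_on unit_disk" unfolding F_def using hol by (intro holomorphic_intros)
  obtain h where h: "h holomorphic_on unit_disk" "\<And>z. cmod z < 1 \<Longrightarrow> F z = z * h z" "deriv F 0 = h 0"
    using Schwarz3[OF F] by (auto simp: F_def)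
  have Hd: "(H has_field_derivative deriv H 0) (at 0)"
    by (intro holomorphic_derivI[OF hol open_ball]) auto
  have "(F has_field_derivative deriv H 0) (at 0)"
    unfolding F_def by (auto intro!: derivative_eq_intros Hd)
  then have h0: "h 0 = deriv H 0" using h(3) by (simp add: DERIV_imp_deriv)
  have Re1: "Re (h z) \<le> 0" if z: "cmod z < 1" "z \<noteq> 0" for z
  proof -
    have "Re (cnj z * F z) \<le> 0"
      using conj_generator_inequality[OF G b z(1)] by (simp only: F_def H_def)
    then have "Re (cnj z * (z * h z)) \<le> 0" by (simp only: h(2)[OF z(1)])
    moreover have "cnj z * (z * h z) = of_real ((cmod z)\<^sup>2) * h z"
      unfolding complex_norm_square by (simp add: mult_ac)
    ultimately have "(cmod z)\<^sup>2 * Re (h z) \<le> 0"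
      by (simp only: Re_of_real_mult)
    then show ?thesis using z by (simp add: mult_le_0_iff)
  qed
  have "Re (h 0) \<le> 0"
  proof -
    have "((\<lambda>x. Re (h (of_real x))) \<longlongrightarrow> Re (h (of_real 0))) (at_right (0::real))"
      by (intro tendsto_Re isCont_tendsto_compose[OF holomorphic_isCont[OF h(1)]] tendsto_of_real tendsto_ident_at) auto
    moreover have "\<forall>\<^sub>F x in at_right (0::real). Re (h (of_real x)) \<le> 0"
      unfolding eventually_at_right_field using Re1 by (intro exI[of _ 1]) auto
    ultimately show ?thesis by (auto dest: tendsto_upperbound)
  qed
  then have "Re (h z) \<le> 0" if "cmod z < 1" for z using Re1 that by (cases "z = 0") auto
  then show ?thesis using that[OF h(1)] h(2) h0 by (simp add: F_def H_def)
qed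

text \<open>If \<open>G\<close> had no zero, then \<open>cmod (G z) / (1 - (cmod z)\<^sup>2)\<close>, which tends to infinity at the
  boundary, would attain its minimum at some \<open>b\<close>. Moving \<open>b\<close> to the origin, minimality kills the
  factor of \<open>conj_generator_factor\<close>, so that the conjugated generator is \<open>c - cnj c * z\<^sup>2\<close>; for this
  function the quotient is constant on a radius.\<close>

lemma generator_has_zero:
  assumes G: "is_inf_generator \<phi> G" and van: "vanishing_log_Bloch G"
  shows "\<exists>b. cmod b < 1 \<and> G b = 0"
proof (rule ccontr)
  assume "\<not> ?thesis"
  then have nz: "\<And>z. cmod z < 1 \<Longrightarrow> G z \<noteq> 0" by auto
  define v where "v z = cmod (G z) / (1 - (cmod z)\<^sup>2)" for z
  \<comment> \<open>Near the circle the logarithm is at least \<open>1\<close>, so the condition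
    forces \<open>v\<close> to tend to infinity.\<close>
  have large: "\<exists>r<1. \<forall>z. r < cmod z \<and> cmod z < 1 \<longrightarrow> N < v z" if N: "0 < N" for N
  proof -
    obtain r1 where r1: "r1 < 1" "\<And>z. r1 < cmod z \<Longrightarrow> cmod z < 1 \<Longrightarrow> 1 \<le> ln (1 / (1 - (cmod z)\<^sup>2))"
      by (rule log_term_ge[of 1]) blast
    obtain r2 where r2: "r2 < 1" "\<And>z. r2 < cmod z \<Longrightarrow> cmod z < 1 \<Longrightarrow>
       (1 - (cmod z)\<^sup>2) / cmod (G z) * ln (1 / (1 - (cmod z)\<^sup>2)) < 1 / N"
      using van N unfolding vanishing_log_Bloch_iff by (metis zero_less_divide_1_iff)
    have "N < v z" if z: "max r1 r2 < cmod z" "cmod z < 1" for z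
    proof -
      have x: "0 < 1 - (cmod z)\<^sup>2" using one_minus_norm_pos z by blast
      have "(1 - (cmod z)\<^sup>2) / cmod (G z) * 1 \<le> (1 - (cmod z)\<^sup>2) / cmod (G z) * ln (1 / (1 - (cmod z)\<^sup>2))"
        using x r1(2)[of z] z by (intro mult_left_mono) auto
      also have "\<dots> < 1 / N" using r2(2)[of z] z by auto
      finally show ?thesis using N x nz[of z] z by (simp add: v_def field_simps)
    qed
    then show ?thesis using r1 r2 by (intro exI[of _ "max r1 r2"]) auto
  qed
  have v0: "0 < v z" if "cmod z < 1" for z
    unfolding v_def using nz one_minus_norm_pos that by (intro divide_pos_pos) auto
  obtain r where r: "r < 1" "\<And>z. r < cmod z \<Longrightarrow> cmod z < 1 \<Longrightarrow> v 0 < v z"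
    using large[OF v0[of 0]] by auto
  have cv: "continuous_on unit_disk v"
  proof -
    have "1 - (cmod z)\<^sup>2 \<noteq> 0" if "z \<in> unit_disk" for z using one_minus_norm_pos[of z] that by auto
    then show ?thesis
      unfolding v_def[abs_def]
      by (intro continuous_on_divide continuous_on_norm holomorphic_on_imp_continuous_on[OF generator_holomorphic[OF G]] continuous_intros) auto
  qed
  define R where "R = max r 0"
  have R: "R < 1" "0 \<le> R" using r by (auto simp: R_def)
  have "continuous_on (cball 0 R) v" by (rule continuous_on_subset[OF cv]) (use R in auto)
  then have "\<exists>x\<in>cball 0 R. \<forall>y\<in>cball 0 R. v x \<le> v y"
    using R by (intro continuous_attains_inf) auto
  then obtain b where b: "b \<in> cball 0 R" "\<And>z. z \<in> cball 0 R \<Longrightarrow> v b \<le> v z" by blast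
  have b1: "cmod b < 1" using b R by simp
  have min: "v b \<le> v z" if z: "cmod z < 1" for z
  proof (cases "cmod z \<le> R")
    case False
    then have "v 0 < v z" using r(2)[of z] z by (simp add: R_def)
    moreover have "v b \<le> v 0" using b R by simp
    ultimately show ?thesis by simp
  qed (use b in simp)
  define H where "H = conj_generator G b"
  have Hhol: "H holomorphic_on unit_disk" unfolding H_def by (rule conj_generator_holomorphic[OF G b1])
  have vH: "v (disk_aut b z) = cmod (H z) / (1 - (cmod z)\<^sup>2)" if "cmod z < 1" for z
    using conj_generator_norm[of b "disk_aut b z" G] b1 that by (simp add: v_def H_def)
  define c where "c = H 0"
  have vb: "v b = cmod c" using vH[of 0] by (simp add: c_def)
  have Hge: "cmod c * (1 - (cmod z)\<^sup>2) \<le> cmod (H z)" if z: "cmod z < 1" for z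
    using min[of "disk_aut b z"] vH[OF z] vb b1 z one_minus_norm_pos[OF z] by (simp add: field_simps)
  have c0: "c \<noteq> 0" using v0[OF b1] vb by auto
  define d where "d = deriv H 0"
  \<comment> \<open>In each direction \<open>e\<close>, the square of \<open>cmod (H (x e))\<close>
    minus that of its lower bound is minimal at \<open>x = 0\<close>, so the derivative there
    vanishes. It is twice the real part of \<open>cnj c * e * d\<close>; the directions
    \<open>1\<close> and \<open>\<i>\<close> give \<open>cnj c * d = 0\<close>.\<close>
  have dir: "Re c * Re (e * d) + Im c * Im (e * d) = 0" if e: "cmod e = 1" for e
  proof -
    define k where "k x = (Re (H (of_real x * e)))\<^sup>2 + (Im (H (of_real x * e)))\<^sup>2 - (cmod c)\<^sup>2 * (1 - x\<^sup>2)\<^sup>2" for x :: real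
    have "(H has_field_derivative d) (at (of_real 0 * e))"
      unfolding d_def by (auto intro!: holomorphic_derivI[OF Hhol open_ball])
    moreover have "((\<lambda>x. of_real x * e) has_vector_derivative e) (at 0)"
      by (auto intro!: derivative_eq_intros simp: has_vector_derivative_def scaleR_conv_of_real)
    ultimately have hv: "((\<lambda>x. H (of_real x * e)) has_vector_derivative (e * d)) (at 0)"
      using field_vector_diff_chain_at[of "\<lambda>x. of_real x * e" e 0 H d] by (simp add: o_def)
    have re: "((\<lambda>x. Re (H (of_real x * e))) has_real_derivative Re (e * d)) (at 0)"
      using bounded_linear.has_vector_derivative[OF bounded_linear_Re hv] by (simp add: has_real_derivative_iff_has_vector_derivative)
    have im: "((\<lambda>x. Im (H (of_real x * e))) has_real_derivative Im (e * d)) (at 0)"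
      using bounded_linear.has_vector_derivative[OF bounded_linear_Im hv] by (simp add: has_real_derivative_iff_has_vector_derivative)
    have "(k has_real_derivative (2 * Re c * Re (e * d) + 2 * Im c * Im (e * d))) (at 0)"
      unfolding k_def by (rule derivative_eq_intros re im refl)+ (simp add: c_def)
    moreover have "k 0 \<le> k x" if x: "\<bar>0 - x\<bar> < 1" for x
    proof -
      have nx: "cmod (of_real x * e) = \<bar>x\<bar>" using e by (simp add: norm_mult)
      have x2: "0 \<le> 1 - x\<^sup>2" using x by (simp add: abs_square_le_1)
      have "cmod c * (1 - x\<^sup>2) \<le> cmod (H (of_real x * e))" using Hge[of "of_real x * e"] x unfolding nx by simp
      then have "(cmod c * (1 - x\<^sup>2))\<^sup>2 \<le> (cmod (H (of_real x * e)))\<^sup>2" using x2 by (intro power_mono mult_nonneg_nonneg) auto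
      then have "0 \<le> k x" by (simp add: k_def cmod_power2 power_mult_distrib)
      moreover have "k 0 = 0" by (simp add: k_def c_def cmod_power2)
      ultimately show ?thesis by simp
    qed
    ultimately have "2 * Re c * Re (e * d) + 2 * Im c * Im (e * d) = 0"
      by (intro DERIV_local_min[of k _ 0 1]) auto
    then show ?thesis by simp
  qed
  have "cnj c * d = 0"
    using dir[of 1] dir[of \<i>] by (simp add: complex_eq_iff algebra_simps)
  then have d0: "d = 0" using c0 by simp
  obtain h where h: "h holomorphic_on unit_disk"
    "\<And>z. cmod z < 1 \<Longrightarrow> H z - c + cnj c * z\<^sup>2 = z * h z" "h 0 = d" "\<And>z. cmod z < 1 \<Longrightarrow> Re (h z) \<le> 0"
    unfolding H_def c_def d_def by (rule conj_generator_factor[OF G b1]) metis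
  \<comment> \<open>Since \<open>h 0 = d = 0\<close>, the function \<open>- h\<close> touches the
    boundary of its half-plane at the origin, so \<open>h\<close> vanishes identically.\<close>
  have "- h z = - h 0" if "cmod z < 1" for z
    using holomorphic_const_if_Re_nonneg_zero[of "\<lambda>z. - h z" 0 z] h d0 that
    by (auto intro!: holomorphic_on_minus)
  then have Hz: "H z = c - cnj c * z\<^sup>2" if "cmod z < 1" for z
    using h(2)[OF that] h(3) d0 that by (simp add: algebra_simps)
  obtain r' where r': "r' < 1" "\<And>z. r' < cmod z \<Longrightarrow> cmod z < 1 \<Longrightarrow> cmod c < v z"
    using large[of "cmod c"] c0 by auto
  \<comment> \<open>Prepares the choice of \<open>x\<close>, so close to \<open>1\<close> that
    \<open>disk_aut b\<close> maps the circle of radius \<open>x\<close> beyond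
    \<open>r'\<close>.\<close>
  have "((\<lambda>x. 2 * (1 - x\<^sup>2) / (1 - cmod b)) \<longlongrightarrow> 2 * (1 - 1\<^sup>2) / (1 - cmod b)) (at_left (1::real))"
    using b1 by (intro tendsto_intros) auto
  moreover have "0 < 1 - (max r' 0)\<^sup>2" using r' by (simp add: power_less_one_iff abs_square_less_1)
  ultimately have "\<forall>\<^sub>F x in at_left (1::real). 2 * (1 - x\<^sup>2) / (1 - cmod b) < 1 - (max r' 0)\<^sup>2"
    by (intro order_tendstoD(2)) auto
  then obtain x0 where x0: "x0 < 1" "\<And>x. x0 < x \<Longrightarrow> x < 1 \<Longrightarrow> 2 * (1 - x\<^sup>2) / (1 - cmod b) < 1 - (max r' 0)\<^sup>2"
    unfolding eventually_at_left_field by blast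
  define x where "x = (max x0 0 + 1) / 2"
  have x: "0 < x" "x0 < x" "x < 1" using x0 by (auto simp: x_def)
  \<comment> \<open>In the direction of \<open>c\<close> the number
    \<open>cnj c * \<zeta>\<^sup>2\<close> is \<open>x\<^sup>2 * c\<close>. Hence
    \<open>H \<zeta> = (1 - x\<^sup>2) * c\<close>, and the quotient keeps the value
    \<open>cmod c\<close> up to the boundary.\<close>
  define \<zeta> where "\<zeta> = of_real (x / cmod c) * c"
  have \<zeta>: "cmod \<zeta> = x" using c0 x by (simp add: \<zeta>_def norm_mult norm_divide)
  have "cnj c * \<zeta>\<^sup>2 = of_real (x\<^sup>2) * c"
  proof -
    have "cnj c * \<zeta>\<^sup>2 = of_real ((x / cmod c)\<^sup>2) * (c * cnj c) * c"
      by (simp add: \<zeta>_def power2_eq_square mult_ac)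
    also have "\<dots> = of_real ((x / cmod c)\<^sup>2 * (cmod c)\<^sup>2) * c"
      unfolding complex_norm_square[symmetric] by (simp only: of_real_mult)
    also have "(x / cmod c)\<^sup>2 * (cmod c)\<^sup>2 = x\<^sup>2" using c0 by (simp add: power_divide)
    finally show ?thesis .
  qed
  then have "H \<zeta> = of_real (1 - x\<^sup>2) * c" using Hz[of \<zeta>] \<zeta> x by (simp add: algebra_simps)
  then have "cmod (H \<zeta>) = (1 - x\<^sup>2) * cmod c"
    using x by (simp add: norm_mult abs_square_le_1 del: of_real_diff of_real_power)
  then have "v (disk_aut b \<zeta>) = cmod c" using vH[of \<zeta>] \<zeta> x by (simp add: power_less_one_iff abs_square_eq_1)
  moreover have "r' < cmod (disk_aut b \<zeta>)"
  proof -
    have "(1 - (cmod (disk_aut \<zeta> b))\<^sup>2) * (1 - cmod b) \<le> 2 * (1 - (cmod \<zeta>)\<^sup>2)"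
      using \<zeta> x b1 by (intro one_minus_norm_disk_aut_le) auto
    then have "1 - (cmod (disk_aut b \<zeta>))\<^sup>2 \<le> 2 * (1 - x\<^sup>2) / (1 - cmod b)"
      using b1 \<zeta> by (simp add: cmod_disk_aut_commute[of b] field_simps)
    also have "\<dots> < 1 - (max r' 0)\<^sup>2" using x0(2) x by blast
    finally have "(max r' 0)\<^sup>2 < (cmod (disk_aut b \<zeta>))\<^sup>2" by simp
    then have "max r' 0 < cmod (disk_aut b \<zeta>)" by (rule power2_less_imp_less) simp
    then show ?thesis by simp
  qed
  ultimately show False using r'(2)[of "disk_aut b \<zeta>"] b1 \<zeta> x by simp
qed

text \<open>For \<open>H 0 = 0\<close> the factorization reads \<open>H z = z * h z\<close>. The
  primitive of \<open>1 / h\<close> is injective because the real part of \<open>1 / h\<close> has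
  one sign, or because \<open>h\<close> is constant. Composed with \<open>disk_aut b\<close> it
  becomes \<open>\<gamma>\<close>.\<close>

lemma generator_zero_structure:
  assumes G: "is_inf_generator \<phi> G" and nt: "nontrivial_semigroup \<phi>" and b: "cmod b < 1" "G b = 0"
  obtains \<gamma> where "\<gamma> holomorphic_on unit_disk" "inj_on \<gamma> unit_disk"
    "\<And>w. cmod w < 1 \<Longrightarrow> deriv \<gamma> w * G w = disk_aut b w"
proof -
  define H where "H = conj_generator G b"
  have H0: "H 0 = 0" using b by (simp add: H_def conj_generator_def)
  obtain h where h: "h holomorphic_on unit_disk"
    "\<And>z. cmod z < 1 \<Longrightarrow> H z - H 0 + cnj (H 0) * z\<^sup>2 = z * h z" "\<And>z. cmod z < 1 \<Longrightarrow> Re (h z) \<le> 0"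
    unfolding H_def by (rule conj_generator_factor[OF G b(1)]) metis
  have HG: "deriv (disk_aut b) w * G w = disk_aut b w * h (disk_aut b w)" if "cmod w < 1" for w
    using h(2)[of "disk_aut b w"] b that H0 by (simp add: H_def conj_generator_def)
  have const: "h z = h z0" if "Re (h z0) = 0" "cmod z0 < 1" "cmod z < 1" for z z0
    using holomorphic_const_if_Re_nonneg_zero[of "\<lambda>z. - h z" z0 z] h that
    by (auto intro!: holomorphic_on_minus)
  have h0: "h z \<noteq> 0" if z: "cmod z < 1" for z
  proof
    assume "h z = 0"
    then have "h w = 0" if "cmod w < 1" for w using const[of z w] z that by simp
    then have "G w = 0" if "cmod w < 1" for w
      using HG[OF that] deriv_disk_aut_nonzero[OF b(1) that] b that by simp
    then show False using trivial_if_generator_0[OF G] nt by blast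
  qed
  have "(\<lambda>z. 1 / h z) holomorphic_on unit_disk" using h(1) h0 by (intro holomorphic_intros) auto
  then obtain \<Gamma> where "\<And>z. z \<in> unit_disk \<Longrightarrow> (\<Gamma> has_field_derivative 1 / h z) (at z within unit_disk)"
    using holomorphic_convex_primitive'[of unit_disk "\<lambda>z. 1 / h z"] by auto
  then have \<Gamma>: "(\<Gamma> has_field_derivative 1 / h z) (at z)" if "cmod z < 1" for z
    using that by (metis at_within_open mem_ball_0 open_ball)
  have \<Gamma>hol: "\<Gamma> holomorphic_on unit_disk"
    unfolding holomorphic_on_open[OF open_ball] using \<Gamma> by (metis mem_ball_0)
  have d\<Gamma>: "deriv \<Gamma> z = 1 / h z" if "cmod z < 1" for z using \<Gamma>[OF that] by (rule DERIV_imp_deriv)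
  have inj: "inj_on \<Gamma> unit_disk"
  \<comment> \<open>If the real part of \<open>h\<close> vanishes somewhere, then \<open>h\<close>
    is constant, and the factor \<open>\<alpha> = h z0\<close> normalises the derivative of
    \<open>\<Gamma>\<close> to \<open>1\<close>.\<close>
  proof (cases "\<exists>z0. cmod z0 < 1 \<and> Re (h z0) = 0")
    case True
    then obtain z0 where z0: "cmod z0 < 1" "Re (h z0) = 0" by blast
    show ?thesis
    proof (rule inj_on_if_Re_deriv_pos[OF \<Gamma>hol, of "h z0"])
      show "0 < Re (h z0 * deriv \<Gamma> z)" if "cmod z < 1" for z
        using const[OF z0(2,1) that] h0[OF z0(1)] by (simp add: d\<Gamma>[OF that])
    qed
  next
    case False
    show ?thesis
    proof (rule inj_on_if_Re_deriv_pos[OF \<Gamma>hol, of "- 1"])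
      fix z assume z: "cmod z < 1"
      have "Re (h z) < 0" using False h(3)[OF z] z by force
      moreover have "0 < (cmod (h z))\<^sup>2" using h0[OF z] by simp
      ultimately show "0 < Re (- 1 * deriv \<Gamma> z)"
        by (simp add: d\<Gamma>[OF z] Re_divide cmod_power2[symmetric] divide_less_0_iff)
    qed
  qed
  show ?thesis
  proof (rule that[of "\<lambda>w. \<Gamma> (disk_aut b w)"])
    show "(\<lambda>w. \<Gamma> (disk_aut b w)) holomorphic_on unit_disk"
      by (rule holomorphic_compose_disk_aut[OF \<Gamma>hol b(1)])
    have "inj_on (\<Gamma> \<circ> disk_aut b) unit_disk"
      using b inj by (intro comp_inj_on inj_on_disk_aut) auto
    then show "inj_on (\<lambda>w. \<Gamma> (disk_aut b w)) unit_disk" by (simp add: o_def)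
    fix w assume w: "cmod w < 1"
    have "deriv (\<lambda>w. \<Gamma> (disk_aut b w)) w = 1 / h (disk_aut b w) * deriv (disk_aut b) w"
      using deriv_compose_disk_aut[OF \<Gamma>hol b(1) w] d\<Gamma> b w by simp
    then show "deriv (\<lambda>w. \<Gamma> (disk_aut b w)) w * G w = disk_aut b w"
      using HG[OF w] h0[of "disk_aut b w"] b w by simp
  qed
qed

end

subsection \<open>Sufficiency of the logarithmic condition\<close>

lemma M0_imp_Bloch:
  assumes adm: "admissible p s" and f: "f \<in> M0 p s"
  obtains \<beta> where "0 < \<beta>" "\<And>w. cmod w < 1 \<Longrightarrow> (1 - (cmod w)\<^sup>2) * cmod (deriv f w) \<le> \<beta>"
proof -
  have hol: "f holomorphic_on unit_disk" using f by (simp add: M0_iff[OF adm])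
  obtain B where B: "0 < B" "\<And>a. cmod a < 1 \<Longrightarrow> mob_energy p s f a \<le> ennreal (B powr p)"
    using f unfolding M0_iff[OF adm] by auto
  obtain c where c: "0 < c" "\<And>f a B. f holomorphic_on unit_disk \<Longrightarrow> cmod a < 1 \<Longrightarrow> 0 \<le> B \<Longrightarrow> mob_energy p s f a \<le> ennreal (B powr p)
       \<Longrightarrow> (1 - (cmod a)\<^sup>2) * cmod (deriv f a) \<le> c * B"
    using Bloch_le_mob_energy[OF adm] by metis
  show ?thesis
    using that[of "c * B"] c(1) c(2)[OF hol _ _ B(2)] B(1) by simp
qed

text \<open>The logarithmic growth of the Bloch function \<open>f \<circ> disk_aut a\<close> is
  weakened to a power, the shape of loss that \<open>injective_mob_energy_bound\<close>
  tolerates.\<close>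

lemma Bloch_disk_aut_diff_le:
  assumes f: "f holomorphic_on unit_disk" and a: "cmod a < 1" and z: "cmod z < 1" and \<kappa>: "0 < \<kappa>"
    and \<beta>: "0 \<le> \<beta>" "\<And>w. cmod w < 1 \<Longrightarrow> (1 - (cmod w)\<^sup>2) * cmod (deriv f w) \<le> \<beta>"
  shows "cmod (f (disk_aut a z) - f a) \<le> \<beta> / \<kappa> * (1 - cmod z) powr (- \<kappa>)"
proof -
  have "cmod (f (disk_aut a z) - f (disk_aut a 0)) \<le> \<beta> / \<kappa> * (1 - cmod z) powr (- \<kappa>)"
  proof (rule norm_diff_0_le_powr[OF holomorphic_compose_disk_aut[OF f a] z \<kappa> \<beta>(1)])
    fix w assume w: "cmod w < 1"
    define D where "D = cmod (deriv (\<lambda>z. f (disk_aut a z)) w)"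
    have D: "D = cmod (deriv f (disk_aut a w)) * cmod (deriv (disk_aut a) w)"
      unfolding D_def using deriv_compose_disk_aut[OF f a w] by (simp add: norm_mult)
    have "D * (1 - cmod w) \<le> D * (1 - (cmod w)\<^sup>2)"
      using w one_minus_norm_le(1)[of w] by (intro mult_left_mono) (auto simp: D_def)
    also have "\<dots> = (1 - (cmod (disk_aut a w))\<^sup>2) * cmod (deriv f (disk_aut a w))"
      unfolding D mult.assoc norm_deriv_disk_aut[OF a w] by simp
    also have "\<dots> \<le> \<beta>" using a w by (intro \<beta>(2)) auto
    finally have "D \<le> \<beta> * (1 - cmod w) powr (- 1)" using w by (simp add: powr_minus field_simps)
    also have "\<dots> \<le> \<beta> * (1 - cmod w) powr (- 1 - \<kappa>)"
      using w \<kappa> \<beta>(1) by (intro mult_left_mono powr_mono') auto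
    finally show "cmod (deriv (\<lambda>z. f (disk_aut a z)) w) \<le> \<beta> * (1 - cmod w) powr (- 1 - \<kappa>)" by (simp add: D_def)
  qed
  then show ?thesis by simp
qed

lemma ln_one_minus_norm_le:
  assumes "cmod c < 1"
  shows "ln (1 / (1 - cmod c)) \<le> 1 + ln (1 / (1 - (cmod c)\<^sup>2))"
proof -
  have x: "0 < 1 - (cmod c)\<^sup>2" using one_minus_norm_pos[OF assms] .
  have "1 / (1 - cmod c) \<le> 2 * (1 / (1 - (cmod c)\<^sup>2))"
    using x assms one_minus_norm_le(2)[of c] by (simp add: field_simps)
  then have "ln (1 / (1 - cmod c)) \<le> ln (2 * (1 / (1 - (cmod c)\<^sup>2)))" using assms x by (intro ln_mono) auto
  also have "\<dots> = ln 2 + ln (1 / (1 - (cmod c)\<^sup>2))" using x by (subst ln_mult) auto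
  also have "ln 2 \<le> (1::real)" using ln_le_minus_one[of 2] by simp
  finally show ?thesis by simp
qed

lemma Bloch_log_growth:
  assumes f: "f holomorphic_on unit_disk" and a: "cmod a < 1"
    and \<beta>: "0 \<le> \<beta>" "\<And>w. cmod w < 1 \<Longrightarrow> (1 - (cmod w)\<^sup>2) * cmod (deriv f w) \<le> \<beta>"
  shows "cmod (f a - f 0) \<le> \<beta> * (1 + ln (1 / (1 - (cmod a)\<^sup>2)))"
proof -
  have "cmod (f a - f 0) \<le> \<beta> * ln (1 / (1 - cmod a))" by (rule Bloch_norm_diff_0_le[OF f a \<beta>(2)])
  also have "\<dots> \<le> \<beta> * (1 + ln (1 / (1 - (cmod a)\<^sup>2)))"
    by (intro mult_left_mono \<beta>(1) ln_one_minus_norm_le a)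
  finally show ?thesis .
qed

text \<open>Taking logarithms in \<open>one_minus_norm_disk_aut_le\<close> bounds the logarithm at
  \<open>a\<close> by the one at \<open>disk_aut a z\<close>, plus a constant, plus
  \<open>ln (1 / (1 - cmod z))\<close>, which is at most a power divided by \<open>\<kappa>\<close>.
  The summands \<open>1\<close> allow the sum to be written as a product.\<close>

lemma log_term_disk_aut:
  assumes a: "cmod a < 1" and z: "cmod z < 1" and \<kappa>: "0 < \<kappa>"
  shows "1 + ln (1 / (1 - (cmod a)\<^sup>2)) \<le> (2 + 1 / \<kappa>) * (1 + ln (1 / (1 - (cmod (disk_aut a z))\<^sup>2))) * (1 - cmod z) powr (- \<kappa>)"
proof -
  define w where "w = disk_aut a z"
  define La where "La = ln (1 / (1 - (cmod a)\<^sup>2))"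
  define Lw where "Lw = ln (1 / (1 - (cmod w)\<^sup>2))"
  define X where "X = (1 - cmod z) powr (- \<kappa>)"
  have w: "cmod w < 1" using a z by (simp add: w_def)
  have pos: "0 < 1 - (cmod a)\<^sup>2" "0 < 1 - (cmod w)\<^sup>2" "0 < 1 - cmod z"
    using one_minus_norm_pos a w z by auto
  have Lw: "0 \<le> Lw" unfolding Lw_def by (rule log_term_nonneg[OF w])
  have X: "1 \<le> X" using z \<kappa> by (simp add: X_def powr_minus powr_le1 one_le_inverse_iff)
  have "ln ((1 - (cmod w)\<^sup>2) * (1 - cmod z)) \<le> ln (2 * (1 - (cmod a)\<^sup>2))"
    using one_minus_norm_disk_aut_le[OF a z] pos by (intro ln_mono) (auto simp: w_def)
  also have "\<dots> = ln 2 + ln (1 - (cmod a)\<^sup>2)" using pos by (subst ln_mult) auto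
  finally have "- Lw - ln (1 / (1 - cmod z)) \<le> ln 2 - La"
    using pos by (simp add: Lw_def La_def ln_mult ln_div)
  moreover have "ln 2 \<le> (1::real)" using ln_le_minus_one[of 2] by simp
  moreover have "ln (1 / (1 - cmod z)) \<le> X / \<kappa>"
    using ln_powr_bound[of "1 / (1 - cmod z)" \<kappa>] pos \<kappa> by (simp add: X_def powr_divide powr_minus inverse_eq_divide)
  ultimately have "1 + La \<le> (1 + Lw) + 1 + X / \<kappa>" by simp
  also have "\<dots> \<le> (1 + Lw) * X + (1 + Lw) * X + (1 + Lw) * (X / \<kappa>)"
  proof (intro add_mono)
    have "1 * 1 \<le> (1 + Lw) * X" using Lw X by (intro mult_mono) auto
    then show "1 \<le> (1 + Lw) * X" by simp
    have "(1 + Lw) * 1 \<le> (1 + Lw) * X" using Lw X by (intro mult_left_mono) auto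
    then show "1 + Lw \<le> (1 + Lw) * X" by simp
    have "1 * (X / \<kappa>) \<le> (1 + Lw) * (X / \<kappa>)" using Lw X \<kappa> by (intro mult_right_mono) auto
    then show "X / \<kappa> \<le> (1 + Lw) * (X / \<kappa>)" by simp
  qed
  also have "\<dots> = (2 + 1 / \<kappa>) * (1 + Lw) * X" by (simp add: algebra_simps)
  finally show ?thesis by (simp add: La_def Lw_def X_def w_def)
qed

text \<open>Both logarithms, the one in the growth of \<open>h\<close> and the one in the condition on \<open>\<gamma>\<close>, are
  compared at the centre \<open>a\<close>; they then cancel, and the loss is a small power of
  \<open>1 - cmod z\<close>, which the area estimate absorbs.\<close>

lemma mob_energy_vanishes:
  assumes adm: "admissible p s" and A: "A holomorphic_on unit_disk" and h: "h holomorphic_on unit_disk"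
    and \<beta>: "0 < \<beta>" "\<And>w. cmod w < 1 \<Longrightarrow> (1 - (cmod w)\<^sup>2) * cmod (deriv h w) \<le> \<beta>"
    and \<gamma>: "\<gamma> holomorphic_on unit_disk" "inj_on \<gamma> unit_disk"
    and C0: "0 < C0" "\<And>w. cmod w < 1 \<Longrightarrow> cmod (deriv A w) \<le> C0 * (1 + cmod (h w)) * cmod (deriv \<gamma> w)"
    and van: "\<And>\<epsilon>. 0 < \<epsilon> \<Longrightarrow> \<exists>r<1. \<forall>w. r < cmod w \<and> cmod w < 1 \<longrightarrow>
       cmod (deriv \<gamma> w) * (1 - (cmod w)\<^sup>2) * (1 + ln (1 / (1 - (cmod w)\<^sup>2))) \<le> \<epsilon>"
    and \<epsilon>: "0 < \<epsilon>"
  shows "\<exists>r<1. \<forall>a. r < cmod a \<and> cmod a < 1 \<longrightarrow> mob_energy p s A a \<le> ennreal (\<epsilon> powr p)"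
proof -
  define L where "L w = ln (1 / (1 - (cmod w)\<^sup>2))" for w :: complex
  have L0: "0 \<le> L w" if "cmod w < 1" for w unfolding L_def by (rule log_term_nonneg[OF that])
  define b where "b w = cmod (deriv \<gamma> w) * (1 - (cmod w)\<^sup>2) * (1 + L w)" for w
  obtain \<kappa> C where \<kappa>: "0 < \<kappa>" "\<kappa> \<le> 1" and C: "0 < C"
    and bound: "\<forall>f \<gamma> a K M. f holomorphic_on unit_disk \<longrightarrow> \<gamma> holomorphic_on unit_disk \<longrightarrow> inj_on \<gamma> unit_disk \<longrightarrow>
       cmod a < 1 \<longrightarrow> 0 < K \<longrightarrow> 0 < M \<longrightarrow>
       (\<forall>z. cmod z < 1 \<longrightarrow> cmod (deriv \<gamma> (disk_aut a z)) * (1 - (cmod (disk_aut a z))\<^sup>2) \<le> K * (1 - cmod z) powr (- \<kappa>)) \<longrightarrow>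
       (\<forall>z. cmod z < 1 \<longrightarrow> cmod (deriv f (disk_aut a z)) \<le> M * (1 - cmod z) powr (- \<kappa>) * cmod (deriv \<gamma> (disk_aut a z))) \<longrightarrow>
       mob_energy p s f a \<le> ennreal ((C * M * K) powr p)"
    by (rule injective_mob_energy_bound[OF adm]) (erule (3) that)
  obtain B where B: "0 < B" "\<And>w. cmod w < 1 \<Longrightarrow> b w \<le> B"
  proof -
    obtain r where r: "r < 1" "\<And>w. r < cmod w \<Longrightarrow> cmod w < 1 \<Longrightarrow> b w \<le> 1"
      using van[of 1] by (auto simp: b_def L_def)
    have "continuous_on unit_disk b"
    proof -
      have "1 - (cmod z)\<^sup>2 \<noteq> 0" "1 / (1 - (cmod z)\<^sup>2) \<noteq> 0" if "z \<in> unit_disk" for z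
        using one_minus_norm_pos[of z] that by auto
      then show ?thesis
        unfolding b_def[abs_def] L_def
        by (intro continuous_on_mult continuous_on_norm continuous_on_add continuous_on_ln continuous_on_divide
            holomorphic_on_imp_continuous_on[OF holomorphic_deriv[OF \<gamma>(1)]] continuous_intros) auto
    qed
    then have "continuous_on (cball 0 r) b" by (rule continuous_on_subset) (use r(1) in auto)
    then have "compact (b ` cball 0 r)" by (rule compact_continuous_image) simp
    then obtain M where M: "\<And>w. w \<in> cball 0 r \<Longrightarrow> b w \<le> M"
      using bounded_has_Sup(1)[of "b ` cball 0 r"] compact_imp_bounded by (metis empty_iff imageI)
    show ?thesis
    proof (rule that[of "max M 1"])
      fix w assume "cmod w < 1"
      then show "b w \<le> max M 1" using r(2)[of w] M[of w] by (cases "r < cmod w") auto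
    qed simp
  qed
  \<comment> \<open>The constant of \<open>log_term_disk_aut\<close> for the exponent
    \<open>\<kappa> / 2\<close>.\<close>
  define C1 where "C1 = 2 + 2 / \<kappa>"
  have C1: "0 < C1" using \<kappa> by (simp add: C1_def add_pos_pos)
  define C2 where "C2 = 1 + cmod (h 0) + \<beta> + \<beta> / \<kappa>"
  have C2: "0 < C2" using \<beta> \<kappa> by (simp add: C2_def add_pos_nonneg)
  \<comment> \<open>Such that the constants of the final bound, in which the factor
    \<open>1 + L a\<close> cancels, multiply to \<open>\<epsilon>\<close>.\<close>
  define \<eta> where "\<eta> = \<epsilon> / (C * C0 * C2)"
  have \<eta>: "0 < \<eta>" using \<epsilon> C C0 C2 by (simp add: \<eta>_def)
  obtain r0 where r0: "r0 < 1" "\<And>w. r0 < cmod w \<Longrightarrow> cmod w < 1 \<Longrightarrow> b w \<le> \<eta> / C1"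
    using van[of "\<eta> / C1"] \<eta> C1 by (auto simp: b_def L_def)
  define r1 where "r1 = max r0 0"
  have r1: "0 \<le> r1" "r1 < 1" "r0 \<le> r1" using r0 by (auto simp: r1_def)
  have r12: "0 < 1 - r1\<^sup>2" using r1 by (simp add: abs_square_less_1)
  \<comment> \<open>For \<open>1 - cmod z < \<delta>\<close> the power
    \<open>(1 - cmod z) powr (- (\<kappa> / 2))\<close> is at least \<open>B * C1 / \<eta>\<close>,
    which makes up for the crude bound \<open>b w \<le> B\<close>.\<close>
  define \<delta> where "\<delta> = (\<eta> / (B * C1)) powr (2 / \<kappa>)"
  have \<delta>: "0 < \<delta>" using \<eta> B C1 by (simp add: \<delta>_def)
  have "\<forall>\<^sub>F a in at_unit_circle. 1 - (cmod a)\<^sup>2 < \<delta> * (1 - r1\<^sup>2) / 2"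
    using \<delta> r12 by (intro order_tendstoD(2)[OF tendsto_one_minus_norm_at_unit_circle]) auto
  then obtain r where r: "r < 1" "\<And>a. r < cmod a \<Longrightarrow> cmod a < 1 \<Longrightarrow> 1 - (cmod a)\<^sup>2 < \<delta> * (1 - r1\<^sup>2) / 2"
    unfolding eventually_at_unit_circle by blast
  have "mob_energy p s A a \<le> ennreal (\<epsilon> powr p)" if a: "r < cmod a" "cmod a < 1" for a
  proof -
    have La: "0 < 1 + L a" using L0[OF a(2)] by simp
    have step: "cmod (deriv \<gamma> (disk_aut a z)) * (1 - (cmod (disk_aut a z))\<^sup>2) \<le> \<eta> / (1 + L a) * (1 - cmod z) powr (- \<kappa>)"
      if z: "cmod z < 1" for z
    proof -
      define w where "w = disk_aut a z"
      \<comment> \<open>Half of the allowed loss. One factor \<open>X\<close> pays for moving the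
        logarithm from \<open>w\<close> to \<open>a\<close>, the other for points \<open>w\<close>
        that are not near the circle.\<close>
      define X where "X = (1 - cmod z) powr (- (\<kappa> / 2))"
      have w: "cmod w < 1" using a z by (simp add: w_def)
      have X: "1 \<le> X" using z \<kappa> by (simp add: X_def powr_minus powr_le1 one_le_inverse_iff)
      have XX: "X * X = (1 - cmod z) powr (- \<kappa>)" using z by (simp add: X_def powr_add[symmetric])
      have Lw: "0 < 1 + L w" using L0[OF w] by simp
      have le: "1 + L a \<le> C1 * (1 + L w) * X"
        using log_term_disk_aut[OF a(2) z, of "\<kappa> / 2"] \<kappa> by (simp add: L_def w_def X_def C1_def)
      have bw0: "0 \<le> b w" unfolding b_def using one_minus_norm_pos[OF w] Lw by (intro mult_nonneg_nonneg) auto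
      have "b w * (1 + L a) \<le> b w * (C1 * (1 + L w) * X)" using le bw0 by (intro mult_left_mono)
      also have "\<dots> = (1 + L w) * (C1 * b w * X)" by simp
      finally have 1: "cmod (deriv \<gamma> w) * (1 - (cmod w)\<^sup>2) * (1 + L a) \<le> C1 * b w * X"
        using Lw unfolding b_def by (simp add: mult_ac)
      have 2: "C1 * b w * X \<le> \<eta> * (X * X)"
      \<comment> \<open>Near the circle \<open>b w\<close> is small. Elsewhere, as \<open>a\<close>
        is very close to the circle, \<open>disk_aut a z\<close> can be far from it only if
        \<open>1 - cmod z < \<delta>\<close>.\<close>
      proof (cases "r0 < cmod w")
        case True
        then have "C1 * b w \<le> \<eta>" using r0(2)[of w] w C1 by (simp add: field_simps)
        then have "C1 * b w * X \<le> \<eta> * X" using X by (intro mult_right_mono) auto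
        also have "\<dots> \<le> \<eta> * (X * X)" using X \<eta> by (intro mult_left_mono) auto
        finally show ?thesis .
      next
        case False
        then have "cmod w \<le> r1" using r1 by simp
        then have "1 - r1\<^sup>2 \<le> 1 - (cmod w)\<^sup>2" by (simp add: power_mono)
        then have "(1 - r1\<^sup>2) * (1 - cmod z) \<le> (1 - (cmod w)\<^sup>2) * (1 - cmod z)" using z by (intro mult_right_mono) auto
        also have "\<dots> \<le> 2 * (1 - (cmod a)\<^sup>2)" unfolding w_def by (rule one_minus_norm_disk_aut_le[OF a(2) z])
        also have "\<dots> < \<delta> * (1 - r1\<^sup>2)" using r(2)[OF a] by simp
        finally have "1 - cmod z < \<delta>" using r12 by (simp add: mult.commute)
        then have "\<delta> powr (- (\<kappa> / 2)) \<le> X" unfolding X_def using z \<kappa> by (intro powr_mono2') auto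
        moreover have "\<delta> powr (- (\<kappa> / 2)) = B * C1 / \<eta>"
        proof -
          have "\<delta> powr (- (\<kappa> / 2)) = (\<eta> / (B * C1)) powr (- 1)"
            unfolding \<delta>_def powr_powr using \<kappa> by simp
          then show ?thesis using \<eta> B C1 by (simp add: powr_minus)
        qed
        ultimately have "B * C1 \<le> \<eta> * X" using \<eta> by (simp add: field_simps)
        moreover have "b w * C1 \<le> B * C1" using B(2)[OF w] C1 by (intro mult_right_mono) auto
        ultimately have "C1 * b w \<le> \<eta> * X" by (simp add: mult.commute)
        then have "C1 * b w * X \<le> \<eta> * X * X" using X by (intro mult_right_mono) auto
        then show ?thesis by simp
      qed
      show ?thesis
        using order_trans[OF 1 2] La unfolding XX by (simp add: w_def field_simps)
    qed
    have "mob_energy p s A a \<le> ennreal ((C * (C0 * C2 * (1 + L a)) * (\<eta> / (1 + L a))) powr p)"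
    proof (rule bound[rule_format, OF A \<gamma> a(2)])
      show "0 < \<eta> / (1 + L a)" using \<eta> La by simp
      show "0 < C0 * C2 * (1 + L a)" using C0 C2 La by simp
      fix z assume z: "cmod z < 1"
      show "cmod (deriv \<gamma> (disk_aut a z)) * (1 - (cmod (disk_aut a z))\<^sup>2) \<le> \<eta> / (1 + L a) * (1 - cmod z) powr (- \<kappa>)"
        by (rule step[OF z])
      define w where "w = disk_aut a z"
      define Y where "Y = (1 - cmod z) powr (- \<kappa>)"
      have w: "cmod w < 1" using a z by (simp add: w_def)
      have Y: "1 \<le> Y" using z \<kappa> by (simp add: Y_def powr_minus powr_le1 one_le_inverse_iff)
      have "cmod (h w) \<le> cmod (h w - h a) + cmod (h a - h 0) + cmod (h 0)"
        using norm_triangle_ineq[of "h w - h a" "h a"] norm_triangle_ineq[of "h a - h 0" "h 0"] by simp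
      also have "\<dots> \<le> \<beta> / \<kappa> * Y + \<beta> * (1 + L a) + cmod (h 0)"
        unfolding w_def Y_def L_def using \<beta> \<kappa>
        by (intro add_mono Bloch_disk_aut_diff_le Bloch_log_growth h a z) auto
      finally have "1 + cmod (h w) \<le> (1 + cmod (h 0)) + \<beta> * (1 + L a) + \<beta> / \<kappa> * Y" by simp
      also have "\<dots> \<le> (1 + cmod (h 0)) * ((1 + L a) * Y) + \<beta> * ((1 + L a) * Y) + \<beta> / \<kappa> * ((1 + L a) * Y)"
      proof (intro add_mono)
        have a1: "1 \<le> 1 + L a" using L0[OF a(2)] by simp
        have "1 * 1 \<le> (1 + L a) * Y" using a1 Y by (intro mult_mono) auto
        then have "(1 + cmod (h 0)) * 1 \<le> (1 + cmod (h 0)) * ((1 + L a) * Y)" by (intro mult_left_mono) auto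
        then show "1 + cmod (h 0) \<le> (1 + cmod (h 0)) * ((1 + L a) * Y)" by simp
        have "(1 + L a) * 1 \<le> (1 + L a) * Y" using a1 Y by (intro mult_left_mono) auto
        then show "\<beta> * (1 + L a) \<le> \<beta> * ((1 + L a) * Y)" using \<beta>(1) by (intro mult_left_mono) auto
        have "1 * Y \<le> (1 + L a) * Y" using a1 Y by (intro mult_right_mono) auto
        then show "\<beta> / \<kappa> * Y \<le> \<beta> / \<kappa> * ((1 + L a) * Y)" using \<beta>(1) \<kappa> by (intro mult_left_mono) auto
      qed
      also have "\<dots> = C2 * (1 + L a) * Y" by (simp add: C2_def algebra_simps)
      finally have hb: "1 + cmod (h w) \<le> C2 * (1 + L a) * Y" .
      have "cmod (deriv A w) \<le> C0 * (1 + cmod (h w)) * cmod (deriv \<gamma> w)" by (rule C0(2)[OF w])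
      also have "\<dots> \<le> C0 * (C2 * (1 + L a) * Y) * cmod (deriv \<gamma> w)"
        using C0(1) hb by (intro mult_right_mono mult_left_mono) auto
      finally show "cmod (deriv A (disk_aut a z)) \<le> C0 * C2 * (1 + L a) * (1 - cmod z) powr (- \<kappa>) * cmod (deriv \<gamma> (disk_aut a z))"
        by (simp add: w_def Y_def mult.assoc)
    qed
    also have "C * (C0 * C2 * (1 + L a)) * (\<eta> / (1 + L a)) = \<epsilon>"
      using La C C0 C2 by (simp add: \<eta>_def)
    finally show ?thesis .
  qed
  then show ?thesis using r(1) by blast
qed

section \<open>Strongly continuous functions lie in \<open>m0\<close>\<close>

context disk_semigroup
begin

lemma strong_cont_subset_m0:
  assumes adm: "admissible p s" and G: "is_inf_generator \<phi> G" and nt: "nontrivial_semigroup \<phi>"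
    and van: "vanishing_log_Bloch G"
  shows "strong_cont_subspace \<phi> (M0 p s) (M0_norm p s) \<subseteq> m0 p s"
proof
  fix f assume f: "f \<in> strong_cont_subspace \<phi> (M0 p s) (M0_norm p s)"
  note ps = admissible_range[OF adm]
  have fM: "f \<in> M0 p s" using f by (simp add: strong_cont_subspace_def)
  have hol: "f holomorphic_on unit_disk" using fM by (simp add: M0_iff[OF adm])
  obtain b where b: "cmod b < 1" "G b = 0" using generator_has_zero[OF G van] by blast
  obtain \<gamma> where \<gamma>: "\<gamma> holomorphic_on unit_disk" "inj_on \<gamma> unit_disk"
    "\<And>w. cmod w < 1 \<Longrightarrow> deriv \<gamma> w * G w = disk_aut b w"
    using generator_zero_structure[OF G nt b] by metis
  have d\<gamma>: "deriv \<gamma> w \<noteq> 0" if "cmod w < 1" for w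
    using that by (intro holomorphic_injective_imp_regular[OF \<gamma>(1) open_ball \<gamma>(2)]) auto
  have van\<gamma>: "\<exists>r<1. \<forall>w. r < cmod w \<and> cmod w < 1 \<longrightarrow>
       cmod (deriv \<gamma> w) * (1 - (cmod w)\<^sup>2) * (1 + ln (1 / (1 - (cmod w)\<^sup>2))) \<le> \<epsilon>" if \<epsilon>: "0 < \<epsilon>" for \<epsilon>
  proof -
    obtain r1 where r1: "r1 < 1" "\<And>z. r1 < cmod z \<Longrightarrow> cmod z < 1 \<Longrightarrow> 1 \<le> ln (1 / (1 - (cmod z)\<^sup>2))"
      by (rule log_term_ge[of 1]) blast
    obtain r2 where r2: "r2 < 1" "\<And>z. r2 < cmod z \<Longrightarrow> cmod z < 1 \<Longrightarrow>
       (1 - (cmod z)\<^sup>2) / cmod (G z) * ln (1 / (1 - (cmod z)\<^sup>2)) < \<epsilon> / 2"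
      using van \<epsilon> unfolding vanishing_log_Bloch_iff by (metis half_gt_zero)
    have "cmod (deriv \<gamma> w) * (1 - (cmod w)\<^sup>2) * (1 + ln (1 / (1 - (cmod w)\<^sup>2))) \<le> \<epsilon>"
      if w: "max (max r1 r2) (cmod b) < cmod w" "cmod w < 1" for w
    proof -
      define l where "l = ln (1 / (1 - (cmod w)\<^sup>2))"
      have l: "1 \<le> l" using r1(2)[of w] w by (simp add: l_def)
      have x: "0 < 1 - (cmod w)\<^sup>2" using one_minus_norm_pos w by blast
      have "disk_aut b w \<noteq> 0"
      proof
        assume "disk_aut b w = 0"
        then have "w = b" using disk_aut_involution[OF b(1) w(2)] by simp
        then show False using w by simp
      qed
      then have G0: "G w \<noteq> 0" using \<gamma>(3)[OF w(2)] by auto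
      have "cmod (deriv \<gamma> w) * cmod (G w) = cmod (disk_aut b w)"
        using \<gamma>(3)[OF w(2)] by (metis norm_mult)
      also have "\<dots> \<le> 1" using cmod_disk_aut_less[OF b(1) w(2)] by simp
      finally have "cmod (deriv \<gamma> w) \<le> 1 / cmod (G w)" using G0 by (simp add: field_simps)
      then have "cmod (deriv \<gamma> w) * (1 - (cmod w)\<^sup>2) * (1 + l) \<le> 1 / cmod (G w) * (1 - (cmod w)\<^sup>2) * (2 * l)"
        using x l by (intro mult_mono) auto
      also have "\<dots> = 2 * ((1 - (cmod w)\<^sup>2) / cmod (G w) * l)" by simp
      also have "\<dots> \<le> 2 * (\<epsilon> / 2)" using r2(2)[of w] w unfolding l_def by (intro mult_left_mono) auto
      finally show ?thesis by (simp add: l_def)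
    qed
    then show ?thesis using r1(1) r2(1) b(1) by (intro exI[of _ "max (max r1 r2) (cmod b)"]) auto
  qed
  have "\<exists>r<1. \<forall>a. r < cmod a \<and> cmod a < 1 \<longrightarrow> mob_energy p s f a \<le> ennreal (\<epsilon> powr p)" if \<epsilon>: "0 < \<epsilon>" for \<epsilon>
  proof -
    have ev: "\<forall>\<^sub>F t in at_right 0. (\<lambda>z. f (\<phi> t z) - f z) \<in> M0 p s"
      and lim: "((\<lambda>t. M0_norm p s (\<lambda>z. f (\<phi> t z) - f z)) \<longlongrightarrow> 0) (at_right 0)"
      using f by (auto simp: strong_cont_subspace_def)
    then have "\<forall>\<^sub>F t in at_right 0. (\<lambda>z. f (\<phi> t z) - f z) \<in> M0 p s \<and> M0_norm p s (\<lambda>z. f (\<phi> t z) - f z) < \<epsilon> / 2"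
      using \<epsilon> by (intro eventually_conj ev order_tendstoD(2)[OF lim]) auto
    then obtain \<delta> where \<delta>: "0 < \<delta>" "\<And>t. 0 < t \<Longrightarrow> t < \<delta> \<Longrightarrow> (\<lambda>z. f (\<phi> t z) - f z) \<in> M0 p s"
      "\<And>t. 0 < t \<Longrightarrow> t < \<delta> \<Longrightarrow> M0_norm p s (\<lambda>z. f (\<phi> t z) - f z) < \<epsilon> / 2"
      unfolding eventually_at_right_field by blast
    have small: "mob_energy p s (\<lambda>z. f (\<phi> t z) - f z) a \<le> ennreal ((\<epsilon> / 2) powr p)" if t: "0 < t" "t < \<delta>" and a: "cmod a < 1" for t a
    proof -
      let ?g = "\<lambda>z. f (\<phi> t z) - f z"
      have "mob_energy p s ?g a \<le> ennreal (M0_norm p s ?g powr p)"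
        by (rule mob_energy_le_M0_norm[OF adm \<delta>(2)[OF t] a])
      also have "\<dots> \<le> ennreal ((\<epsilon> / 2) powr p)"
      proof (intro ennreal_leI powr_mono2)
        obtain B where B: "0 < B" "\<And>a. cmod a < 1 \<Longrightarrow> mob_energy p s ?g a \<le> ennreal (B powr p)"
          using \<delta>(2)[OF t] unfolding M0_iff[OF adm] by auto
        then show "0 \<le> M0_norm p s ?g"
          using \<delta>(2)[OF t] by (intro M0_norm_le(2)[OF adm _ B]) (auto simp: M0_iff[OF adm])
      qed (use ps \<delta>(3)[OF t] in auto)
      finally show ?thesis .
    qed
    \<comment> \<open>For this one \<open>T\<close>, the function \<open>T * f\<close> is within
      \<open>T * (\<epsilon> / 2)\<close> of \<open>avg f T\<close> at every \<open>a\<close>. It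
      remains to show that the energy of this average vanishes at the boundary.\<close>
    define T where "T = \<delta> / 2"
    have T: "0 < T" "T < \<delta>" using \<delta>(1) by (auto simp: T_def)
    define h where "h z = f (\<phi> T z) - f z" for z
    have hM: "h \<in> M0 p s" unfolding h_def by (rule \<delta>(2)[OF T])
    then have hhol: "h holomorphic_on unit_disk" by (simp add: M0_iff[OF adm])
    obtain \<beta> where \<beta>: "0 < \<beta>" "\<And>w. cmod w < 1 \<Longrightarrow> (1 - (cmod w)\<^sup>2) * cmod (deriv h w) \<le> \<beta>"
      using M0_imp_Bloch[OF adm hM] by metis
    have Ahol: "avg f T holomorphic_on unit_disk" by (rule avg_holomorphic[OF hol])
    have AG: "deriv (avg f T) w * G w = h w" if "cmod w < 1" for w
      unfolding h_def using avg_deriv_generator[OF G hol _ that, of T] T by simp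
    \<comment> \<open>Dividing \<open>deriv \<gamma> w * G w = disk_aut b w\<close> into the
      equation for the average is useless near \<open>b\<close>, where \<open>disk_aut b\<close>
      vanishes. There the quotient of the derivatives is bounded by compactness,
      \<open>deriv \<gamma>\<close> having no zeros.\<close>
    obtain C where C: "\<And>w. cmod w < 1 \<Longrightarrow> cmod (disk_aut b w) \<le> 1 / 2 \<Longrightarrow> cmod (deriv (avg f T) w) \<le> C * cmod (deriv \<gamma> w)"
    proof -
      have "continuous_on (cball 0 (1 / 2)) (disk_aut b)"
        using b by (intro holomorphic_on_imp_continuous_on holomorphic_on_subset[OF disk_aut_holomorphic]) auto
      then have comp: "compact (disk_aut b ` cball 0 (1 / 2))" by (intro compact_continuous_image) auto
      have sub: "disk_aut b ` cball 0 (1 / 2) \<subseteq> unit_disk" using b by auto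
      have "(\<lambda>w. deriv (avg f T) w / deriv \<gamma> w) holomorphic_on unit_disk"
        by (rule holomorphic_on_divide[OF holomorphic_deriv[OF Ahol open_ball] holomorphic_deriv[OF \<gamma>(1) open_ball]])
          (simp add: d\<gamma>)
      then have "continuous_on (disk_aut b ` cball 0 (1 / 2)) (\<lambda>w. deriv (avg f T) w / deriv \<gamma> w)"
        using sub by (metis holomorphic_on_imp_continuous_on holomorphic_on_subset)
      then have "bounded ((\<lambda>w. deriv (avg f T) w / deriv \<gamma> w) ` (disk_aut b ` cball 0 (1 / 2)))"
        by (intro compact_imp_bounded compact_continuous_image[OF _ comp])
      then obtain C where C: "\<And>w. w \<in> disk_aut b ` cball 0 (1 / 2) \<Longrightarrow> cmod (deriv (avg f T) w / deriv \<gamma> w) \<le> C"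
        unfolding bounded_iff by blast
      show ?thesis
      proof (rule that[of C])
        fix w assume w: "cmod w < 1" "cmod (disk_aut b w) \<le> 1 / 2"
        have "w = disk_aut b (disk_aut b w)" using b w by simp
        then have "w \<in> disk_aut b ` cball 0 (1 / 2)" using w(2) by (metis image_eqI mem_cball_0)
        then show "cmod (deriv (avg f T) w) \<le> C * cmod (deriv \<gamma> w)"
          using C[of w] d\<gamma>[OF w(1)] by (simp add: norm_divide field_simps)
      qed
    qed
    have AC: "cmod (deriv (avg f T) w) \<le> max C 2 * (1 + cmod (h w)) * cmod (deriv \<gamma> w)" if w: "cmod w < 1" for w
    proof (cases "cmod (disk_aut b w) \<le> 1 / 2")
      case True
      have "cmod (deriv (avg f T) w) \<le> C * cmod (deriv \<gamma> w)" by (rule C[OF w True])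
      also have "\<dots> \<le> max C 2 * (1 + cmod (h w)) * cmod (deriv \<gamma> w)"
      proof (intro mult_right_mono)
        have "max C 2 * 1 \<le> max C 2 * (1 + cmod (h w))" by (intro mult_left_mono) auto
        then show "C \<le> max C 2 * (1 + cmod (h w))" by simp
      qed simp
      finally show ?thesis .
    next
      case False
      have "deriv (avg f T) w * disk_aut b w = deriv \<gamma> w * h w"
        using \<gamma>(3)[OF w] AG[OF w] by (metis mult.assoc mult.commute)
      then have eq: "cmod (deriv (avg f T) w) * cmod (disk_aut b w) = cmod (deriv \<gamma> w) * cmod (h w)"
        by (metis norm_mult)
      have "cmod (deriv (avg f T) w) * (1 / 2) \<le> cmod (deriv (avg f T) w) * cmod (disk_aut b w)"
        using False by (intro mult_left_mono) auto
      then have "cmod (deriv (avg f T) w) \<le> 2 * (cmod (h w) * cmod (deriv \<gamma> w))"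
        unfolding eq by (simp add: mult.commute)
      also have "\<dots> = 2 * cmod (h w) * cmod (deriv \<gamma> w)" by simp
      also have "\<dots> \<le> max C 2 * (1 + cmod (h w)) * cmod (deriv \<gamma> w)"
        by (intro mult_right_mono mult_mono) auto
      finally show ?thesis .
    qed
    have "0 < T * (\<epsilon> / 2)" "0 < max C 2" using T \<epsilon> by simp_all
    from mob_energy_vanishes[OF adm Ahol hhol \<beta> \<gamma>(1,2) this(2) AC van\<gamma> this(1)]
    obtain r where r: "r < 1" "\<And>a. r < cmod a \<Longrightarrow> cmod a < 1 \<Longrightarrow> mob_energy p s (avg f T) a \<le> ennreal ((T * (\<epsilon> / 2)) powr p)"
      by blast
    have "mob_energy p s f a \<le> ennreal (\<epsilon> powr p)" if a: "r < cmod a" "cmod a < 1" for a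
    proof -
      have "mob_energy p s (\<lambda>z. avg f T z - of_real T * f z) a \<le> ennreal (T powr p) * ennreal ((\<epsilon> / 2) powr p)"
        using T a small by (intro mob_energy_avg_diff_le ps hol) auto
      also have "\<dots> = ennreal ((T * (\<epsilon> / 2)) powr p)"
        using T \<epsilon> by (subst powr_mult) (auto simp: ennreal_mult)
      finally have 1: "mob_energy p s (\<lambda>z. avg f T z - of_real T * f z) a \<le> ennreal ((T * (\<epsilon> / 2)) powr p)" .
      have hd: "(\<lambda>z. avg f T z - of_real T * f z) holomorphic_on unit_disk"
        using Ahol hol by (intro holomorphic_intros)
      \<comment> \<open>\<open>T * f\<close> is written as the average minus the approximation
        error; each contributes \<open>T * (\<epsilon> / 2)\<close>.\<close>
      have "mob_energy p s (\<lambda>z. avg f T z - (avg f T z - of_real T * f z)) a \<le> ennreal ((T * (\<epsilon> / 2) + T * (\<epsilon> / 2)) powr p)"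
        using T \<epsilon> a r(2) 1 by (intro mob_energy_diff_le ps Ahol hd) auto
      then have "ennreal (T powr p) * mob_energy p s f a \<le> ennreal (T powr p) * ennreal (\<epsilon> powr p)"
        using mob_energy_cmult[OF hol ps(2) a(2), of s "of_real T"] T \<epsilon>
        by (simp add: powr_mult ennreal_mult)
      then show ?thesis using T by (subst (asm) ennreal_mult_le_mult_iff) auto
    qed
    then show ?thesis using r(1) by blast
  qed
  then show "f \<in> m0 p s" unfolding m0_iff[OF adm] using fM by blast
qed

end

subsection \<open>Necessity of the logarithmic condition\<close>

text \<open>The sign makes the value at \<open>c\<close> the positive number
  \<open>ln (1 / (1 - (cmod c)\<^sup>2))\<close>.\<close>

definition log_kernel :: "complex \<Rightarrow> complex \<Rightarrow> complex"
  where "log_kernel c z = - Ln (1 - cnj c * z)"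

lemma cmod_cnj_mult_less: "cmod c < 1 \<Longrightarrow> cmod z < 1 \<Longrightarrow> cmod (cnj c * z) < 1"
  using mult_strict_mono[of "cmod c" 1 "cmod z" 1] by (simp add: norm_mult)

lemma log_kernel_has_derivative:
  assumes "cmod c < 1" "cmod z < 1"
  shows "(log_kernel c has_field_derivative cnj c / (1 - cnj c * z)) (at z)"
proof -
  have "0 < Re (1 - cnj c * z)"
    using complex_Re_le_cmod[of "cnj c * z"] cmod_cnj_mult_less[OF assms] by simp
  then have "1 - cnj c * z \<notin> \<real>\<^sub>\<le>\<^sub>0" by (metis complex_nonpos_Reals_iff not_le)
  then show ?thesis
    unfolding log_kernel_def[abs_def] by (auto intro!: derivative_eq_intros simp: field_simps)
qed

lemma log_kernel_holomorphic: "cmod c < 1 \<Longrightarrow> log_kernel c holomorphic_on unit_disk"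
  unfolding holomorphic_on_open[OF open_ball] using log_kernel_has_derivative by (metis mem_ball_0)

lemma inj_on_log_kernel:
  assumes c: "cmod c < 1" "c \<noteq> 0"
  shows "inj_on (log_kernel c) unit_disk"
proof (rule inj_onI)
  fix x y assume xy: "x \<in> unit_disk" "y \<in> unit_disk" and eq: "log_kernel c x = log_kernel c y"
  have nz: "1 - cnj c * z \<noteq> 0" if "z \<in> unit_disk" for z
    using cmod_cnj_mult_less[OF c(1), of z] that by auto
  have "exp (Ln (1 - cnj c * x)) = exp (Ln (1 - cnj c * y))" using eq by (simp add: log_kernel_def)
  then show "x = y" using nz[OF xy(1)] nz[OF xy(2)] c by simp
qed

text \<open>\<open>cmod (1 - cnj c * w)\<close> is at least \<open>1 - cmod w\<close> and at least
  \<open>1 - cmod c\<close>. The former yields a Bloch bound uniform in \<open>c\<close>, the latter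
  a bounded derivative for each \<open>c\<close>.\<close>

lemma norm_deriv_log_kernel_le:
  assumes c: "cmod c < 1" and w: "cmod w < 1"
  shows "(1 - (cmod w)\<^sup>2) * cmod (deriv (log_kernel c) w) \<le> 2"
    and "(1 - cmod c) * cmod (deriv (log_kernel c) w) \<le> 1"
proof -
  have ge: "1 - cmod c * cmod w \<le> cmod (1 - cnj c * w)"
    using norm_triangle_ineq2[of 1 "cnj c * w"] by (simp add: norm_mult)
  have d: "cmod (deriv (log_kernel c) w) = cmod c / cmod (1 - cnj c * w)"
    using DERIV_imp_deriv[OF log_kernel_has_derivative[OF c w]] by (simp add: norm_divide)
  have "cmod c * cmod w \<le> 1 * cmod w" "cmod c * cmod w \<le> cmod c * 1"
    using c w by (intro mult_right_mono mult_left_mono; simp)+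
  then have x: "1 - cmod w \<le> cmod (1 - cnj c * w)" "1 - cmod c \<le> cmod (1 - cnj c * w)" using ge by auto
  have pos: "0 < cmod (1 - cnj c * w)" using x(1) w by linarith
  have "(1 - (cmod w)\<^sup>2) * cmod c \<le> 2 * (1 - cmod w) * 1"
    using c w one_minus_norm_le(2)[of w] by (intro mult_mono) auto
  then show "(1 - (cmod w)\<^sup>2) * cmod (deriv (log_kernel c) w) \<le> 2"
    unfolding d using x(1) pos by (simp add: divide_le_eq)
  have "(1 - cmod c) * cmod c \<le> (1 - cmod c) * 1"
    using c by (intro mult_left_mono) auto
  then show "(1 - cmod c) * cmod (deriv (log_kernel c) w) \<le> 1"
    unfolding d using x(2) pos by (simp add: divide_le_eq)
qed

text \<open>The kernel depends on \<open>c\<close> and \<open>z\<close> only through \<open>cnj c * z\<close>, so the two arguments play symmetric roles.\<close>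

lemma norm_log_kernel_le:
  assumes c: "cmod c < 1" and z: "cmod z < 1"
  shows "cmod (log_kernel c z) \<le> 2 * ln (1 / (1 - cmod z))" "cmod (log_kernel c z) \<le> 2 * ln (1 / (1 - cmod c))"
proof -
  have *: "cmod (log_kernel a w) \<le> 2 * ln (1 / (1 - cmod w))" if "cmod a < 1" "cmod w < 1" for a w
    using Bloch_norm_diff_0_le[OF log_kernel_holomorphic[OF that(1)] that(2) norm_deriv_log_kernel_le(1)[OF that(1)]]
    by (simp add: log_kernel_def)
  show "cmod (log_kernel c z) \<le> 2 * ln (1 / (1 - cmod z))" by (rule *[OF c z])
  have "0 < Re (1 - cnj c * z)"
    using complex_Re_le_cmod[of "cnj c * z"] cmod_cnj_mult_less[OF c z] by simp
  then have "1 - cnj c * z \<notin> \<real>\<^sub>\<le>\<^sub>0" by (metis complex_nonpos_Reals_iff not_le)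
  then have "cnj (Ln (1 - cnj c * z)) = Ln (1 - cnj z * c)" by (simp add: cnj_Ln mult.commute)
  then have "cmod (log_kernel c z) = cmod (log_kernel z c)"
    unfolding log_kernel_def by (metis complex_mod_cnj norm_minus_cancel)
  then show "cmod (log_kernel c z) \<le> 2 * ln (1 / (1 - cmod c))" using *[OF z c] by simp
qed

text \<open>The kernel alone already attains the largest order of growth of Bloch functions at
  \<open>c\<close>, but it does not fade elsewhere. Squaring it and dividing by its value
  \<open>L\<close> at \<open>c\<close> keeps the value \<open>L\<close> at \<open>c\<close> and
  makes the function of order \<open>1 / L\<close> on compact sets.\<close>

definition log_test :: "complex \<Rightarrow> complex \<Rightarrow> complex"
  where "log_test c z = (log_kernel c z)\<^sup>2 / of_real (ln (1 / (1 - (cmod c)\<^sup>2)))"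

lemma log_test_holomorphic: "cmod c < 1 \<Longrightarrow> log_test c holomorphic_on unit_disk"
  unfolding log_test_def[abs_def] divide_inverse by (intro holomorphic_intros log_kernel_holomorphic)

lemma deriv_log_test:
  assumes "cmod c < 1" "cmod w < 1"
  shows "deriv (log_test c) w = 2 * log_kernel c w * deriv (log_kernel c) w / of_real (ln (1 / (1 - (cmod c)\<^sup>2)))"
proof (rule DERIV_imp_deriv)
  define L where "L = complex_of_real (ln (1 / (1 - (cmod c)\<^sup>2)))"
  have "(log_kernel c has_field_derivative deriv (log_kernel c) w) (at w)"
    using log_kernel_has_derivative[OF assms] by (metis DERIV_imp_deriv)
  then have "((\<lambda>z. (log_kernel c z)\<^sup>2 * inverse L) has_field_derivative 2 * log_kernel c w * deriv (log_kernel c) w * inverse L) (at w)"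
    by (auto intro!: derivative_eq_intros)
  then show "(log_test c has_field_derivative 2 * log_kernel c w * deriv (log_kernel c) w / of_real (ln (1 / (1 - (cmod c)\<^sup>2)))) (at w)"
    unfolding log_test_def[abs_def] L_def divide_inverse .
qed

lemma log_test_self:
  assumes c: "cmod c < 1"
  shows "log_test c c = of_real (ln (1 / (1 - (cmod c)\<^sup>2)))"
proof -
  have x: "0 < 1 - (cmod c)\<^sup>2" using one_minus_norm_pos[OF c] .
  have "1 - cnj c * c = of_real (1 - (cmod c)\<^sup>2)" by (simp flip: complex_norm_square add: mult.commute)
  then have "log_kernel c c = of_real (- ln (1 - (cmod c)\<^sup>2))"
    unfolding log_kernel_def using Ln_of_real[OF x] by simp
  also have "- ln (1 - (cmod c)\<^sup>2) = ln (1 / (1 - (cmod c)\<^sup>2))" using x by (simp add: ln_div)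
  finally show ?thesis by (simp add: log_test_def power2_eq_square)
qed

text \<open>In the gliding hump, the first bound makes later functions small at earlier points, and
  the second bounds earlier functions at later points.\<close>

lemma norm_log_test_le:
  assumes c: "cmod c < 1" and L: "1 \<le> ln (1 / (1 - (cmod c)\<^sup>2))" and z: "cmod z < 1"
  shows "cmod (log_test c z) \<le> 4 / (1 - cmod z)\<^sup>2 / ln (1 / (1 - (cmod c)\<^sup>2))"
    and "cmod (log_test c z) \<le> 16 * ln (1 / (1 - (cmod c)\<^sup>2))"
proof -
  define l where "l = ln (1 / (1 - (cmod c)\<^sup>2))"
  have l: "1 \<le> l" using L by (simp add: l_def)
  have eq: "cmod (log_test c z) = (cmod (log_kernel c z))\<^sup>2 / l"
    using l by (simp add: log_test_def norm_divide norm_power l_def[symmetric])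
  have "ln (1 / (1 - cmod z)) \<le> 1 / (1 - cmod z)"
    using ln_le_minus_one[of "1 / (1 - cmod z)"] z by simp
  then have "cmod (log_kernel c z) \<le> 2 / (1 - cmod z)"
    using norm_log_kernel_le(1)[OF c z] by simp
  then have "(cmod (log_kernel c z))\<^sup>2 \<le> (2 / (1 - cmod z))\<^sup>2" by (intro power_mono) auto
  then show "cmod (log_test c z) \<le> 4 / (1 - cmod z)\<^sup>2 / ln (1 / (1 - (cmod c)\<^sup>2))"
    unfolding eq l_def[symmetric] using l by (intro divide_right_mono) (auto simp: power_divide)
  have "cmod (log_kernel c z) \<le> 4 * l"
    using norm_log_kernel_le(2)[OF c z] ln_one_minus_norm_le[OF c] l by (simp add: l_def[symmetric])
  then have "(cmod (log_kernel c z))\<^sup>2 \<le> (4 * l)\<^sup>2" by (intro power_mono) auto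
  then have "(cmod (log_kernel c z))\<^sup>2 \<le> 16 * l * l" by (simp add: power2_eq_square)
  then show "cmod (log_test c z) \<le> 16 * ln (1 / (1 - (cmod c)\<^sup>2))"
    unfolding eq l_def[symmetric] using l by (simp add: divide_le_eq)
qed

text \<open>For fixed \<open>c\<close> the singularity of the kernel lies outside the closed disk,
  so the derivative is bounded.\<close>

lemma log_test_in_m0:
  assumes adm: "admissible p s" and c: "cmod c < 1" and L: "1 \<le> ln (1 / (1 - (cmod c)\<^sup>2))"
  shows "log_test c \<in> m0 p s"
proof (rule bounded_deriv_in_m0[OF adm log_test_holomorphic[OF c]])
  fix z assume z: "cmod z < 1"
  define l where "l = ln (1 / (1 - (cmod c)\<^sup>2))"
  have l: "1 \<le> l" using L by (simp add: l_def)
  have 1: "cmod (log_kernel c z) \<le> 4 * l"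
    using norm_log_kernel_le(2)[OF c z] ln_one_minus_norm_le[OF c] l by (simp add: l_def[symmetric])
  have 2: "cmod (deriv (log_kernel c) z) \<le> 1 / (1 - cmod c)"
    using norm_deriv_log_kernel_le(2)[OF c z] c by (simp add: field_simps)
  have "cmod (deriv (log_test c) z) = 2 * cmod (log_kernel c z) * cmod (deriv (log_kernel c) z) / l"
    using deriv_log_test[OF c z] l by (simp add: norm_divide norm_mult l_def[symmetric])
  also have "\<dots> \<le> 2 * (4 * l) * (1 / (1 - cmod c)) / l"
    using 1 2 l c by (intro divide_right_mono mult_mono) auto
  finally show "cmod (deriv (log_test c) z) \<le> 2 * (4 * l) * (1 / (1 - cmod c)) / l" .
qed

text \<open>The kernel itself serves as the injective function: the derivative of
  \<open>log_test c\<close> is that of the kernel times \<open>2 * log_kernel c / L\<close>. This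
  factor is at most \<open>8\<close>, as the kernel is bounded by \<open>2 * (1 + L)\<close>; seen
  from the origin it is a small power of \<open>1 - cmod z\<close> divided by \<open>L\<close>,
  whence the decay of the energy.\<close>

lemma mob_energy_log_test_le:
  assumes adm: "admissible p s"
  obtains C where "0 < C"
    "\<forall>c a. cmod c < 1 \<longrightarrow> 1 \<le> ln (1 / (1 - (cmod c)\<^sup>2)) \<longrightarrow> cmod a < 1 \<longrightarrow>
       mob_energy p s (log_test c) a \<le> ennreal (C powr p)"
    "\<forall>c. cmod c < 1 \<longrightarrow> 1 \<le> ln (1 / (1 - (cmod c)\<^sup>2)) \<longrightarrow>
       energy p s (log_test c) \<le> ennreal ((C / ln (1 / (1 - (cmod c)\<^sup>2))) powr p)"
proof -
  note ps = admissible_range[OF adm]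
  obtain \<kappa> C where \<kappa>: "0 < \<kappa>" "\<kappa> \<le> 1" and C: "0 < C"
    and bound: "\<forall>f \<gamma> a K M. f holomorphic_on unit_disk \<longrightarrow> \<gamma> holomorphic_on unit_disk \<longrightarrow> inj_on \<gamma> unit_disk \<longrightarrow>
       cmod a < 1 \<longrightarrow> 0 < K \<longrightarrow> 0 < M \<longrightarrow>
       (\<forall>z. cmod z < 1 \<longrightarrow> cmod (deriv \<gamma> (disk_aut a z)) * (1 - (cmod (disk_aut a z))\<^sup>2) \<le> K * (1 - cmod z) powr (- \<kappa>)) \<longrightarrow>
       (\<forall>z. cmod z < 1 \<longrightarrow> cmod (deriv f (disk_aut a z)) \<le> M * (1 - cmod z) powr (- \<kappa>) * cmod (deriv \<gamma> (disk_aut a z))) \<longrightarrow>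
       mob_energy p s f a \<le> ennreal ((C * M * K) powr p)"
    by (rule injective_mob_energy_bound[OF adm]) (erule (3) that)
  have key: "mob_energy p s (log_test c) a \<le> ennreal ((C * M * 2) powr p)"
    if c: "cmod c < 1" and L: "1 \<le> ln (1 / (1 - (cmod c)\<^sup>2))" and a: "cmod a < 1" and M: "0 < M"
      and le: "\<And>z. cmod z < 1 \<Longrightarrow> 2 * cmod (log_kernel c (disk_aut a z)) \<le> M * ln (1 / (1 - (cmod c)\<^sup>2)) * (1 - cmod z) powr (- \<kappa>)"
    for c a M
  proof -
    define l where "l = ln (1 / (1 - (cmod c)\<^sup>2))"
    have l: "1 \<le> l" using L by (simp add: l_def)
    have c0: "c \<noteq> 0" using L by auto
    show ?thesis
    proof (rule bound[rule_format, OF log_test_holomorphic[OF c] log_kernel_holomorphic[OF c] inj_on_log_kernel[OF c c0] a _ M])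
      fix z assume z: "cmod z < 1"
      define w where "w = disk_aut a z"
      have w: "cmod w < 1" using a z by (simp add: w_def)
      have "cmod (deriv (log_kernel c) w) * (1 - (cmod w)\<^sup>2) \<le> 2 * 1"
        using norm_deriv_log_kernel_le(1)[OF c w] by (simp add: mult.commute)
      also have "\<dots> \<le> 2 * (1 - cmod z) powr (- \<kappa>)"
        using z \<kappa> by (intro mult_left_mono) (auto simp: powr_minus powr_le1 one_le_inverse_iff)
      finally show "cmod (deriv (log_kernel c) (disk_aut a z)) * (1 - (cmod (disk_aut a z))\<^sup>2) \<le> 2 * (1 - cmod z) powr (- \<kappa>)"
        by (simp add: w_def)
      have "cmod (deriv (log_test c) w) = 2 * cmod (log_kernel c w) * cmod (deriv (log_kernel c) w) / l"
        using deriv_log_test[OF c w] l by (simp add: norm_divide norm_mult l_def[symmetric])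
      also have "\<dots> \<le> M * l * (1 - cmod z) powr (- \<kappa>) * cmod (deriv (log_kernel c) w) / l"
        using le[OF z] l by (intro divide_right_mono mult_right_mono) (auto simp: w_def l_def)
      also have "\<dots> = M * (1 - cmod z) powr (- \<kappa>) * cmod (deriv (log_kernel c) w)" using l by simp
      finally show "cmod (deriv (log_test c) (disk_aut a z)) \<le> M * (1 - cmod z) powr (- \<kappa>) * cmod (deriv (log_kernel c) (disk_aut a z))"
        by (simp add: w_def)
    qed simp
  qed
  define C' where "C' = max (C * 8 * 2) (C * (4 / \<kappa>) * 2)"
  show ?thesis
  proof (rule that[of C'])
    show "0 < C'" using C by (simp add: C'_def)
    show "\<forall>c a. cmod c < 1 \<longrightarrow> 1 \<le> ln (1 / (1 - (cmod c)\<^sup>2)) \<longrightarrow> cmod a < 1 \<longrightarrow>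
       mob_energy p s (log_test c) a \<le> ennreal (C' powr p)"
    proof (intro allI impI)
      fix c a assume c: "cmod c < 1" and L: "1 \<le> ln (1 / (1 - (cmod c)\<^sup>2))" and a: "cmod a < 1"
      have "mob_energy p s (log_test c) a \<le> ennreal ((C * 8 * 2) powr p)"
      proof (rule key[OF c L a])
        fix z assume z: "cmod z < 1"
        have w: "cmod (disk_aut a z) < 1" using a z by simp
        have "2 * cmod (log_kernel c (disk_aut a z)) \<le> 8 * ln (1 / (1 - (cmod c)\<^sup>2)) * 1"
          using norm_log_kernel_le(2)[OF c w] ln_one_minus_norm_le[OF c] L by simp
        also have "\<dots> \<le> 8 * ln (1 / (1 - (cmod c)\<^sup>2)) * (1 - cmod z) powr (- \<kappa>)"
          using z \<kappa> L by (intro mult_left_mono) (auto simp: powr_minus powr_le1 one_le_inverse_iff)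
        finally show "2 * cmod (log_kernel c (disk_aut a z)) \<le> 8 * ln (1 / (1 - (cmod c)\<^sup>2)) * (1 - cmod z) powr (- \<kappa>)" .
      qed simp
      also have "\<dots> \<le> ennreal (C' powr p)" using C ps by (intro ennreal_leI powr_mono2) (auto simp: C'_def)
      finally show "mob_energy p s (log_test c) a \<le> ennreal (C' powr p)" .
    qed
    show "\<forall>c. cmod c < 1 \<longrightarrow> 1 \<le> ln (1 / (1 - (cmod c)\<^sup>2)) \<longrightarrow>
       energy p s (log_test c) \<le> ennreal ((C' / ln (1 / (1 - (cmod c)\<^sup>2))) powr p)"
    proof (intro allI impI)
      fix c :: complex assume c: "cmod c < 1" and L: "1 \<le> ln (1 / (1 - (cmod c)\<^sup>2))"
      define l where "l = ln (1 / (1 - (cmod c)\<^sup>2))"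
      have l: "1 \<le> l" using L by (simp add: l_def)
      have "mob_energy p s (log_test c) 0 \<le> ennreal ((C * (4 / \<kappa> / l) * 2) powr p)"
      proof (rule key[OF c L])
        show "0 < 4 / \<kappa> / l" using \<kappa> l by simp
        fix z :: complex assume z: "cmod z < 1"
        have w: "cmod (disk_aut 0 z) < 1" "cmod (disk_aut 0 z) = cmod z" using z by (auto simp: disk_aut_def)
        have "ln (1 / (1 - cmod z)) \<le> (1 - cmod z) powr (- \<kappa>) / \<kappa>"
          using ln_powr_bound[of "1 / (1 - cmod z)" \<kappa>] z \<kappa> by (simp add: powr_divide powr_minus inverse_eq_divide)
        then have "2 * cmod (log_kernel c (disk_aut 0 z)) \<le> 4 * ((1 - cmod z) powr (- \<kappa>) / \<kappa>)"
          using norm_log_kernel_le(1)[OF c w(1)] unfolding w(2) by simp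
        then show "2 * cmod (log_kernel c (disk_aut 0 z)) \<le> 4 / \<kappa> / l * ln (1 / (1 - (cmod c)\<^sup>2)) * (1 - cmod z) powr (- \<kappa>)"
          unfolding l_def[symmetric] using l by simp
      qed simp
      also have "\<dots> \<le> ennreal ((C' / l) powr p)"
      proof (intro ennreal_leI powr_mono2)
        have "C * (4 / \<kappa>) * 2 / l \<le> C' / l" using l by (intro divide_right_mono) (auto simp: C'_def)
        then show "C * (4 / \<kappa> / l) * 2 \<le> C' / l" by simp
      qed (use C \<kappa> l ps in auto)
      finally show "energy p s (log_test c) \<le> ennreal ((C' / ln (1 / (1 - (cmod c)\<^sup>2))) powr p)"
        unfolding l_def mob_energy_0[OF adm log_test_holomorphic[OF c]] .
    qed
  qed
qed

section \<open>The gliding hump\<close>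

lemma mob_energy_sum_le:
  fixes f :: "nat \<Rightarrow> complex \<Rightarrow> complex"
  assumes p: "1 < p" and a: "cmod a < 1" and f: "\<And>k. f k holomorphic_on unit_disk"
    and b: "\<And>k. k \<le> n \<Longrightarrow> 0 < b k" "\<And>k. k \<le> n \<Longrightarrow> mob_energy p s (f k) a \<le> ennreal (b k powr p)"
  shows "mob_energy p s (\<lambda>z. \<Sum>k\<le>n. f k z) a \<le> ennreal ((\<Sum>k\<le>n. b k) powr p)"
  using b
proof (induction n)
  case 0
  then show ?case by simp
next
  case (Suc n)
  have "mob_energy p s (\<lambda>z. (\<Sum>k\<le>n. f k z) + f (Suc n) z) a \<le> ennreal (((\<Sum>k\<le>n. b k) + b (Suc n)) powr p)"
  proof (rule mob_energy_add_le[OF p _ f a _ Suc.IH])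
    show "(\<lambda>z. \<Sum>k\<le>n. f k z) holomorphic_on unit_disk" by (intro holomorphic_intros f)
    show "0 < (\<Sum>k\<le>n. b k)" using Suc.prems(1) by (intro sum_pos) auto
  qed (use Suc.prems in auto)
  then show ?case by simp
qed

text \<open>If of any two of the seminorms the smaller one is tiny, all but the largest are tiny.\<close>

lemma mob_energy_almost_disjoint_sum_le:
  fixes f :: "nat \<Rightarrow> complex \<Rightarrow> complex"
  assumes p: "1 < p" and a: "cmod a < 1" and f: "\<And>k. f k holomorphic_on unit_disk" and C: "0 < C"
    and le: "\<And>k. mob_energy p s (f k) a \<le> ennreal (C powr p)"
    and dis: "\<And>i k. i < k \<Longrightarrow> mob_energy p s (f i) a \<le> ennreal (((1/2) ^ k) powr p) \<or> mob_energy p s (f k) a \<le> ennreal (((1/2) ^ k) powr p)"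
  shows "mob_energy p s (\<lambda>z. \<Sum>k\<le>n. f k z) a \<le> ennreal ((C + 2) powr p)"
proof -
  define m where "m k = mob_energy p s (f k) a" for k
  have "Max (m ` {..n}) \<in> m ` {..n}" by (intro Max_in) auto
  then obtain j where j: "j \<le> n" "Max (m ` {..n}) = m j" by (metis atMost_iff imageE)
  have mj: "m k \<le> m j" if "k \<le> n" for k
    unfolding j(2)[symmetric] using that by (intro Max_ge) auto
  define b where "b k = (if k = j then C else (1/2) ^ k)" for k
  have small: "m k \<le> ennreal (((1/2) ^ k) powr p)" if k: "k \<le> n" "k \<noteq> j" for k
  proof (cases "k < j")
    case True
    have "m k \<le> ennreal (((1/2) ^ j) powr p)" using dis[OF True] mj[OF k(1)] by (auto simp: m_def)
    also have "\<dots> \<le> ennreal (((1/2) ^ k) powr p)"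
      using True p by (intro ennreal_leI powr_mono2 power_decreasing) auto
    finally show ?thesis .
  next
    case False
    then show ?thesis using dis[of j k] mj[OF k(1)] k by (auto simp: m_def)
  qed
  have "mob_energy p s (\<lambda>z. \<Sum>k\<le>n. f k z) a \<le> ennreal ((\<Sum>k\<le>n. b k) powr p)"
  proof (rule mob_energy_sum_le[OF p a f])
    show "mob_energy p s (f k) a \<le> ennreal (b k powr p)" if "k \<le> n" for k
      using le[of k] small[OF that] by (auto simp: b_def m_def)
  qed (auto simp: b_def C)
  also have "\<dots> \<le> ennreal ((C + 2) powr p)"
  proof (intro ennreal_leI powr_mono2)
    have "(\<Sum>k\<le>n. b k) \<le> (\<Sum>k\<le>n. (if k = j then C else 0) + (1/2) ^ k)"
      by (intro sum_mono) (auto simp: b_def)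
    also have "\<dots> = C + (\<Sum>k\<le>n. (1/2) ^ k)" using j(1) by (simp add: sum.distrib)
    also have "(\<Sum>k\<le>n. (1/2) ^ k) \<le> (2::real)"
      using sum_le_suminf[of "\<lambda>k. (1/2::real) ^ k" "{..n}"] suminf_geometric[of "1/2::real"] by (simp add: summable_geometric)
    finally show "(\<Sum>k\<le>n. b k) \<le> C + 2" by simp
    show "0 \<le> (\<Sum>k\<le>n. b k)" using C by (intro sum_nonneg) (auto simp: b_def)
  qed (use p in auto)
  finally show ?thesis .
qed

lemma energy_small_imp_mob_energy_small:
  assumes adm: "admissible p s" and R: "0 \<le> R" "R < 1" and \<epsilon>: "0 < \<epsilon>"
  obtains \<delta> where "0 < \<delta>"
    "\<And>g a. g holomorphic_on unit_disk \<Longrightarrow> energy p s g \<le> ennreal (\<delta> powr p) \<Longrightarrow> cmod a \<le> R \<Longrightarrow> mob_energy p s g a \<le> ennreal (\<epsilon> powr p)"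
proof -
  note ps = admissible_range[OF adm]
  define q where "q = s - p + 2"
  have q: "0 < q" using ps by (simp add: q_def)
  define M where "M = (1 + R) / (1 - R)"
  have M: "0 < M" using R by (simp add: M_def)
  \<comment> \<open>\<open>M powr q\<close> bounds the constant of
    \<open>mob_energy_le_energy\<close> for \<open>cmod a \<le> R\<close>; \<open>\<delta>\<close>
    is such that \<open>M powr q * \<delta> powr p = \<epsilon> powr p\<close>.\<close>
  define \<delta> where "\<delta> = \<epsilon> * M powr (- q / p)"
  have \<delta>: "0 < \<delta>" using \<epsilon> M by (simp add: \<delta>_def)
  have \<delta>p: "M powr q * \<delta> powr p = \<epsilon> powr p"
  proof -
    have "\<delta> powr p = \<epsilon> powr p * M powr (- q)"
      using \<epsilon> M ps by (simp add: \<delta>_def powr_mult powr_powr)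
    then show ?thesis using M by (simp add: powr_minus)
  qed
  show ?thesis
  proof (rule that[OF \<delta>])
    fix g a assume g: "g holomorphic_on unit_disk" and e: "energy p s g \<le> ennreal (\<delta> powr p)" and a: "cmod a \<le> R"
    have "mob_energy p s g a \<le> ennreal (((1 + cmod a) / (1 - cmod a)) powr q) * energy p s g"
      unfolding q_def using a R by (intro mob_energy_le_energy adm g) simp
    also have "\<dots> \<le> ennreal (M powr q) * ennreal (\<delta> powr p)"
      unfolding M_def using a R q by (intro mult_mono e ennreal_leI powr_mono2 frac_le) auto
    also have "\<dots> = ennreal (\<epsilon> powr p)" unfolding \<delta>p[symmetric] by (simp add: ennreal_mult)
    finally show "mob_energy p s g a \<le> ennreal (\<epsilon> powr p)" .
  qed
qed

lemma eventually_at_unit_circleI: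
  "r < 1 \<Longrightarrow> (\<And>z. r < cmod z \<Longrightarrow> cmod z < 1 \<Longrightarrow> P z) \<Longrightarrow> eventually P at_unit_circle"
  unfolding eventually_at_unit_circle by blast

lemma log_term_at_top: "\<forall>\<^sub>F z in at_unit_circle. N \<le> ln (1 / (1 - (cmod z)\<^sup>2))"
  by (rule log_term_ge[of N]) (rule eventually_at_unit_circleI)

text \<open>For \<open>a\<close> near the circle the energy of \<open>log_test c\<close> is small
  because the function is in \<open>m0\<close>. For the remaining \<open>a\<close>, which stay in a
  compact disk, that of \<open>log_test w\<close> is small once the logarithm at \<open>w\<close> is
  large.\<close>

lemma log_test_eventually_disjoint:
  assumes adm: "admissible p s" and c: "cmod c < 1" and L: "1 \<le> ln (1 / (1 - (cmod c)\<^sup>2))" and \<epsilon>: "0 < \<epsilon>"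
  shows "\<forall>\<^sub>F w in at_unit_circle. \<forall>a. cmod a < 1 \<longrightarrow>
      mob_energy p s (log_test c) a \<le> ennreal (\<epsilon> powr p) \<or> mob_energy p s (log_test w) a \<le> ennreal (\<epsilon> powr p)"
proof -
  note ps = admissible_range[OF adm]
  obtain r where r: "r < 1" "\<And>a. r < cmod a \<Longrightarrow> cmod a < 1 \<Longrightarrow> mob_energy p s (log_test c) a \<le> ennreal (\<epsilon> powr p)"
    using log_test_in_m0[OF adm c L] \<epsilon> unfolding m0_iff[OF adm] by meson
  have R: "0 \<le> max r 0" "max r 0 < 1" using r(1) by auto
  obtain \<delta> where \<delta>: "0 < \<delta>"
    "\<And>g a. g holomorphic_on unit_disk \<Longrightarrow> energy p s g \<le> ennreal (\<delta> powr p) \<Longrightarrow> cmod a \<le> max r 0 \<Longrightarrow> mob_energy p s g a \<le> ennreal (\<epsilon> powr p)"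
    using energy_small_imp_mob_energy_small[OF adm R \<epsilon>] by metis
  obtain C where C: "0 < C"
    "\<forall>c. cmod c < 1 \<longrightarrow> 1 \<le> ln (1 / (1 - (cmod c)\<^sup>2)) \<longrightarrow>
       energy p s (log_test c) \<le> ennreal ((C / ln (1 / (1 - (cmod c)\<^sup>2))) powr p)"
    using mob_energy_log_test_le[OF adm] by metis
  have "\<forall>\<^sub>F w in at_unit_circle. 0 < cmod w \<and> cmod w < 1"
    by (rule eventually_at_unit_circleI[of 0]) auto
  with log_term_at_top[of "max 1 (C / \<delta>)"] show ?thesis
  proof eventually_elim
    case (elim w)
    define l where "l = ln (1 / (1 - (cmod w)\<^sup>2))"
    have l: "1 \<le> l" "C / \<delta> \<le> l" using elim by (auto simp: l_def)
    have "energy p s (log_test w) \<le> ennreal ((C / l) powr p)" unfolding l_def using C(2) elim by auto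
    also have "\<dots> \<le> ennreal (\<delta> powr p)"
      using l C(1) \<delta>(1) ps by (intro ennreal_leI powr_mono2) (auto simp: field_simps)
    finally have e: "energy p s (log_test w) \<le> ennreal (\<delta> powr p)" .
    show ?case
    proof (intro allI impI)
      fix a :: complex assume a: "cmod a < 1"
      show "mob_energy p s (log_test c) a \<le> ennreal (\<epsilon> powr p) \<or> mob_energy p s (log_test w) a \<le> ennreal (\<epsilon> powr p)"
      proof (cases "r < cmod a")
        case True
        then show ?thesis using r(2) a by blast
      next
        case False
        then show ?thesis using elim by (intro disjI2 \<delta>(2) log_test_holomorphic e) auto
      qed
    qed
  qed
qed

text \<open>Given the previous points, all other requirements on \<open>z k\<close> hold for every
  point sufficiently near the circle, while \<open>bad\<close> points occur arbitrarily near it.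
  Almost disjointness controls the seminorm of the sum; the last two requirements control its values
  at the points themselves.\<close>

lemma gliding_hump_sequence:
  assumes adm: "admissible p s" and bad: "\<exists>\<^sub>F z in at_unit_circle. bad z"
  obtains z :: "nat \<Rightarrow> complex" where "\<And>k. cmod (z k) < 1" "\<And>k. bad (z k)"
    "\<And>k. 2 ^ k + 8 \<le> ln (1 / (1 - (cmod (z k))\<^sup>2))"
    "\<And>i k a. i < k \<Longrightarrow> cmod a < 1 \<Longrightarrow> mob_energy p s (log_test (z i)) a \<le> ennreal (((1/2) ^ k) powr p) \<or>
        mob_energy p s (log_test (z k)) a \<le> ennreal (((1/2) ^ k) powr p)"
    "\<And>i k. i < k \<Longrightarrow> cmod (log_test (z k) (z i)) \<le> (1/2) ^ k"
    "\<And>k. (\<Sum>i<k. cmod (log_test (z i) (z k))) \<le> ln (1 / (1 - (cmod (z k))\<^sup>2)) / 4"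
proof -
  define L where "L w = ln (1 / (1 - (cmod w)\<^sup>2))" for w :: complex
  define A where "A k v w \<longleftrightarrow> (\<forall>a. cmod a < 1 \<longrightarrow> mob_energy p s (log_test v) a \<le> ennreal (((1/2) ^ k) powr p) \<or>
        mob_energy p s (log_test w) a \<le> ennreal (((1/2) ^ k) powr p))" for k v w
  \<comment> \<open>The lower bound \<open>2 ^ k\<close> gives convergence of the series; the
    \<open>8\<close> absorbs the tail of the sum in \<open>gliding_hump_function\<close>.\<close>
  define Q where "Q f k w \<longleftrightarrow> (cmod w < 1 \<and> bad w \<and> 2 ^ k + 8 \<le> L w) \<and>
     (\<forall>i<k. A k (f i) w \<and> cmod (log_test w (f i)) \<le> (1/2) ^ k) \<and> (\<Sum>i<k. cmod (log_test (f i) w)) \<le> L w / 4"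
    for f :: "nat \<Rightarrow> complex" and k w
  have "\<exists>z. \<forall>k. Q z k (z k)"
  proof (rule dependent_wellorder_choice)
    fix w and f g :: "nat \<Rightarrow> complex" and k :: nat
    assume "\<And>y. y < k \<Longrightarrow> f y = g y"
    then show "Q f k w = Q g k w" by (simp add: Q_def)
  next
    fix k :: nat and f :: "nat \<Rightarrow> complex" assume prev: "\<And>i. i < k \<Longrightarrow> Q f i (f i)"
    have fi: "cmod (f i) < 1" "1 \<le> L (f i)" if "i < k" for i
      using prev[OF that] by (auto simp: Q_def intro: order_trans[of 1 "2 ^ i + 8" "L (f i)"])
    have in_disk: "\<forall>\<^sub>F w in at_unit_circle. cmod w < 1"
      by (rule eventually_at_unit_circleI[of 0]) auto
    have evA: "\<forall>\<^sub>F w in at_unit_circle. \<forall>i\<in>{..<k}. A k (f i) w"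
      unfolding A_def using fi by (intro eventually_ball_finite ballI log_test_eventually_disjoint adm) (auto simp: L_def)
    have evB: "\<forall>\<^sub>F w in at_unit_circle. \<forall>i\<in>{..<k}. cmod (log_test w (f i)) \<le> (1/2) ^ k"
    proof (intro eventually_ball_finite ballI)
      fix i assume "i \<in> {..<k}"
      then have i: "cmod (f i) < 1" using fi by auto
      define B where "B = 4 / (1 - cmod (f i))\<^sup>2"
      from in_disk log_term_at_top[of "max 1 (B * 2 ^ k)"]
      show "\<forall>\<^sub>F w in at_unit_circle. cmod (log_test w (f i)) \<le> (1/2) ^ k"
      proof eventually_elim
        case (elim w)
        then have l: "1 \<le> L w" "B * 2 ^ k \<le> L w" by (auto simp: L_def)
        have "cmod (log_test w (f i)) \<le> B / L w"
          unfolding B_def L_def using l by (intro norm_log_test_le(1) elim i) (auto simp: L_def)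
        also have "\<dots> \<le> (1/2) ^ k" using l by (simp add: field_simps power_divide)
        finally show ?case .
      qed
    qed simp
    define S where "S = (\<Sum>i<k. 16 * L (f i))"
    have "\<forall>\<^sub>F w in at_unit_circle. (cmod w < 1 \<and> 2 ^ k + 8 \<le> L w) \<and>
     (\<forall>i<k. A k (f i) w \<and> cmod (log_test w (f i)) \<le> (1/2) ^ k) \<and> (\<Sum>i<k. cmod (log_test (f i) w)) \<le> L w / 4"
      using in_disk log_term_at_top[of "max (2 ^ k + 8) (4 * S)"] evA evB
    proof eventually_elim
      case (elim w)
      have "(\<Sum>i<k. cmod (log_test (f i) w)) \<le> S"
        unfolding S_def L_def using fi elim by (intro sum_mono norm_log_test_le(2)) (auto simp: L_def)
      also have "S \<le> L w / 4" using elim by (simp add: L_def)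
      finally show ?case using elim by (auto simp: L_def)
    qed
    from frequently_eventually_conj[OF bad this] have "\<exists>\<^sub>F w in at_unit_circle. Q f k w"
      by (rule frequently_elim1) (auto simp: Q_def)
    then show "\<exists>w. Q f k w" by (rule frequently_ex)
  qed
  then obtain z where z: "\<And>k. Q z k (z k)" by blast
  show ?thesis
  proof (rule that[of z])
    show "cmod (z k) < 1" "bad (z k)" "2 ^ k + 8 \<le> ln (1 / (1 - (cmod (z k))\<^sup>2))"
      "(\<Sum>i<k. cmod (log_test (z i) (z k))) \<le> ln (1 / (1 - (cmod (z k))\<^sup>2)) / 4" for k
      using z[of k] by (auto simp: Q_def L_def)
    show "cmod (log_test (z k) (z i)) \<le> (1/2) ^ k" if "i < k" for i k
      using z[of k] that by (simp add: Q_def)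
    show "mob_energy p s (log_test (z i)) a \<le> ennreal (((1/2) ^ k) powr p) \<or>
        mob_energy p s (log_test (z k)) a \<le> ennreal (((1/2) ^ k) powr p)" if "i < k" "cmod a < 1" for i k a
      using z[of k] that by (simp add: Q_def A_def)
  qed
qed

text \<open>\<open>h\<close> is the sum of the test functions at the points of the sequence. Its
  partial sums have bounded seminorms since they are almost disjoint, and Fatou's lemma passes to
  the limit. At \<open>z k\<close> its own term has modulus \<open>L\<close>, and the others cannot
  cancel more than half of it.\<close>

lemma gliding_hump_function:
  assumes adm: "admissible p s" and bad: "\<exists>\<^sub>F z in at_unit_circle. bad z"
  obtains h and z :: "nat \<Rightarrow> complex" where "h \<in> M0 p s" "\<And>k. cmod (z k) < 1" "\<And>k. bad (z k)"
    "\<And>k. 2 ^ k + 8 \<le> ln (1 / (1 - (cmod (z k))\<^sup>2))"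
    "\<And>k. ln (1 / (1 - (cmod (z k))\<^sup>2)) / 2 \<le> cmod (h (z k))"
proof -
  note ps = admissible_range[OF adm]
  define L where "L w = ln (1 / (1 - (cmod w)\<^sup>2))" for w :: complex
  obtain z :: "nat \<Rightarrow> complex" where z: "\<And>k. cmod (z k) < 1" "\<And>k. bad (z k)" "\<And>k. 2 ^ k + 8 \<le> L (z k)"
    and dis: "\<And>i k a. i < k \<Longrightarrow> cmod a < 1 \<Longrightarrow> mob_energy p s (log_test (z i)) a \<le> ennreal (((1/2) ^ k) powr p) \<or>
        mob_energy p s (log_test (z k)) a \<le> ennreal (((1/2) ^ k) powr p)"
    and later: "\<And>i k. i < k \<Longrightarrow> cmod (log_test (z k) (z i)) \<le> (1/2) ^ k"
    and earlier: "\<And>k. (\<Sum>i<k. cmod (log_test (z i) (z k))) \<le> L (z k) / 4"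
    unfolding L_def using gliding_hump_sequence[OF adm bad] by metis
  have L: "2 ^ k \<le> L (z k)" "1 \<le> L (z k)" for k
    using z(3)[of k] by (auto intro: order_trans[of 1 "2 ^ k + 8" "L (z k)"])
  define f where "f k = log_test (z k)" for k
  have hol: "f k holomorphic_on unit_disk" for k unfolding f_def by (rule log_test_holomorphic[OF z(1)])
  \<comment> \<open>On compact sets the terms are of order \<open>1 / L (z k)\<close>, hence
    dominated by a geometric series, which makes the sum holomorphic.\<close>
  have small: "cmod (f k y) \<le> 4 / (1 - R)\<^sup>2 * (1/2) ^ k" if "cmod y \<le> R" "R < 1" for k y R
  proof -
    have y: "cmod y < 1" using that by simp
    have "cmod (f k y) \<le> 4 / (1 - cmod y)\<^sup>2 / L (z k)"
      unfolding f_def L_def using L(2)[of k] by (intro norm_log_test_le(1) z y) (simp add: L_def)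
    also have "\<dots> \<le> 4 / (1 - R)\<^sup>2 / 2 ^ k"
      using that y L(1)[of k] by (intro frac_le power_mono) auto
    finally show ?thesis by (simp add: power_divide)
  qed
  have "\<exists>h h'. \<forall>x\<in>unit_disk. ((\<lambda>n. f n x) sums h x) \<and> ((\<lambda>n. deriv (f n) x) sums h' x) \<and> (h has_field_derivative h' x) (at x)"
  proof (rule series_and_derivative_comparison_complex[OF open_ball])
    show "(f n has_field_derivative deriv (f n) x) (at x)" if "x \<in> unit_disk" for n x
      by (rule holomorphic_derivI[OF hol open_ball that])
    fix x :: complex assume x: "x \<in> unit_disk"
    define R where "R = (1 + cmod x) / 2"
    have R: "cmod x < R" "R < 1" using x by (auto simp: R_def)
    define e where "e n = complex_of_real (4 / (1 - R)\<^sup>2 * (1/2) ^ n)" for n :: nat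
    have "summable (\<lambda>n. 4 / (1 - R)\<^sup>2 * (1/2) ^ n)" by (intro summable_mult summable_geometric) simp
    then have "summable e" unfolding e_def[abs_def] by (rule summable_of_real)
    moreover have "range e \<subseteq> \<real>\<^sub>\<ge>\<^sub>0" by (auto simp: e_def simp del: of_real_divide of_real_mult of_real_power)
    moreover have "cmod (f n y) \<le> cmod (e n)" if y: "y \<in> ball x (R - cmod x) \<inter> unit_disk" for n y
    proof -
      have "cmod y \<le> cmod x + dist x y" using norm_triangle_ineq[of x "y - x"] by (simp add: dist_norm norm_minus_commute)
      then have "cmod y \<le> R" using y by simp
      then show ?thesis using small[of y R n] R unfolding e_def norm_of_real by (auto intro: order_trans)
    qed
    ultimately show "\<exists>d e. 0 < d \<and> summable e \<and> range e \<subseteq> \<real>\<^sub>\<ge>\<^sub>0 \<and> (\<forall>\<^sub>F n in sequentially. \<forall>y\<in>ball x d \<inter> unit_disk. cmod (f n y) \<le> cmod (e n))"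
      using R(1) by (intro exI[of _ "R - cmod x"] exI[of _ e]) auto
  qed
  then obtain h h' where h: "\<And>x. x \<in> unit_disk \<Longrightarrow> (\<lambda>n. f n x) sums h x" "\<And>x. x \<in> unit_disk \<Longrightarrow> (\<lambda>n. deriv (f n) x) sums h' x"
    "\<And>x. x \<in> unit_disk \<Longrightarrow> (h has_field_derivative h' x) (at x)" by metis
  have hhol: "h holomorphic_on unit_disk" unfolding holomorphic_on_open[OF open_ball] using h(3) by blast
  define S where "S n x = (\<Sum>k\<le>n. f k x)" for n x
  have Shol: "S n holomorphic_on unit_disk" for n unfolding S_def by (intro holomorphic_intros hol)
  have dS: "(\<lambda>n. deriv (S n) x) \<longlonglongrightarrow> deriv h x" if x: "x \<in> unit_disk" for x
  proof -
    have "(S n has_field_derivative (\<Sum>k\<le>n. deriv (f k) x)) (at x)" for n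
      unfolding S_def by (rule DERIV_sum) (rule holomorphic_derivI[OF hol open_ball x])
    then have "deriv (S n) x = (\<Sum>k\<le>n. deriv (f k) x)" for n by (rule DERIV_imp_deriv)
    moreover have "deriv h x = h' x" by (rule DERIV_imp_deriv[OF h(3)[OF x]])
    ultimately show ?thesis using h(2)[OF x] by (simp add: sums_def_le)
  qed
  obtain C where C: "0 < C"
    "\<forall>c a. cmod c < 1 \<longrightarrow> 1 \<le> ln (1 / (1 - (cmod c)\<^sup>2)) \<longrightarrow> cmod a < 1 \<longrightarrow> mob_energy p s (log_test c) a \<le> ennreal (C powr p)"
    using mob_energy_log_test_le[OF adm] by metis
  have "mob_energy p s h a \<le> ennreal ((C + 2) powr p)" if a: "cmod a < 1" for a
  proof (rule mob_energy_Fatou[OF Shol ps(2) hhol a dS])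
    fix n
    show "mob_energy p s (S n) a \<le> ennreal ((C + 2) powr p)"
      unfolding S_def
    proof (rule mob_energy_almost_disjoint_sum_le[OF ps(1) a hol C(1)])
      show "mob_energy p s (f k) a \<le> ennreal (C powr p)" for k
        unfolding f_def using C(2) z(1)[of k] L(2)[of k] a by (auto simp: L_def)
    qed (use dis[OF _ a] in \<open>simp add: f_def\<close>)
  qed
  then have hM: "h \<in> M0 p s" unfolding M0_iff[OF adm] using hhol C(1) by (auto intro!: exI[of _ "C + 2"])
  have "L (z k) / 2 \<le> cmod (h (z k))" for k
  proof -
    have zk: "z k \<in> unit_disk" using z(1) by simp
    have "(\<lambda>n. cmod (S n (z k))) \<longlonglongrightarrow> cmod (h (z k))"
      using h(1)[OF zk] unfolding S_def by (intro tendsto_norm) (simp add: sums_def_le)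
    moreover have "L (z k) / 2 \<le> cmod (S n (z k))" if n: "k \<le> n" for n
    proof -
      have "{..n} = {..<k} \<union> {k} \<union> {k<..n}" using n by auto
      then have "S n (z k) = (\<Sum>i\<in>{..<k} \<union> {k} \<union> {k<..n}. f i (z k))" by (simp add: S_def)
      also have "\<dots> = (\<Sum>i\<in>{..<k} \<union> {k}. f i (z k)) + (\<Sum>i\<in>{k<..n}. f i (z k))"
        by (rule sum.union_disjoint) auto
      also have "(\<Sum>i\<in>{..<k} \<union> {k}. f i (z k)) = (\<Sum>i<k. f i (z k)) + f k (z k)"
        by (subst sum.union_disjoint) auto
      finally have "f k (z k) = S n (z k) - (\<Sum>i<k. f i (z k)) - (\<Sum>i\<in>{k<..n}. f i (z k))" by simp
      then have "cmod (f k (z k)) \<le> cmod (S n (z k)) + cmod (\<Sum>i<k. f i (z k)) + cmod (\<Sum>i\<in>{k<..n}. f i (z k))"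
        by (metis norm_triangle_ineq4 add_right_mono order_trans)
      also have "cmod (\<Sum>i<k. f i (z k)) \<le> L (z k) / 4"
        using norm_sum[of "\<lambda>i. f i (z k)" "{..<k}"] earlier[of k] by (simp add: f_def)
      also have "cmod (\<Sum>i\<in>{k<..n}. f i (z k)) \<le> (\<Sum>i\<in>{k<..n}. (1/2) ^ i)"
        using later[of k] by (intro sum_norm_le) (auto simp: f_def)
      also have "\<dots> \<le> 2"
        using sum_le_suminf[of "\<lambda>k. (1/2::real) ^ k" "{k<..n}"] suminf_geometric[of "1/2::real"] by (simp add: summable_geometric)
      finally have "cmod (f k (z k)) \<le> cmod (S n (z k)) + L (z k) / 4 + 2" by simp
      moreover have "cmod (f k (z k)) = L (z k)"
        unfolding f_def log_test_self[OF z(1)] norm_of_real using L(2)[of k] by (simp add: L_def)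
      \<comment> \<open>Earlier terms take away at most a quarter of \<open>L (z k)\<close> and
        later ones at most \<open>2\<close>, which by this is another quarter.\<close>
      moreover have "8 \<le> L (z k)" using z(3)[of k] by (smt (verit) zero_le_power)
      ultimately show ?thesis by simp
    qed
    ultimately show ?thesis by (intro tendsto_lowerbound[of _ _ sequentially]) (auto intro: eventually_sequentiallyI[of k])
  qed
  then show ?thesis using that[of h z] hM z by (simp add: L_def)
qed

section \<open>Logarithmic growth of little Bloch functions\<close>

lemma m0_imp_little_Bloch:
  assumes adm: "admissible p s" and f: "f \<in> m0 p s" and \<epsilon>: "0 < \<epsilon>"
  shows "\<forall>\<^sub>F a in at_unit_circle. (1 - (cmod a)\<^sup>2) * cmod (deriv f a) \<le> \<epsilon>"
proof -
  have hol: "f holomorphic_on unit_disk" using f by (simp add: m0_iff[OF adm] M0_iff[OF adm])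
  obtain c where c: "0 < c" "\<And>f a B. f holomorphic_on unit_disk \<Longrightarrow> cmod a < 1 \<Longrightarrow> 0 \<le> B \<Longrightarrow> mob_energy p s f a \<le> ennreal (B powr p)
       \<Longrightarrow> (1 - (cmod a)\<^sup>2) * cmod (deriv f a) \<le> c * B"
    using Bloch_le_mob_energy[OF adm] by metis
  have "0 < \<epsilon> / c" using \<epsilon> c by simp
  then obtain r where r: "r < 1" "\<And>a. r < cmod a \<Longrightarrow> cmod a < 1 \<Longrightarrow> mob_energy p s f a \<le> ennreal ((\<epsilon> / c) powr p)"
    using f unfolding m0_iff[OF adm] by meson
  show ?thesis
  proof (rule eventually_at_unit_circleI[OF r(1)])
    fix a assume a: "r < cmod a" "cmod a < 1"
    show "(1 - (cmod a)\<^sup>2) * cmod (deriv f a) \<le> \<epsilon>"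
      using c(2)[OF hol a(2) _ r(2)[OF a]] \<epsilon> c(1) by simp
  qed
qed

text \<open>Integrating along a radius, the part beyond \<open>r\<close> contributes a small
  multiple of the logarithm and the part up to \<open>r\<close> only a constant, which is negligible
  near the circle.\<close>

lemma little_Bloch_log_growth:
  assumes f: "f holomorphic_on unit_disk"
    and little: "\<And>\<epsilon>. 0 < \<epsilon> \<Longrightarrow> \<forall>\<^sub>F a in at_unit_circle. (1 - (cmod a)\<^sup>2) * cmod (deriv f a) \<le> \<epsilon>" and \<epsilon>: "0 < \<epsilon>"
  shows "\<forall>\<^sub>F z in at_unit_circle. cmod (f z) \<le> \<epsilon> * ln (1 / (1 - (cmod z)\<^sup>2))"
proof -
  obtain r where r: "r < 1" "\<And>a. r < cmod a \<Longrightarrow> cmod a < 1 \<Longrightarrow> (1 - (cmod a)\<^sup>2) * cmod (deriv f a) \<le> \<epsilon> / 4"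
    using little[of "\<epsilon> / 4"] \<epsilon> unfolding eventually_at_unit_circle by auto
  have "continuous_on (cball 0 r) (deriv f)"
    using r(1) by (intro holomorphic_on_imp_continuous_on holomorphic_on_subset[OF holomorphic_deriv[OF f open_ball]]) auto
  then have "bounded (deriv f ` cball 0 r)" by (intro compact_imp_bounded compact_continuous_image) auto
  then obtain M where M: "0 < M" "\<And>w. w \<in> cball 0 r \<Longrightarrow> cmod (deriv f w) \<le> M"
    unfolding bounded_pos by blast
  have le: "cmod (f z - f 0) \<le> \<epsilon> / 4 * ln (1 / (1 - cmod z)) + M" if z: "cmod z < 1" for z
  proof -
    have "cmod (f z - f 0) \<le> (\<epsilon> / 4 * (- ln (1 - cmod z)) + M * cmod z) - (\<epsilon> / 4 * (- ln (1 - 0)) + M * 0)"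
    proof (rule norm_diff_0_le_radial[OF f z, where g = "\<lambda>x. \<epsilon> / 4 * (- ln (1 - x)) + M * x" and g' = "\<lambda>x. \<epsilon> / 4 / (1 - x) + M"])
      show "((\<lambda>x. \<epsilon> / 4 * (- ln (1 - x)) + M * x) has_real_derivative \<epsilon> / 4 / (1 - x) + M) (at x)" if "0 \<le> x" "x < 1" for x
        using that by (auto intro!: derivative_eq_intros simp: field_simps)
      fix w :: complex assume w: "cmod w < 1"
      show "cmod (deriv f w) \<le> \<epsilon> / 4 / (1 - cmod w) + M"
      proof (cases "r < cmod w")
        case True
        have "(1 - cmod w) * cmod (deriv f w) \<le> (1 - (cmod w)\<^sup>2) * cmod (deriv f w)"
          using w one_minus_norm_le(1)[of w] by (intro mult_right_mono) auto
        also have "\<dots> \<le> \<epsilon> / 4" by (rule r(2)[OF True w])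
        finally have "cmod (deriv f w) \<le> \<epsilon> / 4 / (1 - cmod w)" using w by (simp add: field_simps)
        then show ?thesis using M(1) by simp
      next
        case False
        then have "cmod (deriv f w) \<le> M" by (intro M(2)) simp
        moreover have "0 \<le> \<epsilon> / 4 / (1 - cmod w)" using \<epsilon> w by simp
        ultimately show ?thesis by simp
      qed
    qed
    moreover have "M * cmod z \<le> M" using M(1) z by simp
    ultimately show ?thesis using z by (simp add: ln_div)
  qed
  \<comment> \<open>Once the logarithm \<open>l\<close> exceeds \<open>N\<close>, the constants are
    at most \<open>\<epsilon> * l / 2\<close>.\<close>
  define N where "N = 2 * (M + cmod (f 0) + \<epsilon>) / \<epsilon>"
  have "\<forall>\<^sub>F z in at_unit_circle. cmod z < 1" by (rule eventually_at_unit_circleI[of 0]) auto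
  with log_term_at_top[of N] show ?thesis
  proof eventually_elim
    case (elim z)
    define l where "l = ln (1 / (1 - (cmod z)\<^sup>2))"
    have l: "M + cmod (f 0) + \<epsilon> \<le> \<epsilon> * l / 2" using elim(1) \<epsilon> by (simp add: N_def l_def field_simps)
    have "cmod (f z) \<le> cmod (f z - f 0) + cmod (f 0)" using norm_triangle_ineq[of "f z - f 0" "f 0"] by simp
    also have "cmod (f z - f 0) \<le> \<epsilon> / 4 * ln (1 / (1 - cmod z)) + M" by (rule le[OF elim(2)])
    also have "\<epsilon> / 4 * ln (1 / (1 - cmod z)) \<le> \<epsilon> / 4 * (1 + l)"
      unfolding l_def using \<epsilon> by (intro mult_left_mono ln_one_minus_norm_le elim) auto
    finally have "cmod (f z) \<le> \<epsilon> / 4 * (1 + l) + M + cmod (f 0)" by simp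
    also have "\<epsilon> / 4 * (1 + l) = \<epsilon> / 4 + \<epsilon> * l / 4" by (simp add: field_simps)
    finally have "cmod (f z) \<le> \<epsilon> * l" using l \<epsilon> M(1) norm_ge_zero[of "f 0"] by linarith
    then show ?case by (simp add: l_def)
  qed
qed

context disk_semigroup
begin

text \<open>Over bounded times the flow reduces \<open>1 - (cmod z)\<^sup>2\<close> by at most a
  constant factor, which the logarithm turns into a summand.\<close>

lemma log_term_flow_le:
  obtains K where "0 \<le> K"
    "\<And>t z. 0 \<le> t \<Longrightarrow> t \<le> T \<Longrightarrow> cmod z < 1 \<Longrightarrow> ln (1 / (1 - (cmod (\<phi> t z))\<^sup>2)) \<le> K + ln (1 / (1 - (cmod z)\<^sup>2))"
proof -
  obtain c where c: "0 < c" "\<And>t z. 0 \<le> t \<Longrightarrow> t \<le> T \<Longrightarrow> cmod z < 1 \<Longrightarrow> c * (1 - (cmod z)\<^sup>2) \<le> 1 - (cmod (\<phi> t z))\<^sup>2"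
    using one_minus_norm_ge by metis
  show ?thesis
  proof (rule that[of "\<bar>ln c\<bar>"])
    fix t z assume t: "0 \<le> t" "t \<le> T" and z: "cmod z < (1::real)"
    have x: "0 < 1 - (cmod z)\<^sup>2" "0 < 1 - (cmod (\<phi> t z))\<^sup>2"
      using one_minus_norm_pos[OF z] one_minus_norm_pos[OF in_disk[OF t(1) z]] by auto
    have "ln (c * (1 - (cmod z)\<^sup>2)) \<le> ln (1 - (cmod (\<phi> t z))\<^sup>2)"
      using c x t z by (intro ln_mono) auto
    moreover have "ln (c * (1 - (cmod z)\<^sup>2)) = ln c + ln (1 - (cmod z)\<^sup>2)"
      using c(1) x by (subst ln_mult) auto
    ultimately show "ln (1 / (1 - (cmod (\<phi> t z))\<^sup>2)) \<le> \<bar>ln c\<bar> + ln (1 / (1 - (cmod z)\<^sup>2))"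
      using x by (simp add: ln_div)
  qed simp
qed

lemma vanishing_if_strong_cont_subset_m0:
  assumes adm: "admissible p s" and G: "is_inf_generator \<phi> G"
    and sub: "strong_cont_subspace \<phi> (M0 p s) (M0_norm p s) \<subseteq> m0 p s"
  shows "vanishing_log_Bloch G"
proof (rule ccontr)
  assume "\<not> vanishing_log_Bloch G"
  then obtain \<eta> where \<eta>: "0 < \<eta>" "\<forall>r<1. \<exists>z. r < cmod z \<and> cmod z < 1 \<and> \<eta> \<le> (1 - (cmod z)\<^sup>2) / cmod (G z) * ln (1 / (1 - (cmod z)\<^sup>2))"
    unfolding vanishing_log_Bloch_iff by (metis not_less)
  define bad where "bad w \<longleftrightarrow> \<eta> \<le> (1 - (cmod w)\<^sup>2) / cmod (G w) * ln (1 / (1 - (cmod w)\<^sup>2))" for w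
  have "\<exists>\<^sub>F z in at_unit_circle. bad z"
    unfolding frequently_def eventually_at_unit_circle using \<eta>(2) by (auto simp: bad_def)
  then obtain h and z :: "nat \<Rightarrow> complex" where hM: "h \<in> M0 p s" and z: "\<And>k. cmod (z k) < 1"
    "\<And>k. bad (z k)" "\<And>k. 2 ^ k + 8 \<le> ln (1 / (1 - (cmod (z k))\<^sup>2))"
    "\<And>k. ln (1 / (1 - (cmod (z k))\<^sup>2)) / 2 \<le> cmod (h (z k))"
    using gliding_hump_function[OF adm] by metis
  define L where "L k = ln (1 / (1 - (cmod (z k))\<^sup>2))" for k
  have L: "2 ^ k \<le> L k" "1 \<le> L k" for k
    using z(3)[of k] zero_le_power[of "2::real" k] unfolding L_def by linarith+
  have hol: "h holomorphic_on unit_disk" using hM by (simp add: M0_iff[OF adm])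
  \<comment> \<open>The logarithms \<open>L k \<ge> 2 ^ k\<close> tend to infinity, so the points
    \<open>z k\<close> tend to the circle.\<close>
  have ev: "\<forall>\<^sub>F k in sequentially. P (z k)" if P: "eventually P at_unit_circle" for P
  proof -
    obtain r where r: "r < 1" "\<And>w. r < cmod w \<Longrightarrow> cmod w < 1 \<Longrightarrow> P w" using P unfolding eventually_at_unit_circle by blast
    define r' where "r' = max r 0"
    have r': "0 \<le> r'" "r' < 1" using r by (auto simp: r'_def)
    then have pos: "0 < 1 - r'\<^sup>2" by (simp add: abs_square_less_1)
    obtain n where n: "ln (1 / (1 - r'\<^sup>2)) < 2 ^ n" using real_arch_pow[of 2] by auto
    show ?thesis
    proof (rule eventually_sequentiallyI[of n])
      fix k assume "n \<le> k"
      then have "(2::real) ^ n \<le> 2 ^ k" by (intro power_increasing) auto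
      then have "ln (1 / (1 - r'\<^sup>2)) < ln (1 / (1 - (cmod (z k))\<^sup>2))" using n L(1)[of k] unfolding L_def by linarith
      then have "(1 - (cmod (z k))\<^sup>2) < 1 - r'\<^sup>2"
        using pos one_minus_norm_pos[OF z(1)[of k]] by (simp add: ln_div)
      then have "r' < cmod (z k)" by (intro power_less_imp_less_base[of r' 2]) auto
      then show "P (z k)" using r(2)[of "z k"] z(1) by (simp add: r'_def)
    qed
  qed
  \<comment> \<open>Increments of \<open>h\<close> along the flow, on the scale \<open>L k\<close>
    of \<open>h (z k)\<close>. They tend to \<open>0\<close> for each fixed \<open>t\<close>;
    dominated convergence then passes to the mean over \<open>t\<close>.\<close>
  define D where "D k t = (h (\<phi> t (z k)) - h (z k)) / of_real (L k)" for k t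
  have avg_m0: "avg h T \<in> m0 p s" if "0 < T" for T using avg_in_strong_cont[OF adm hM that] sub by blast
  have D0: "(\<lambda>k. D k t) \<longlonglongrightarrow> 0" if t: "t \<in> {0..1}" for t
  proof (cases "t = 0")
    case True
    then show ?thesis using z(1) by (simp add: D_def)
  next
    case False
    then have t: "0 < t" "0 \<le> t" using t by auto
    show ?thesis
    proof (rule LIMSEQ_I)
      fix e :: real assume e: "0 < e"
      have "\<forall>\<^sub>F k in sequentially. (1 - (cmod (z k))\<^sup>2) * cmod (deriv (avg h t) (z k)) \<le> e * \<eta> / 2"
        using e \<eta>(1) by (intro ev m0_imp_little_Bloch[OF adm avg_m0[OF t(1)]]) auto
      then have "\<forall>\<^sub>F k in sequentially. cmod (D k t - 0) < e"
      proof eventually_elim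
        case (elim k)
        \<comment> \<open>By the convention \<open>x / 0 = 0\<close> a zero of \<open>G\<close>
          would give \<open>\<eta> \<le> 0\<close>.\<close>
        have Gk: "G (z k) \<noteq> 0" using z(2)[of k] \<eta>(1) by (auto simp: bad_def)
        have Gle: "\<eta> * cmod (G (z k)) \<le> (1 - (cmod (z k))\<^sup>2) * L k"
          using z(2)[of k] Gk by (simp add: bad_def L_def field_simps)
        have "\<eta> * cmod (h (\<phi> t (z k)) - h (z k)) = cmod (deriv (avg h t) (z k)) * (\<eta> * cmod (G (z k)))"
          unfolding avg_deriv_generator[OF G hol t(2) z(1), symmetric] norm_mult by simp
        also have "\<dots> \<le> cmod (deriv (avg h t) (z k)) * ((1 - (cmod (z k))\<^sup>2) * L k)"
          by (intro mult_left_mono Gle) auto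
        also have "\<dots> = ((1 - (cmod (z k))\<^sup>2) * cmod (deriv (avg h t) (z k))) * L k" by simp
        also have "\<dots> \<le> (e * \<eta> / 2) * L k" using L(2)[of k] by (intro mult_right_mono elim) auto
        finally have "cmod (h (\<phi> t (z k)) - h (z k)) \<le> e / 2 * L k" using \<eta>(1) by (simp add: field_simps)
        then have "cmod (D k t) \<le> e / 2" using L(2)[of k] by (simp add: D_def norm_divide divide_le_eq)
        then show ?case using e by simp
      qed
      then show "\<exists>no. \<forall>n\<ge>no. cmod (D n t - 0) < e" by (simp add: eventually_sequentially)
    qed
  qed
  obtain \<beta> where \<beta>: "0 < \<beta>" "\<And>w. cmod w < 1 \<Longrightarrow> (1 - (cmod w)\<^sup>2) * cmod (deriv h w) \<le> \<beta>"
    using M0_imp_Bloch[OF adm hM] by metis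
  obtain K where K: "0 \<le> K" "\<And>t z. 0 \<le> t \<Longrightarrow> t \<le> 1 \<Longrightarrow> cmod z < 1 \<Longrightarrow> ln (1 / (1 - (cmod (\<phi> t z))\<^sup>2)) \<le> K + ln (1 / (1 - (cmod z)\<^sup>2))"
    using log_term_flow_le[of 1] by metis
  \<comment> \<open>The dominating constant: \<open>h\<close> is a Bloch function, so both values
    grow at most like the logarithm, which changes by at most \<open>K\<close> up to time
    \<open>1\<close>.\<close>
  have Dle: "cmod (D k t) \<le> \<beta> * (K + 4)" if t: "t \<in> {0..1}" for k t
  proof -
    have t: "0 \<le> t" "t \<le> 1" using t by auto
    note zt = in_disk[OF t(1) z(1)[of k]]
    have "cmod (h (\<phi> t (z k)) - h (z k)) \<le> cmod (h (\<phi> t (z k)) - h 0) + cmod (h (z k) - h 0)"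
      using norm_triangle_ineq4[of "h (\<phi> t (z k)) - h 0" "h (z k) - h 0"] by simp
    also have "\<dots> \<le> \<beta> * (1 + (K + L k)) + \<beta> * (1 + L k)"
    proof (intro add_mono)
      have "cmod (h (\<phi> t (z k)) - h 0) \<le> \<beta> * (1 + ln (1 / (1 - (cmod (\<phi> t (z k)))\<^sup>2)))"
        using \<beta> by (intro Bloch_log_growth hol zt) auto
      also have "\<dots> \<le> \<beta> * (1 + (K + L k))"
        unfolding L_def using \<beta>(1) by (intro mult_left_mono add_left_mono K(2) t z) auto
      finally show "cmod (h (\<phi> t (z k)) - h 0) \<le> \<beta> * (1 + (K + L k))" .
      show "cmod (h (z k) - h 0) \<le> \<beta> * (1 + L k)"
        unfolding L_def using \<beta> by (intro Bloch_log_growth hol z) auto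
    qed
    also have "\<dots> = \<beta> * (2 + K + 2 * L k)" by (simp add: algebra_simps)
    also have "\<dots> \<le> \<beta> * ((K + 4) * L k)"
    proof (intro mult_left_mono)
      have "K * 1 \<le> K * L k" using K(1) L(2)[of k] by (intro mult_left_mono)
      then show "2 + K + 2 * L k \<le> (K + 4) * L k" using L(2)[of k] by (simp add: algebra_simps)
    qed (use \<beta> in simp)
    finally show ?thesis using L(2)[of k] by (simp add: D_def norm_divide divide_le_eq)
  qed
  have Dcont: "continuous_on {0..1} (D k)" for k
    unfolding D_def[abs_def] using L(2)[of k] by (intro continuous_intros continuous_on_time hol z) auto
  have "(\<lambda>k. integral {0..1} (D k)) \<longlonglongrightarrow> integral {0..1} (\<lambda>t::real. 0)"
    by (rule dominated_convergence(2)[where h = "\<lambda>t. \<beta> * (K + 4)"])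
      (use Dle D0 in \<open>auto intro: integrable_continuous_interval Dcont\<close>)
  then have lim: "(\<lambda>k. integral {0..1} (D k)) \<longlonglongrightarrow> 0" by simp
  have intD: "integral {0..1} (D k) = (avg h 1 (z k) - h (z k)) / of_real (L k)" for k
  proof -
    have "integral {0..1} (D k) = integral {0..1} (\<lambda>t. h (\<phi> t (z k)) - h (z k)) / of_real (L k)"
      unfolding D_def[abs_def] by (rule integral_divide)
    also have "integral {0..1} (\<lambda>t. h (\<phi> t (z k)) - h (z k)) = avg h 1 (z k) - h (z k)"
      unfolding avg_def using continuous_on_time[OF hol z(1)]
      by (subst integral_diff) (auto intro: integrable_continuous_interval)
    finally show ?thesis .
  qed
  \<comment> \<open>The two eighths bound \<open>cmod (h (z k))\<close> by \<open>L k / 4\<close>,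
    against the lower bound \<open>L k / 2\<close>.\<close>
  have 1: "\<forall>\<^sub>F k in sequentially. cmod (integral {0..1} (D k)) < 1 / 8"
    using lim unfolding tendsto_iff dist_norm by (auto dest: spec[of _ "1/8"])
  have 2: "\<forall>\<^sub>F k in sequentially. cmod (avg h 1 (z k)) \<le> 1 / 8 * ln (1 / (1 - (cmod (z k))\<^sup>2))"
    using avg_m0[of 1] by (intro ev little_Bloch_log_growth avg_holomorphic hol m0_imp_little_Bloch[OF adm]) auto
  have "\<forall>\<^sub>F k in sequentially. False"
    using 1 2
  proof eventually_elim
    case (elim k)
    have "cmod (h (z k)) \<le> cmod (avg h 1 (z k) - h (z k)) + cmod (avg h 1 (z k))"
      using norm_triangle_ineq4[of "avg h 1 (z k)" "avg h 1 (z k) - h (z k)"] by simp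
    moreover have "cmod (avg h 1 (z k) - h (z k)) \<le> 1 / 8 * L k"
      using elim(1) L(2)[of k] unfolding intD by (simp add: norm_divide divide_less_eq)
    ultimately show ?case using elim(2) z(4)[of k] L(2)[of k] by (simp add: L_def)
  qed
  then show False by simp
qed

end

theorem theorem1p3:
  fixes p s :: real
    and \<phi> :: "real \<Rightarrow> complex \<Rightarrow> complex"
    and G :: "complex \<Rightarrow> complex"
  assumes "admissible p s"
    and "holo_semigroup \<phi>"
    and "nontrivial_semigroup \<phi>"
    and "is_inf_generator \<phi> G"
  shows "strong_cont_subspace \<phi> (M0 p s) (M0_norm p s) = m0 p s \<longleftrightarrow> vanishing_log_Bloch G"
proof -
  interpret disk_semigroup \<phi> by standard (rule assms(2))
  show ?thesis
    using vanishing_if_strong_cont_subset_m0[OF assms(1,4)] strong_cont_subset_m0[OF assms(1,4,3)]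
      m0_subset_strong_cont[OF assms(1)] by blast
qed

end
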